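(* There is an absolute constant $C>0$ such that for every $n$ there exists a symmetric tiling body $D\subseteq\mathbb{R}^n$ of volume $1$ whose boundary is a piecewise smooth surface and whose surface area is at most $C\cdot\frac{n}{\sqrt{\log n}}$.
   Context: A body $D\subseteq\mathbb{R}^n$ is a tiling body (of $\mathbb{R}^n$ with respect to $\mathbb{Z}^n$) if its translates $D+z$, $z\in\mathbb{Z}^n$, cover $\mathbb{R}^n$ and have pairwise disjoint interiors. A set $D\subseteq\mathbb{R}^n$ is symmetric if for every permutation $\pi\in S_n$ and every $x\in\mathbb{R}^n$, $x\in D$ if and only if $\pi(x)\in D$, where $\pi(x)$ permutes the coordinates of $x$. *)

theory Defs
  imports "HOL-Analysis.Analysis"
begin

text \<open>The constant in the theorem has to be chosen before the dimension, so the dimension cannot be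
  a type. The space \<open>\<real>\<^sup>n\<close> is the set \<open>{..<n} \<rightarrow>\<^sub>E UNIV\<close> of extensional functions, which is both the
  carrier of the product topology below and the space of the product measure
  \<open>Pi\<^sub>M {..<n} (\<lambda>_. lborel)\<close>.\<close>

abbreviation Rn :: "nat \<Rightarrow> (nat \<Rightarrow> real) topology" where
  "Rn n \<equiv> product_topology (\<lambda>_. euclideanreal) {..<n}"

abbreviation lebesgue_Rn :: "nat \<Rightarrow> (nat \<Rightarrow> real) measure" where
  "lebesgue_Rn n \<equiv> Pi\<^sub>M {..<n} (\<lambda>_. lborel)"

definition dist_Rn :: "nat \<Rightarrow> (nat \<Rightarrow> real) \<Rightarrow> (nat \<Rightarrow> real) \<Rightarrow> real" where
  "dist_Rn n x y = L2_set (\<lambda>i. x i - y i) {..<n}"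

definition translate_Rn :: "nat \<Rightarrow> (nat \<Rightarrow> real) \<Rightarrow> (nat \<Rightarrow> real) set \<Rightarrow> (nat \<Rightarrow> real) set" where
  "translate_Rn n z D = (\<lambda>x. \<lambda>i\<in>{..<n}. x i + z i) ` D"

definition convex_Rn :: "nat \<Rightarrow> (nat \<Rightarrow> real) set \<Rightarrow> bool" where
  "convex_Rn n K \<longleftrightarrow>
     (\<forall>x\<in>K. \<forall>y\<in>K. \<forall>t\<in>{0..1}. (\<lambda>i\<in>{..<n}. (1 - t) * x i + t * y i) \<in> K)"


subsection \<open>Symmetric tiling bodies\<close>

definition body :: "nat \<Rightarrow> (nat \<Rightarrow> real) set \<Rightarrow> bool" where
  "body n D \<longleftrightarrow> D \<noteq> {} \<and> compactin (Rn n) D \<and> Rn n closure_of (Rn n interior_of D) = D"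

definition tiling_body :: "nat \<Rightarrow> (nat \<Rightarrow> real) set \<Rightarrow> bool" where
  "tiling_body n D \<longleftrightarrow>
     body n D \<and>
     (\<Union>z\<in>{..<n} \<rightarrow>\<^sub>E \<int>. translate_Rn n z D) = topspace (Rn n) \<and>
     (\<forall>z\<in>{..<n} \<rightarrow>\<^sub>E \<int>. \<forall>w\<in>{..<n} \<rightarrow>\<^sub>E \<int>. z \<noteq> w \<longrightarrow>
        Rn n interior_of translate_Rn n z D \<inter> Rn n interior_of translate_Rn n w D = {})"

text \<open>A permutation of \<open>{..<n}\<close> fixes all other indices, so \<open>x \<circ> \<pi>\<close> is again extensional.\<close>

definition perm_symmetric :: "nat \<Rightarrow> (nat \<Rightarrow> real) set \<Rightarrow> bool" where
  "perm_symmetric n D \<longleftrightarrow>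
     (\<forall>\<pi>. \<pi> permutes {..<n} \<longrightarrow> (\<forall>x\<in>topspace (Rn n). x \<in> D \<longleftrightarrow> x \<circ> \<pi> \<in> D))"


subsection \<open>Smooth maps and piecewise smooth surfaces\<close>

definition partial_deriv :: "nat \<Rightarrow> ((nat \<Rightarrow> real) \<Rightarrow> real) \<Rightarrow> (nat \<Rightarrow> real) \<Rightarrow> real" where
  "partial_deriv i f x = deriv (\<lambda>t. f (x(i := t))) (x i)"

text \<open>Class \<open>C\<^sup>k\<close> on an open subset \<open>U\<close> of \<open>\<real>\<^sup>m\<close>: all partial derivatives of order at most \<open>k\<close> exist
  and are continuous.\<close>

primrec Ck_on :: "nat \<Rightarrow> nat \<Rightarrow> (nat \<Rightarrow> real) set \<Rightarrow> ((nat \<Rightarrow> real) \<Rightarrow> real) \<Rightarrow> bool" where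
  "Ck_on 0 m U f \<longleftrightarrow> continuous_map (subtopology (Rn m) U) euclideanreal f"
| "Ck_on (Suc k) m U f \<longleftrightarrow>
     continuous_map (subtopology (Rn m) U) euclideanreal f \<and>
     (\<forall>i<m. (\<forall>x\<in>U. (\<lambda>t. f (x(i := t))) differentiable at (x i)) \<and>
            Ck_on k m U (partial_deriv i f))"

definition smooth_map_on ::
    "nat \<Rightarrow> nat \<Rightarrow> (nat \<Rightarrow> real) set \<Rightarrow> ((nat \<Rightarrow> real) \<Rightarrow> (nat \<Rightarrow> real)) \<Rightarrow> bool" where
  "smooth_map_on m n U \<phi> \<longleftrightarrow>
     openin (Rn m) U \<and> \<phi> ` U \<subseteq> topspace (Rn n) \<and> (\<forall>i<n. \<forall>k. Ck_on k m U (\<lambda>x. \<phi> x i))"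

text \<open>The Jacobian matrix of \<open>\<phi> : \<real>\<^sup>m \<rightarrow> \<real>\<^sup>n\<close> at \<open>x\<close> has rank \<open>m\<close>.\<close>

definition immersion_at ::
    "nat \<Rightarrow> nat \<Rightarrow> ((nat \<Rightarrow> real) \<Rightarrow> (nat \<Rightarrow> real)) \<Rightarrow> (nat \<Rightarrow> real) \<Rightarrow> bool" where
  "immersion_at m n \<phi> x \<longleftrightarrow>
     (\<forall>v. (\<forall>i<n. (\<Sum>j<m. partial_deriv j (\<lambda>y. \<phi> y i) x * v j) = 0) \<longrightarrow> (\<forall>j<m. v j = 0))"

text \<open>A regular parametrized patch of dimension \<open>n - 1\<close>: the parametrization is smooth on a
  neighbourhood of the compact parameter domain, and it is injective and immersive except possibly
  at boundary points of the domain (as for a cone, or a sphere in polar coordinates).\<close>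

definition smooth_patch ::
    "nat \<Rightarrow> (nat \<Rightarrow> real) set \<Rightarrow> ((nat \<Rightarrow> real) \<Rightarrow> (nat \<Rightarrow> real)) \<Rightarrow> bool" where
  "smooth_patch n K \<phi> \<longleftrightarrow>
     compactin (Rn (n - 1)) K \<and> convex_Rn (n - 1) K \<and> Rn (n - 1) interior_of K \<noteq> {} \<and>
     (\<exists>U. K \<subseteq> U \<and> smooth_map_on (n - 1) n U \<phi>) \<and>
     (\<forall>x\<in>Rn (n - 1) interior_of K. immersion_at (n - 1) n \<phi> x \<and> (\<forall>y\<in>K. \<phi> x = \<phi> y \<longrightarrow> x = y))"

text \<open>A piecewise smooth hypersurface is a finite union of such patches which meet only along their
  boundaries.\<close>

definition piecewise_smooth_surface :: "nat \<Rightarrow> (nat \<Rightarrow> real) set \<Rightarrow> bool" where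
  "piecewise_smooth_surface n S \<longleftrightarrow>
     (\<exists>(N::nat) K \<phi>.
        (\<forall>i<N. smooth_patch n (K i) (\<phi> i)) \<and>
        S = (\<Union>i<N. \<phi> i ` K i) \<and>
        (\<forall>i<N. \<forall>j<N. i \<noteq> j \<longrightarrow> \<phi> i ` (Rn (n - 1) interior_of K i) \<inter> \<phi> j ` K j = {}))"


subsection \<open>Surface area\<close>

definition diam_Rn :: "nat \<Rightarrow> (nat \<Rightarrow> real) set \<Rightarrow> ennreal" where
  "diam_Rn n U = (SUP x\<in>U. SUP y\<in>U. ennreal (dist_Rn n x y))"

text \<open>The \<open>d\<close>-dimensional Hausdorff measure on \<open>\<real>\<^sup>n\<close>. The factor \<open>unit_ball_vol d / 2 ^ d\<close> makes it
  agree with the classical area on smooth \<open>d\<close>-dimensional surfaces. Empty covering sets contribute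
  \<open>0\<close> also when \<open>d = 0\<close>.\<close>

definition hausdorff_premeasure ::
    "nat \<Rightarrow> nat \<Rightarrow> real \<Rightarrow> (nat \<Rightarrow> real) set \<Rightarrow> ennreal" where
  "hausdorff_premeasure n d \<delta> S =
     (INF U\<in>{U :: nat \<Rightarrow> (nat \<Rightarrow> real) set. S \<subseteq> (\<Union>k. U k) \<and> (\<forall>k. diam_Rn n (U k) \<le> ennreal \<delta>)}.
        \<Sum>k. if U k = {} then 0
             else ennreal (unit_ball_vol (real d)) * (diam_Rn n (U k) / 2) ^ d)"

definition hausdorff_measure :: "nat \<Rightarrow> nat \<Rightarrow> (nat \<Rightarrow> real) set \<Rightarrow> ennreal" where
  "hausdorff_measure n d S = (SUP \<delta>\<in>{0<..}. hausdorff_premeasure n d \<delta> S)"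

definition surface_area :: "nat \<Rightarrow> (nat \<Rightarrow> real) set \<Rightarrow> ennreal" where
  "surface_area n D = hausdorff_measure n (n - 1) (Rn n frontier_of D)"

end

theory Submission
  imports Defs
begin

text \<open>
  Starting from the unit cube, replace the current body \<open>D\<close> again and again by the closure of
  \<open>(int D \<inter> {F > \<theta>}) \<union> ((t, t+1)\<^sup>n \<inter> {F < \<theta>})\<close>. Here \<open>F x = (\<Sum>i<n. f (x i))\<close> for one of \<open>m\<close> periodic
  piecewise linear profiles \<open>f\<close>, each supported in its own window of length \<open>1 / m\<close>, where it has a
  peak of height \<open>B\<close> at \<open>t\<close>, and \<open>\<theta> < B\<close>. As \<open>F\<close> is periodic and symmetric and is at least \<open>B\<close> on the
  boundary of \<open>(t, t+1)\<^sup>n\<close>, the result is again a symmetric tiling body. A wall of \<open>D\<close> survives only where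
  \<open>F \<ge> \<theta>\<close>, and the new walls lie on \<open>{F = \<theta>}\<close>.

  Average over the profile and over \<open>\<theta>\<close> with density proportional to \<open>exp (- \<theta>)\<close>. A wall through \<open>x\<close>
  survives with probability about \<open>1 - Z x / m\<close>, where \<open>Z\<close> is the sum of \<open>exp (- F)\<close> over the profiles, and
  by the coarea formula the expected new area is the integral of \<open>\<bar>\<nabla>F\<bar>\<close> times the density at \<open>F\<close>. For \<open>m\<close> of
  order \<open>n / ln n\<close>, Chebyshev's inequality shows that \<open>Z\<close> is at least half its mean outside a small set,
  so all walls created before the last \<open>m / Z\<close> steps or so have died out and the original ones
  contribute \<open>O(1)\<close>. The rest is estimated by \<open>2 * \<bar>\<nabla>F\<bar> \<le> A + \<bar>\<nabla>F\<bar>\<^sup>2 / A\<close> with \<open>A = n / sqrt (ln n)\<close>, because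
  the integral of \<open>\<bar>\<nabla>F\<bar>\<^sup>2 * exp (- F)\<close> is \<open>O(n * m)\<close> times that of \<open>exp (- F)\<close>.
\<close>

text \<open>The unit cube has area \<open>2 * n\<close>, so a factor of order
  \<open>sqrt (ln n)\<close> has to be gained. For an exponential law the density of new walls at a
  point and the chance that a wall there dies are both about \<open>exp (- F)\<close>. Summed over
  all steps, the new area is therefore roughly the integral over the unit cube of the mean of
  \<bar>\<nabla>F\<bar> over the profiles, each weighted by \<open>exp (- F) / Z\<close>: how often
  walls are created cancels, and only the size of the gradient counts. A profile with a window of
  length \<open>1 / m\<close> sees about \<open>n / m\<close> coordinates of a point, each with a
  slope of order \<open>m\<close>, so \<bar>\<nabla>F\<bar> is of order \<open>sqrt (n * m)\<close>
  and a small \<open>m\<close> is wanted. But the mean of \<open>exp (- F)\<close> is only known to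
  be at least \<open>(1 - 1 / m) ^ n\<close>, about \<open>exp (- n / m)\<close>, and Chebyshev's
  inequality needs \<open>m\<close> times this to be large. So \<open>n / m\<close> may not exceed a
  small multiple of \<open>ln n\<close>, and at that limit \<open>sqrt (n * m)\<close> is of order
  \<open>n / sqrt (ln n)\<close>. The random choices are fixed one at a time by averaging, with a
  weight on the walls that anticipates the steps still to come.\<close>

section \<open>Topology and measurability on finite products of the real line\<close>

abbreviation prodtop :: "'i set \<Rightarrow> ('i \<Rightarrow> real) topology" where
  "prodtop I \<equiv> product_topology (\<lambda>_. euclideanreal) I"

text \<open>Finiteness of \<open>I\<close> makes the product topology that of the sup distance. The
  space is a set of extensional functions rather than a normed type, so closures and interiors are
  handled through such boxes below.\<close>

lemma openin_prodtop:
  assumes "finite I"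
  shows "openin (prodtop I) U \<longleftrightarrow> U \<subseteq> I \<rightarrow>\<^sub>E UNIV \<and>
    (\<forall>x\<in>U. \<exists>e>0. \<forall>y\<in>I \<rightarrow>\<^sub>E UNIV. (\<forall>i\<in>I. \<bar>y i - x i\<bar> < e) \<longrightarrow> y \<in> U)" (is "?L \<longleftrightarrow> ?R")
proof
  assume L: ?L
  have sub: "U \<subseteq> I \<rightarrow>\<^sub>E UNIV"
    using openin_subset[OF L] by simp
  moreover have "\<exists>e>0. \<forall>y\<in>I \<rightarrow>\<^sub>E UNIV. (\<forall>i\<in>I. \<bar>y i - x i\<bar> < e) \<longrightarrow> y \<in> U" if xU: "x \<in> U" for x
  proof -
    obtain W where W: "finite {i \<in> I. W i \<noteq> UNIV}" "\<forall>i\<in>I. open (W i)" "x \<in> Pi\<^sub>E I W" "Pi\<^sub>E I W \<subseteq> U"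
      using bspec[OF L[unfolded openin_product_topology_alt] xU] by auto
    have "\<exists>e>0. \<forall>y. \<bar>y - x i\<bar> < e \<longrightarrow> y \<in> W i" if "i \<in> I" for i
    proof -
      have "x i \<in> W i" "open (W i)" using W that by auto
      then show ?thesis unfolding open_real by (auto simp: dist_real_def)
    qed
    then obtain e where e: "\<And>i. i \<in> I \<Longrightarrow> e i > 0" "\<And>i y. i \<in> I \<Longrightarrow> \<bar>y - x i\<bar> < e i \<Longrightarrow> y \<in> W i"
      by metis
    \<comment> \<open>The entry \<open>1\<close> keeps the minimum defined when \<open>I\<close> is
      empty.\<close>
    define d where "d = Min (insert 1 (e ` I))"
    have "d > 0" unfolding d_def using assms e by (subst Min_gr_iff) auto
    have "d \<le> e i" if "i \<in> I" for i unfolding d_def using assms that by auto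
    note dle = this
    have "y \<in> Pi\<^sub>E I W" if "y \<in> I \<rightarrow>\<^sub>E UNIV" "\<forall>i\<in>I. \<bar>y i - x i\<bar> < d" for y
    proof (rule PiE_I)
      fix i assume i: "i \<in> I"
      then have "\<bar>y i - x i\<bar> < e i" using that(2) dle[OF i] i by (meson less_le_trans)
      then show "y i \<in> W i" using e(2)[OF i] by blast
    next
      fix i assume "i \<notin> I"
      then show "y i = undefined" using that(1) by (rule PiE_arb[rotated])
    qed
    then show ?thesis using \<open>d > 0\<close> W(4) by (meson subsetD)
  qed
  ultimately show ?R by blast
next
  assume R: ?R
  show ?L unfolding openin_product_topology_alt
  proof (intro ballI)
    fix x assume x: "x \<in> U"
    then obtain e where e: "e > 0" "\<forall>y\<in>I \<rightarrow>\<^sub>E UNIV. (\<forall>i\<in>I. \<bar>y i - x i\<bar> < e) \<longrightarrow> y \<in> U"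
      using R by blast
    show "\<exists>W. finite {i \<in> I. W i \<noteq> topspace euclideanreal} \<and> (\<forall>i\<in>I. openin euclideanreal (W i)) \<and>
         x \<in> Pi\<^sub>E I W \<and> Pi\<^sub>E I W \<subseteq> U"
    proof (intro exI[of _ "\<lambda>i. {x i - e<..<x i + e}"] conjI)
      show "x \<in> (\<Pi>\<^sub>E i\<in>I. {x i - e<..<x i + e})" using x R e by (auto simp: PiE_iff)
      show "(\<Pi>\<^sub>E i\<in>I. {x i - e<..<x i + e}) \<subseteq> U"
      proof
        fix y assume y: "y \<in> (\<Pi>\<^sub>E i\<in>I. {x i - e<..<x i + e})"
        have "\<bar>y i - x i\<bar> < e" if "i \<in> I" for i
          using PiE_mem[OF y that] by (simp add: abs_less_iff)
        moreover have "y \<in> I \<rightarrow>\<^sub>E UNIV" using y by (auto simp: PiE_iff)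
        ultimately show "y \<in> U" using e by blast
      qed
    qed (use assms in auto)
  qed
qed

lemma openin_prodtop_box:
  assumes "finite I" "x \<in> I \<rightarrow>\<^sub>E UNIV"
  shows "openin (prodtop I) {y \<in> I \<rightarrow>\<^sub>E UNIV. \<forall>i\<in>I. \<bar>y i - x i\<bar> < e}"
proof -
  have "{y \<in> I \<rightarrow>\<^sub>E UNIV. \<forall>i\<in>I. \<bar>y i - x i\<bar> < e} = (\<Pi>\<^sub>E i\<in>I. {x i - e<..<x i + e})"
    by (auto simp: PiE_iff extensional_def abs_less_iff algebra_simps)
  then show ?thesis using assms(1) by (simp add: openin_PiE_gen)
qed

lemma in_closure_of_prodtop:
  assumes "finite I"
  shows "x \<in> prodtop I closure_of S \<longleftrightarrow> x \<in> I \<rightarrow>\<^sub>E UNIV \<and>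
    (\<forall>e>0. \<exists>y\<in>S \<inter> (I \<rightarrow>\<^sub>E UNIV). \<forall>i\<in>I. \<bar>y i - x i\<bar> < e)" (is "?L \<longleftrightarrow> ?R")
proof
  assume L: ?L
  have x: "x \<in> I \<rightarrow>\<^sub>E UNIV" using L by (simp add: in_closure_of)
  moreover have "\<exists>y\<in>S \<inter> (I \<rightarrow>\<^sub>E UNIV). \<forall>i\<in>I. \<bar>y i - x i\<bar> < e" if "e > 0" for e
  proof -
    let ?T = "{y \<in> I \<rightarrow>\<^sub>E UNIV. \<forall>i\<in>I. \<bar>y i - x i\<bar> < e}"
    have "x \<in> ?T" using x that by auto
    then obtain y where "y \<in> S" "y \<in> ?T"
      using L openin_prodtop_box[OF assms x, of e] unfolding in_closure_of by meson
    then show ?thesis by blast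
  qed
  ultimately show ?R by blast
next
  assume R: ?R
  show ?L unfolding in_closure_of
  proof (intro conjI allI impI)
    show "x \<in> topspace (prodtop I)" using R by simp
    fix T assume T: "x \<in> T \<and> openin (prodtop I) T"
    then obtain e where "e > 0" "\<forall>y\<in>I \<rightarrow>\<^sub>E UNIV. (\<forall>i\<in>I. \<bar>y i - x i\<bar> < e) \<longrightarrow> y \<in> T"
      unfolding openin_prodtop[OF assms] by blast
    then show "\<exists>y. y \<in> S \<and> y \<in> T" using R by blast
  qed
qed

lemma in_interior_of_prodtop:
  assumes "finite I"
  shows "x \<in> prodtop I interior_of S \<longleftrightarrow> x \<in> I \<rightarrow>\<^sub>E UNIV \<and>
    (\<exists>e>0. \<forall>y\<in>I \<rightarrow>\<^sub>E UNIV. (\<forall>i\<in>I. \<bar>y i - x i\<bar> < e) \<longrightarrow> y \<in> S)" (is "?L \<longleftrightarrow> ?R")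
proof
  assume L: ?L
  have "x \<in> I \<rightarrow>\<^sub>E UNIV"
    using L interior_of_subset_topspace[of "prodtop I" S] by auto
  moreover have "\<exists>e>0. \<forall>y\<in>I \<rightarrow>\<^sub>E UNIV. (\<forall>i\<in>I. \<bar>y i - x i\<bar> < e) \<longrightarrow> y \<in> prodtop I interior_of S"
    using L openin_interior_of[of "prodtop I" S] unfolding openin_prodtop[OF assms] by blast
  moreover have "prodtop I interior_of S \<subseteq> S" by (rule interior_of_subset)
  ultimately show ?R by blast
next
  assume R: ?R
  then obtain e where e: "e > 0" "\<forall>y\<in>I \<rightarrow>\<^sub>E UNIV. (\<forall>i\<in>I. \<bar>y i - x i\<bar> < e) \<longrightarrow> y \<in> S" by blast
  let ?T = "{y \<in> I \<rightarrow>\<^sub>E UNIV. \<forall>i\<in>I. \<bar>y i - x i\<bar> < e}"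
  have "openin (prodtop I) ?T" using openin_prodtop_box[OF assms] R by blast
  moreover have "x \<in> ?T" "?T \<subseteq> S" using R e by auto
  ultimately show ?L unfolding interior_of_def by blast
qed

lemma closedin_prodtop:
  assumes "finite I"
  shows "closedin (prodtop I) S \<longleftrightarrow> S \<subseteq> I \<rightarrow>\<^sub>E UNIV \<and>
    (\<forall>x\<in>I \<rightarrow>\<^sub>E UNIV. (\<forall>e>0. \<exists>y\<in>S. \<forall>i\<in>I. \<bar>y i - x i\<bar> < e) \<longrightarrow> x \<in> S)"
proof -
  have "closedin (prodtop I) S \<longleftrightarrow> S \<subseteq> topspace (prodtop I) \<and> prodtop I closure_of S \<subseteq> S"
    using closure_of_eq[of "prodtop I" S] closure_of_subset[of S "prodtop I"] closedin_subset[of "prodtop I" S]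
    by (metis subset_antisym order_refl)
  also have "\<dots> \<longleftrightarrow> S \<subseteq> I \<rightarrow>\<^sub>E UNIV \<and> (\<forall>x\<in>I \<rightarrow>\<^sub>E UNIV. (\<forall>e>0. \<exists>y\<in>S. \<forall>i\<in>I. \<bar>y i - x i\<bar> < e) \<longrightarrow> x \<in> S)"
  proof (cases "S \<subseteq> I \<rightarrow>\<^sub>E UNIV")
    case True
    then have "S \<inter> (I \<rightarrow>\<^sub>E UNIV) = S" by blast
    then show ?thesis using True
      unfolding subset_iff[of "prodtop I closure_of S"] in_closure_of_prodtop[OF assms] by auto
  qed auto
  finally show ?thesis .
qed

lemma compactin_prodtop:
  assumes "closedin (prodtop I) S" "\<And>x i. x \<in> S \<Longrightarrow> i \<in> I \<Longrightarrow> a \<le> x i \<and> x i \<le> b"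
  shows "compactin (prodtop I) S"
proof (rule closed_compactin)
  show "compactin (prodtop I) (\<Pi>\<^sub>E i\<in>I. {a..b})" by (simp add: compactin_PiE)
  have "S \<subseteq> topspace (prodtop I)" using assms(1) by (rule closedin_subset)
  then show "S \<subseteq> (\<Pi>\<^sub>E i\<in>I. {a..b})"
    by (auto simp: PiE_iff subset_iff assms(2))
qed (fact assms(1))

lemma compactin_prodtop_imp_closedin: "compactin (prodtop I) S \<Longrightarrow> closedin (prodtop I) S"
  by (rule compactin_imp_closedin) (simp add: Hausdorff_space_product_topology)

lemma compactin_prodtop_bounded:
  assumes "finite I" "compactin (prodtop I) S"
  obtains r where "r > 0" "\<And>x i. x \<in> S \<Longrightarrow> i \<in> I \<Longrightarrow> \<bar>x i\<bar> \<le> r"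
proof -
  have "\<exists>r. \<forall>x\<in>S. \<bar>x i\<bar> \<le> r" if "i \<in> I" for i
  proof -
    have "continuous_map (prodtop I) euclideanreal (\<lambda>x. x i)"
      using that by (rule continuous_map_product_projection)
    then have "compactin euclideanreal ((\<lambda>x. x i) ` S)"
      using assms(2) image_compactin by blast
    then have "bounded ((\<lambda>x. x i) ` S)" by (simp add: compact_imp_bounded)
    then show ?thesis unfolding bounded_iff by auto
  qed
  then obtain r where r: "\<And>i x. i \<in> I \<Longrightarrow> x \<in> S \<Longrightarrow> \<bar>x i\<bar> \<le> r i" by metis
  show ?thesis
  proof (rule that[of "1 + (\<Sum>i\<in>I. \<bar>r i\<bar>)"])
    show "0 < 1 + (\<Sum>i\<in>I. \<bar>r i\<bar>)" by (intro add_pos_nonneg sum_nonneg) auto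
    fix x i assume "x \<in> S" "i \<in> I"
    then have "\<bar>x i\<bar> \<le> \<bar>r i\<bar>" using r by fastforce
    also have "\<dots> \<le> (\<Sum>i\<in>I. \<bar>r i\<bar>)" using \<open>i \<in> I\<close> assms(1) by (intro member_le_sum) auto
    finally show "\<bar>x i\<bar> \<le> 1 + (\<Sum>i\<in>I. \<bar>r i\<bar>)" by simp
  qed
qed

text \<open>An open set is the union of the rational boxes inside it, and there are countably many
  of these. This links the topology with the product sigma-algebra, which is generated by
  boxes.\<close>

lemma openin_prodtop_imp_measurable:
  assumes "finite I" "openin (prodtop I) U"
  shows "U \<in> sets (Pi\<^sub>M I (\<lambda>_. lborel))"
proof -
  \<comment> \<open>The endpoints are taken extensional, so that there are only countably many
    pairs.\<close>
  define \<B> where "\<B> = {(p, q) | p q. p \<in> I \<rightarrow>\<^sub>E \<rat> \<and> q \<in> I \<rightarrow>\<^sub>E \<rat> \<and> (\<Pi>\<^sub>E i\<in>I. {p i<..<q i::real}) \<subseteq> U}"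
  have "U = (\<Union>(p, q)\<in>\<B>. \<Pi>\<^sub>E i\<in>I. {p i<..<q i})"
  proof (intro subset_antisym subsetI)
    fix x assume x: "x \<in> U"
    then obtain e where e: "e > 0" "\<forall>y\<in>I \<rightarrow>\<^sub>E UNIV. (\<forall>i\<in>I. \<bar>y i - x i\<bar> < e) \<longrightarrow> y \<in> U"
      and xE: "x \<in> I \<rightarrow>\<^sub>E UNIV"
      using assms(2) unfolding openin_prodtop[OF assms(1)] by blast
    have "\<exists>p\<in>\<rat>. x i - e < p \<and> p < x i" "\<exists>q\<in>\<rat>. x i < q \<and> q < x i + e" for i
      using e Rats_dense_in_real[of "x i - e" "x i"] Rats_dense_in_real[of "x i" "x i + e"] by auto
    then obtain p q where pq: "\<And>i. p i \<in> \<rat>" "\<And>i. x i - e < p i" "\<And>i. p i < x i"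
      "\<And>i. q i \<in> \<rat>" "\<And>i. x i < q i" "\<And>i. q i < x i + e" by metis
    have "(\<Pi>\<^sub>E i\<in>I. {p i<..<q i}) \<subseteq> U"
    proof
      fix y assume y: "y \<in> (\<Pi>\<^sub>E i\<in>I. {p i<..<q i})"
      have "\<bar>y i - x i\<bar> < e" if "i \<in> I" for i
      proof -
        have "p i < y i" "y i < q i" using PiE_mem[OF y that] by auto
        then show ?thesis using pq(2)[of i] pq(6)[of i] by (simp add: abs_less_iff)
      qed
      moreover have "y \<in> I \<rightarrow>\<^sub>E UNIV" using y by (auto simp: PiE_iff)
      ultimately show "y \<in> U" using e by blast
    qed
    moreover have "(\<Pi>\<^sub>E i\<in>I. {restrict p I i<..<restrict q I i}) = (\<Pi>\<^sub>E i\<in>I. {p i<..<q i})"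
      by (rule PiE_cong) auto
    ultimately have "(restrict p I, restrict q I) \<in> \<B>"
      unfolding \<B>_def using pq by auto
    moreover have "x \<in> (\<Pi>\<^sub>E i\<in>I. {restrict p I i<..<restrict q I i})"
      using pq xE by (auto simp: PiE_iff)
    ultimately show "x \<in> (\<Union>(p, q)\<in>\<B>. \<Pi>\<^sub>E i\<in>I. {p i<..<q i})" by blast
  qed (auto simp: \<B>_def)
  moreover have "countable \<B>"
  proof (rule countable_subset)
    show "\<B> \<subseteq> (I \<rightarrow>\<^sub>E \<rat>) \<times> (I \<rightarrow>\<^sub>E \<rat>)" by (auto simp: \<B>_def)
    show "countable ((I \<rightarrow>\<^sub>E (\<rat> :: real set)) \<times> (I \<rightarrow>\<^sub>E \<rat>))"
      using assms(1) by (intro countable_SIGMA countable_PiE) (auto simp: countable_rat)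
  qed
  moreover have "(\<Pi>\<^sub>E i\<in>I. {p i<..<q i}) \<in> sets (Pi\<^sub>M I (\<lambda>_. lborel))" for p q :: "'a \<Rightarrow> real"
    using assms(1) by (intro sets_PiM_I_finite) auto
  ultimately have "(\<Union>b\<in>\<B>. case b of (p, q) \<Rightarrow> \<Pi>\<^sub>E i\<in>I. {p i<..<q i}) \<in> sets (Pi\<^sub>M I (\<lambda>_. lborel))"
    by (intro sets.countable_UN') (auto split: prod.split)
  with \<open>U = _\<close> show ?thesis by simp
qed

lemma closedin_prodtop_imp_measurable:
  assumes "finite I" "closedin (prodtop I) S"
  shows "S \<in> sets (Pi\<^sub>M I (\<lambda>_. lborel))"
proof -
  have "openin (prodtop I) ((I \<rightarrow>\<^sub>E UNIV) - S)"
    using assms(2) by (simp add: closedin_def)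
  from openin_prodtop_imp_measurable[OF assms(1) this]
  have "space (Pi\<^sub>M I (\<lambda>_. lborel)) - ((I \<rightarrow>\<^sub>E UNIV) - S) \<in> sets (Pi\<^sub>M I (\<lambda>_. lborel))"
    by blast
  moreover have "space (Pi\<^sub>M I (\<lambda>_. lborel :: real measure)) - ((I \<rightarrow>\<^sub>E UNIV) - S) = S"
    using closedin_subset[OF assms(2)] by (auto simp: space_PiM)
  ultimately show ?thesis by simp
qed

section \<open>Lebesgue measure under affine maps and shears\<close>

interpretation lborel_PiM: product_sigma_finite "\<lambda>_::'i. lborel :: real measure"
  by standard

abbreviation leb :: "'i set \<Rightarrow> ('i \<Rightarrow> real) measure" where
  "leb I \<equiv> Pi\<^sub>M I (\<lambda>_. lborel)"

lemma space_leb: "space (leb I) = I \<rightarrow>\<^sub>E UNIV"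
  by (simp add: space_PiM)

lemma measurable_affine_leb:
  "(\<lambda>x. \<lambda>i\<in>I. c * x i + z i) \<in> measurable (leb I) (leb I)"
  by (rule measurable_restrict) measurable

text \<open>Product measures are determined by boxes, and there the claim splits into
  one-dimensional substitutions with one factor \<open>\<bar>c\<bar>\<close> per coordinate.\<close>

lemma leb_affine:
  assumes "finite I" "c \<noteq> 0"
  shows "leb I = density (distr (leb I) (leb I) (\<lambda>x. \<lambda>i\<in>I. c * x i + z i)) (\<lambda>_. ennreal (\<bar>c\<bar> ^ card I))"
proof (rule lborel_PiM.PiM_eqI[symmetric])
  let ?T = "\<lambda>x. \<lambda>i\<in>I. c * x i + z i"
  note measurable_affine_leb[measurable]
  fix A :: "'a \<Rightarrow> real set" assume A: "\<And>i. i \<in> I \<Longrightarrow> A i \<in> sets lborel"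
  have Am: "Pi\<^sub>E I A \<in> sets (leb I)" using A assms(1) by (intro sets_PiM_I_finite) auto
  have one: "ennreal \<bar>c\<bar> * emeasure lborel ((\<lambda>x. z i + c * x) -` A i) = emeasure lborel (A i)" if "i \<in> I" for i
  proof -
    have m: "(\<lambda>x. z i + c * x) -` A i \<in> sets lborel"
    proof -
      have "(\<lambda>x. z i + c * x) \<in> measurable borel borel" by measurable
      from measurable_sets[OF this] show ?thesis using A[OF that] by simp
    qed
    have "emeasure lborel (A i) = (\<integral>\<^sup>+ x. indicator (A i) x \<partial>lborel)" using A[OF that] by simp
    also have "\<dots> = ennreal \<bar>c\<bar> * (\<integral>\<^sup>+ x. indicator (A i) (z i + c * x) \<partial>lborel)"
      using A[OF that] assms(2) by (intro nn_integral_real_affine) auto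
    also have "(\<lambda>x. indicator (A i) (z i + c * x) :: ennreal) = indicator ((\<lambda>x. z i + c * x) -` A i)"
      by (auto simp: indicator_def)
    also have "(\<integral>\<^sup>+ x. indicator ((\<lambda>x. z i + c * x) -` A i) x \<partial>lborel) = emeasure lborel ((\<lambda>x. z i + c * x) -` A i)"
      using m by (rule nn_integral_indicator)
    finally show ?thesis by simp
  qed
  have "emeasure (density (distr (leb I) (leb I) ?T) (\<lambda>_. ennreal (\<bar>c\<bar> ^ card I))) (Pi\<^sub>E I A)
      = ennreal (\<bar>c\<bar> ^ card I) * emeasure (leb I) (?T -` (Pi\<^sub>E I A) \<inter> space (leb I))"
    using Am by (simp add: emeasure_density nn_integral_cmult emeasure_distr)
  also have "?T -` (Pi\<^sub>E I A) \<inter> space (leb I) = Pi\<^sub>E I (\<lambda>i. (\<lambda>x. z i + c * x) -` A i)"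
    by (auto simp: space_PiM PiE_iff add.commute)
  also have "emeasure (leb I) \<dots> = (\<Prod>i\<in>I. emeasure lborel ((\<lambda>x. z i + c * x) -` A i))"
  proof (rule lborel_PiM.emeasure_PiM[OF assms(1)])
    fix i assume "i \<in> I"
    have "(\<lambda>x. z i + c * x) \<in> measurable borel borel" by measurable
    from measurable_sets[OF this] show "(\<lambda>x. z i + c * x) -` A i \<in> sets lborel"
      using A[OF \<open>i \<in> I\<close>] by simp
  qed
  also have "ennreal (\<bar>c\<bar> ^ card I) * \<dots> = (\<Prod>i\<in>I. ennreal \<bar>c\<bar> * emeasure lborel ((\<lambda>x. z i + c * x) -` A i))"
    by (simp add: prod.distrib ennreal_power)
  also have "\<dots> = (\<Prod>i\<in>I. emeasure lborel (A i))" using one by (intro prod.cong) auto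
  finally show "emeasure (density (distr (leb I) (leb I) ?T) (\<lambda>_. ennreal (\<bar>c\<bar> ^ card I))) (Pi\<^sub>E I A)
      = (\<Prod>i\<in>I. emeasure lborel (A i))" .
qed (use assms in auto)

lemma nn_integral_leb_affine:
  assumes "finite I" "c \<noteq> 0" and [measurable]: "u \<in> borel_measurable (leb I)"
  shows "(\<integral>\<^sup>+ x. u x \<partial>leb I) = ennreal (\<bar>c\<bar> ^ card I) * (\<integral>\<^sup>+ x. u (\<lambda>i\<in>I. c * x i + z i) \<partial>leb I)"
proof -
  note measurable_affine_leb[measurable]
  show ?thesis
    by (subst leb_affine[OF assms(1,2), of z])
       (simp add: nn_integral_density nn_integral_distr nn_integral_cmult)
qed

lemma nn_integral_leb_translate:
  assumes "finite I" and "u \<in> borel_measurable (leb I)"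
  shows "(\<integral>\<^sup>+ x. u x \<partial>leb I) = (\<integral>\<^sup>+ x. u (\<lambda>i\<in>I. x i + z i) \<partial>leb I)"
  using nn_integral_leb_affine[OF assms(1) _ assms(2), of 1 z] by simp

lemma emeasure_leb_affine:
  assumes "finite I" "c \<noteq> 0" and "A \<in> sets (leb I)"
  shows "emeasure (leb I) A = ennreal (\<bar>c\<bar> ^ card I) *
    emeasure (leb I) {x \<in> space (leb I). (\<lambda>i\<in>I. c * x i + z i) \<in> A}"
proof -
  note measurable_affine_leb[measurable]
  have *: "{x \<in> space (leb I). (\<lambda>i\<in>I. c * x i + z i) \<in> A} \<in> sets (leb I)"
    using assms(3) by measurable
  have "emeasure (leb I) A = (\<integral>\<^sup>+ x. indicator A x \<partial>leb I)" using assms(3) by simp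
  also have "\<dots> = ennreal (\<bar>c\<bar> ^ card I) * (\<integral>\<^sup>+ x. indicator A (\<lambda>i\<in>I. c * x i + z i) \<partial>leb I)"
    using assms by (intro nn_integral_leb_affine) auto
  also have "(\<integral>\<^sup>+ x. indicator A (\<lambda>i\<in>I. c * x i + z i) \<partial>leb I)
      = (\<integral>\<^sup>+ x. indicator {x \<in> space (leb I). (\<lambda>i\<in>I. c * x i + z i) \<in> A} x \<partial>leb I)"
    by (rule nn_integral_cong) (auto simp: indicator_def)
  also have "\<dots> = emeasure (leb I) {x \<in> space (leb I). (\<lambda>i\<in>I. c * x i + z i) \<in> A}"
    using * by (rule nn_integral_indicator)
  finally show ?thesis .
qed

lemma measurable_update_leb [measurable]:
  assumes "h \<in> borel_measurable (leb I)"
  shows "(\<lambda>y. y(k := h y)) \<in> measurable (leb I) (leb (insert k I))"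
proof -
  have "(\<lambda>y. (y, h y)) \<in> measurable (leb I) (leb I \<Otimes>\<^sub>M lborel)" using assms by simp
  from measurable_compose[OF this measurable_add_dim] show ?thesis by simp
qed

lemma measurable_eval_leb: "i \<in> I \<Longrightarrow> (\<lambda>y. y i) \<in> borel_measurable (leb I)"
  using measurable_component_singleton[of i I "\<lambda>_. lborel"] by simp

lemma measurable_linear_leb [measurable]:
  "(\<lambda>y. \<Sum>i\<in>I. w i * y i) \<in> borel_measurable (leb I)"
  by (intro borel_measurable_sum borel_measurable_times borel_measurable_const measurable_eval_leb)

lemma measurable_sqsum_leb [measurable]:
  "(\<lambda>y. \<Sum>i\<in>I. (y i)\<^sup>2) \<in> borel_measurable (leb I)"
  by (intro borel_measurable_sum borel_measurable_power measurable_eval_leb)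

text \<open>Fubini with the coordinate \<open>k\<close> innermost allows a substitution for each
  fixed \<open>y\<close>; swapping the order then makes \<open>t\<close> the outer variable. For
  suitable \<open>h\<close> and \<open>c\<close> this variable is the level of an affine functional,
  which gives the coarea formula below.\<close>

lemma nn_integral_shear_scale:
  assumes "finite I" "k \<notin> I" "c \<noteq> 0" and u: "u \<in> borel_measurable (leb (insert k I))"
    and [measurable]: "h \<in> borel_measurable (leb I)"
  shows "(\<integral>\<^sup>+ x. u x \<partial>leb (insert k I)) = ennreal \<bar>c\<bar> * (\<integral>\<^sup>+ t. \<integral>\<^sup>+ y. u (y(k := h y + c * t)) \<partial>leb I \<partial>lborel)"
proof -
  interpret pair_sigma_finite "leb I" "lborel :: real measure"
    using assms(1) by (intro pair_sigma_finite.intro lborel_PiM.sigma_finite sigma_finite_lborel)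
  have m0: "(\<lambda>(y, t). u (y(k := t))) \<in> borel_measurable (leb I \<Otimes>\<^sub>M lborel)"
    using measurable_compose[OF measurable_add_dim u] by (simp add: split_def)
  have "(\<lambda>p. (fst p, h (fst p) + c * snd p)) \<in> measurable (leb I \<Otimes>\<^sub>M lborel) (leb I \<Otimes>\<^sub>M lborel)"
    by measurable
  from measurable_compose[OF this m0]
  have m: "(\<lambda>(y, t). u (y(k := h y + c * t))) \<in> borel_measurable (leb I \<Otimes>\<^sub>M lborel)"
    by (simp add: split_def)
  have m': "(\<lambda>y. \<integral>\<^sup>+ t. u (y(k := h y + c * t)) \<partial>lborel) \<in> borel_measurable (leb I)"
    using sigma_finite_measure.borel_measurable_nn_integral[OF sigma_finite_lborel m] by simp
  have "(\<integral>\<^sup>+ x. u x \<partial>leb (insert k I)) = (\<integral>\<^sup>+ y. \<integral>\<^sup>+ t. u (y(k := t)) \<partial>lborel \<partial>leb I)"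
    using assms by (intro lborel_PiM.product_nn_integral_insert)
  also have "\<dots> = (\<integral>\<^sup>+ y. ennreal \<bar>c\<bar> * \<integral>\<^sup>+ t. u (y(k := h y + c * t)) \<partial>lborel \<partial>leb I)"
  proof (rule nn_integral_cong)
    fix y assume y: "y \<in> space (leb I)"
    have "(\<lambda>t. u (y(k := t))) \<in> borel_measurable lborel"
      using measurable_Pair2[OF m0 y] by simp
    then show "(\<integral>\<^sup>+ t. u (y(k := t)) \<partial>lborel) = ennreal \<bar>c\<bar> * (\<integral>\<^sup>+ t. u (y(k := h y + c * t)) \<partial>lborel)"
      using nn_integral_real_affine[of "\<lambda>t. u (y(k := t))" c "h y"] assms(3) by simp
  qed
  also have "\<dots> = ennreal \<bar>c\<bar> * (\<integral>\<^sup>+ y. \<integral>\<^sup>+ t. u (y(k := h y + c * t)) \<partial>lborel \<partial>leb I)"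
    by (rule nn_integral_cmult[OF m'])
  also have "(\<integral>\<^sup>+ y. \<integral>\<^sup>+ t. u (y(k := h y + c * t)) \<partial>lborel \<partial>leb I) = (\<integral>\<^sup>+ t. \<integral>\<^sup>+ y. u (y(k := h y + c * t)) \<partial>leb I \<partial>lborel)"
    using Fubini'[OF m] by simp
  finally show ?thesis .
qed

lemma nn_integral_shear:
  assumes "finite I" "k \<notin> I" "u \<in> borel_measurable (leb (insert k I))" "h \<in> borel_measurable (leb I)"
  shows "(\<integral>\<^sup>+ x. u x \<partial>leb (insert k I)) = (\<integral>\<^sup>+ t. \<integral>\<^sup>+ y. u (y(k := t + h y)) \<partial>leb I \<partial>lborel)"
  using nn_integral_shear_scale[OF assms(1,2) _ assms(3,4), of 1] by (simp add: add.commute)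

section \<open>Volumes of ellipsoids\<close>

text \<open>The Euclidean length of \<open>y\<close> after it is lifted to the graph of the linear
  functional \<open>w\<close>.\<close>

definition ellnorm :: "('i \<Rightarrow> real) \<Rightarrow> 'i set \<Rightarrow> ('i \<Rightarrow> real) \<Rightarrow> real" where
  "ellnorm w I y = sqrt ((\<Sum>i\<in>I. (y i)\<^sup>2) + (\<Sum>i\<in>I. w i * y i)\<^sup>2)"

lemma measurable_ellnorm [measurable]: "ellnorm w I \<in> borel_measurable (leb I)"
  unfolding ellnorm_def by measurable

lemma ellnorm_scale: "c \<ge> 0 \<Longrightarrow> ellnorm w I (\<lambda>i\<in>I. c * y i + 0) = c * ellnorm w I y"
proof -
  assume "c \<ge> 0"
  have "(\<Sum>i\<in>I. ((\<lambda>i\<in>I. c * y i + 0) i)\<^sup>2) = c\<^sup>2 * (\<Sum>i\<in>I. (y i)\<^sup>2)"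
    unfolding sum_distrib_left by (rule sum.cong) (auto simp: power_mult_distrib)
  moreover have "(\<Sum>i\<in>I. w i * (\<lambda>i\<in>I. c * y i + 0) i) = c * (\<Sum>i\<in>I. w i * y i)"
    unfolding sum_distrib_left by (rule sum.cong) auto
  ultimately show ?thesis using \<open>c \<ge> 0\<close> unfolding ellnorm_def
    by (simp add: power_mult_distrib flip: distrib_left) (simp add: real_sqrt_mult)
qed

lemma emeasure_ellnorm_scale:
  assumes "finite I" "r > 0"
  shows "emeasure (leb I) {y \<in> space (leb I). ellnorm w I y \<le> r}
    = ennreal (r ^ card I) * emeasure (leb I) {y \<in> space (leb I). ellnorm w I y \<le> 1}"
proof -
  have "{x \<in> space (leb I). (\<lambda>i\<in>I. r * x i + 0) \<in> {y \<in> space (leb I). ellnorm w I y \<le> r}}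
      = {y \<in> space (leb I). ellnorm w I y \<le> 1}"
    using ellnorm_scale[of r w I] assms(2) by (auto simp: space_leb)
  then show ?thesis
    using emeasure_leb_affine[OF assms(1), of r "{y \<in> space (leb I). ellnorm w I y \<le> r}" "\<lambda>_. 0"] assms(2)
    by simp
qed

text \<open>The unit ball of one dimension more is sheared along the new axis; its slices become translates
  of scaled ellipsoids, so that the ellipsoid is compared with the ball (the case \<open>w = 0\<close>).\<close>

lemma emeasure_ellipsoid_slices:
  assumes "finite I" "k \<notin> I"
  shows "ennreal (unit_ball_vol (real (Suc (card I))))
    = ennreal (Beta (1 / 2) (real (card I) / 2 + 1)) * (ennreal (sqrt (1 + (\<Sum>i\<in>I. (w i)\<^sup>2)))
      * emeasure (leb I) {y \<in> space (leb I). ellnorm w I y \<le> 1})"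
proof -
  define W where "W = (\<Sum>i\<in>I. (w i)\<^sup>2)"
  define \<kappa> where "\<kappa> = sqrt (1 + W)"
  have W0: "W \<ge> 0" unfolding W_def by (simp add: sum_nonneg)
  have \<kappa>: "\<kappa> > 0" "\<kappa>\<^sup>2 = 1 + W" unfolding \<kappa>_def using W0 by auto
  define E1 where "E1 = emeasure (leb I) {y \<in> space (leb I). ellnorm w I y \<le> 1}"
  let ?J = "insert k I"
  let ?B = "{x \<in> space (leb ?J). (\<Sum>i\<in>?J. (x i)\<^sup>2) \<le> 1}"
  have B[measurable]: "?B \<in> sets (leb ?J)" by measurable
  have "ennreal (unit_ball_vol (real (Suc (card I)))) = emeasure (leb ?J) ?B"
    using emeasure_cball_aux[of ?J 1] assms
    by (simp add: Int_def conj_commute)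
  also have "\<dots> = (\<integral>\<^sup>+ x. indicator ?B x \<partial>leb ?J)" by simp
  also have "\<dots> = (\<integral>\<^sup>+ t. \<integral>\<^sup>+ y. indicator ?B (y(k := t + (\<Sum>i\<in>I. w i * y i))) \<partial>leb I \<partial>lborel)"
    using assms by (intro nn_integral_shear) auto
  also have "\<dots> = (\<integral>\<^sup>+ t. indicator {-1..1} (t / \<kappa>) * ennreal (sqrt (1 - (t / \<kappa>)\<^sup>2) ^ card I) * E1 \<partial>lborel)"
  proof (rule nn_integral_cong_AE)
    \<comment> \<open>At these two heights the slice degenerates to radius 0, which
      \<open>emeasure_ellnorm_scale\<close> excludes.\<close>
    have "AE t in lborel. t \<notin> {\<kappa>, - \<kappa>}"
      by (rule AE_not_in) (rule finite_imp_null_set_lborel, simp)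
    then show "AE t in lborel. (\<integral>\<^sup>+ y. indicator ?B (y(k := t + (\<Sum>i\<in>I. w i * y i))) \<partial>leb I)
        = indicator {-1..1} (t / \<kappa>) * ennreal (sqrt (1 - (t / \<kappa>)\<^sup>2) ^ card I) * E1"
    proof (rule eventually_mono)
      fix t assume t: "t \<notin> {\<kappa>, - \<kappa>}"
      \<comment> \<open>Completing the square in \<open>y\<close>: the slice at height
        \<open>t\<close> is a translate of the ellipsoid of squared radius
        \<open>1 - (t / \<kappa>)\<^sup>2\<close>.\<close>
      have sq: "(\<Sum>i\<in>I. (y i)\<^sup>2) + (t + (\<Sum>i\<in>I. w i * y i))\<^sup>2 =
          (ellnorm w I (\<lambda>i\<in>I. y i + t * w i / \<kappa>\<^sup>2))\<^sup>2 + (t / \<kappa>)\<^sup>2" for y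
      proof -
        define a where "a = (\<Sum>i\<in>I. (y i)\<^sup>2)"
        define b where "b = (\<Sum>i\<in>I. w i * y i)"
        define s where "s = t / \<kappa>\<^sup>2"
        have "(\<Sum>i\<in>I. ((\<lambda>i\<in>I. y i + t * w i / \<kappa>\<^sup>2) i)\<^sup>2) = (\<Sum>i\<in>I. (y i)\<^sup>2 + 2 * s * (w i * y i) + s\<^sup>2 * (w i)\<^sup>2)"
          by (rule sum.cong) (auto simp: power2_eq_square algebra_simps s_def)
        also have "\<dots> = a + 2 * s * b + s\<^sup>2 * W"
          unfolding a_def b_def W_def by (simp add: sum.distrib sum_distrib_left)
        finally have 1: "(\<Sum>i\<in>I. ((\<lambda>i\<in>I. y i + t * w i / \<kappa>\<^sup>2) i)\<^sup>2) = a + 2 * s * b + s\<^sup>2 * W" .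
        have "(\<Sum>i\<in>I. w i * ((\<lambda>i\<in>I. y i + t * w i / \<kappa>\<^sup>2) i)) = (\<Sum>i\<in>I. w i * y i + s * (w i)\<^sup>2)"
          by (rule sum.cong) (auto simp: power2_eq_square algebra_simps s_def)
        also have "\<dots> = b + s * W"
          unfolding b_def W_def by (simp add: sum.distrib sum_distrib_left)
        finally have 2: "(\<Sum>i\<in>I. w i * ((\<lambda>i\<in>I. y i + t * w i / \<kappa>\<^sup>2) i)) = b + s * W" .
        have "(ellnorm w I (\<lambda>i\<in>I. y i + t * w i / \<kappa>\<^sup>2))\<^sup>2 = a + 2 * s * b + s\<^sup>2 * W + (b + s * W)\<^sup>2"
          unfolding ellnorm_def 1[symmetric] 2[symmetric]
          by (rule real_sqrt_pow2) (simp add: sum_nonneg)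
        moreover have "t = s * (1 + W)" using \<kappa> W0 by (simp add: s_def)
        moreover have "(t / \<kappa>)\<^sup>2 = s\<^sup>2 * (1 + W)"
        proof -
          have "t / \<kappa> = s * \<kappa>" using \<kappa>(1) by (simp add: s_def power2_eq_square)
          then show ?thesis using \<kappa>(2) by (simp add: power_mult_distrib)
        qed
        ultimately show ?thesis unfolding a_def[symmetric] b_def[symmetric]
          by (simp add: power2_eq_square algebra_simps)
      qed
      have ind: "indicator ?B (y(k := t + (\<Sum>i\<in>I. w i * y i))) =
          (indicator {y \<in> space (leb I). (ellnorm w I (\<lambda>i\<in>I. 1 * y i + t * w i / \<kappa>\<^sup>2))\<^sup>2 \<le> 1 - (t / \<kappa>)\<^sup>2} y :: ennreal)"
        if y: "y \<in> space (leb I)" for y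
      proof -
        let ?y = "y(k := t + (\<Sum>i\<in>I. w i * y i))"
        have "?y \<in> space (leb ?J)" using y by (auto simp: space_leb PiE_iff extensional_def)
        moreover have "(\<Sum>i\<in>?J. (?y i)\<^sup>2) = (\<Sum>i\<in>I. (y i)\<^sup>2) + (t + (\<Sum>i\<in>I. w i * y i))\<^sup>2"
        proof -
          have "(\<Sum>i\<in>I. (?y i)\<^sup>2) = (\<Sum>i\<in>I. (y i)\<^sup>2)" using assms(2) by (intro sum.cong) auto
          then show ?thesis using assms by simp
        qed
        ultimately show ?thesis using y sq[of y] by (auto simp: indicator_def algebra_simps)
      qed
      have int: "(\<integral>\<^sup>+ y. indicator ?B (y(k := t + (\<Sum>i\<in>I. w i * y i))) \<partial>leb I)
        = emeasure (leb I) {y \<in> space (leb I). (ellnorm w I (\<lambda>i\<in>I. 1 * y i + t * w i / \<kappa>\<^sup>2))\<^sup>2 \<le> 1 - (t / \<kappa>)\<^sup>2}"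
      proof -
        have [measurable]: "(\<lambda>y. ellnorm w I (\<lambda>i\<in>I. 1 * y i + t * w i / \<kappa>\<^sup>2)) \<in> borel_measurable (leb I)"
          by (rule measurable_compose[OF measurable_affine_leb measurable_ellnorm])
        have "(\<integral>\<^sup>+ y. indicator ?B (y(k := t + (\<Sum>i\<in>I. w i * y i))) \<partial>leb I)
          = (\<integral>\<^sup>+ y. indicator {y \<in> space (leb I). (ellnorm w I (\<lambda>i\<in>I. 1 * y i + t * w i / \<kappa>\<^sup>2))\<^sup>2 \<le> 1 - (t / \<kappa>)\<^sup>2} y \<partial>leb I)"
          by (rule nn_integral_cong) (rule ind)
        also have "\<dots> = emeasure (leb I) {y \<in> space (leb I). (ellnorm w I (\<lambda>i\<in>I. 1 * y i + t * w i / \<kappa>\<^sup>2))\<^sup>2 \<le> 1 - (t / \<kappa>)\<^sup>2}"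
          by (rule nn_integral_indicator) measurable
        finally show ?thesis .
      qed
      show "(\<integral>\<^sup>+ y. indicator ?B (y(k := t + (\<Sum>i\<in>I. w i * y i))) \<partial>leb I)
        = indicator {-1..1} (t / \<kappa>) * ennreal (sqrt (1 - (t / \<kappa>)\<^sup>2) ^ card I) * E1"
      proof (cases "\<bar>t\<bar> < \<kappa>")
        case True
        define r where "r = sqrt (1 - (t / \<kappa>)\<^sup>2)"
        have "\<bar>t / \<kappa>\<bar> < 1" using True \<kappa> by (simp add: abs_divide)
        then have lt: "(t / \<kappa>)\<^sup>2 < 1" by (simp add: abs_square_less_1)
        then have r: "r > 0" "r\<^sup>2 = 1 - (t / \<kappa>)\<^sup>2" unfolding r_def by auto
        have nn: "ellnorm w I z \<ge> 0" for z unfolding ellnorm_def by (simp add: sum_nonneg)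
        have "{y \<in> space (leb I). (ellnorm w I (\<lambda>i\<in>I. 1 * y i + t * w i / \<kappa>\<^sup>2))\<^sup>2 \<le> 1 - (t / \<kappa>)\<^sup>2}
          = {y \<in> space (leb I). (\<lambda>i\<in>I. 1 * y i + t * w i / \<kappa>\<^sup>2) \<in> {y \<in> space (leb I). ellnorm w I y \<le> r}}"
          using r nn by (auto simp: space_leb power_mono_iff simp flip: r(2))
        also have "emeasure (leb I) \<dots> = emeasure (leb I) {y \<in> space (leb I). ellnorm w I y \<le> r}"
          using emeasure_leb_affine[OF assms(1), of 1 "{y \<in> space (leb I). ellnorm w I y \<le> r}" "\<lambda>i. t * w i / \<kappa>\<^sup>2"]
          by simp
        also have "\<dots> = ennreal (r ^ card I) * E1" unfolding E1_def
          using emeasure_ellnorm_scale[OF assms(1) r(1)] .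
        finally show ?thesis unfolding int r_def
          using True \<kappa> by (simp add: indicator_def abs_less_iff field_simps)
      next
        case False
        then have *: "\<bar>t / \<kappa>\<bar> > 1" using t \<kappa> by (auto simp: abs_divide)
        then have "(t / \<kappa>)\<^sup>2 > 1" using abs_le_square_iff[of "t / \<kappa>" 1] by (simp add: not_le[symmetric])
        then have emp: "{y \<in> space (leb I). (ellnorm w I (\<lambda>i\<in>I. 1 * y i + t * w i / \<kappa>\<^sup>2))\<^sup>2 \<le> 1 - (t / \<kappa>)\<^sup>2} = {}"
          using zero_le_power2 by (auto simp: not_le intro: less_le_trans[of _ 0])
        have "t / \<kappa> \<notin> {-1..1}" using * by auto
        then show ?thesis unfolding int emp by simp
      qed
    qed
  qed
  also have "\<dots> = ennreal \<kappa> * (\<integral>\<^sup>+ s. indicator {-1..1} s * ennreal (sqrt (1 - s\<^sup>2) ^ card I) * E1 \<partial>lborel)"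
    using \<kappa> by (subst nn_integral_real_affine[of _ \<kappa> 0]) auto
  also have "(\<integral>\<^sup>+ s. indicator {-1..1} s * ennreal (sqrt (1 - s\<^sup>2) ^ card I) * E1 \<partial>lborel)
      = (\<integral>\<^sup>+ s. indicator {-1..1} s * sqrt (1 - s\<^sup>2) ^ card I \<partial>lborel) * E1"
    by (subst nn_integral_multc[symmetric]) (auto intro!: nn_integral_cong simp: indicator_def)
  also have "\<dots> = ennreal (Beta (1 / 2) (real (card I) / 2 + 1)) * E1"
    unfolding emeasure_cball_aux_integral ..
  finally show ?thesis unfolding E1_def \<kappa>_def W_def by (simp add: mult_ac)
qed

text \<open>The Beta factor in the slice formula does not depend on \<open>w\<close>, so it cancels
  against the one for \<open>w = 0\<close>. The index type is \<open>nat\<close> so that a fresh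
  axis \<open>k\<close> exists.\<close>

lemma emeasure_ellipsoid:
  fixes I :: "nat set"
  assumes "finite I" "r > 0"
  shows "emeasure (leb I) {y \<in> space (leb I). ellnorm w I y \<le> r}
    = ennreal (unit_ball_vol (real (card I)) * r ^ card I / sqrt (1 + (\<Sum>i\<in>I. (w i)\<^sup>2)))"
proof -
  obtain k where k: "k \<notin> I" using assms(1) ex_new_if_finite infinite_UNIV_nat by blast
  define v where "v = unit_ball_vol (real (card I))"
  define \<beta> where "\<beta> = Beta (1 / 2) (real (card I) / 2 + 1)"
  define \<kappa> where "\<kappa> = sqrt (1 + (\<Sum>i\<in>I. (w i)\<^sup>2))"
  define E where "E = emeasure (leb I) {y \<in> space (leb I). ellnorm w I y \<le> 1}"
  have \<kappa>: "\<kappa> > 0" unfolding \<kappa>_def by (simp add: add_pos_nonneg sum_nonneg)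
  have "{y \<in> space (leb I). ellnorm (\<lambda>_. 0) I y \<le> 1} = {f. sqrt (\<Sum>i\<in>I. (f i)\<^sup>2) \<le> 1} \<inter> space (leb I)"
    by (auto simp: ellnorm_def)
  then have "emeasure (leb I) {y \<in> space (leb I). ellnorm (\<lambda>_. 0) I y \<le> 1} = ennreal v"
    using emeasure_cball_aux[OF assms(1), of 1] by (simp add: v_def)
  then have 0: "ennreal (unit_ball_vol (real (Suc (card I)))) = ennreal \<beta> * ennreal v"
    using emeasure_ellipsoid_slices[OF assms(1) k, of "\<lambda>_. 0"] by (simp add: \<beta>_def)
  moreover have "unit_ball_vol (real (Suc (card I))) > 0" by (rule unit_ball_vol_pos) simp
  ultimately have \<beta>: "ennreal \<beta> \<noteq> 0" by (metis ennreal_eq_0_iff mult_zero_left not_le)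
  have "ennreal \<beta> * (ennreal \<kappa> * E) = ennreal \<beta> * ennreal v"
    using emeasure_ellipsoid_slices[OF assms(1) k, of w] 0 by (simp add: \<beta>_def \<kappa>_def E_def)
  then have "ennreal \<kappa> * E = ennreal v"
    using \<beta> by (simp add: ennreal_mult_cancel_left)
  then have "E = ennreal v / ennreal \<kappa>"
    using \<kappa> by (metis ennreal_eq_0_iff ennreal_mult_divide_eq ennreal_neq_top mult.commute not_le)
  also have "\<dots> = ennreal (v / \<kappa>)" using \<kappa> by (simp add: divide_ennreal v_def unit_ball_vol_nonneg)
  finally show ?thesis
    unfolding emeasure_ellnorm_scale[OF assms] E_def[symmetric] v_def[symmetric] \<kappa>_def[symmetric]
    using assms \<kappa> by (simp add: v_def flip: ennreal_mult)
qed

section \<open>Monotonicity and subadditivity of Hausdorff measures\<close>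

lemma hausdorff_premeasure_mono:
  "S \<subseteq> T \<Longrightarrow> hausdorff_premeasure n d \<delta> S \<le> hausdorff_premeasure n d \<delta> T"
  unfolding hausdorff_premeasure_def by (rule INF_superset_mono) auto

lemma hausdorff_premeasure_le_cover:
  assumes "S \<subseteq> (\<Union>k. U k)" "\<And>k::nat. diam_Rn n (U k) \<le> ennreal \<delta>"
  shows "hausdorff_premeasure n d \<delta> S \<le> (\<Sum>k. if U k = {} then 0
    else ennreal (unit_ball_vol (real d)) * (diam_Rn n (U k) / 2) ^ d)"
  unfolding hausdorff_premeasure_def by (rule INF_lower) (use assms in auto)

lemma diam_Rn_le: "(\<And>x y. x \<in> U \<Longrightarrow> y \<in> U \<Longrightarrow> dist_Rn n x y \<le> r) \<Longrightarrow> diam_Rn n U \<le> ennreal r"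
  unfolding diam_Rn_def by (intro SUP_least ennreal_leI) auto

lemma diam_Rn_empty [simp]: "diam_Rn n {} = 0"
  by (simp add: diam_Rn_def bot_ennreal)

lemma hausdorff_premeasure_le_single:
  assumes "0 \<le> r" "r \<le> \<delta>" "\<And>x y. x \<in> S \<Longrightarrow> y \<in> S \<Longrightarrow> dist_Rn n x y \<le> r"
  shows "hausdorff_premeasure n d \<delta> S \<le> ennreal (unit_ball_vol (real d) * (r / 2) ^ d)"
proof -
  define U where "U = (\<lambda>k::nat. if k = 0 then S else {})"
  have diam: "diam_Rn n S \<le> ennreal r" using assms(3) by (rule diam_Rn_le)
  have "hausdorff_premeasure n d \<delta> S \<le> (\<Sum>k. if U k = {} then 0
    else ennreal (unit_ball_vol (real d)) * (diam_Rn n (U k) / 2) ^ d)"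
  proof (rule hausdorff_premeasure_le_cover)
    show "S \<subseteq> (\<Union>k. U k)" by (auto simp: U_def)
    show "diam_Rn n (U k) \<le> ennreal \<delta>" for k
      using order_trans[OF diam ennreal_leI[OF assms(2)]] by (auto simp: U_def)
  qed
  also have "\<dots> = (\<Sum>k\<in>{0}. if U k = {} then 0
    else ennreal (unit_ball_vol (real d)) * (diam_Rn n (U k) / 2) ^ d)"
    by (rule suminf_finite) (auto simp: U_def)
  also have "\<dots> \<le> ennreal (unit_ball_vol (real d)) * (diam_Rn n S / 2) ^ d"
    by (simp add: U_def)
  also have "\<dots> \<le> ennreal (unit_ball_vol (real d)) * (ennreal r / 2) ^ d"
    by (intro mult_left_mono power_mono divide_right_mono_ennreal diam) auto
  also have "ennreal r / 2 = ennreal (r / 2)"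
    using assms(1) by (simp add: ennreal_divide_numeral)
  also have "ennreal (unit_ball_vol (real d)) * ennreal (r / 2) ^ d = ennreal (unit_ball_vol (real d) * (r / 2) ^ d)"
    using assms(1) by (simp add: ennreal_power ennreal_mult)
  finally show ?thesis .
qed

text \<open>Two countable covers are merged into one by using even and odd indices.\<close>

lemma suminf_interleave_le:
  fixes a b :: "nat \<Rightarrow> ennreal"
  shows "(\<Sum>k. if even k then a (k div 2) else b (k div 2)) \<le> (\<Sum>k. a k) + (\<Sum>k. b k)"
proof -
  let ?f = "\<lambda>k. if even k then a (k div 2) else b (k div 2)"
  have eq: "sum ?f {..<2 * n} = sum a {..<n} + sum b {..<n}" for n
    by (induction n) (simp_all add: algebra_simps)
  have "sum ?f {..<n} \<le> suminf a + suminf b" for n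
  proof -
    have "sum ?f {..<n} \<le> sum ?f {..<2 * n}" by (rule sum_mono2) auto
    also have "\<dots> \<le> suminf a + suminf b" unfolding eq
      by (intro add_mono sum_le_suminf) auto
    finally show ?thesis .
  qed
  then show ?thesis unfolding suminf_eq_SUP by (intro SUP_least)
qed

lemma hausdorff_premeasure_Un:
  "hausdorff_premeasure n d \<delta> (A \<union> B) \<le> hausdorff_premeasure n d \<delta> A + hausdorff_premeasure n d \<delta> B"
proof (rule ennreal_le_epsilon)
  fix e :: real
  assume fin: "hausdorff_premeasure n d \<delta> A + hausdorff_premeasure n d \<delta> B < top" and e: "0 < e"
  let ?c = "\<lambda>U. if U = {} then 0 else ennreal (unit_ball_vol (real d)) * (diam_Rn n U / 2) ^ d"
  have ex: "\<exists>U. S \<subseteq> (\<Union>k. U k) \<and> (\<forall>k::nat. diam_Rn n (U k) \<le> ennreal \<delta>) \<and>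
      (\<Sum>k. ?c (U k)) < hausdorff_premeasure n d \<delta> S + ennreal (e / 2)"
    if "hausdorff_premeasure n d \<delta> S < top" for S
  proof -
    have "hausdorff_premeasure n d \<delta> S < hausdorff_premeasure n d \<delta> S + ennreal (e / 2)"
      using that e by (cases "hausdorff_premeasure n d \<delta> S") (auto simp: ennreal_plus[symmetric] ennreal_less_iff simp del: ennreal_plus)
    from this[unfolded hausdorff_premeasure_def[of n d \<delta> S] INF_less_iff]
    show ?thesis unfolding hausdorff_premeasure_def[of n d \<delta> S] by auto
  qed
  have "hausdorff_premeasure n d \<delta> A < top" "hausdorff_premeasure n d \<delta> B < top"
    using fin by (auto simp: less_top)
  then obtain U V where U: "A \<subseteq> (\<Union>k. U k)" "\<And>k::nat. diam_Rn n (U k) \<le> ennreal \<delta>"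
      "(\<Sum>k. ?c (U k)) < hausdorff_premeasure n d \<delta> A + ennreal (e / 2)"
    and V: "B \<subseteq> (\<Union>k. V k)" "\<And>k::nat. diam_Rn n (V k) \<le> ennreal \<delta>"
      "(\<Sum>k. ?c (V k)) < hausdorff_premeasure n d \<delta> B + ennreal (e / 2)"
    using ex by meson
  define W where "W = (\<lambda>k. if even k then U (k div 2) else V (k div 2))"
  have "hausdorff_premeasure n d \<delta> (A \<union> B) \<le> (\<Sum>k. ?c (W k))"
  proof (rule hausdorff_premeasure_le_cover)
    have "U k \<subseteq> (\<Union>k. W k)" "V k \<subseteq> (\<Union>k. W k)" for k
      using UN_upper[of "2 * k" UNIV W] UN_upper[of "Suc (2 * k)" UNIV W] by (simp_all add: W_def)
    then have "(\<Union>k. U k) \<union> (\<Union>k. V k) \<subseteq> (\<Union>k. W k)" by (intro Un_least UN_least)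
    moreover have "A \<union> B \<subseteq> (\<Union>k. U k) \<union> (\<Union>k. V k)" using U(1) V(1) by (rule Un_mono)
    ultimately show "A \<union> B \<subseteq> (\<Union>k. W k)" by order
    show "diam_Rn n (W k) \<le> ennreal \<delta>" for k using U V by (simp add: W_def)
  qed
  also have "(\<lambda>k. ?c (W k)) = (\<lambda>k. if even k then ?c (U (k div 2)) else ?c (V (k div 2)))"
    by (auto simp: W_def)
  also have "suminf \<dots> \<le> (\<Sum>k. ?c (U k)) + (\<Sum>k. ?c (V k))" by (rule suminf_interleave_le)
  also have "\<dots> \<le> (hausdorff_premeasure n d \<delta> A + ennreal (e / 2)) + (hausdorff_premeasure n d \<delta> B + ennreal (e / 2))"
    using U(3) V(3) by (intro add_mono) auto
  also have "\<dots> = hausdorff_premeasure n d \<delta> A + hausdorff_premeasure n d \<delta> B + ennreal e"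
  proof -
    have "ennreal e = ennreal (e / 2) + ennreal (e / 2)" using e by (simp flip: ennreal_plus)
    then show ?thesis by (simp add: ac_simps)
  qed
  finally show "hausdorff_premeasure n d \<delta> (A \<union> B) \<le> hausdorff_premeasure n d \<delta> A + hausdorff_premeasure n d \<delta> B + ennreal e" .
qed

lemma hausdorff_premeasure_empty: "\<delta> \<ge> 0 \<Longrightarrow> hausdorff_premeasure n d \<delta> {} = 0"
  using hausdorff_premeasure_le_cover[of "{}" "\<lambda>_. {}" n \<delta> d] by simp

lemma hausdorff_premeasure_UN:
  assumes "finite Z" "\<delta> \<ge> 0"
  shows "hausdorff_premeasure n d \<delta> (\<Union>z\<in>Z. A z) \<le> (\<Sum>z\<in>Z. hausdorff_premeasure n d \<delta> (A z))"
  using assms(1)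
proof induction
  case empty
  then show ?case using hausdorff_premeasure_empty[OF assms(2)] by simp
next
  case (insert z Z)
  have "hausdorff_premeasure n d \<delta> (\<Union>z\<in>insert z Z. A z) \<le>
      hausdorff_premeasure n d \<delta> (A z) + hausdorff_premeasure n d \<delta> (\<Union>z\<in>Z. A z)"
    using hausdorff_premeasure_Un by simp
  also have "\<dots> \<le> hausdorff_premeasure n d \<delta> (A z) + (\<Sum>z\<in>Z. hausdorff_premeasure n d \<delta> (A z))"
    using insert by (intro add_left_mono) auto
  finally show ?case using insert by simp
qed

lemma hausdorff_measure_mono: "S \<subseteq> T \<Longrightarrow> hausdorff_measure n d S \<le> hausdorff_measure n d T"
  unfolding hausdorff_measure_def by (intro SUP_mono) (use hausdorff_premeasure_mono in blast)

lemma hausdorff_measure_Un: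
  "hausdorff_measure n d (A \<union> B) \<le> hausdorff_measure n d A + hausdorff_measure n d B"
  unfolding hausdorff_measure_def
proof (rule SUP_least)
  fix \<delta> :: real assume \<delta>: "\<delta> \<in> {0<..}"
  have "hausdorff_premeasure n d \<delta> (A \<union> B) \<le> hausdorff_premeasure n d \<delta> A + hausdorff_premeasure n d \<delta> B"
    by (rule hausdorff_premeasure_Un)
  also have "\<dots> \<le> (SUP \<delta>\<in>{0<..}. hausdorff_premeasure n d \<delta> A) + (SUP \<delta>\<in>{0<..}. hausdorff_premeasure n d \<delta> B)"
    using \<delta> by (intro add_mono SUP_upper)
  finally show "hausdorff_premeasure n d \<delta> (A \<union> B) \<le> \<dots>" .
qed

lemma hausdorff_measure_UN:
  assumes "finite Z"
  shows "hausdorff_measure n d (\<Union>z\<in>Z. A z) \<le> (\<Sum>z\<in>Z. hausdorff_measure n d (A z))"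
  using assms
proof induction
  case empty
  then show ?case by (simp add: hausdorff_measure_def hausdorff_premeasure_empty)
next
  case (insert z Z)
  have "hausdorff_measure n d (\<Union>z\<in>insert z Z. A z) \<le>
      hausdorff_measure n d (A z) + hausdorff_measure n d (\<Union>z\<in>Z. A z)"
    using hausdorff_measure_Un by simp
  also have "\<dots> \<le> hausdorff_measure n d (A z) + (\<Sum>z\<in>Z. hausdorff_measure n d (A z))"
    using insert by (intro add_left_mono) auto
  finally show ?case using insert by simp
qed

section \<open>Hausdorff measure of graphs\<close>

text \<open>Half-open, so that dyadic cubes of the same side length are disjoint.\<close>

definition cube :: "'i set \<Rightarrow> ('i \<Rightarrow> real) \<Rightarrow> real \<Rightarrow> ('i \<Rightarrow> real) set" where
  "cube I p s = (\<Pi>\<^sub>E i\<in>I. {p i..<p i + s})"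

lemma emeasure_cube:
  assumes "finite I" "s \<ge> 0"
  shows "cube I p s \<in> sets (leb I)" "emeasure (leb I) (cube I p s) = ennreal (s ^ card I)"
  unfolding cube_def using assms
  by (auto simp: lborel_PiM.emeasure_PiM ennreal_power intro!: sets_PiM_I_finite)

text \<open>The union of the dyadic cubes of side \<open>1 / 2 ^ j\<close> that meet
  \<open>K\<close>. For closed \<open>K\<close> these sets decrease to \<open>K\<close>, which turns
  a bound on cubes into a bound on compact sets.\<close>

definition dyadic_nbhd :: "'i set \<Rightarrow> nat \<Rightarrow> ('i \<Rightarrow> real) set \<Rightarrow> ('i \<Rightarrow> real) set" where
  "dyadic_nbhd I j K = {y \<in> I \<rightarrow>\<^sub>E UNIV. \<exists>z\<in>K. \<forall>i\<in>I. \<lfloor>2 ^ j * y i\<rfloor> = \<lfloor>2 ^ j * z i\<rfloor>}"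

lemma in_cube_dyadic:
  "y \<in> I \<rightarrow>\<^sub>E UNIV \<Longrightarrow> y \<in> cube I (\<lambda>i. real_of_int (k i) / 2 ^ j) (1 / 2 ^ j) \<longleftrightarrow> (\<forall>i\<in>I. \<lfloor>2 ^ j * y i\<rfloor> = k i)"
  unfolding cube_def PiE_iff floor_eq_iff
  by (auto simp: field_simps PiE_iff)

lemma decseq_dyadic_nbhd: "decseq (\<lambda>j. dyadic_nbhd I j K)"
proof (rule decseq_SucI)
  fix j
  have fl: "\<lfloor>2 ^ j * a\<rfloor> = \<lfloor>2 ^ Suc j * a\<rfloor> div 2" for a :: real
    using floor_divide_real_eq_div[of 2 "2 ^ Suc j * a"] by simp
  show "dyadic_nbhd I (Suc j) K \<subseteq> dyadic_nbhd I j K"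
  proof
    fix y assume "y \<in> dyadic_nbhd I (Suc j) K"
    then obtain z where "y \<in> I \<rightarrow>\<^sub>E UNIV" "z \<in> K" "\<forall>i\<in>I. \<lfloor>2 ^ Suc j * y i\<rfloor> = \<lfloor>2 ^ Suc j * z i\<rfloor>"
      unfolding dyadic_nbhd_def by blast
    then have "y \<in> I \<rightarrow>\<^sub>E UNIV \<and> (\<exists>z\<in>K. \<forall>i\<in>I. \<lfloor>2 ^ j * y i\<rfloor> = \<lfloor>2 ^ j * z i\<rfloor>)"
      unfolding fl by metis
    then show "y \<in> dyadic_nbhd I j K" unfolding dyadic_nbhd_def by blast
  qed
qed

lemma INT_dyadic_nbhd:
  assumes "finite I" "closedin (prodtop I) K"
  shows "(\<Inter>j. dyadic_nbhd I j K) = K"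
proof
  have KE: "K \<subseteq> I \<rightarrow>\<^sub>E UNIV" using assms unfolding closedin_prodtop[OF assms(1)] by blast
  then show "K \<subseteq> (\<Inter>j. dyadic_nbhd I j K)" unfolding dyadic_nbhd_def by auto
  show "(\<Inter>j. dyadic_nbhd I j K) \<subseteq> K"
  proof
    fix y assume y: "y \<in> (\<Inter>j. dyadic_nbhd I j K)"
    then have yE: "y \<in> I \<rightarrow>\<^sub>E UNIV" by (auto simp: dyadic_nbhd_def)
    have "\<exists>z\<in>K. \<forall>i\<in>I. \<bar>z i - y i\<bar> < e" if e: "e > 0" for e
    proof -
      obtain j where j: "(1 / 2) ^ j < e" using real_arch_pow_inv[OF e, of "1/2"] by auto
      have "y \<in> dyadic_nbhd I j K" using y by blast
      then obtain z where z: "z \<in> K" "\<forall>i\<in>I. \<lfloor>2 ^ j * y i\<rfloor> = \<lfloor>2 ^ j * z i\<rfloor>"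
        unfolding dyadic_nbhd_def by blast
      have "\<bar>z i - y i\<bar> < e" if "i \<in> I" for i
      proof -
        have "\<lfloor>2 ^ j * y i\<rfloor> = \<lfloor>2 ^ j * z i\<rfloor>" using z that by blast
        then have "\<bar>2 ^ j * z i - 2 ^ j * y i\<bar> < 1" by linarith
        then have "2 ^ j * \<bar>z i - y i\<bar> < 1" by (simp add: abs_mult flip: right_diff_distrib)
        then have "\<bar>z i - y i\<bar> < (1 / 2) ^ j" by (simp add: field_simps power_divide)
        then show ?thesis using j by simp
      qed
      then show ?thesis using z by blast
    qed
    then show "y \<in> K" using assms yE unfolding closedin_prodtop[OF assms(1)] by blast
  qed
qed

lemma dyadic_nbhd_cubes:
  assumes "finite I" "compactin (prodtop I) K"
  obtains Z :: "('i \<Rightarrow> int) set" where "finite Z"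
    "dyadic_nbhd I j K = (\<Union>k\<in>Z. cube I (\<lambda>i. real_of_int (k i) / 2 ^ j) (1 / 2 ^ j))"
    "disjoint_family_on (\<lambda>k. cube I (\<lambda>i. real_of_int (k i) / 2 ^ j) (1 / 2 ^ j)) Z"
proof -
  obtain r where r: "r > 0" "\<And>x i. x \<in> K \<Longrightarrow> i \<in> I \<Longrightarrow> \<bar>x i\<bar> \<le> r"
    using compactin_prodtop_bounded[OF assms] by blast
  define fl where "fl = (\<lambda>z::'i \<Rightarrow> real. \<lambda>i\<in>I. \<lfloor>2 ^ j * z i\<rfloor>)"
  define Z where "Z = fl ` K"
  have "Z \<subseteq> I \<rightarrow>\<^sub>E {\<lfloor>- (2 ^ j * r)\<rfloor>..\<lfloor>2 ^ j * r\<rfloor>}"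
  proof
    fix k assume "k \<in> Z"
    then obtain z where z: "z \<in> K" "k = fl z" by (auto simp: Z_def)
    have "\<lfloor>- (2 ^ j * r)\<rfloor> \<le> \<lfloor>2 ^ j * z i\<rfloor> \<and> \<lfloor>2 ^ j * z i\<rfloor> \<le> \<lfloor>2 ^ j * r\<rfloor>" if "i \<in> I" for i
    proof -
      have "\<bar>z i\<bar> \<le> r" using r z that by blast
      then have "2 ^ j * \<bar>z i\<bar> \<le> 2 ^ j * r" by simp
      then have "\<bar>2 ^ j * z i\<bar> \<le> 2 ^ j * r" by (simp add: abs_mult)
      then show ?thesis by (auto intro!: floor_mono simp: abs_le_iff)
    qed
    then show "k \<in> I \<rightarrow>\<^sub>E {\<lfloor>- (2 ^ j * r)\<rfloor>..\<lfloor>2 ^ j * r\<rfloor>}"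
      using z by (auto simp: fl_def)
  qed
  then have fin: "finite Z" by (rule finite_subset) (use assms in \<open>auto intro!: finite_PiE\<close>)
  have "dyadic_nbhd I j K = (\<Union>k\<in>Z. cube I (\<lambda>i. real_of_int (k i) / 2 ^ j) (1 / 2 ^ j))"
  proof (intro set_eqI iffI)
    fix y assume "y \<in> dyadic_nbhd I j K"
    then obtain z where z: "y \<in> I \<rightarrow>\<^sub>E UNIV" "z \<in> K" "\<forall>i\<in>I. \<lfloor>2 ^ j * y i\<rfloor> = \<lfloor>2 ^ j * z i\<rfloor>"
      by (auto simp: dyadic_nbhd_def)
    then have "y \<in> cube I (\<lambda>i. real_of_int (fl z i) / 2 ^ j) (1 / 2 ^ j)"
      unfolding in_cube_dyadic[OF z(1)] fl_def by simp
    then show "y \<in> (\<Union>k\<in>Z. cube I (\<lambda>i. real_of_int (k i) / 2 ^ j) (1 / 2 ^ j))"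
      using z(2) by (auto simp: Z_def)
  next
    fix y assume "y \<in> (\<Union>k\<in>Z. cube I (\<lambda>i. real_of_int (k i) / 2 ^ j) (1 / 2 ^ j))"
    then obtain z where z: "z \<in> K" "y \<in> cube I (\<lambda>i. real_of_int (fl z i) / 2 ^ j) (1 / 2 ^ j)"
      by (auto simp: Z_def)
    have yE: "y \<in> I \<rightarrow>\<^sub>E UNIV" using z(2) by (auto simp: cube_def PiE_iff)
    show "y \<in> dyadic_nbhd I j K"
      using z unfolding in_cube_dyadic[OF yE] dyadic_nbhd_def using yE by (auto simp: fl_def)
  qed
  moreover have "disjoint_family_on (\<lambda>k. cube I (\<lambda>i. real_of_int (k i) / 2 ^ j) (1 / 2 ^ j)) Z"
    unfolding disjoint_family_on_def
  proof (intro ballI impI)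
    fix k l assume kl: "k \<in> Z" "l \<in> Z" "k \<noteq> l"
    have ext: "k \<in> extensional I" "l \<in> extensional I" using kl by (auto simp: Z_def fl_def)
    show "cube I (\<lambda>i. real_of_int (k i) / 2 ^ j) (1 / 2 ^ j) \<inter> cube I (\<lambda>i. real_of_int (l i) / 2 ^ j) (1 / 2 ^ j) = {}"
    proof (rule ccontr)
      assume "\<not> ?thesis"
      then obtain y where y: "y \<in> cube I (\<lambda>i. real_of_int (k i) / 2 ^ j) (1 / 2 ^ j)"
        "y \<in> cube I (\<lambda>i. real_of_int (l i) / 2 ^ j) (1 / 2 ^ j)" by blast
      have yE: "y \<in> I \<rightarrow>\<^sub>E UNIV" using y by (auto simp: cube_def PiE_iff)
      have "\<forall>i\<in>I. k i = l i" using y unfolding in_cube_dyadic[OF yE] by auto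
      then have "k = l" using ext by (intro extensionalityI[of _ I]) auto
      then show False using kl by blast
    qed
  qed
  ultimately show ?thesis using fin that by blast
qed

lemma ellnorm_triangle:
  "ellnorm w I (\<lambda>i\<in>I. a i - b i) \<le> ellnorm w I (\<lambda>i\<in>I. a i - q i) + ellnorm w I (\<lambda>i\<in>I. b i - q i)"
proof -
  \<comment> \<open>\<open>f u\<close> is the lift of \<open>u\<close> to the graph of
    \<open>w\<close>, with \<open>None\<close> indexing the additional coordinate; the claim becomes
    Minkowski's inequality.\<close>
  define f where "f u j = (case j of None \<Rightarrow> \<Sum>i\<in>I. w i * u i | Some i \<Rightarrow> u i)" for u j
  have L2: "ellnorm w I u = L2_set (f u) (insert None (Some ` I))" if "finite I" for u
    unfolding ellnorm_def L2_set_def f_def using that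
    by (simp add: sum.reindex)
  show ?thesis
  proof (cases "finite I")
    case True
    let ?J = "insert None (Some ` I)"
    let ?a = "\<lambda>i\<in>I. a i - q i" and ?b = "\<lambda>i\<in>I. b i - q i"
    have "ellnorm w I (\<lambda>i\<in>I. a i - b i) = L2_set (\<lambda>j. f ?a j + - f ?b j) ?J"
      unfolding L2[OF True]
    proof (rule L2_set_cong)
      fix j assume "j \<in> ?J"
      then show "f (\<lambda>i\<in>I. a i - b i) j = f ?a j + - f ?b j"
        by (auto simp: f_def algebra_simps sum_subtractf)
    qed simp
    also have "\<dots> \<le> L2_set (f ?a) ?J + L2_set (\<lambda>j. - f ?b j) ?J" by (rule L2_set_triangle_ineq)
    also have "L2_set (\<lambda>j. - f ?b j) ?J = L2_set (f ?b) ?J" by (simp add: L2_set_def)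
    finally show ?thesis unfolding L2[OF True] .
  qed (simp add: ellnorm_def)
qed

text \<open>In a set-up of the following form, the map \<open>g\<close> distorts distances like a linear graph.\<close>

locale linear_graph =
  fixes n :: nat and I :: "nat set" and w :: "nat \<Rightarrow> real" and g :: "(nat \<Rightarrow> real) \<Rightarrow> (nat \<Rightarrow> real)"
  assumes finite_I: "finite I"
    and dist_g: "\<And>x y. dist_Rn n (g x) (g y) = ellnorm w I (\<lambda>i\<in>I. x i - y i)"
begin

definition "d = card I"
definition "\<kappa> = sqrt (1 + (\<Sum>i\<in>I. (w i)\<^sup>2))"
text \<open>The share of a cube of side \<open>s\<close> that the concentric ellipsoid of
  \<open>ellnorm\<close> radius \<open>s / 2\<close> fills.\<close>

definition "\<alpha> = unit_ball_vol (real d) / (2 ^ d * \<kappa>)"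
text \<open>A cube of side \<open>s\<close> has \<open>ellnorm\<close> diameter at most
  \<open>s * \<rho>\<close>.\<close>

definition "\<rho> = sqrt (real d + (\<Sum>i\<in>I. \<bar>w i\<bar>)\<^sup>2)"

text \<open>The restriction on \<open>s\<close> makes the image of the cube small enough to be a
  single covering set; the \<open>+ 1\<close> also gives \<open>s \<le> \<delta>\<close>, needed for
  the inscribed ellipsoid.\<close>

definition cube_bound :: "real \<Rightarrow> real \<Rightarrow> bool" where
  "cube_bound \<delta> M \<longleftrightarrow> (\<forall>p s. 0 < s \<longrightarrow> s * (\<rho> + 1) \<le> \<delta> \<longrightarrow>
     hausdorff_premeasure n d \<delta> (g ` cube I p s) \<le> ennreal (M * s ^ d))"

lemma \<kappa>_ge_1: "\<kappa> \<ge> 1"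
  unfolding \<kappa>_def by (simp add: sum_nonneg)

lemma \<alpha>_pos: "\<alpha> > 0"
  unfolding \<alpha>_def using \<kappa>_ge_1 by (simp add: unit_ball_vol_pos)

lemma \<rho>_nonneg: "\<rho> \<ge> 0"
  unfolding \<rho>_def by (simp add: sum_nonneg)

text \<open>Cover \<open>K\<close> by the dyadic cubes that meet it, for \<open>j\<close> so large
  that \<open>cube_bound\<close> applies. Their total volume tends to that of \<open>K\<close> by
  continuity from above.\<close>

lemma cube_bound_compact:
  assumes "cube_bound \<delta> M" "M \<ge> 0" "\<delta> > 0" "compactin (prodtop I) K"
  shows "hausdorff_premeasure n d \<delta> (g ` K) \<le> ennreal M * emeasure (leb I) K"
proof -
  have cl: "closedin (prodtop I) K" using assms(4) by (rule compactin_prodtop_imp_closedin)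
  have KE: "K \<subseteq> I \<rightarrow>\<^sub>E UNIV" using cl unfolding closedin_prodtop[OF finite_I] by blast
  have meas: "dyadic_nbhd I j K \<in> sets (leb I)" and fin: "emeasure (leb I) (dyadic_nbhd I j K) \<noteq> top"
    and bound: "(1 / 2 ^ j) * (\<rho> + 1) \<le> \<delta> \<Longrightarrow>
      hausdorff_premeasure n d \<delta> (g ` K) \<le> ennreal M * emeasure (leb I) (dyadic_nbhd I j K)" for j
  proof -
    obtain Z :: "(nat \<Rightarrow> int) set" where Z: "finite Z"
      "dyadic_nbhd I j K = (\<Union>k\<in>Z. cube I (\<lambda>i. real_of_int (k i) / 2 ^ j) (1 / 2 ^ j))"
      "disjoint_family_on (\<lambda>k. cube I (\<lambda>i. real_of_int (k i) / 2 ^ j) (1 / 2 ^ j)) Z"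
      using dyadic_nbhd_cubes[OF finite_I assms(4)] by blast
    let ?Q = "\<lambda>k::nat \<Rightarrow> int. cube I (\<lambda>i. real_of_int (k i) / 2 ^ j) (1 / 2 ^ j)"
    have Qm: "?Q k \<in> sets (leb I)" "emeasure (leb I) (?Q k) = ennreal ((1 / 2 ^ j) ^ d)" for k
      unfolding d_def using emeasure_cube[OF finite_I, of "1 / 2 ^ j"] by auto
    show "dyadic_nbhd I j K \<in> sets (leb I)" unfolding Z(2) using Z(1) Qm by (intro sets.finite_UN) auto
    have em: "emeasure (leb I) (dyadic_nbhd I j K) = (\<Sum>k\<in>Z. ennreal ((1 / 2 ^ j) ^ d))"
      unfolding Z(2) using Z Qm by (subst sum_emeasure[symmetric]) auto
    then show "emeasure (leb I) (dyadic_nbhd I j K) \<noteq> top" by (simp add: ennreal_mult_eq_top_iff)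
    assume j: "(1 / 2 ^ j) * (\<rho> + 1) \<le> \<delta>"
    have "K \<subseteq> dyadic_nbhd I j K" using KE by (auto simp: dyadic_nbhd_def)
    then have "g ` K \<subseteq> (\<Union>k\<in>Z. g ` ?Q k)" unfolding Z(2) by blast
    then have "hausdorff_premeasure n d \<delta> (g ` K) \<le> hausdorff_premeasure n d \<delta> (\<Union>k\<in>Z. g ` ?Q k)"
      by (rule hausdorff_premeasure_mono)
    also have "\<dots> \<le> (\<Sum>k\<in>Z. hausdorff_premeasure n d \<delta> (g ` ?Q k))"
      using Z(1) assms(3) by (intro hausdorff_premeasure_UN) auto
    also have "\<dots> \<le> (\<Sum>k\<in>Z. ennreal (M * (1 / 2 ^ j) ^ d))"
      using assms(1) j unfolding cube_bound_def by (intro sum_mono) simp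
    also have "\<dots> = ennreal M * emeasure (leb I) (dyadic_nbhd I j K)"
      unfolding em sum_distrib_left using assms(2) by (intro sum.cong) (auto simp: ennreal_mult)
    finally show "hausdorff_premeasure n d \<delta> (g ` K) \<le> ennreal M * emeasure (leb I) (dyadic_nbhd I j K)" .
  qed
  have "(\<lambda>j. emeasure (leb I) (dyadic_nbhd I j K)) \<longlonglongrightarrow> emeasure (leb I) (\<Inter>j. dyadic_nbhd I j K)"
    using meas fin decseq_dyadic_nbhd by (intro Lim_emeasure_decseq) auto
  then have "(\<lambda>j. ennreal M * emeasure (leb I) (dyadic_nbhd I j K)) \<longlonglongrightarrow> ennreal M * emeasure (leb I) K"
    unfolding INT_dyadic_nbhd[OF finite_I cl] by (intro ennreal_tendsto_cmult) auto
  moreover obtain j0 where j0: "(1 / 2) ^ j0 < \<delta> / (\<rho> + 1)"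
    using real_arch_pow_inv[of "\<delta> / (\<rho> + 1)" "1/2"] assms(3) \<rho>_nonneg by auto
  have "hausdorff_premeasure n d \<delta> (g ` K) \<le> ennreal M * emeasure (leb I) (dyadic_nbhd I j K)" if "j \<ge> j0" for j
  proof (rule bound)
    have "(1 / 2 ^ j) \<le> (1 / 2 ^ j0 :: real)" using that by (simp add: field_simps power_increasing)
    then have "(1 / 2 ^ j) < \<delta> / (\<rho> + 1)" using j0 by (simp add: power_one_over)
    then show "(1 / 2 ^ j) * (\<rho> + 1) \<le> \<delta>" using \<rho>_nonneg by (simp add: pos_less_divide_eq)
  qed
  ultimately show ?thesis by (intro LIMSEQ_le_const) auto
qed

text \<open>The image of the cube covers itself. The constant is far from sharp and only starts the
  iteration below.\<close>

lemma cube_bound_crude: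
  assumes "\<delta> > 0"
  shows "cube_bound \<delta> (unit_ball_vol (real d) * (\<rho> / 2) ^ d)"
  unfolding cube_bound_def
proof (intro allI impI)
  fix p :: "nat \<Rightarrow> real" and s :: real assume s: "0 < s" "s * (\<rho> + 1) \<le> \<delta>"
  have "hausdorff_premeasure n d \<delta> (g ` cube I p s) \<le> ennreal (unit_ball_vol (real d) * (s * \<rho> / 2) ^ d)"
  proof (rule hausdorff_premeasure_le_single)
    show "0 \<le> s * \<rho>" using s \<rho>_nonneg by simp
    show "s * \<rho> \<le> \<delta>" using s by (simp add: algebra_simps)
    fix x y assume "x \<in> g ` cube I p s" "y \<in> g ` cube I p s"
    then obtain a b where ab: "x = g a" "y = g b" "a \<in> cube I p s" "b \<in> cube I p s" by blast
    have diff: "\<bar>a i - b i\<bar> \<le> s" if "i \<in> I" for i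
    proof -
      have "a i \<in> {p i..<p i + s}" "b i \<in> {p i..<p i + s}"
        using ab(3,4) that by (auto simp: cube_def PiE_iff)
      then show ?thesis by auto
    qed
    have "(\<Sum>i\<in>I. ((\<lambda>i\<in>I. a i - b i) i)\<^sup>2) \<le> (\<Sum>i\<in>I. s\<^sup>2)"
      using diff s by (intro sum_mono) (auto simp: abs_le_square_iff[symmetric])
    then have 1: "(\<Sum>i\<in>I. ((\<lambda>i\<in>I. a i - b i) i)\<^sup>2) \<le> d * s\<^sup>2" by (simp add: d_def)
    have "\<bar>\<Sum>i\<in>I. w i * (\<lambda>i\<in>I. a i - b i) i\<bar> \<le> (\<Sum>i\<in>I. \<bar>w i * (\<lambda>i\<in>I. a i - b i) i\<bar>)" by (rule sum_abs)
    also have "\<dots> \<le> (\<Sum>i\<in>I. \<bar>w i\<bar> * s)"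
      using diff by (intro sum_mono) (auto simp: abs_mult mult_left_mono)
    finally have "\<bar>\<Sum>i\<in>I. w i * (\<lambda>i\<in>I. a i - b i) i\<bar> \<le> (\<Sum>i\<in>I. \<bar>w i\<bar>) * s" by (simp add: sum_distrib_right)
    then have "(\<Sum>i\<in>I. w i * (\<lambda>i\<in>I. a i - b i) i)\<^sup>2 \<le> ((\<Sum>i\<in>I. \<bar>w i\<bar>) * s)\<^sup>2"
      by (metis abs_ge_zero power2_abs power_mono)
    with 1 have "ellnorm w I (\<lambda>i\<in>I. a i - b i) \<le> sqrt (d * s\<^sup>2 + ((\<Sum>i\<in>I. \<bar>w i\<bar>) * s)\<^sup>2)"
      unfolding ellnorm_def by (intro real_sqrt_le_mono add_mono)
    also have "d * s\<^sup>2 + ((\<Sum>i\<in>I. \<bar>w i\<bar>) * s)\<^sup>2 = s\<^sup>2 * (d + (\<Sum>i\<in>I. \<bar>w i\<bar>)\<^sup>2)"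
      by (simp add: power_mult_distrib algebra_simps)
    also have "sqrt \<dots> = s * \<rho>" using s by (simp add: real_sqrt_mult \<rho>_def)
    finally show "dist_Rn n x y \<le> s * \<rho>" unfolding ab dist_g .
  qed
  then show "hausdorff_premeasure n d \<delta> (g ` cube I p s) \<le> ennreal (unit_ball_vol (real d) * (\<rho> / 2) ^ d * s ^ d)"
    by (simp add: power_divide power_mult_distrib mult_ac)
qed

text \<open>The ellipsoid is open so that its complement in a closed cube is compact; its volume is
  approached from inside by closed ellipsoids of radius \<open>r < s / 2\<close>.\<close>

lemma emeasure_open_ellipsoid_ge:
  assumes "s > 0"
  shows "ennreal (\<alpha> * s ^ d) \<le> emeasure (leb I) {y \<in> space (leb I). ellnorm w I y < s / 2}"
    (is "_ \<le> emeasure _ ?E")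
proof (cases "emeasure (leb I) ?E")
  case (real e)
  have "\<forall>\<^sub>F r in at_left (s / 2). unit_ball_vol (real d) * r ^ d / \<kappa> \<le> e"
  proof (rule eventually_at_leftI[of 0])
    fix r assume r: "r \<in> {0<..<s / 2}"
    have "ennreal (unit_ball_vol (real d) * r ^ d / \<kappa>) = emeasure (leb I) {y \<in> space (leb I). ellnorm w I y \<le> r}"
      unfolding d_def \<kappa>_def using r by (intro emeasure_ellipsoid[symmetric] finite_I) auto
    also have "\<dots> \<le> emeasure (leb I) ?E"
      by (intro emeasure_mono) (use r in auto)
    finally show "unit_ball_vol (real d) * r ^ d / \<kappa> \<le> e" using real by simp
  qed (use assms in auto)
  moreover have "((\<lambda>r. unit_ball_vol (real d) * r ^ d / \<kappa>) \<longlongrightarrow> unit_ball_vol (real d) * (s / 2) ^ d / \<kappa>) (at_left (s / 2))"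
    by (intro tendsto_intros) (use \<kappa>_ge_1 in auto)
  ultimately have "unit_ball_vol (real d) * (s / 2) ^ d / \<kappa> \<le> e"
    by (intro tendsto_upperbound) auto
  then show ?thesis unfolding real(2) \<alpha>_def by (simp add: power_divide mult_ac ennreal_leI)
qed simp

text \<open>The image of the inscribed ellipsoid has diameter at most \<open>s\<close>, so as one
  covering set it costs \<open>unit_ball_vol d * (s / 2) ^ d\<close>, which is
  \<open>\<kappa> * \<alpha> * s ^ d\<close>. The rest of the cube is compact and pays the old rate
  \<open>M\<close>. The resulting map of \<open>M\<close> has the fixed point
  \<open>\<kappa>\<close>, so iterating it takes the place of a Vitali covering.\<close>

lemma cube_bound_improve:
  assumes "cube_bound \<delta> M" "M \<ge> 0" "\<delta> > 0"
  shows "cube_bound \<delta> (\<kappa> * \<alpha> + M * (1 - \<alpha>))" and "\<alpha> \<le> 1"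
proof -
  have main: "\<alpha> \<le> 1 \<and> hausdorff_premeasure n d \<delta> (g ` cube I p s) \<le> ennreal ((\<kappa> * \<alpha> + M * (1 - \<alpha>)) * s ^ d)"
    if s: "0 < s" "s * (\<rho> + 1) \<le> \<delta>" for p s
  proof -
    define q where "q = (\<lambda>i. p i + s / 2)"
    define Q where "Q = (\<Pi>\<^sub>E i\<in>I. {p i..p i + s})"
    define E where "E = {y \<in> I \<rightarrow>\<^sub>E UNIV. ellnorm w I (\<lambda>i\<in>I. y i - q i) < s / 2}"
    have Qm: "Q \<in> sets (leb I)" "emeasure (leb I) Q = ennreal (s ^ d)"
      unfolding Q_def d_def using finite_I s
      by (auto simp: lborel_PiM.emeasure_PiM ennreal_power intro!: sets_PiM_I_finite)
    have E': "E = {y \<in> space (leb I). (\<lambda>i\<in>I. 1 * y i + - q i) \<in> {y \<in> space (leb I). ellnorm w I y < s / 2}}"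
      by (auto simp: E_def space_leb)
    have Em: "E \<in> sets (leb I)" unfolding E'
      using measurable_affine_leb[of 1 "\<lambda>i. - q i" I, measurable] by measurable
    have "emeasure (leb I) E = emeasure (leb I) {y \<in> space (leb I). ellnorm w I y < s / 2}"
      unfolding E'
      using emeasure_leb_affine[OF finite_I, of 1 "{y \<in> space (leb I). ellnorm w I y < s / 2}" "\<lambda>i. - q i"] by simp
    then have Ege: "ennreal (\<alpha> * s ^ d) \<le> emeasure (leb I) E"
      using emeasure_open_ellipsoid_ge[OF s(1)] by simp
    have EQ: "E \<subseteq> Q"
    proof
      fix y assume y: "y \<in> E"
      have "y i \<in> {p i..p i + s}" if "i \<in> I" for i
      proof -
        have "(y i - q i)\<^sup>2 \<le> (\<Sum>i\<in>I. ((\<lambda>i\<in>I. y i - q i) i)\<^sup>2)"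
          using member_le_sum[of i I "\<lambda>i. ((\<lambda>i\<in>I. y i - q i) i)\<^sup>2"] finite_I that by simp
        also have "\<dots> \<le> (ellnorm w I (\<lambda>i\<in>I. y i - q i))\<^sup>2"
          unfolding ellnorm_def by (subst real_sqrt_pow2) (auto simp: sum_nonneg)
        also have "\<dots> \<le> (s / 2)\<^sup>2"
          using y by (intro power_mono) (auto simp: E_def ellnorm_def sum_nonneg)
        finally have "\<bar>y i - q i\<bar> \<le> \<bar>s / 2\<bar>" by (simp only: abs_le_square_iff)
        then show ?thesis using s by (auto simp: q_def abs_le_iff field_simps)
      qed
      then show "y \<in> Q" using y by (auto simp: Q_def E_def PiE_iff)
    qed
    have openE: "openin (prodtop I) E"
    proof -
      have "continuous_map (prodtop I) euclideanreal (\<lambda>y. ellnorm w I (\<lambda>i\<in>I. y i - q i))"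
      proof -
        have sqrt_cont: "continuous_map euclideanreal euclideanreal sqrt"
          by (simp add: continuous_map_iff_continuous2 continuous_on_real_sqrt)
        have eq: "(\<lambda>y. ellnorm w I (\<lambda>i\<in>I. y i - q i)) = (\<lambda>y. sqrt ((\<Sum>i\<in>I. (y i - q i)\<^sup>2) + (\<Sum>i\<in>I. w i * (y i - q i))\<^sup>2))"
          by (simp add: ellnorm_def)
        show ?thesis unfolding eq
          by (intro continuous_map_compose[OF _ sqrt_cont, unfolded o_def] continuous_map_add continuous_map_sum finite_I
              continuous_map_real_pow continuous_map_diff continuous_map_real_mult
              continuous_map_product_projection continuous_map_canonical_const)
      qed
      from openin_continuous_map_preimage[OF this, of "{..<s / 2}"]
      show ?thesis by (simp add: E_def)
    qed
    have "closedin (prodtop I) Q" unfolding Q_def by (simp add: closedin_product_topology)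
    then have "closedin (prodtop I) (Q - E)" using openE by (rule closedin_diff)
    moreover have "\<exists>a b. \<forall>x\<in>Q. \<forall>i\<in>I. a \<le> x i \<and> x i \<le> b"
    proof (intro exI ballI)
      fix x i assume "x \<in> Q" "i \<in> I"
      then have xi: "p i \<le> x i" "x i \<le> p i + s" by (auto simp: Q_def PiE_iff)
      have "\<bar>p i\<bar> \<le> (\<Sum>i\<in>I. \<bar>p i\<bar>)" using finite_I \<open>i \<in> I\<close> by (intro member_le_sum) auto
      then show "- (\<Sum>i\<in>I. \<bar>p i\<bar>) \<le> x i \<and> x i \<le> (\<Sum>i\<in>I. \<bar>p i\<bar>) + s" using xi by linarith
    qed
    ultimately have comp: "compactin (prodtop I) (Q - E)"
      using compactin_prodtop by (metis DiffD1)
    have sum: "emeasure (leb I) (Q - E) + emeasure (leb I) E = ennreal (s ^ d)"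
      using Qm Em EQ by (subst plus_emeasure) (auto simp: Un_absorb2)
    have le: "emeasure (leb I) E \<le> ennreal (s ^ d)" unfolding sum[symmetric] by (rule add_increasing) auto
    have "ennreal (\<alpha> * s ^ d) \<le> ennreal (s ^ d)" using Ege le by (rule order_trans)
    then have "\<alpha> * s ^ d \<le> s ^ d" using s by (simp add: ennreal_le_iff)
    then have \<alpha>1: "\<alpha> \<le> 1" using s by simp
    have QE: "emeasure (leb I) (Q - E) \<le> ennreal ((1 - \<alpha>) * s ^ d)"
    proof -
      obtain a where a: "emeasure (leb I) (Q - E) = ennreal a" "a \<ge> 0"
        using sum by (cases "emeasure (leb I) (Q - E)") auto
      obtain b where b: "emeasure (leb I) E = ennreal b" "b \<ge> 0"
        using sum by (cases "emeasure (leb I) E") auto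
      have "a + b = s ^ d"
        using sum s a(2) b(2) unfolding a(1) b(1) by (simp flip: ennreal_plus)
      moreover have "\<alpha> * s ^ d \<le> b" using Ege b by (simp add: ennreal_le_iff)
      ultimately show ?thesis unfolding a by (intro ennreal_leI) (simp add: algebra_simps)
    qed
    have "cube I p s \<subseteq> Q" unfolding cube_def Q_def by (rule PiE_mono) auto
    then have "g ` cube I p s \<subseteq> g ` E \<union> g ` (Q - E)" by blast
    then have "hausdorff_premeasure n d \<delta> (g ` cube I p s) \<le> hausdorff_premeasure n d \<delta> (g ` E \<union> g ` (Q - E))"
      by (rule hausdorff_premeasure_mono)
    also have "\<dots> \<le> hausdorff_premeasure n d \<delta> (g ` E) + hausdorff_premeasure n d \<delta> (g ` (Q - E))"
      by (rule hausdorff_premeasure_Un)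
    also have "hausdorff_premeasure n d \<delta> (g ` E) \<le> ennreal (unit_ball_vol (real d) * (s / 2) ^ d)"
    proof (rule hausdorff_premeasure_le_single)
      show "0 \<le> s" "s \<le> \<delta>"
      proof -
        have "0 \<le> s * \<rho>" using s \<rho>_nonneg by simp
        then show "0 \<le> s" "s \<le> \<delta>" using s unfolding distrib_left by linarith+
      qed
      fix x y assume "x \<in> g ` E" "y \<in> g ` E"
      then obtain a b where ab: "x = g a" "y = g b" "a \<in> E" "b \<in> E" by blast
      have ell: "ellnorm w I (\<lambda>i\<in>I. a i - b i) \<le> ellnorm w I (\<lambda>i\<in>I. a i - q i) + ellnorm w I (\<lambda>i\<in>I. b i - q i)"
        by (rule ellnorm_triangle)
      then show "dist_Rn n x y \<le> s" unfolding ab dist_g using ab(3,4) by (auto simp: E_def)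
    qed
    also have "hausdorff_premeasure n d \<delta> (g ` (Q - E)) \<le> ennreal M * ennreal ((1 - \<alpha>) * s ^ d)"
      by (rule order_trans[OF cube_bound_compact[OF assms comp] mult_left_mono[OF QE]]) simp
    also have "ennreal (unit_ball_vol (real d) * (s / 2) ^ d) = ennreal (\<kappa> * \<alpha> * s ^ d)"
      unfolding \<alpha>_def using \<kappa>_ge_1 by (simp add: power_divide)
    also have "ennreal (\<kappa> * \<alpha> * s ^ d) + ennreal M * ennreal ((1 - \<alpha>) * s ^ d)
        = ennreal ((\<kappa> * \<alpha> + M * (1 - \<alpha>)) * s ^ d)"
    proof -
      have "ennreal (\<kappa> * \<alpha> * s ^ d) + ennreal (M * ((1 - \<alpha>) * s ^ d)) = ennreal (\<kappa> * \<alpha> * s ^ d + M * ((1 - \<alpha>) * s ^ d))"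
        using s \<alpha>1 \<alpha>_pos \<kappa>_ge_1 assms(2) by (intro ennreal_plus[symmetric]) auto
      then show ?thesis using assms(2) by (simp add: ennreal_mult'' ennreal_mult' distrib_right mult.assoc)
    qed
    finally show ?thesis using \<alpha>1 by (auto simp: add_mono)
  qed
  show "\<alpha> \<le> 1" using main[of "\<delta> / (\<rho> + 1)"] assms(3) \<rho>_nonneg by simp
  show "cube_bound \<delta> (\<kappa> * \<alpha> + M * (1 - \<alpha>))" using main unfolding cube_bound_def by blast
qed

lemma cube_bound_sharp:
  assumes "\<delta> > 0"
  shows "cube_bound \<delta> \<kappa>"
proof -
  define M0 where "M0 = unit_ball_vol (real d) * (\<rho> / 2) ^ d"
  have M0: "cube_bound \<delta> M0" "M0 \<ge> 0"
    using cube_bound_crude[OF assms] \<rho>_nonneg by (auto simp: M0_def)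
  have \<alpha>: "0 < \<alpha>" "\<alpha> \<le> 1" using \<alpha>_pos cube_bound_improve(2)[OF M0 assms] by auto
  \<comment> \<open>The recursion started at \<open>M0\<close> in closed form; it tends to
    \<open>\<kappa>\<close> because \<open>0 < \<alpha> \<le> 1\<close>.\<close>
  define M where "M j = \<kappa> * (1 - (1 - \<alpha>) ^ j) + (1 - \<alpha>) ^ j * M0" for j
  have "M j \<ge> 0 \<and> cube_bound \<delta> (M j)" for j
  proof (induction j)
    case 0
    then show ?case using M0 by (simp add: M_def)
  next
    case (Suc j)
    have "M (Suc j) = \<kappa> * \<alpha> + M j * (1 - \<alpha>)" by (simp add: M_def algebra_simps)
    then show ?case using cube_bound_improve(1)[of \<delta> "M j"] Suc assms \<alpha> \<kappa>_ge_1 by auto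
  qed
  then have bnd: "\<And>j. cube_bound \<delta> (M j)" by blast
  have lim: "M \<longlonglongrightarrow> \<kappa> * (1 - 0) + 0 * M0"
    unfolding M_def using \<alpha> by (intro tendsto_intros LIMSEQ_realpow_zero) auto
  show ?thesis unfolding cube_bound_def
  proof (intro allI impI)
    fix p :: "nat \<Rightarrow> real" and s :: real assume s: "0 < s" "s * (\<rho> + 1) \<le> \<delta>"
    have "(\<lambda>j. ennreal (M j * s ^ d)) \<longlonglongrightarrow> ennreal (\<kappa> * s ^ d)"
      using tendsto_mult[OF lim tendsto_const[of "s ^ d"]] by (intro tendsto_ennrealI) simp
    moreover have "hausdorff_premeasure n d \<delta> (g ` cube I p s) \<le> ennreal (M j * s ^ d)" for j
      using bnd s unfolding cube_bound_def by blast
    ultimately show "hausdorff_premeasure n d \<delta> (g ` cube I p s) \<le> ennreal (\<kappa> * s ^ d)"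
      by (intro LIMSEQ_le_const) auto
  qed
qed

lemma hausdorff_measure_graph_le:
  assumes "compactin (prodtop I) K"
  shows "hausdorff_measure n (card I) (g ` K) \<le> ennreal (sqrt (1 + (\<Sum>i\<in>I. (w i)\<^sup>2))) * emeasure (leb I) K"
  unfolding hausdorff_measure_def d_def[symmetric] \<kappa>_def[symmetric]
  using cube_bound_compact[OF cube_bound_sharp _ _ assms] \<kappa>_ge_1 by (intro SUP_least) auto

end

section \<open>Polyhedral hypersurfaces\<close>

abbreviation aff :: "nat \<Rightarrow> (nat \<Rightarrow> real) \<times> real \<Rightarrow> (nat \<Rightarrow> real) \<Rightarrow> real" where
  "aff n h x \<equiv> snd h + (\<Sum>i<n. fst h i * x i)"

text \<open>The parameter \<open>t\<close> is not confined to \<open>[0, 1]\<close>: slightly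
  negative values step beyond \<open>p\<close>, as in \<open>interior_patch_dom\<close>.\<close>

definition seg :: "nat \<Rightarrow> (nat \<Rightarrow> real) \<Rightarrow> (nat \<Rightarrow> real) \<Rightarrow> real \<Rightarrow> (nat \<Rightarrow> real)" where
  "seg n p q t = (\<lambda>i\<in>{..<n}. (1 - t) * p i + t * q i)"

lemma seg_in [simp]: "seg n p q t \<in> {..<n} \<rightarrow>\<^sub>E UNIV"
  by (simp add: seg_def)

lemma aff_seg: "aff n h (seg n p q t) = (1 - t) * aff n h p + t * aff n h q"
proof -
  have "(\<Sum>i<n. fst h i * seg n p q t i) = (\<Sum>i<n. (1 - t) * (fst h i * p i) + t * (fst h i * q i))"
    by (rule sum.cong) (auto simp: seg_def algebra_simps)
  then show ?thesis by (simp add: sum.distrib flip: sum_distrib_left) (simp add: algebra_simps)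
qed

lemma convex_comb_pos:
  fixes a b t :: real
  assumes "0 \<le> t" "t \<le> 1" "a > 0 \<or> t > 0 \<and> a \<ge> 0" "b > 0"
  shows "(1 - t) * a + t * b > 0"
proof (cases "t = 0")
  case False
  then show ?thesis using assms by (intro add_nonneg_pos mult_nonneg_nonneg mult_pos_pos) auto
qed (use assms in auto)

lemma continuous_map_aff: "continuous_map (Rn n) euclideanreal (aff n h)"
  by (intro continuous_map_add continuous_map_sum continuous_map_real_mult
      continuous_map_product_projection continuous_map_canonical_const) auto

lemma openin_aff_pos: "openin (Rn n) {x \<in> {..<n} \<rightarrow>\<^sub>E UNIV. r * aff n h x > 0}"
proof -
  have "continuous_map (Rn n) euclideanreal (\<lambda>x. r * aff n h x)"
    by (intro continuous_map_real_mult continuous_map_aff) simp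
  from openin_continuous_map_preimage[OF this, of "{0<..}"] show ?thesis by simp
qed

lemma openin_aff_nonzero: "openin (Rn n) {x \<in> {..<n} \<rightarrow>\<^sub>E UNIV. aff n h x \<noteq> 0}"
  using openin_continuous_map_preimage[OF continuous_map_aff[of n h], of "- {0}"] by (simp add: open_Compl)

lemma closedin_aff_nonneg: "closedin (Rn n) {x \<in> {..<n} \<rightarrow>\<^sub>E UNIV. r * aff n h x \<ge> 0}"
proof -
  have "continuous_map (Rn n) euclideanreal (\<lambda>x. r * aff n h x)"
    by (intro continuous_map_real_mult continuous_map_aff) simp
  from closedin_continuous_map_preimage[OF this, of "{0..}"] show ?thesis by simp
qed

lemma openin_aff_cone:
  assumes "finite G"
  shows "openin (Rn n) {x \<in> {..<n} \<rightarrow>\<^sub>E UNIV. \<forall>g\<in>G. s g * aff n g x > 0}"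
proof -
  have "{x \<in> {..<n} \<rightarrow>\<^sub>E UNIV. \<forall>g\<in>G. s g * aff n g x > 0} =
    (\<Inter>g\<in>G. {x \<in> {..<n} \<rightarrow>\<^sub>E UNIV. s g * aff n g x > 0}) \<inter> topspace (Rn n)" by auto
  then show ?thesis using assms openin_aff_pos by (simp only:) (intro openin_INT, auto)
qed

lemma closedin_aff_cone:
  "closedin (Rn n) {x \<in> {..<n} \<rightarrow>\<^sub>E UNIV. \<forall>g\<in>G. s g * aff n g x \<ge> 0}"
proof (cases "G = {}")
  case True
  then show ?thesis using closedin_topspace[of "Rn n"] by simp
next
  case False
  then have "{x \<in> {..<n} \<rightarrow>\<^sub>E UNIV. \<forall>g\<in>G. s g * aff n g x \<ge> 0} =
    (\<Inter>g\<in>G. {x \<in> {..<n} \<rightarrow>\<^sub>E UNIV. s g * aff n g x \<ge> 0})" by auto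
  then show ?thesis using False closedin_aff_nonneg by (simp only:) (intro closedin_INT, auto)
qed

lemma seg_near:
  assumes "e > 0" "x \<in> {..<n} \<rightarrow>\<^sub>E UNIV"
  shows "\<exists>d>0. \<forall>t. \<bar>t\<bar> < d \<longrightarrow> (\<forall>i\<in>{..<n}. \<bar>seg n x p t i - x i\<bar> < e)"
proof -
  define S where "S = 1 + (\<Sum>i<n. \<bar>p i - x i\<bar>)"
  have S: "S > 0" unfolding S_def by (intro add_pos_nonneg sum_nonneg) auto
  show ?thesis
  proof (intro exI[of _ "e / S"] conjI allI impI ballI)
    show "0 < e / S" using assms S by simp
    fix t i assume t: "\<bar>t\<bar> < e / S" and i: "i \<in> {..<n}"
    have "\<bar>p i - x i\<bar> \<le> (\<Sum>i<n. \<bar>p i - x i\<bar>)" using i by (intro member_le_sum) auto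
    then have "\<bar>t\<bar> * \<bar>p i - x i\<bar> \<le> \<bar>t\<bar> * S" unfolding S_def by (intro mult_left_mono) auto
    also have "\<dots> < e" using t S by (simp add: pos_less_divide_eq)
    also have "\<bar>t\<bar> * \<bar>p i - x i\<bar> = \<bar>seg n x p t i - x i\<bar>"
      using i by (simp add: seg_def abs_mult[symmetric] algebra_simps)
    finally show "\<bar>seg n x p t i - x i\<bar> < e" .
  qed
qed

text \<open>An affine functional that is not identically zero cannot vanish on a nonempty open set,
  so the hyperplanes can be removed one by one and a nonempty open set remains.\<close>

lemma open_avoid_hyperplanes:
  assumes "finite \<A>" "openin (Rn n) U" "U \<noteq> {}"
    and "\<And>h. h \<in> \<A> \<Longrightarrow> \<exists>p\<in>{..<n} \<rightarrow>\<^sub>E UNIV. aff n h p \<noteq> 0"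
  shows "\<exists>x\<in>U. \<forall>h\<in>\<A>. aff n h x \<noteq> 0"
  using assms
proof (induction \<A> arbitrary: U)
  case empty
  then show ?case by blast
next
  case (insert h \<A>)
  have UE: "U \<subseteq> {..<n} \<rightarrow>\<^sub>E UNIV"
    and Uop: "\<And>x. x \<in> U \<Longrightarrow> \<exists>e>0. \<forall>y\<in>{..<n} \<rightarrow>\<^sub>E UNIV. (\<forall>i\<in>{..<n}. \<bar>y i - x i\<bar> < e) \<longrightarrow> y \<in> U"
    using insert.prems(1) unfolding openin_prodtop[OF finite_lessThan] by blast+
  have "\<exists>x\<in>U. aff n h x \<noteq> 0"
  proof (rule ccontr)
    assume no: "\<not> ?thesis"
    obtain x where x: "x \<in> U" using insert.prems by blast
    obtain p where p: "p \<in> {..<n} \<rightarrow>\<^sub>E UNIV" "aff n h p \<noteq> 0" using insert.prems by blast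
    obtain e where e: "e > 0" "\<forall>y\<in>{..<n} \<rightarrow>\<^sub>E UNIV. (\<forall>i\<in>{..<n}. \<bar>y i - x i\<bar> < e) \<longrightarrow> y \<in> U"
      using Uop[OF x] by blast
    obtain d where d: "d > 0" "\<forall>t. \<bar>t\<bar> < d \<longrightarrow> (\<forall>i\<in>{..<n}. \<bar>seg n x p t i - x i\<bar> < e)"
      using seg_near[OF e(1), of x n p] x UE by blast
    have "seg n x p (d / 2) \<in> U" using d e(2) by auto
    then have "aff n h (seg n x p (d / 2)) = 0" "aff n h x = 0" using no x by blast+
    then show False using p(2) d(1) by (simp add: aff_seg)
  qed
  then have "U \<inter> {x \<in> {..<n} \<rightarrow>\<^sub>E UNIV. aff n h x \<noteq> 0} \<noteq> {}" using UE by blast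
  moreover have "openin (Rn n) (U \<inter> {x \<in> {..<n} \<rightarrow>\<^sub>E UNIV. aff n h x \<noteq> 0})"
    using insert.prems(1) openin_aff_nonzero by (rule openin_Int)
  ultimately have "\<exists>x\<in>U \<inter> {x \<in> {..<n} \<rightarrow>\<^sub>E UNIV. aff n h x \<noteq> 0}. \<forall>h\<in>\<A>. aff n h x \<noteq> 0"
    using insert.prems(3) by (intro insert.IH) auto
  then show ?case by blast
qed

lemma seg_meets_frontier:
  assumes "p \<in> {..<n} \<rightarrow>\<^sub>E UNIV" "q \<in> {..<n} \<rightarrow>\<^sub>E UNIV" "p \<in> D" "q \<notin> D"
  shows "\<exists>t\<in>{0..1}. seg n p q t \<in> Rn n frontier_of D"
proof -
  have "continuous_map (top_of_set {0..1::real}) (Rn n) (seg n p q)"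
    unfolding continuous_map_componentwise
  proof (intro conjI ballI)
    show "seg n p q ` topspace (top_of_set {0..1}) \<subseteq> extensional {..<n}" by (auto simp: seg_def)
    fix i assume "i \<in> {..<n}"
    then have "(\<lambda>t. seg n p q t i) = (\<lambda>t. (1 - t) * p i + t * q i)" by (auto simp: seg_def)
    then show "continuous_map (top_of_set {0..1}) euclideanreal (\<lambda>t. seg n p q t i)"
      by (simp add: continuous_map_iff_continuous) (intro continuous_intros)
  qed
  then have "connectedin (Rn n) (seg n p q ` {0..1})"
    by (rule connectedin_continuous_map_image) (simp add: connectedin_subtopology)
  moreover have "seg n p q 0 = p"
    unfolding seg_def using assms(1) by (intro PiE_ext[of _ "{..<n}" "\<lambda>_. UNIV"]) auto
  then have "seg n p q ` {0..1} \<inter> D \<noteq> {}" using assms(3) imageI[of 0 "{0..1}" "seg n p q"] by auto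
  moreover have "seg n p q 1 = q"
    unfolding seg_def using assms(2) by (intro PiE_ext[of _ "{..<n}" "\<lambda>_. UNIV"]) auto
  then have "seg n p q ` {0..1} - D \<noteq> {}" using assms(4) imageI[of 1 "{0..1}" "seg n p q"] by auto
  ultimately have "seg n p q ` {0..1} \<inter> Rn n frontier_of D \<noteq> {}"
    by (rule connectedin_Int_frontier_of)
  then show ?thesis by blast
qed

text \<open>If two functionals had the same zero set, the facets below, which ask all other
  functionals to be nonzero, would be empty on it.\<close>

lemma distinct_hyperplanes:
  assumes "finite H"
  obtains H' where "H' \<subseteq> H" "finite H'" "inj_on (\<lambda>h. {x \<in> {..<n} \<rightarrow>\<^sub>E UNIV. aff n h x = 0}) H'"
    "(\<Union>h\<in>H. {x \<in> {..<n} \<rightarrow>\<^sub>E UNIV. aff n h x = 0}) = (\<Union>h\<in>H'. {x \<in> {..<n} \<rightarrow>\<^sub>E UNIV. aff n h x = 0})"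
proof -
  define z where "z = (\<lambda>h. {x \<in> {..<n} \<rightarrow>\<^sub>E UNIV. aff n h x = 0})"
  define H' where "H' = inv_into H z ` (z ` H)"
  have inv: "z (inv_into H z y) = y" "inv_into H z y \<in> H" if "y \<in> z ` H" for y
    using f_inv_into_f[OF that] inv_into_into[OF that] by simp_all
  have "H' \<subseteq> H" using inv(2) by (auto simp: H'_def)
  moreover have "finite H'" using assms by (simp add: H'_def)
  moreover have "inj_on z H'"
  proof (rule inj_onI)
    fix a b assume "a \<in> H'" "b \<in> H'" "z a = z b"
    then obtain a' b' where "a = inv_into H z a'" "b = inv_into H z b'" "a' \<in> z ` H" "b' \<in> z ` H"
      unfolding H'_def by blast
    then show "a = b" using \<open>z a = z b\<close> inv(1) by simp
  qed
  moreover have "(\<Union>h\<in>H. z h) = (\<Union>h\<in>H'. z h)"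
  proof -
    have "z ` H' = z ` H" unfolding H'_def image_image using inv(1) by (auto simp: image_iff)
    then show ?thesis by metis
  qed
  ultimately show ?thesis using that unfolding z_def by blast
qed

text \<open>The goal is \<open>frontier_eq_cfacets\<close>: the frontier is a union of whole closed
  facets. Regularity of \<open>D\<close> excludes lower-dimensional pieces.\<close>

locale arrangement =
  fixes n :: nat and D :: "(nat \<Rightarrow> real) set" and H :: "((nat \<Rightarrow> real) \<times> real) set"
  assumes comp: "compactin (Rn n) D" and regular: "Rn n closure_of (Rn n interior_of D) = D"
    and finite_H: "finite H" and nonconst: "\<And>h. h \<in> H \<Longrightarrow> \<exists>i<n. fst h i \<noteq> 0"
    and distinct_H: "inj_on (\<lambda>h. {x \<in> {..<n} \<rightarrow>\<^sub>E UNIV. aff n h x = 0}) H"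
    and frontier_H: "Rn n frontier_of D \<subseteq> (\<Union>h\<in>H. {x \<in> {..<n} \<rightarrow>\<^sub>E UNIV. aff n h x = 0})"
begin

text \<open>\<open>s\<close> prescribes the side of every other hyperplane. \<open>cfacet\<close>
  turns out to be the closure of a nonempty facet, and \<open>side\<close> is the chamber next to it
  on the side \<open>r\<close> of \<open>h\<close>.\<close>

definition facet where
  "facet h s = {x \<in> {..<n} \<rightarrow>\<^sub>E UNIV. aff n h x = 0 \<and> (\<forall>g\<in>H - {h}. s g * aff n g x > 0)}"

definition cfacet where
  "cfacet h s = {x \<in> {..<n} \<rightarrow>\<^sub>E UNIV. aff n h x = 0 \<and> (\<forall>g\<in>H - {h}. s g * aff n g x \<ge> 0)}"

definition side where
  "side h s r = {x \<in> {..<n} \<rightarrow>\<^sub>E UNIV. r * aff n h x > 0 \<and> (\<forall>g\<in>H - {h}. s g * aff n g x > 0)}"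

definition faces where
  "faces = {(h, s). h \<in> H \<and> s \<in> (H - {h}) \<rightarrow>\<^sub>E {-1, 1} \<and> facet h s \<inter> Rn n frontier_of D \<noteq> {}}"

lemma closed_D: "closedin (Rn n) D"
  using comp by (rule compactin_prodtop_imp_closedin)

lemma D_sub: "D \<subseteq> {..<n} \<rightarrow>\<^sub>E UNIV"
  using closedin_subset[OF closed_D] by simp

lemma nonzero_point:
  assumes "\<exists>i<n. fst h i \<noteq> 0"
  shows "\<exists>p\<in>{..<n} \<rightarrow>\<^sub>E UNIV. aff n h p \<noteq> 0"
proof -
  obtain k where k: "k < n" "fst h k \<noteq> 0" using assms by blast
  define p where "p c = (\<lambda>i\<in>{..<n}. if i = k then c else 0 :: real)" for c
  have "(\<Sum>i<n. fst h i * p c i) = (\<Sum>i<n. if i = k then fst h i * c else 0)" for c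
    by (rule sum.cong) (auto simp: p_def)
  then have "aff n h (p c) = snd h + fst h k * c" for c using k(1) by simp
  then have "aff n h (p 0) \<noteq> 0 \<or> aff n h (p 1) \<noteq> 0" using k(2) by auto
  moreover have "p c \<in> {..<n} \<rightarrow>\<^sub>E UNIV" for c by (simp add: p_def)
  ultimately show ?thesis by blast
qed

text \<open>A chamber is convex and meets no hyperplane, hence no frontier point; a segment leaving
  \<open>D\<close> inside it would cross the frontier.\<close>

lemma side_dichotomy:
  assumes "h \<in> H" "r \<noteq> 0" "p \<in> side h s r" "q \<in> side h s r" "p \<in> D"
  shows "q \<in> D"
proof (rule ccontr)
  assume "q \<notin> D"
  then obtain t where t: "t \<in> {0..1}" "seg n p q t \<in> Rn n frontier_of D"
    using seg_meets_frontier[of p n q D] assms by (auto simp: side_def)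
  have pos: "r * aff n g (seg n p q t) > 0" if "r * aff n g p > 0" "r * aff n g q > 0" for r g
  proof -
    have "r * aff n g (seg n p q t) = (1 - t) * (r * aff n g p) + t * (r * aff n g q)"
      unfolding aff_seg by (simp only: distrib_left mult.left_commute)
    also have "\<dots> > 0" using t(1) that by (intro convex_comb_pos) auto
    finally show ?thesis .
  qed
  obtain g where g: "g \<in> H" "aff n g (seg n p q t) = 0" using t(2) frontier_H by blast
  have "(if g = h then r else s g) * aff n g (seg n p q t) > 0"
    using assms(3,4) g(1) by (intro pos) (auto simp: side_def)
  then show False using g(2) by simp
qed

lemma facet_near_side:
  assumes h: "h \<in> H" and x: "x \<in> facet h s" and "r \<noteq> 0"
    and U: "openin (Rn n) U" "x \<in> U"
  shows "\<exists>y\<in>U. y \<in> side h s r"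
proof -
  obtain p where p: "p \<in> {..<n} \<rightarrow>\<^sub>E UNIV" "aff n h p \<noteq> 0"
    using nonzero_point[OF nonconst[OF h]] by blast
  define V where "V = U \<inter> {x \<in> {..<n} \<rightarrow>\<^sub>E UNIV. \<forall>g\<in>H - {h}. s g * aff n g x > 0}"
  have "openin (Rn n) V" unfolding V_def
    using finite_H by (intro openin_Int U(1) openin_aff_cone) simp
  moreover have "x \<in> V" using x U by (auto simp: V_def facet_def)
  ultimately obtain e where e: "e > 0" "\<forall>y\<in>{..<n} \<rightarrow>\<^sub>E UNIV. (\<forall>i\<in>{..<n}. \<bar>y i - x i\<bar> < e) \<longrightarrow> y \<in> V"
    unfolding openin_prodtop[OF finite_lessThan] by blast
  have xE: "x \<in> {..<n} \<rightarrow>\<^sub>E UNIV" using x by (simp add: facet_def)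
  obtain d where d: "d > 0" "\<forall>t. \<bar>t\<bar> < d \<longrightarrow> (\<forall>i\<in>{..<n}. \<bar>seg n x p t i - x i\<bar> < e)"
    using seg_near[OF e(1) xE, of p] by blast
  \<comment> \<open>The sign moves \<open>x\<close> towards \<open>p\<close> or away from it,
    whichever makes \<open>r * aff n h\<close> positive.\<close>
  define t where "t = (d / 2) * sgn (r * aff n h p)"
  have "\<bar>t\<bar> < d" using d(1) by (simp add: t_def abs_mult sgn_if)
  then have V: "seg n x p t \<in> V" using d(2) e(2) by auto
  have "aff n h x = 0" using x by (simp add: facet_def)
  then have "r * aff n h (seg n x p t) = (d / 2) * \<bar>r * aff n h p\<bar>"
    unfolding aff_seg t_def by (simp add: abs_sgn mult_ac)
  also have "\<dots> > 0" using d(1) p(2) assms(3) by simp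
  finally have "seg n x p t \<in> side h s r" using V by (auto simp: side_def V_def)
  then show ?thesis using V by (auto simp: V_def)
qed

text \<open>Each of the two chambers at a facet lies in \<open>D\<close> or outside. A facet point
  off the frontier forces the same answer on both sides. If both lie in \<open>D\<close>, the whole
  facet is interior to \<open>D\<close>; if both lie outside, \<open>D\<close> has no interior near
  the facet, against regularity. Either way no facet point could be on the frontier.\<close>

lemma facet_sub_frontier:
  assumes h: "h \<in> H" and ne: "facet h s \<inter> Rn n frontier_of D \<noteq> {}"
  shows "facet h s \<subseteq> Rn n frontier_of D"
proof
  fix y assume y: "y \<in> facet h s"
  obtain x where x: "x \<in> facet h s" "x \<in> Rn n frontier_of D" using ne by blast
  have xD: "x \<in> D" "x \<notin> Rn n interior_of D"
    using x(2) closed_D by (auto simp: frontier_of_def closure_of_closedin)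
  show "y \<in> Rn n frontier_of D"
  proof (rule ccontr)
    assume nf: "y \<notin> Rn n frontier_of D"
    have yE: "y \<in> topspace (Rn n)" using y by (simp add: facet_def)
    consider "y \<in> Rn n interior_of D" | "y \<in> topspace (Rn n) - D"
      using nf closed_D yE by (auto simp: frontier_of_def closure_of_closedin)
    then show False
    proof cases
      case 1
      have sd: "side h s r \<subseteq> D" if r: "r \<noteq> 0" for r
      proof
        fix q assume q: "q \<in> side h s r"
        obtain p where p: "p \<in> Rn n interior_of D" "p \<in> side h s r"
          using facet_near_side[OF h y r openin_interior_of 1] by blast
        have "p \<in> D" using p(1) interior_of_subset[of "Rn n" D] by blast
        then show "q \<in> D" by (rule side_dichotomy[OF h r p(2) q])
      qed
      define V where "V = {x \<in> {..<n} \<rightarrow>\<^sub>E UNIV. \<forall>g\<in>H - {h}. s g * aff n g x > 0}"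
      have "openin (Rn n) V" unfolding V_def using finite_H by (intro openin_aff_cone) simp
      moreover have "x \<in> V" using x by (auto simp: V_def facet_def)
      moreover have "V \<subseteq> D"
      proof
        fix v assume v: "v \<in> V"
        show "v \<in> D"
        proof (cases "aff n h v = 0")
          case True
          then have vf: "v \<in> facet h s" using v by (auto simp: facet_def V_def)
          have "v \<in> Rn n closure_of D" unfolding in_closure_of
          proof (intro conjI allI impI)
            show "v \<in> topspace (Rn n)" using v by (simp add: V_def)
            fix T assume T: "v \<in> T \<and> openin (Rn n) T"
            then show "\<exists>y. y \<in> D \<and> y \<in> T"
              using facet_near_side[OF h vf, of 1 T] sd[of 1] by auto
          qed
          then show ?thesis using closed_D by (simp add: closure_of_closedin)
        next
          case False
          then have "v \<in> side h s (sgn (aff n h v))"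
            using v by (auto simp: side_def V_def sgn_if)
          then show ?thesis using sd[of "sgn (aff n h v)"] False by (auto simp: sgn_if split: if_splits)
        qed
      qed
      ultimately show False using xD(2) interior_of_maximal by blast
    next
      case 2
      have sd: "side h s r \<inter> D = {}" if r: "r \<noteq> 0" for r
      proof -
        obtain p where p: "p \<in> topspace (Rn n) - D" "p \<in> side h s r"
          using facet_near_side[OF h y r openin_diff[OF openin_topspace closed_D] 2] by blast
        have "q \<notin> D" if "q \<in> side h s r" for q
          using side_dichotomy[OF h r that p(2)] p(1) by blast
        then show ?thesis by blast
      qed
      define V where "V = {x \<in> {..<n} \<rightarrow>\<^sub>E UNIV. \<forall>g\<in>H - {h}. s g * aff n g x > 0}"
      have "openin (Rn n) V" unfolding V_def using finite_H by (intro openin_aff_cone) simp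
      moreover have xV: "x \<in> V" using x by (auto simp: V_def facet_def)
      ultimately have op: "openin (Rn n) (V \<inter> Rn n interior_of D)"
        by (intro openin_Int openin_interior_of)
      have "x \<in> Rn n closure_of (Rn n interior_of D)" using xD(1) regular by simp
      then have "V \<inter> Rn n interior_of D \<noteq> {}"
        using \<open>openin (Rn n) V\<close> xV unfolding in_closure_of by blast
      then obtain v where v: "v \<in> V \<inter> Rn n interior_of D" "aff n h v \<noteq> 0"
        using open_avoid_hyperplanes[of "{h}", OF _ op] nonzero_point[OF nonconst[OF h]] by force
      then have "v \<in> side h s (sgn (aff n h v))" by (auto simp: side_def V_def sgn_if)
      moreover have "sgn (aff n h v) \<noteq> 0" using v(2) by (simp add: sgn_if)
      ultimately show False using sd v(1) interior_of_subset[of "Rn n" D] by blast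
    qed
  qed
qed

lemma closed_cfacet: "closedin (Rn n) (cfacet h s)"
proof -
  have "cfacet h s = {x \<in> {..<n} \<rightarrow>\<^sub>E UNIV. 1 * aff n h x \<ge> 0} \<inter> {x \<in> {..<n} \<rightarrow>\<^sub>E UNIV. (-1) * aff n h x \<ge> 0} \<inter>
    {x \<in> {..<n} \<rightarrow>\<^sub>E UNIV. \<forall>g\<in>H - {h}. s g * aff n g x \<ge> 0}"
    by (auto simp: cfacet_def)
  also have "closedin (Rn n) \<dots>" by (intro closedin_Int closedin_aff_nonneg closedin_aff_cone)
  finally show ?thesis .
qed

lemma closure_facet:
  assumes "facet h s \<noteq> {}"
  shows "Rn n closure_of (facet h s) = cfacet h s"
proof
  have "facet h s \<subseteq> cfacet h s" by (auto simp: facet_def cfacet_def intro: less_imp_le)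
  then show "Rn n closure_of (facet h s) \<subseteq> cfacet h s"
    using closed_cfacet by (rule closure_of_minimal)
  obtain p where p: "p \<in> facet h s" using assms by blast
  show "cfacet h s \<subseteq> Rn n closure_of (facet h s)"
  proof
    fix x assume x: "x \<in> cfacet h s"
    then have xE: "x \<in> {..<n} \<rightarrow>\<^sub>E UNIV" by (simp add: cfacet_def)
    show "x \<in> Rn n closure_of (facet h s)"
      unfolding in_closure_of_prodtop[OF finite_lessThan]
    proof (intro conjI allI impI)
      fix e :: real assume e: "e > 0"
      obtain d where d: "d > 0" "\<forall>t. \<bar>t\<bar> < d \<longrightarrow> (\<forall>i\<in>{..<n}. \<bar>seg n x p t i - x i\<bar> < e)"
        using seg_near[OF e xE, of p] by blast
      define t where "t = min (d / 2) 1"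
      have t: "0 < t" "t \<le> 1" "\<bar>t\<bar> < d" using d(1) by (auto simp: t_def)
      have "seg n x p t \<in> facet h s" unfolding facet_def
      proof (intro CollectI conjI ballI)
        show "aff n h (seg n x p t) = 0" using x p unfolding aff_seg by (simp add: facet_def cfacet_def)
        fix g assume g: "g \<in> H - {h}"
        have "s g * aff n g (seg n x p t) = (1 - t) * (s g * aff n g x) + t * (s g * aff n g p)"
          unfolding aff_seg by (simp only: distrib_left mult.left_commute)
        also have "\<dots> > 0" using t x p g
          by (intro convex_comb_pos disjI2) (auto simp: facet_def cfacet_def)
        finally show "0 < s g * aff n g (seg n x p t)" .
      qed simp
      then have "seg n x p t \<in> facet h s \<inter> ({..<n} \<rightarrow>\<^sub>E UNIV)" by simp
      moreover have "\<forall>i\<in>{..<n}. \<bar>seg n x p t i - x i\<bar> < e" using d(2) t(3) by blast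
      ultimately show "\<exists>y\<in>facet h s \<inter> ({..<n} \<rightarrow>\<^sub>E UNIV). \<forall>i\<in>{..<n}. \<bar>y i - x i\<bar> < e" by blast
    qed (rule xE)
  qed
qed

lemma finite_faces: "finite faces"
proof (rule finite_subset)
  show "faces \<subseteq> (SIGMA h:H. (H - {h}) \<rightarrow>\<^sub>E {-1, 1})" by (auto simp: faces_def)
  show "finite (SIGMA h:H. (H - {h}) \<rightarrow>\<^sub>E {-1, 1 :: real})"
    using finite_H by (intro finite_SigmaI finite_PiE) auto
qed

text \<open>A generic segment from the interior of \<open>D\<close> to its complement meets only one hyperplane at a
  time, so it leaves \<open>D\<close> through the relative interior of a facet.\<close>

lemma frontier_sub_closure_facets:
  "Rn n frontier_of D \<subseteq> Rn n closure_of (\<Union>(h, s)\<in>faces. facet h s)"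
proof
  fix x assume x: "x \<in> Rn n frontier_of D"
  have xD: "x \<in> D" "x \<notin> Rn n interior_of D" using x closed_D by (auto simp: frontier_of_def closure_of_closedin)
  have xE: "x \<in> {..<n} \<rightarrow>\<^sub>E UNIV" using xD D_sub by blast
  show "x \<in> Rn n closure_of (\<Union>(h, s)\<in>faces. facet h s)"
    unfolding in_closure_of_prodtop[OF finite_lessThan]
  proof (intro conjI allI impI)
    fix e :: real assume e: "e > 0"
    define B where "B = {y \<in> {..<n} \<rightarrow>\<^sub>E UNIV. \<forall>i\<in>{..<n}. \<bar>y i - x i\<bar> < e}"
    have B: "openin (Rn n) B" unfolding B_def by (rule openin_prodtop_box[OF finite_lessThan xE])
    have xB: "x \<in> B" using xE e by (simp add: B_def)
    have 1: "openin (Rn n) (B \<inter> Rn n interior_of D)" using B by (intro openin_Int openin_interior_of)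
    have "x \<in> Rn n closure_of (Rn n interior_of D)" using xD regular by simp
    then have "B \<inter> Rn n interior_of D \<noteq> {}" using B xB unfolding in_closure_of by blast
    then obtain y where y: "y \<in> B \<inter> Rn n interior_of D" "\<forall>h\<in>H. aff n h y \<noteq> 0"
      using open_avoid_hyperplanes[OF finite_H 1 _ nonzero_point[OF nonconst]] by blast
    have 2: "openin (Rn n) (B - D)" using B closed_D by (rule openin_diff)
    have ne2: "B - D \<noteq> {}"
      using xD(2) xB B interior_of_maximal[of B D "Rn n"] by blast
    \<comment> \<open>\<open>comb (h, g)\<close> is the combination of \<open>h\<close> and
      \<open>g\<close> that vanishes at \<open>y\<close>. If the segment from \<open>y\<close> to
      \<open>y'\<close> met both hyperplanes at one point, it would vanish at \<open>y'\<close> too;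
      so \<open>y'\<close> is chosen off its zero set.\<close>
    define comb where "comb = (\<lambda>(h, g). ((\<lambda>i. fst h i * aff n g y - fst g i * aff n h y),
        snd h * aff n g y - snd g * aff n h y) :: (nat \<Rightarrow> real) \<times> real)"
    have comb: "aff n (comb (h, g)) z = aff n h z * aff n g y - aff n g z * aff n h y" for h g z
    proof -
      have "(\<Sum>i<n. fst (comb (h, g)) i * z i) = (\<Sum>i<n. fst h i * z i) * aff n g y - (\<Sum>i<n. fst g i * z i) * aff n h y"
      proof -
        have "(\<Sum>i<n. (fst h i * A - fst g i * B) * z i) = (\<Sum>i<n. fst h i * z i) * A - (\<Sum>i<n. fst g i * z i) * B" for A B
          by (simp add: algebra_simps sum_subtractf sum_distrib_left)
        then show ?thesis by (simp only: comb_def split_conv fst_conv)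
      qed
      then show ?thesis by (simp add: comb_def algebra_simps)
    qed
    define \<A> where "\<A> = comb ` {(h, g). h \<in> H \<and> g \<in> H \<and> h \<noteq> g}"
    have fin: "finite \<A>"
    proof -
      have "finite {(h, g). h \<in> H \<and> g \<in> H \<and> h \<noteq> g}"
        by (rule finite_subset[OF _ finite_cartesian_product[OF finite_H finite_H]]) auto
      then show ?thesis unfolding \<A>_def by (rule finite_imageI)
    qed
    have nz: "\<exists>p\<in>{..<n} \<rightarrow>\<^sub>E UNIV. aff n f p \<noteq> 0" if "f \<in> \<A>" for f
    proof (rule ccontr)
      assume no: "\<not> ?thesis"
      obtain h g where hg: "f = comb (h, g)" "h \<in> H" "g \<in> H" "h \<noteq> g" using \<open>f \<in> \<A>\<close> by (auto simp: \<A>_def)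
      have nzy: "aff n h y \<noteq> 0" "aff n g y \<noteq> 0" using y(2) hg by auto
      have "aff n h z = 0 \<longleftrightarrow> aff n g z = 0" if "z \<in> {..<n} \<rightarrow>\<^sub>E UNIV" for z
      proof -
        have "aff n (comb (h, g)) z = 0" using no that unfolding hg(1) by blast
        then have "aff n h z * aff n g y = aff n g z * aff n h y" unfolding comb by (simp only: right_minus_eq)
        moreover have "a = 0 \<longleftrightarrow> b = 0" if "a * c = b * d" "c \<noteq> 0" "d \<noteq> 0" for a b c d :: real using that by auto
        ultimately show ?thesis using nzy by blast
      qed
      then have "{x \<in> {..<n} \<rightarrow>\<^sub>E UNIV. aff n h x = 0} = {x \<in> {..<n} \<rightarrow>\<^sub>E UNIV. aff n g x = 0}" by blast
      then show False using distinct_H hg by (auto dest: inj_onD)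
    qed
    obtain y' where y': "y' \<in> B - D" "\<forall>f\<in>\<A>. aff n f y' \<noteq> 0"
      using open_avoid_hyperplanes[OF fin 2 ne2 nz] by blast
    have yD: "y \<in> D" using y(1) interior_of_subset[of "Rn n" D] by blast
    obtain t where t: "t \<in> {0..1}" "seg n y y' t \<in> Rn n frontier_of D"
      using seg_meets_frontier[of y n y' D] yD y y' by (auto simp: B_def)
    define z where "z = seg n y y' t"
    obtain h where h: "h \<in> H" "aff n h z = 0" using t(2) frontier_H by (auto simp: z_def)
    have ng: "aff n g z \<noteq> 0" if g: "g \<in> H - {h}" for g
    proof
      assume g0: "aff n g z = 0"
      have eqs: "(1 - t) * aff n h y + t * aff n h y' = 0" "(1 - t) * aff n g y + t * aff n g y' = 0"
        using h(2) g0 unfolding z_def aff_seg by auto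
      have "t \<noteq> 0" using eqs(1) y(2) h by auto
      have "t * (aff n h y' * aff n g y - aff n g y' * aff n h y) =
        ((1 - t) * aff n h y + t * aff n h y') * aff n g y - ((1 - t) * aff n g y + t * aff n g y') * aff n h y"
        by (simp only: algebra_simps)
      also have "\<dots> = 0" unfolding eqs by simp
      finally have "aff n (comb (h, g)) y' = 0" unfolding comb using \<open>t \<noteq> 0\<close> by simp
      moreover have "comb (h, g) \<in> \<A>" using g h by (auto simp: \<A>_def)
      ultimately show False using y'(2) by blast
    qed
    define s where "s = (\<lambda>g\<in>H - {h}. sgn (aff n g z))"
    have zE: "z \<in> {..<n} \<rightarrow>\<^sub>E UNIV" by (simp add: z_def)
    have pos: "s g * aff n g z > 0" if g: "g \<in> H - {h}" for g
    proof -
      have "s g * aff n g z = \<bar>aff n g z\<bar>" using g by (simp only: s_def restrict_apply' abs_sgn mult.commute)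
      then show ?thesis using ng[OF g] by (simp only: zero_less_abs_iff not_False_eq_True)
    qed
    then have zf: "z \<in> facet h s" using zE h(2) unfolding facet_def by blast
    have "(h, s) \<in> faces" unfolding faces_def
      using h(1) zf t(2) ng by (auto simp: s_def z_def sgn_if)
    moreover have "\<bar>z i - x i\<bar> < e" if i: "i \<in> {..<n}" for i
    proof -
      have a: "\<bar>y i - x i\<bar> < e" "\<bar>y' i - x i\<bar> < e" using y y' i by (auto simp: B_def)
      have "z i - x i = (1 - t) * (y i - x i) + t * (y' i - x i)" using i by (simp add: z_def seg_def algebra_simps)
      also have "\<bar>\<dots>\<bar> \<le> (1 - t) * \<bar>y i - x i\<bar> + t * \<bar>y' i - x i\<bar>"
        using t(1) by (intro order_trans[OF abs_triangle_ineq]) (auto simp: abs_mult)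
      also have "\<dots> < (1 - t) * e + t * e"
      proof (cases "t = 0")
        case False
        then show ?thesis using a t(1) by (intro add_le_less_mono mult_left_mono mult_strict_left_mono) auto
      qed (use a in auto)
      finally show ?thesis by (simp add: algebra_simps)
    qed
    ultimately show "\<exists>y\<in>(\<Union>(h, s)\<in>faces. facet h s) \<inter> ({..<n} \<rightarrow>\<^sub>E UNIV). \<forall>i\<in>{..<n}. \<bar>y i - x i\<bar> < e"
      using zf zE by blast
  qed (rule xE)
qed

lemma frontier_eq_cfacets: "Rn n frontier_of D = (\<Union>(h, s)\<in>faces. cfacet h s)"
proof
  have ne: "facet (fst f) (snd f) \<noteq> {}" if "f \<in> faces" for f using that by (auto simp: faces_def)
  have "Rn n closure_of (\<Union>f\<in>faces. facet (fst f) (snd f)) = (\<Union>f\<in>faces. Rn n closure_of (facet (fst f) (snd f)))"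
    using finite_faces by (simp add: closure_of_Union image_image)
  also have "\<dots> = (\<Union>f\<in>faces. cfacet (fst f) (snd f))"
    using ne closure_facet by (intro SUP_cong) auto
  finally show "Rn n frontier_of D \<subseteq> (\<Union>(h, s)\<in>faces. cfacet h s)"
    using frontier_sub_closure_facets by (simp add: split_def)
  show "(\<Union>(h, s)\<in>faces. cfacet h s) \<subseteq> Rn n frontier_of D"
  proof (safe)
    fix h s x assume hs: "(h, s) \<in> faces" "x \<in> cfacet h s"
    have "Rn n closure_of (facet h s) \<subseteq> Rn n frontier_of D"
      using hs facet_sub_frontier[of h s] by (intro closure_of_minimal) (auto simp: faces_def closedin_frontier_of)
    moreover have "facet h s \<noteq> {}" using ne[OF hs(1)] by simp
    ultimately show "x \<in> Rn n frontier_of D" using hs(2) closure_facet by blast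
  qed
qed

lemma facet_cfacet_disjoint:
  assumes "(h, s) \<in> faces" "(h', s') \<in> faces" "x \<in> facet h s" "x \<in> cfacet h' s'"
  shows "h = h' \<and> s = s'"
proof
  have H: "h \<in> H" "h' \<in> H" using assms by (auto simp: faces_def)
  show hh: "h = h'"
  proof (rule ccontr)
    assume "h \<noteq> h'"
    then have "s h' * aff n h' x > 0" using H assms(3) by (auto simp: facet_def)
    then show False using assms(4) by (auto simp: cfacet_def)
  qed
  have ext: "s \<in> (H - {h}) \<rightarrow>\<^sub>E {-1, 1}" "s' \<in> (H - {h}) \<rightarrow>\<^sub>E {-1, 1}" using assms hh by (auto simp: faces_def)
  show "s = s'"
  proof (rule PiE_ext[OF ext])
    fix g assume g: "g \<in> H - {h}"
    have "s g * aff n g x > 0" "s' g * aff n g x \<ge> 0" using g assms(3,4) hh by (auto simp: facet_def cfacet_def)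
    moreover have "s g \<in> {-1, 1}" "s' g \<in> {-1, 1}" using ext g by (auto dest: PiE_mem)
    ultimately show "s g = s' g" by auto
  qed
qed

end

section \<open>Hyperplanes as smooth graphs\<close>

lemma Ck_on_affine:
  "Ck_on k m ({..<m} \<rightarrow>\<^sub>E UNIV) (\<lambda>x. c + (\<Sum>j<m. a j * x j))"
proof (induction k arbitrary: a c)
  case 0
  have "continuous_map (Rn m) euclideanreal (\<lambda>x. c + (\<Sum>j<m. a j * x j))"
    using continuous_map_aff[of m "(a, c)"] by simp
  then show ?case by (simp add: continuous_map_from_subtopology)
next
  case (Suc k)
  have cont: "continuous_map (Rn m) euclideanreal (\<lambda>x. c + (\<Sum>j<m. a j * x j))"
    using continuous_map_aff[of m "(a, c)"] by simp
  have D: "((\<lambda>t. c + (\<Sum>j<m. a j * (x(i := t)) j)) has_field_derivative a i) (at (x i))" if "i < m" for x i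
  proof -
    have "(\<lambda>t. c + (\<Sum>j<m. a j * (x(i := t)) j)) = (\<lambda>t. (c + (\<Sum>j\<in>{..<m} - {i}. a j * x j)) + a i * t)"
    proof
      fix t
      have "(\<Sum>j<m. a j * (x(i := t)) j) = a i * t + (\<Sum>j\<in>{..<m} - {i}. a j * (x(i := t)) j)"
        using that by (subst sum.remove[of _ i]) auto
      also have "(\<Sum>j\<in>{..<m} - {i}. a j * (x(i := t)) j) = (\<Sum>j\<in>{..<m} - {i}. a j * x j)"
        by (rule sum.cong) auto
      finally show "c + (\<Sum>j<m. a j * (x(i := t)) j) = (c + (\<Sum>j\<in>{..<m} - {i}. a j * x j)) + a i * t" by simp
    qed
    then show ?thesis by (auto intro!: derivative_eq_intros)
  qed
  \<comment> \<open>The constant derivative is written as an affine map again, so that the induction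
    hypothesis applies.\<close>
  have pd: "partial_deriv i (\<lambda>x. c + (\<Sum>j<m. a j * x j)) = (\<lambda>x. a i + (\<Sum>j<m. 0 * x j))" if "i < m" for i
    unfolding partial_deriv_def using DERIV_imp_deriv[OF D[OF that]] by simp
  show ?case unfolding Ck_on.simps
  proof (intro conjI allI impI ballI)
    show "continuous_map (subtopology (Rn m) ({..<m} \<rightarrow>\<^sub>E UNIV)) euclideanreal (\<lambda>x. c + (\<Sum>j<m. a j * x j))"
      using cont by (rule continuous_map_from_subtopology)
    fix i assume i: "i < m"
    show "Ck_on k m ({..<m} \<rightarrow>\<^sub>E UNIV) (partial_deriv i (\<lambda>x. c + (\<Sum>j<m. a j * x j)))"
      unfolding pd[OF i] by (rule Suc.IH)
    fix x
    show "(\<lambda>t. c + (\<Sum>j<m. a j * (x(i := t)) j)) differentiable at (x i)"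
      using D[OF i] real_differentiable_def by blast
  qed
qed

lemma partial_deriv_affine:
  "i < m \<Longrightarrow> partial_deriv i (\<lambda>x. c + (\<Sum>j<m. a j * x j)) x = a i"
proof -
  assume i: "i < m"
  have "(\<lambda>t. c + (\<Sum>j<m. a j * (x(i := t)) j)) = (\<lambda>t. (c + (\<Sum>j\<in>{..<m} - {i}. a j * x j)) + a i * t)"
  proof
    fix t
    have "(\<Sum>j<m. a j * (x(i := t)) j) = a i * t + (\<Sum>j\<in>{..<m} - {i}. a j * (x(i := t)) j)"
      using i by (subst sum.remove[of _ i]) auto
    also have "(\<Sum>j\<in>{..<m} - {i}. a j * (x(i := t)) j) = (\<Sum>j\<in>{..<m} - {i}. a j * x j)"
      by (rule sum.cong) auto
    finally show "c + (\<Sum>j<m. a j * (x(i := t)) j) = (c + (\<Sum>j\<in>{..<m} - {i}. a j * x j)) + a i * t" by simp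
  qed
  then show ?thesis unfolding partial_deriv_def
    by (auto intro!: DERIV_imp_deriv derivative_eq_intros)
qed

definition skip :: "nat \<Rightarrow> nat \<Rightarrow> nat" where
  "skip k j = (if j < k then j else Suc j)"

lemma skip_inj: "skip k i = skip k j \<longleftrightarrow> i = j"
  by (auto simp: skip_def)

lemma skip_neq: "skip k j \<noteq> k"
  by (auto simp: skip_def)

lemma skip_less: "k < n \<Longrightarrow> j < n - 1 \<Longrightarrow> skip k j < n"
  by (auto simp: skip_def)

lemma skip_surj: "k < n \<Longrightarrow> i < n \<Longrightarrow> i \<noteq> k \<Longrightarrow> \<exists>j<n - 1. i = skip k j"
  by (rule exI[of _ "if i < k then i else i - 1"]) (auto simp: skip_def)

lemma sum_skip:
  fixes f :: "nat \<Rightarrow> real"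
  assumes "k < n"
  shows "(\<Sum>i<n. f i) = f k + (\<Sum>j<n - 1. f (skip k j))"
proof -
  have "bij_betw (skip k) {..<n - 1} ({..<n} - {k})"
    unfolding bij_betw_def using assms skip_surj[OF assms]
    by (auto simp: inj_on_def skip_inj skip_neq skip_less)
  then have "(\<Sum>i\<in>{..<n} - {k}. f i) = (\<Sum>j<n - 1. f (skip k j))"
    by (simp add: sum.reindex_bij_betw)
  then show ?thesis using assms by (subst sum.remove[of _ k]) auto
qed

text \<open>The hyperplane \<open>aff n h = 0\<close> as a graph over the coordinates other than \<open>k\<close>, renumbered by \<open>skip k\<close>.\<close>

definition hyper_coeff :: "(nat \<Rightarrow> real) \<times> real \<Rightarrow> nat \<Rightarrow> nat \<Rightarrow> nat \<Rightarrow> real" where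
  "hyper_coeff h k i j = (if i = k then - fst h (skip k j) / fst h k else if skip k j = i then 1 else 0)"

definition hyper_param :: "nat \<Rightarrow> (nat \<Rightarrow> real) \<times> real \<Rightarrow> nat \<Rightarrow> (nat \<Rightarrow> real) \<Rightarrow> (nat \<Rightarrow> real)" where
  "hyper_param n h k y = (\<lambda>i\<in>{..<n}. (if i = k then - snd h / fst h k else 0) + (\<Sum>j<n - 1. hyper_coeff h k i j * y j))"

lemma hyper_param_in [simp]: "hyper_param n h k y \<in> {..<n} \<rightarrow>\<^sub>E UNIV"
  by (simp add: hyper_param_def)

lemma hyper_param_skip:
  assumes "k < n" "j < n - 1"
  shows "hyper_param n h k y (skip k j) = y j"
proof -
  have "(\<Sum>l<n - 1. hyper_coeff h k (skip k j) l * y l) = (\<Sum>l<n - 1. if l = j then y l else 0)"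
    by (rule sum.cong) (auto simp: hyper_coeff_def skip_inj skip_neq)
  then show ?thesis using assms skip_less[OF assms]
    by (simp add: hyper_param_def skip_neq)
qed

lemma hyper_param_aff:
  assumes "k < n" "fst h k \<noteq> 0"
  shows "aff n h (hyper_param n h k y) = 0"
proof -
  have "hyper_param n h k y k = - snd h / fst h k + (\<Sum>j<n - 1. - fst h (skip k j) / fst h k * y j)"
    using assms by (simp add: hyper_param_def hyper_coeff_def)
  then have "fst h k * hyper_param n h k y k = - snd h - (\<Sum>j<n - 1. fst h (skip k j) * y j)"
    using assms by (simp add: right_diff_distrib sum_distrib_left sum_negf)
  moreover have "(\<Sum>j<n - 1. fst h (skip k j) * hyper_param n h k y (skip k j)) = (\<Sum>j<n - 1. fst h (skip k j) * y j)"
    using assms hyper_param_skip by (intro sum.cong) auto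
  ultimately show ?thesis using sum_skip[OF assms(1), of "\<lambda>i. fst h i * hyper_param n h k y i"] by simp
qed

lemma hyper_param_surj:
  assumes "k < n" "fst h k \<noteq> 0" "x \<in> {..<n} \<rightarrow>\<^sub>E UNIV" "aff n h x = 0"
  shows "hyper_param n h k (\<lambda>j\<in>{..<n - 1}. x (skip k j)) = x"
proof (rule PiE_ext[of _ "{..<n}" "\<lambda>_. UNIV"])
  let ?y = "\<lambda>j\<in>{..<n - 1}. x (skip k j)"
  have sk: "hyper_param n h k ?y (skip k j) = x (skip k j)" if "j < n - 1" for j
    using hyper_param_skip[OF assms(1) that, of h ?y] that by simp
  have "fst h k * hyper_param n h k ?y k + (\<Sum>j<n - 1. fst h (skip k j) * hyper_param n h k ?y (skip k j))
      = fst h k * x k + (\<Sum>j<n - 1. fst h (skip k j) * x (skip k j))"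
    using hyper_param_aff[OF assms(1,2), of ?y] assms(4)
    unfolding sum_skip[OF assms(1), of "\<lambda>i. fst h i * hyper_param n h k ?y i"] sum_skip[OF assms(1), of "\<lambda>i. fst h i * x i"]
    by linarith
  moreover have "(\<Sum>j<n - 1. fst h (skip k j) * hyper_param n h k ?y (skip k j)) = (\<Sum>j<n - 1. fst h (skip k j) * x (skip k j))"
    using sk by (intro sum.cong) auto
  ultimately have kk: "hyper_param n h k ?y k = x k" using assms(2) by simp
  fix i assume i: "i \<in> {..<n}"
  show "hyper_param n h k ?y i = x i"
  proof (cases "i = k")
    case False
    then obtain j where "j < n - 1" "i = skip k j" using skip_surj[OF assms(1)] i by auto
    then show ?thesis using sk by blast
  qed (use kk in simp)
qed (use assms in auto)

lemma hyper_param_inj: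
  assumes "k < n" "x \<in> {..<n - 1} \<rightarrow>\<^sub>E UNIV" "y \<in> {..<n - 1} \<rightarrow>\<^sub>E UNIV" "hyper_param n h k x = hyper_param n h k y"
  shows "x = y"
proof (rule PiE_ext[OF assms(2,3)])
  fix j assume "j \<in> {..<n - 1}"
  then show "x j = y j" using hyper_param_skip[OF assms(1)] assms(4) by (metis lessThan_iff)
qed

lemma hyper_param_seg:
  "hyper_param n h k (seg (n - 1) p q t) = seg n (hyper_param n h k p) (hyper_param n h k q) t"
proof -
  have "c + (\<Sum>j<n - 1. f j * seg (n - 1) p q t j) = (1 - t) * (c + (\<Sum>j<n - 1. f j * p j)) + t * (c + (\<Sum>j<n - 1. f j * q j))" for c f
    using aff_seg[where n = "n - 1" and h = "(f, c)"] by simp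
  then show ?thesis unfolding hyper_param_def seg_def[of n] by (intro restrict_ext) simp
qed

lemma continuous_map_hyper_param: "continuous_map (Rn (n - 1)) (Rn n) (hyper_param n h k)"
  unfolding continuous_map_componentwise
proof (intro conjI ballI)
  show "hyper_param n h k ` topspace (Rn (n - 1)) \<subseteq> extensional {..<n}" by (auto simp: hyper_param_def)
  fix i assume i: "i \<in> {..<n}"
  have "continuous_map (Rn (n - 1)) euclideanreal (\<lambda>y. (if i = k then - snd h / fst h k else 0) + (\<Sum>j<n - 1. hyper_coeff h k i j * y j))"
    using continuous_map_aff[of "n - 1" "(hyper_coeff h k i, if i = k then - snd h / fst h k else 0)"] by simp
  then show "continuous_map (Rn (n - 1)) euclideanreal (\<lambda>y. hyper_param n h k y i)"
    using i by (simp add: hyper_param_def)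
qed

lemma smooth_map_hyper_param: "smooth_map_on (n - 1) n ({..<n - 1} \<rightarrow>\<^sub>E UNIV) (hyper_param n h k)"
  unfolding smooth_map_on_def
proof (intro conjI allI impI)
  show "openin (Rn (n - 1)) ({..<n - 1} \<rightarrow>\<^sub>E UNIV)" using openin_topspace[of "Rn (n - 1)"] by simp
  show "hyper_param n h k ` ({..<n - 1} \<rightarrow>\<^sub>E UNIV) \<subseteq> topspace (Rn n)" by (rule image_subsetI) simp
  fix i m assume "i < n"
  then have "(\<lambda>x. hyper_param n h k x i) = (\<lambda>x. (if i = k then - snd h / fst h k else 0) + (\<Sum>j<n - 1. hyper_coeff h k i j * x j))"
    by (auto simp: hyper_param_def)
  then show "Ck_on m (n - 1) ({..<n - 1} \<rightarrow>\<^sub>E UNIV) (\<lambda>x. hyper_param n h k x i)"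
    using Ck_on_affine by simp
qed

text \<open>All coordinates except \<open>k\<close> are the parameters themselves, so the Jacobian
  contains an identity matrix.\<close>

lemma immersion_hyper_param:
  assumes "k < n"
  shows "immersion_at (n - 1) n (hyper_param n h k) x"
  unfolding immersion_at_def
proof (intro allI impI)
  fix v j assume v: "\<forall>i<n. (\<Sum>j<n - 1. partial_deriv j (\<lambda>y. hyper_param n h k y i) x * v j) = 0" and j: "j < n - 1"
  have sk: "skip k j < n" using assms j by (rule skip_less)
  have "(\<lambda>y. hyper_param n h k y (skip k j)) = (\<lambda>y. 0 + (\<Sum>l<n - 1. hyper_coeff h k (skip k j) l * y l))"
    using sk by (auto simp: hyper_param_def skip_neq)
  then have "partial_deriv l (\<lambda>y. hyper_param n h k y (skip k j)) x = (if l = j then 1 else 0)" if "l < n - 1" for l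
    using partial_deriv_affine[OF that, of 0 "hyper_coeff h k (skip k j)" x]
    by (simp add: hyper_coeff_def skip_neq skip_inj)
  then have "(\<Sum>l<n - 1. partial_deriv l (\<lambda>y. hyper_param n h k y (skip k j)) x * v l) = (\<Sum>l<n - 1. if l = j then v l else 0)"
    by (intro sum.cong) auto
  then show "v j = 0" using v sk j by simp
qed

context arrangement
begin

definition pivot where "pivot h = (SOME k. k < n \<and> fst h k \<noteq> 0)"

lemma pivot: "h \<in> H \<Longrightarrow> pivot h < n \<and> fst h (pivot h) \<noteq> 0"
  unfolding pivot_def by (rule someI_ex[OF nonconst])

definition patch_dom where
  "patch_dom h s = {y \<in> {..<n - 1} \<rightarrow>\<^sub>E UNIV. hyper_param n h (pivot h) y \<in> cfacet h s}"

lemma hyper_param_patch: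
  assumes "h \<in> H" "S \<subseteq> {x \<in> {..<n} \<rightarrow>\<^sub>E UNIV. aff n h x = 0}"
  shows "hyper_param n h (pivot h) ` {y \<in> {..<n - 1} \<rightarrow>\<^sub>E UNIV. hyper_param n h (pivot h) y \<in> S} = S"
proof
  show "S \<subseteq> hyper_param n h (pivot h) ` {y \<in> {..<n - 1} \<rightarrow>\<^sub>E UNIV. hyper_param n h (pivot h) y \<in> S}"
  proof
    fix x assume x: "x \<in> S"
    then have "hyper_param n h (pivot h) (\<lambda>j\<in>{..<n - 1}. x (skip (pivot h) j)) = x"
      using assms pivot by (intro hyper_param_surj) auto
    then show "x \<in> hyper_param n h (pivot h) ` {y \<in> {..<n - 1} \<rightarrow>\<^sub>E UNIV. hyper_param n h (pivot h) y \<in> S}"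
      using x by (intro image_eqI[of _ _ "\<lambda>j\<in>{..<n - 1}. x (skip (pivot h) j)"]) auto
  qed
qed auto

lemma image_patch_dom: "h \<in> H \<Longrightarrow> hyper_param n h (pivot h) ` patch_dom h s = cfacet h s"
  unfolding patch_dom_def by (rule hyper_param_patch) (auto simp: cfacet_def)

text \<open>From an interior point \<open>y\<close> of the domain one can step beyond
  \<open>y\<close>, away from a point \<open>p\<close> with strict inequalities, and stay in the
  domain. As \<open>y\<close> lies strictly between the two, the inequalities are strict at
  \<open>y\<close>.\<close>

lemma interior_patch_dom:
  assumes h: "h \<in> H" and ne: "facet h s \<noteq> {}"
  shows "Rn (n - 1) interior_of patch_dom h s = {y \<in> {..<n - 1} \<rightarrow>\<^sub>E UNIV. hyper_param n h (pivot h) y \<in> facet h s}"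
    (is "_ = ?F")
proof
  have eq: "?F = {y \<in> topspace (Rn (n - 1)). hyper_param n h (pivot h) y \<in> {x \<in> {..<n} \<rightarrow>\<^sub>E UNIV. \<forall>g\<in>H - {h}. s g * aff n g x > 0}}"
    unfolding facet_def using hyper_param_aff pivot[OF h] by auto
  have "openin (Rn (n - 1)) ?F" unfolding eq
    by (rule openin_continuous_map_preimage[OF continuous_map_hyper_param openin_aff_cone]) (simp add: finite_H)
  moreover have "?F \<subseteq> patch_dom h s" by (auto simp: patch_dom_def facet_def cfacet_def intro: less_imp_le)
  ultimately show "?F \<subseteq> Rn (n - 1) interior_of patch_dom h s" by (simp add: interior_of_maximal)
  show "Rn (n - 1) interior_of patch_dom h s \<subseteq> ?F"
  proof
    fix y assume y: "y \<in> Rn (n - 1) interior_of patch_dom h s"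
    let ?\<phi> = "hyper_param n h (pivot h)"
    obtain e where e: "e > 0" "\<forall>z\<in>{..<n - 1} \<rightarrow>\<^sub>E UNIV. (\<forall>i\<in>{..<n - 1}. \<bar>z i - y i\<bar> < e) \<longrightarrow> z \<in> patch_dom h s"
      and yE: "y \<in> {..<n - 1} \<rightarrow>\<^sub>E UNIV"
      using y unfolding in_interior_of_prodtop[OF finite_lessThan] by blast
    obtain x where x: "x \<in> facet h s" using ne by blast
    have "?\<phi> ` ?F = facet h s" using h by (intro hyper_param_patch) (auto simp: facet_def)
    then obtain p where p: "p \<in> ?F" using x by blast
    obtain d where d: "d > 0" "\<forall>t. \<bar>t\<bar> < d \<longrightarrow> (\<forall>i\<in>{..<n - 1}. \<bar>seg (n - 1) y p t i - y i\<bar> < e)"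
      using seg_near[OF e(1) yE, of p] by blast
    define z where "z = seg (n - 1) y p (- d / 2)"
    have "z \<in> patch_dom h s" using d e(2) by (auto simp: z_def)
    then have z: "?\<phi> z \<in> cfacet h s" by (simp add: patch_dom_def)
    have ycf: "?\<phi> y \<in> cfacet h s" using y interior_of_subset[of "Rn (n - 1)" "patch_dom h s"] by (auto simp: patch_dom_def)
    have "s g * aff n g (?\<phi> y) > 0" if g: "g \<in> H - {h}" for g
    proof -
      have "0 \<le> s g * aff n g (?\<phi> z)" using z g by (simp add: cfacet_def)
      also have "s g * aff n g (?\<phi> z) = (1 + d / 2) * (s g * aff n g (?\<phi> y)) - (d / 2) * (s g * aff n g (?\<phi> p))"
        unfolding z_def hyper_param_seg aff_seg by (simp only: algebra_simps)
      finally have 1: "(d / 2) * (s g * aff n g (?\<phi> p)) \<le> (1 + d / 2) * (s g * aff n g (?\<phi> y))" by linarith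
      have "s g * aff n g (?\<phi> p) > 0" using p g by (simp add: facet_def)
      with half_gt_zero[OF d(1)] have "0 < (d / 2) * (s g * aff n g (?\<phi> p))" by (rule mult_pos_pos)
      then have "0 < (1 + d / 2) * (s g * aff n g (?\<phi> y))" using 1 by linarith
      then show ?thesis using d(1) by (simp only: zero_less_mult_iff) (auto simp: not_less)
    qed
    then show "y \<in> ?F" using ycf yE unfolding facet_def cfacet_def by blast
  qed
qed

lemma smooth_patch_face:
  assumes hs: "(h, s) \<in> faces"
  shows "smooth_patch n (patch_dom h s) (hyper_param n h (pivot h))"
  unfolding smooth_patch_def
proof (intro conjI ballI)
  let ?\<phi> = "hyper_param n h (pivot h)"
  have h: "h \<in> H" and ne: "facet h s \<noteq> {}" using hs by (auto simp: faces_def)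
  have k: "pivot h < n" "fst h (pivot h) \<noteq> 0" using pivot[OF h] by auto
  have int: "Rn (n - 1) interior_of patch_dom h s = {y \<in> {..<n - 1} \<rightarrow>\<^sub>E UNIV. ?\<phi> y \<in> facet h s}"
    by (rule interior_patch_dom[OF h ne])
  have cf: "cfacet h s \<subseteq> D"
  proof -
    have "cfacet h s \<subseteq> Rn n frontier_of D" unfolding frontier_eq_cfacets using hs by blast
    then show ?thesis using frontier_of_subset_closedin[OF closed_D] by blast
  qed
  show "compactin (Rn (n - 1)) (patch_dom h s)"
  proof -
    have "closedin (Rn (n - 1)) {y \<in> topspace (Rn (n - 1)). ?\<phi> y \<in> cfacet h s}"
      by (rule closedin_continuous_map_preimage[OF continuous_map_hyper_param closed_cfacet])
    then have cl: "closedin (Rn (n - 1)) (patch_dom h s)" by (simp add: patch_dom_def)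
    obtain r where "r > 0" and r: "\<And>x i. x \<in> D \<Longrightarrow> i \<in> {..<n} \<Longrightarrow> \<bar>x i\<bar> \<le> r"
        using compactin_prodtop_bounded[OF finite_lessThan comp] by metis
      have bd: "- r \<le> y j \<and> y j \<le> r" if "y \<in> patch_dom h s" "j \<in> {..<n - 1}" for y j
    proof -
      have "?\<phi> y \<in> D" using that(1) cf by (auto simp: patch_dom_def)
      then have "\<bar>?\<phi> y (skip (pivot h) j)\<bar> \<le> r" using r skip_less[OF k(1), of j] that(2) by simp
      then show ?thesis using hyper_param_skip[OF k(1), of j h y] that(2) by (simp add: abs_le_iff)
    qed
    show ?thesis by (rule compactin_prodtop[OF cl]) (rule bd)
  qed
  show "convex_Rn (n - 1) (patch_dom h s)" unfolding convex_Rn_def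
  proof (intro ballI)
    fix x y t assume xy: "x \<in> patch_dom h s" "y \<in> patch_dom h s" and t: "t \<in> {0..1::real}"
    have "seg n (?\<phi> x) (?\<phi> y) t \<in> cfacet h s" unfolding cfacet_def
    proof (intro CollectI conjI ballI)
      show "aff n h (seg n (?\<phi> x) (?\<phi> y) t) = 0" unfolding aff_seg hyper_param_aff[OF k] by simp
      fix g assume g: "g \<in> H - {h}"
      have "0 \<le> (1 - t) * (s g * aff n g (?\<phi> x)) + t * (s g * aff n g (?\<phi> y))"
        using t xy g by (intro add_nonneg_nonneg mult_nonneg_nonneg[of "1 - t"] mult_nonneg_nonneg[of t]) (auto simp: patch_dom_def cfacet_def)
      also have "\<dots> = s g * aff n g (seg n (?\<phi> x) (?\<phi> y) t)"
        unfolding aff_seg by (simp only: distrib_left mult.left_commute)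
      finally show "0 \<le> s g * aff n g (seg n (?\<phi> x) (?\<phi> y) t)" .
    qed simp
    then have "?\<phi> (seg (n - 1) x y t) \<in> cfacet h s" unfolding hyper_param_seg .
    then have "seg (n - 1) x y t \<in> patch_dom h s" unfolding patch_dom_def by simp
    then show "(\<lambda>i\<in>{..<n - 1}. (1 - t) * x i + t * y i) \<in> patch_dom h s" by (simp add: seg_def)
  qed
  show "Rn (n - 1) interior_of patch_dom h s \<noteq> {}"
  proof -
    have "?\<phi> ` {y \<in> {..<n - 1} \<rightarrow>\<^sub>E UNIV. ?\<phi> y \<in> facet h s} = facet h s"
      using h by (intro hyper_param_patch) (auto simp: facet_def)
    then show ?thesis unfolding int using ne by blast
  qed
  show "\<exists>U. patch_dom h s \<subseteq> U \<and> smooth_map_on (n - 1) n U ?\<phi>"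
    using smooth_map_hyper_param[of n h "pivot h"] by (intro exI[of _ "{..<n - 1} \<rightarrow>\<^sub>E UNIV"]) (auto simp: patch_dom_def)
  fix x assume x: "x \<in> Rn (n - 1) interior_of patch_dom h s"
  show "immersion_at (n - 1) n ?\<phi> x" using k(1) by (rule immersion_hyper_param)
  fix y assume "y \<in> patch_dom h s"
  then show "?\<phi> x = ?\<phi> y \<longrightarrow> x = y"
    using x hyper_param_inj[OF k(1), of x y h] unfolding int by (auto simp: patch_dom_def)
qed

lemma piecewise_smooth: "piecewise_smooth_surface n (Rn n frontier_of D)"
proof -
  obtain f where f: "bij_betw f {0..<card faces} faces"
    using ex_bij_betw_nat_finite[OF finite_faces] by blast
  define K where "K i = patch_dom (fst (f i)) (snd (f i))" for i
  define \<phi> where "\<phi> i = hyper_param n (fst (f i)) (pivot (fst (f i)))" for i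
  have fi: "f i \<in> faces" if "i < card faces" for i using f that by (auto simp: bij_betw_def)
  have fH: "fst (f i) \<in> H" "facet (fst (f i)) (snd (f i)) \<noteq> {}" if "i < card faces" for i
  proof -
    have "(fst (f i), snd (f i)) \<in> faces" using fi[OF that] by simp
    then show "fst (f i) \<in> H" "facet (fst (f i)) (snd (f i)) \<noteq> {}" by (simp_all only: faces_def mem_Collect_eq prod.case) blast+
  qed
  have image: "\<phi> i ` K i = cfacet (fst (f i)) (snd (f i))" if "i < card faces" for i
    unfolding \<phi>_def K_def by (rule image_patch_dom[OF fH(1)[OF that]])
  show ?thesis unfolding piecewise_smooth_surface_def
  proof (intro exI[of _ "card faces"] exI[of _ K] exI[of _ \<phi>] conjI allI impI)
    show "smooth_patch n (K i) (\<phi> i)" if "i < card faces" for i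
      unfolding K_def \<phi>_def using smooth_patch_face fi[OF that] by simp
    have "(\<Union>(h, s)\<in>faces. cfacet h s) = (\<Union>x\<in>f ` {..<card faces}. cfacet (fst x) (snd x))"
      using f by (auto simp: bij_betw_def split_def lessThan_atLeast0)
    also have "\<dots> = (\<Union>i<card faces. \<phi> i ` K i)" using image by auto
    finally show "Rn n frontier_of D = (\<Union>i<card faces. \<phi> i ` K i)" unfolding frontier_eq_cfacets .
    fix i j assume ij: "i < card faces" "j < card faces" "i \<noteq> j"
    have "f i \<noteq> f j" using f ij by (auto simp: bij_betw_def inj_on_def)
    have A: "\<phi> i ` (Rn (n - 1) interior_of K i) \<subseteq> facet (fst (f i)) (snd (f i))"
      unfolding K_def \<phi>_def interior_patch_dom[OF fH[OF ij(1)]] by blast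
    have B: "facet (fst (f i)) (snd (f i)) \<inter> cfacet (fst (f j)) (snd (f j)) = {}"
    proof (rule ccontr)
      assume "\<not> ?thesis"
      then obtain x where x: "x \<in> facet (fst (f i)) (snd (f i))" "x \<in> cfacet (fst (f j)) (snd (f j))" by blast
      have mem: "(fst (f i), snd (f i)) \<in> faces" "(fst (f j), snd (f j)) \<in> faces" using fi ij by simp_all
      have "f i = f j" using facet_cfacet_disjoint[OF mem x] by (simp only: prod_eq_iff[of "f i" "f j"])
      then show False using \<open>f i \<noteq> f j\<close> by blast
    qed
    show "\<phi> i ` (Rn (n - 1) interior_of K i) \<inter> \<phi> j ` K j = {}"
      unfolding image[OF ij(2)] using A B by blast
  qed
qed

end

lemma piecewise_smooth_frontier:
  assumes "compactin (Rn n) D" "Rn n closure_of (Rn n interior_of D) = D"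
    and "finite H" "\<And>h. h \<in> H \<Longrightarrow> \<exists>i<n. fst h i \<noteq> 0"
    and "Rn n frontier_of D \<subseteq> (\<Union>h\<in>H. {x \<in> {..<n} \<rightarrow>\<^sub>E UNIV. aff n h x = 0})"
  shows "piecewise_smooth_surface n (Rn n frontier_of D)"
proof -
  obtain H' where H': "H' \<subseteq> H" "finite H'" "inj_on (\<lambda>h. {x \<in> {..<n} \<rightarrow>\<^sub>E UNIV. aff n h x = 0}) H'"
    "(\<Union>h\<in>H. {x \<in> {..<n} \<rightarrow>\<^sub>E UNIV. aff n h x = 0}) = (\<Union>h\<in>H'. {x \<in> {..<n} \<rightarrow>\<^sub>E UNIV. aff n h x = 0})"
    using distinct_hyperplanes[OF assms(3)] by blast
  interpret arrangement n D H'
  proof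
    show "Rn n frontier_of D \<subseteq> (\<Union>h\<in>H'. {x \<in> {..<n} \<rightarrow>\<^sub>E UNIV. aff n h x = 0})"
      using assms(5) unfolding H'(4) .
    show "\<exists>i<n. fst h i \<noteq> 0" if "h \<in> H'" for h using assms(4) H'(1) that by blast
  qed (use assms H' in auto)
  show ?thesis by (rule piecewise_smooth)
qed

section \<open>Tilings and periodic functions\<close>

definition tr :: "nat \<Rightarrow> (nat \<Rightarrow> real) \<Rightarrow> (nat \<Rightarrow> real) \<Rightarrow> (nat \<Rightarrow> real)" where
  "tr n z x = (\<lambda>i\<in>{..<n}. x i + z i)"

lemma tr_in [simp]: "tr n z x \<in> {..<n} \<rightarrow>\<^sub>E UNIV"
  by (simp add: tr_def)

lemma translate_Rn_tr: "translate_Rn n z D = tr n z ` D"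
  by (simp add: translate_Rn_def tr_def[abs_def])

lemma tr_neg_tr: "x \<in> {..<n} \<rightarrow>\<^sub>E UNIV \<Longrightarrow> tr n (\<lambda>i\<in>{..<n}. - z i) (tr n z x) = x"
  by (intro PiE_ext[of _ "{..<n}" "\<lambda>_. UNIV"]) (auto simp: tr_def)

lemma tr_tr_neg: "x \<in> {..<n} \<rightarrow>\<^sub>E UNIV \<Longrightarrow> tr n z (tr n (\<lambda>i\<in>{..<n}. - z i) x) = x"
  by (intro PiE_ext[of _ "{..<n}" "\<lambda>_. UNIV"]) (auto simp: tr_def)

lemma mem_tr_image:
  assumes "D \<subseteq> {..<n} \<rightarrow>\<^sub>E UNIV" "x \<in> {..<n} \<rightarrow>\<^sub>E UNIV"
  shows "x \<in> tr n z ` D \<longleftrightarrow> tr n (\<lambda>i\<in>{..<n}. - z i) x \<in> D"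
proof
  assume "x \<in> tr n z ` D"
  then obtain y where "y \<in> D" "x = tr n z y" by blast
  then show "tr n (\<lambda>i\<in>{..<n}. - z i) x \<in> D" using tr_neg_tr[of y n z] assms(1) by auto
next
  assume *: "tr n (\<lambda>i\<in>{..<n}. - z i) x \<in> D"
  have "x = tr n z (tr n (\<lambda>i\<in>{..<n}. - z i) x)" using tr_tr_neg[OF assms(2), of z] by simp
  then show "x \<in> tr n z ` D" using * by (rule image_eqI)
qed

lemma interior_of_tr:
  assumes "D \<subseteq> {..<n} \<rightarrow>\<^sub>E UNIV"
  shows "Rn n interior_of (tr n z ` D) = tr n z ` (Rn n interior_of D)"
proof (intro set_eqI)
  fix x
  have int: "Rn n interior_of D \<subseteq> {..<n} \<rightarrow>\<^sub>E UNIV"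
    using interior_of_subset_topspace[of "Rn n" D] by simp
  show "x \<in> Rn n interior_of (tr n z ` D) \<longleftrightarrow> x \<in> tr n z ` (Rn n interior_of D)"
  proof (cases "x \<in> {..<n} \<rightarrow>\<^sub>E UNIV")
    case True
    let ?x = "tr n (\<lambda>i\<in>{..<n}. - z i) x"
    have "(\<forall>y\<in>{..<n} \<rightarrow>\<^sub>E UNIV. (\<forall>i\<in>{..<n}. \<bar>y i - x i\<bar> < e) \<longrightarrow> y \<in> tr n z ` D) \<longleftrightarrow>
        (\<forall>y\<in>{..<n} \<rightarrow>\<^sub>E UNIV. (\<forall>i\<in>{..<n}. \<bar>y i - ?x i\<bar> < e) \<longrightarrow> y \<in> D)" (is "?A \<longleftrightarrow> ?B") for e
    proof
      assume A: ?A
      show ?B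
      proof (intro ballI impI)
        fix y assume y: "y \<in> {..<n} \<rightarrow>\<^sub>E UNIV" "\<forall>i\<in>{..<n}. \<bar>y i - ?x i\<bar> < e"
        then have "\<forall>i\<in>{..<n}. \<bar>tr n z y i - x i\<bar> < e" by (simp add: tr_def algebra_simps)
        then have "tr n z y \<in> tr n z ` D" using A by simp
        then show "y \<in> D" using mem_tr_image[OF assms, of "tr n z y" z] tr_neg_tr[OF y(1)] by simp
      qed
    next
      assume B: ?B
      show ?A
      proof (intro ballI impI)
        fix y assume y: "y \<in> {..<n} \<rightarrow>\<^sub>E UNIV" "\<forall>i\<in>{..<n}. \<bar>y i - x i\<bar> < e"
        then have "\<forall>i\<in>{..<n}. \<bar>tr n (\<lambda>i\<in>{..<n}. - z i) y i - ?x i\<bar> < e" by (simp add: tr_def)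
        then have "tr n (\<lambda>i\<in>{..<n}. - z i) y \<in> D" using B by simp
        then show "y \<in> tr n z ` D" using mem_tr_image[OF assms y(1)] by simp
      qed
    qed
    then show ?thesis
      unfolding mem_tr_image[OF int True] in_interior_of_prodtop[OF finite_lessThan] using True by simp
  next
    case False
    then have "x \<notin> Rn n interior_of (tr n z ` D)"
      using interior_of_subset_topspace[of "Rn n" "tr n z ` D"] by auto
    moreover have "x \<notin> tr n z ` (Rn n interior_of D)"
    proof
      assume "x \<in> tr n z ` (Rn n interior_of D)"
      then obtain y where "x = tr n z y" by blast
      then have "x \<in> {..<n} \<rightarrow>\<^sub>E UNIV" using tr_in[of n z y] by (simp only:)
      with False show False by blast
    qed
    ultimately show ?thesis by blast
  qed
qed

lemma emeasure_hyperplane: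
  assumes "\<exists>i<n. fst h i \<noteq> 0"
  shows "{x \<in> {..<n} \<rightarrow>\<^sub>E UNIV. aff n h x = 0} \<in> null_sets (leb {..<n})" (is "?S \<in> _")
proof -
  obtain k where k: "k < n" "fst h k \<noteq> 0" using assms by blast
  let ?I = "{..<n} - {k}"
  have ins: "insert k ?I = {..<n}" using k by auto
  have cl: "closedin (Rn n) ?S"
    using closedin_continuous_map_preimage[OF continuous_map_aff[of n h], of "{0}"] by simp
  have S: "?S \<in> sets (leb {..<n})" by (rule closedin_prodtop_imp_measurable[OF finite_lessThan cl])
  have "emeasure (leb {..<n}) ?S = (\<integral>\<^sup>+ x. indicator ?S x \<partial>leb (insert k ?I))"
    unfolding ins using S by simp
  also have "\<dots> = (\<integral>\<^sup>+ y. \<integral>\<^sup>+ t. indicator ?S (y(k := t)) \<partial>lborel \<partial>leb ?I)"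
  proof (rule lborel_PiM.product_nn_integral_insert)
    show "indicator ?S \<in> borel_measurable (leb (insert k ?I))" unfolding ins using S by simp
  qed auto
  also have "\<dots> = (\<integral>\<^sup>+ y. 0 \<partial>leb ?I)"
  proof (rule nn_integral_cong)
    fix y assume y: "y \<in> space (leb ?I)"
    define t0 where "t0 = - (snd h + (\<Sum>i\<in>?I. fst h i * y i)) / fst h k"
    have "aff n h (y(k := t)) = 0 \<longleftrightarrow> t = t0" for t
    proof -
      have "(\<Sum>i<n. fst h i * (y(k := t)) i) = fst h k * t + (\<Sum>i\<in>?I. fst h i * (y(k := t)) i)"
        using k by (subst sum.remove[of _ k]) auto
      also have "(\<Sum>i\<in>?I. fst h i * (y(k := t)) i) = (\<Sum>i\<in>?I. fst h i * y i)" by (rule sum.cong) auto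
      finally show ?thesis using k(2) by (auto simp: t0_def field_simps)
    qed
    then have "(\<integral>\<^sup>+ t. indicator ?S (y(k := t)) \<partial>lborel) \<le> (\<integral>\<^sup>+ t. indicator {t0} t \<partial>lborel)"
      by (intro nn_integral_mono) (auto simp: indicator_def)
    also have "\<dots> = 0" by simp
    finally show "(\<integral>\<^sup>+ t. indicator ?S (y(k := t)) \<partial>lborel) = 0" by simp
  qed
  finally show ?thesis using S by (simp add: null_setsI)
qed

lemma null_sets_hyperplanes:
  assumes "finite H" "\<And>h. h \<in> H \<Longrightarrow> \<exists>i<n. fst h i \<noteq> 0" "closedin (Rn n) S"
    and "S \<subseteq> (\<Union>h\<in>H. {x \<in> {..<n} \<rightarrow>\<^sub>E UNIV. aff n h x = 0})"
  shows "S \<in> null_sets (leb {..<n})"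
proof (rule null_sets_subset[OF _ _ assms(4)])
  show "(\<Union>h\<in>H. {x \<in> {..<n} \<rightarrow>\<^sub>E UNIV. aff n h x = 0}) \<in> null_sets (leb {..<n})"
    using emeasure_hyperplane assms(2) by (intro null_sets.finite_UN assms(1)) blast
  show "S \<in> sets (leb {..<n})" by (rule closedin_prodtop_imp_measurable[OF finite_lessThan assms(3)])
qed

section \<open>Integrals of periodic functions over tiling bodies\<close>

abbreviation box_Rn :: "nat \<Rightarrow> real \<Rightarrow> real \<Rightarrow> (nat \<Rightarrow> real) set" where
  "box_Rn n a b \<equiv> {..<n} \<rightarrow>\<^sub>E {a..b}"

definition periodic_Rn :: "nat \<Rightarrow> ((nat \<Rightarrow> real) \<Rightarrow> 'a) \<Rightarrow> bool" where
  "periodic_Rn n v \<longleftrightarrow> (\<forall>z\<in>{..<n} \<rightarrow>\<^sub>E \<int>. \<forall>x\<in>{..<n} \<rightarrow>\<^sub>E UNIV. v (tr n z x) = v x)"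

lemma measurable_tr: "tr n z \<in> measurable (leb {..<n}) (leb {..<n})"
  using measurable_affine_leb[of 1 z "{..<n}"] by (simp add: tr_def[abs_def])

lemma nn_integral_tr:
  "u \<in> borel_measurable (leb {..<n}) \<Longrightarrow> (\<integral>\<^sup>+ x. u x \<partial>leb {..<n}) = (\<integral>\<^sup>+ x. u (tr n z x) \<partial>leb {..<n})"
  using nn_integral_leb_translate[of "{..<n}" u z] by (simp add: tr_def)

text \<open>The parts of \<open>D\<close> in the half-open lattice cubes are moved back to the unit
  cube, which does not change \<open>v\<close>. By covering and disjointness of interiors almost
  every point of that cube is then hit exactly once. The bound on \<open>D\<close> leaves only
  finitely many shifts.\<close>

lemma tiling_nn_integral_half_open:
  assumes tile: "tiling_body n D" and D2: "D \<subseteq> box_Rn n 0 2"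
    and null: "Rn n frontier_of D \<in> null_sets (leb {..<n})"
    and [measurable]: "v \<in> borel_measurable (leb {..<n})" and per: "periodic_Rn n v"
  shows "(\<integral>\<^sup>+ x. v x * indicator D x \<partial>leb {..<n}) = (\<integral>\<^sup>+ x. v x * indicator ({..<n} \<rightarrow>\<^sub>E {0..<1}) x \<partial>leb {..<n})"
proof -
  \<comment> \<open>The value \<open>2\<close> is the floor of the coordinate \<open>2\<close>,
    which the closed box contains.\<close>
  let ?Z = "{..<n} \<rightarrow>\<^sub>E {0, 1, 2 :: real}"
  let ?Q = "{..<n} \<rightarrow>\<^sub>E {0..<1 :: real}"
  have finZ: "finite ?Z" by (intro finite_PiE) auto
  have ZZ: "z \<in> {..<n} \<rightarrow>\<^sub>E \<int>" if "z \<in> ?Z" for z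
    by (rule subsetD[OF PiE_mono that]) auto
  have cl: "closedin (Rn n) D" using tile unfolding tiling_body_def body_def
    by (auto intro: compactin_prodtop_imp_closedin)
  have DE: "D \<subseteq> {..<n} \<rightarrow>\<^sub>E UNIV" using closedin_subset[OF cl] by simp
  have Dm[measurable]: "D \<in> sets (leb {..<n})" by (rule closedin_prodtop_imp_measurable[OF finite_lessThan cl])
  have Qm[measurable]: "?Q \<in> sets (leb {..<n})" by (intro sets_PiM_I_finite) auto
  have trm[measurable]: "tr n z \<in> measurable (leb {..<n}) (leb {..<n})" for z by (rule measurable_tr)
  define fl where "fl = (\<lambda>x::nat \<Rightarrow> real. \<lambda>i\<in>{..<n}. real_of_int \<lfloor>x i\<rfloor>)"
  define P where "P z = {x \<in> {..<n} \<rightarrow>\<^sub>E UNIV. tr n (\<lambda>i\<in>{..<n}. - z i) x \<in> ?Q}" for z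
  have P_iff: "x \<in> P z \<longleftrightarrow> fl x = z" if "x \<in> {..<n} \<rightarrow>\<^sub>E UNIV" "z \<in> {..<n} \<rightarrow>\<^sub>E \<int>" for x z
  proof
    assume "x \<in> P z"
    then have Q: "0 \<le> x i - z i \<and> x i - z i < 1" if "i < n" for i
      using that by (auto simp: P_def tr_def PiE_iff)
    show "fl x = z"
    proof (rule PiE_ext[of _ "{..<n}" "\<lambda>_. UNIV"])
      fix i assume i: "i \<in> {..<n}"
      then obtain m where "z i = of_int m" using PiE_mem[OF \<open>z \<in> _\<close> i] by (auto elim: Ints_cases)
      then show "fl x i = z i" using Q[of i] i by (auto simp: fl_def floor_eq_iff)
    qed (use \<open>z \<in> _\<close> in \<open>auto simp: fl_def PiE_iff\<close>)
  next
    assume "fl x = z"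
    then have "z i = of_int \<lfloor>x i\<rfloor>" if "i < n" for i using that by (auto simp: fl_def)
    then show "x \<in> P z" using \<open>x \<in> _\<close> by (auto simp: P_def tr_def PiE_iff) linarith+
  qed
  have flZ: "fl x \<in> ?Z" if "x \<in> D" for x
  proof
    fix i assume i: "i \<in> {..<n}"
    have "x i \<in> {0..2}" using that D2 i by (auto simp: PiE_iff)
    then have "0 \<le> \<lfloor>x i\<rfloor>" "\<lfloor>x i\<rfloor> \<le> 2" by (auto simp: floor_le_iff)
    then have "\<lfloor>x i\<rfloor> = 0 \<or> \<lfloor>x i\<rfloor> = 1 \<or> \<lfloor>x i\<rfloor> = 2" by linarith
    then show "fl x i \<in> {0, 1, 2}" using i by (auto simp: fl_def)
  qed (auto simp: fl_def)
  have ind: "(indicator D x :: ennreal) = (\<Sum>z\<in>?Z. indicator D x * indicator (P z) x)" if "x \<in> {..<n} \<rightarrow>\<^sub>E UNIV" for x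
  proof (cases "x \<in> D")
    case True
    have "(\<Sum>z\<in>?Z. indicator D x * indicator (P z) x :: ennreal) = (\<Sum>z\<in>?Z. if z = fl x then 1 else 0)"
      using True P_iff[OF \<open>x \<in> {..<n} \<rightarrow>\<^sub>E UNIV\<close> ZZ] by (intro sum.cong) (auto simp: indicator_def)
    then show ?thesis using True flZ[OF True] finZ by simp
  qed simp
  have Pm[measurable]: "P z \<in> sets (leb {..<n})" for z
  proof -
    have "P z = {x \<in> space (leb {..<n}). tr n (\<lambda>i\<in>{..<n}. - z i) x \<in> ?Q}" by (simp add: P_def space_leb)
    also have "\<dots> \<in> sets (leb {..<n})" by measurable
    finally show ?thesis .
  qed
  have "(\<integral>\<^sup>+ x. v x * indicator D x \<partial>leb {..<n}) = (\<integral>\<^sup>+ x. (\<Sum>z\<in>?Z. v x * (indicator D x * indicator (P z) x)) \<partial>leb {..<n})"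
    using ind by (intro nn_integral_cong) (simp add: space_leb sum_distrib_left[symmetric])
  also have "\<dots> = (\<Sum>z\<in>?Z. \<integral>\<^sup>+ x. v x * (indicator D x * indicator (P z) x) \<partial>leb {..<n})"
    by (intro nn_integral_sum) measurable
  also have "\<dots> = (\<Sum>z\<in>?Z. \<integral>\<^sup>+ x. v x * (indicator D (tr n z x) * indicator ?Q x) \<partial>leb {..<n})"
  proof (rule sum.cong[OF refl])
    fix z assume z: "z \<in> ?Z"
    have "(\<integral>\<^sup>+ x. v x * (indicator D x * indicator (P z) x) \<partial>leb {..<n})
      = (\<integral>\<^sup>+ x. v (tr n z x) * (indicator D (tr n z x) * indicator (P z) (tr n z x)) \<partial>leb {..<n})"
      by (rule nn_integral_tr) measurable
    also have "\<dots> = (\<integral>\<^sup>+ x. v x * (indicator D (tr n z x) * indicator ?Q x) \<partial>leb {..<n})"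
    proof (rule nn_integral_cong)
      fix x assume x: "x \<in> space (leb {..<n})"
      have "v (tr n z x) = v x" using per ZZ[OF z] x by (auto simp: periodic_Rn_def space_leb)
      moreover have "tr n z x \<in> P z \<longleftrightarrow> x \<in> ?Q" using tr_neg_tr[of x n z] x by (simp add: P_def space_leb)
      ultimately show "v (tr n z x) * (indicator D (tr n z x) * indicator (P z) (tr n z x)) = v x * (indicator D (tr n z x) * indicator ?Q x)"
        by (simp add: indicator_def)
    qed
    finally show "(\<integral>\<^sup>+ x. v x * (indicator D x * indicator (P z) x) \<partial>leb {..<n}) = \<dots>" .
  qed
  also have "\<dots> = (\<integral>\<^sup>+ x. (\<Sum>z\<in>?Z. v x * (indicator D (tr n z x) * indicator ?Q x)) \<partial>leb {..<n})"
    by (intro nn_integral_sum[symmetric]) measurable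
  also have "\<dots> = (\<integral>\<^sup>+ x. v x * indicator ?Q x \<partial>leb {..<n})"
  proof (rule nn_integral_cong_AE)
    \<comment> \<open>Off this null set a translate of \<open>x\<close> in \<open>D\<close> even
      lies in the interior of \<open>D\<close>, so the disjointness of interiors allows only one
      shift.\<close>
    let ?N = "\<Union>z\<in>?Z. {x \<in> space (leb {..<n}). tr n z x \<in> Rn n frontier_of D}"
    have "?N \<in> null_sets (leb {..<n})"
    proof (rule null_sets.finite_UN[OF finZ])
      fix z
      have fm: "Rn n frontier_of D \<in> sets (leb {..<n})" using null by auto
      have "emeasure (leb {..<n}) (Rn n frontier_of D) = emeasure (leb {..<n}) {x \<in> space (leb {..<n}). tr n z x \<in> Rn n frontier_of D}"
        using emeasure_leb_affine[of "{..<n}" 1 "Rn n frontier_of D" z] fm by (simp add: tr_def)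
      moreover have "{x \<in> space (leb {..<n}). tr n z x \<in> Rn n frontier_of D} \<in> sets (leb {..<n})"
        using fm by measurable
      ultimately show "{x \<in> space (leb {..<n}). tr n z x \<in> Rn n frontier_of D} \<in> null_sets (leb {..<n})"
        using null by (simp add: null_sets_def)
    qed
    then have "AE x in leb {..<n}. x \<notin> ?N" by (rule AE_not_in)
    then show "AE x in leb {..<n}. (\<Sum>z\<in>?Z. v x * (indicator D (tr n z x) * indicator ?Q x)) = v x * indicator ?Q x"
      using AE_space
    proof eventually_elim
      fix x assume xN: "x \<notin> ?N" and xs: "x \<in> space (leb {..<n})"
      then have xE: "x \<in> {..<n} \<rightarrow>\<^sub>E UNIV" by (simp add: space_leb)
      show "(\<Sum>z\<in>?Z. v x * (indicator D (tr n z x) * indicator ?Q x)) = v x * indicator ?Q x"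
      proof (cases "x \<in> ?Q")
        case True
        have "x \<in> (\<Union>z\<in>{..<n} \<rightarrow>\<^sub>E \<int>. translate_Rn n z D)" using tile xE by (simp add: tiling_body_def)
        then obtain w where w: "w \<in> {..<n} \<rightarrow>\<^sub>E \<int>" "x \<in> tr n w ` D" by (auto simp: translate_Rn_tr)
        define z where "z = (\<lambda>i\<in>{..<n}. - w i)"
        have zD: "tr n z x \<in> D" using mem_tr_image[OF DE xE] w(2) by (simp add: z_def)
        have zZ: "z \<in> ?Z"
        proof
          fix i assume i: "i \<in> {..<n}"
          obtain m where m: "w i = of_int m" using PiE_mem[OF w(1) i] by (auto elim: Ints_cases)
          have "x i \<in> {0..<1}" using True i by (auto simp: PiE_iff)
          moreover have "tr n z x i \<in> {0..2}" using zD D2 i by (auto simp: PiE_iff)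
          ultimately have "of_int m < (1::real)" "- of_int m \<le> (2::real)" using i by (auto simp: tr_def z_def m)
          then have "m = 0 \<or> m = -1 \<or> m = -2" by linarith
          then show "z i \<in> {0, 1, 2}" using i m by (auto simp: z_def)
        qed (simp add: z_def)
        have intD: "tr n y x \<in> Rn n interior_of D" if "y \<in> ?Z" "tr n y x \<in> D" for y
          using xN xs that cl by (auto simp: frontier_of_def closure_of_closedin)
        have uniq: "y = z" if y: "y \<in> ?Z" "tr n y x \<in> D" for y
        proof (rule ccontr)
          assume "y \<noteq> z"
          define y' where "y' = (\<lambda>i\<in>{..<n}. - y i)"
          define z' where "z' = (\<lambda>i\<in>{..<n}. - z i)"
          have yz: "y = (\<lambda>i\<in>{..<n}. - y' i)" "z = (\<lambda>i\<in>{..<n}. - z' i)"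
            using y(1) zZ unfolding y'_def z'_def
            by (auto intro!: extensionalityI[of _ "{..<n}"] simp: PiE_def)
          have neq: "y' \<noteq> z'" using yz \<open>y \<noteq> z\<close> by metis
          have Z': "y' \<in> {..<n} \<rightarrow>\<^sub>E \<int>" "z' \<in> {..<n} \<rightarrow>\<^sub>E \<int>"
            using ZZ[OF y(1)] ZZ[OF zZ] by (auto simp: y'_def z'_def PiE_iff)
          have int: "Rn n interior_of D \<subseteq> {..<n} \<rightarrow>\<^sub>E UNIV"
            using interior_of_subset_topspace[of "Rn n" D] by simp
          have "x \<in> tr n y' ` (Rn n interior_of D)" "x \<in> tr n z' ` (Rn n interior_of D)"
            unfolding mem_tr_image[OF int xE] yz[symmetric] using intD y zZ zD by auto
          then have "x \<in> Rn n interior_of translate_Rn n y' D \<inter> Rn n interior_of translate_Rn n z' D"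
            by (simp add: translate_Rn_tr interior_of_tr[OF DE])
          then show False using tile Z' neq unfolding tiling_body_def by blast
        qed
        have "(\<Sum>y\<in>?Z. v x * (indicator D (tr n y x) * indicator ?Q x)) = (\<Sum>y\<in>?Z. if y = z then v x else 0)"
        proof (rule sum.cong[OF refl])
          fix y assume y: "y \<in> ?Z"
          show "v x * (indicator D (tr n y x) * indicator ?Q x) = (if y = z then v x else 0)"
          proof (cases "tr n y x \<in> D")
            case in_D: True
            then have "y = z" using uniq[OF y] by blast
            then show ?thesis using in_D True by simp
          next
            case False
            then have "y \<noteq> z" using zD by blast
            then show ?thesis using False by simp
          qed
        qed
        then show ?thesis using True zZ finZ by simp
      qed simp
    qed
  qed
  finally show ?thesis .
qed

lemma AE_coord_neq:
  assumes "finite I" "countable S"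
  shows "AE x in leb I. \<forall>i\<in>I. x i \<notin> S"
proof -
  have "AE x in leb I. x i \<notin> S" if i: "i \<in> I" for i
  proof (rule AE_I')
    have ins: "insert i (I - {i}) = I" using i by auto
    have Sm: "S \<in> sets lborel" by (rule sets.countable) (use assms in auto)
    have eq: "{x \<in> space (leb I). x i \<in> S} = (\<Pi>\<^sub>E j\<in>I. if j = i then S else UNIV)"
      using i by (auto simp: space_leb PiE_iff extensional_def split: if_splits)
    have "emeasure (leb I) (\<Pi>\<^sub>E j\<in>I. if j = i then S else UNIV) = (\<Prod>j\<in>I. emeasure lborel (if j = i then S else UNIV))"
      using Sm assms(1) by (intro lborel_PiM.emeasure_PiM) auto
    also have "\<dots> = 0"
      using i assms countable_imp_null_set_lborel[OF assms(2)] by (subst prod_zero) auto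
    finally show "{x \<in> space (leb I). x i \<in> S} \<in> null_sets (leb I)"
      unfolding eq using Sm assms(1) by (intro null_setsI) (auto intro!: sets_PiM_I_finite)
  qed auto
  then show ?thesis using assms(1) by (simp add: AE_finite_all)
qed

lemma tiling_nn_integral:
  assumes "tiling_body n D" "D \<subseteq> box_Rn n 0 2" "Rn n frontier_of D \<in> null_sets (leb {..<n})"
    and "v \<in> borel_measurable (leb {..<n})" "periodic_Rn n v"
  shows "(\<integral>\<^sup>+ x. v x * indicator D x \<partial>leb {..<n}) = (\<integral>\<^sup>+ x. v x * indicator (box_Rn n 0 1) x \<partial>leb {..<n})"
proof -
  have "AE x in leb {..<n}. \<forall>i\<in>{..<n}. x i \<notin> {1}" by (rule AE_coord_neq) auto
  then have "(\<integral>\<^sup>+ x. v x * indicator ({..<n} \<rightarrow>\<^sub>E {0..<1}) x \<partial>leb {..<n}) = (\<integral>\<^sup>+ x. v x * indicator (box_Rn n 0 1) x \<partial>leb {..<n})"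
  proof (intro nn_integral_cong_AE, elim eventually_mono)
    fix x assume x: "\<forall>i\<in>{..<n}. x i \<notin> {1::real}"
    have "x \<in> {..<n} \<rightarrow>\<^sub>E {0..<1} \<longleftrightarrow> x \<in> box_Rn n 0 1" using x by (auto simp: PiE_iff less_le)
    then show "v x * indicator ({..<n} \<rightarrow>\<^sub>E {0..<1}) x = v x * indicator (box_Rn n 0 1) x"
      by (simp only: indicator_def)
  qed
  then show ?thesis using tiling_nn_integral_half_open[OF assms] by simp
qed

section \<open>Area of level sets of affine functionals\<close>

definition gradnorm :: "nat \<Rightarrow> (nat \<Rightarrow> real) \<times> real \<Rightarrow> real" where
  "gradnorm n h = sqrt (\<Sum>i<n. (fst h i)\<^sup>2)"

definition graph_at :: "nat \<Rightarrow> (nat \<Rightarrow> real) \<times> real \<Rightarrow> nat \<Rightarrow> real \<Rightarrow> (nat \<Rightarrow> real) \<Rightarrow> (nat \<Rightarrow> real)" where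
  "graph_at n h p \<theta> y = y(p := (\<theta> - snd h - (\<Sum>i\<in>{..<n} - {p}. fst h i * y i)) / fst h p)"

text \<open>The surface measure of the hyperplane \<open>aff n h = \<theta>\<close> inside \<open>B\<close>, which is parametrized as a
  graph over the coordinates different from \<open>p\<close>.\<close>

definition surf :: "nat \<Rightarrow> (nat \<Rightarrow> real) \<times> real \<Rightarrow> nat \<Rightarrow> (nat \<Rightarrow> real) set \<Rightarrow> real \<Rightarrow> (nat \<Rightarrow> real) measure" where
  "surf n h p B \<theta> = density (distr (leb ({..<n} - {p})) (leb {..<n}) (graph_at n h p \<theta>))
     (\<lambda>x. ennreal (gradnorm n h / \<bar>fst h p\<bar>) * indicator B x)"

lemma sets_surf [simp]: "sets (surf n h p B \<theta>) = sets (leb {..<n})"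
  by (simp add: surf_def)

lemma measurable_graph_at:
  assumes "p < n"
  shows "graph_at n h p \<theta> \<in> measurable (leb ({..<n} - {p})) (leb {..<n})"
proof -
  have "insert p ({..<n} - {p}) = {..<n}" using assms by auto
  moreover have "(\<lambda>y. (\<theta> - snd h - (\<Sum>i\<in>{..<n} - {p}. fst h i * y i)) / fst h p) \<in> borel_measurable (leb ({..<n} - {p}))"
    by measurable
  from measurable_update_leb[OF this, of p]
  have "graph_at n h p \<theta> \<in> measurable (leb ({..<n} - {p})) (leb (insert p ({..<n} - {p})))"
    unfolding graph_at_def[abs_def] .
  ultimately show ?thesis by simp
qed

lemma nn_integral_surf:
  assumes "p < n" "B \<in> sets (leb {..<n})" "u \<in> borel_measurable (leb {..<n})"
  shows "(\<integral>\<^sup>+ x. u x \<partial>surf n h p B \<theta>) =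
    (\<integral>\<^sup>+ y. ennreal (gradnorm n h / \<bar>fst h p\<bar>) * indicator B (graph_at n h p \<theta> y) * u (graph_at n h p \<theta> y) \<partial>leb ({..<n} - {p}))"
  unfolding surf_def using assms measurable_graph_at[OF assms(1)]
  by (simp add: nn_integral_density nn_integral_distr)

lemma aff_graph_at:
  assumes "p < n" "fst h p \<noteq> 0"
  shows "aff n h (graph_at n h p \<theta> y) = \<theta>"
proof -
  have "(\<Sum>i<n. fst h i * graph_at n h p \<theta> y i) = fst h p * graph_at n h p \<theta> y p + (\<Sum>i\<in>{..<n} - {p}. fst h i * graph_at n h p \<theta> y i)"
    using assms by (subst sum.remove[of _ p]) auto
  also have "(\<Sum>i\<in>{..<n} - {p}. fst h i * graph_at n h p \<theta> y i) = (\<Sum>i\<in>{..<n} - {p}. fst h i * y i)"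
    by (rule sum.cong) (auto simp: graph_at_def)
  finally show ?thesis using assms by (simp add: graph_at_def)
qed

text \<open>Replacing the coordinate \<open>p\<close> by the level \<open>\<theta>\<close> costs the
  factor \<open>1 / \<bar>fst h p\<bar>\<close>, and the graph has the area element
  \<open>gradnorm n h / \<bar>fst h p\<bar>\<close>; comparing them leaves
  \<open>gradnorm n h\<close>.\<close>

lemma nn_integral_surf_coarea:
  assumes "p < n" "fst h p \<noteq> 0" "B \<in> sets (leb {..<n})" "u \<in> borel_measurable (leb {..<n})"
    and r: "r \<in> borel_measurable borel"
  shows "(\<integral>\<^sup>+ \<theta>. r \<theta> * (\<integral>\<^sup>+ x. u x \<partial>surf n h p B \<theta>) \<partial>lborel) =
    (\<integral>\<^sup>+ x. ennreal (gradnorm n h) * indicator B x * u x * r (aff n h x) \<partial>leb {..<n})"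
proof -
  let ?I = "{..<n} - {p}"
  have ins: "insert p ?I = {..<n}" using assms by auto
  note assms(3,4)[measurable] r[measurable]
  define G where "G x = ennreal (gradnorm n h) * indicator B x * u x * r (aff n h x)" for x
  have affm[measurable]: "aff n h \<in> borel_measurable (leb {..<n})" by measurable
  have G: "G \<in> borel_measurable (leb (insert p ?I))" unfolding ins G_def by measurable
  have sm: "(\<lambda>y. - (snd h + (\<Sum>i\<in>?I. fst h i * y i)) / fst h p) \<in> borel_measurable (leb ?I)" by measurable
  have eq: "y(p := - (snd h + (\<Sum>i\<in>?I. fst h i * y i)) / fst h p + 1 / fst h p * \<theta>) = graph_at n h p \<theta> y" for y \<theta>
  proof -
    have "- (a + S) / q + 1 / q * t = (t - a - S) / q" for a S q t :: real
      by (simp add: diff_divide_distrib add_divide_distrib)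
    then show ?thesis unfolding graph_at_def by (simp only:)
  qed
  have "(\<integral>\<^sup>+ x. G x \<partial>leb {..<n}) = ennreal \<bar>1 / fst h p\<bar> *
      (\<integral>\<^sup>+ \<theta>. \<integral>\<^sup>+ y. G (graph_at n h p \<theta> y) \<partial>leb ?I \<partial>lborel)"
    using nn_integral_shear_scale[OF _ _ _ G sm, of "1 / fst h p"] assms(2) unfolding eq ins by simp
  also have "\<dots> = (\<integral>\<^sup>+ \<theta>. ennreal \<bar>1 / fst h p\<bar> * (\<integral>\<^sup>+ y. G (graph_at n h p \<theta> y) \<partial>leb ?I) \<partial>lborel)"
  proof (rule nn_integral_cmult[symmetric])
    have gm: "(\<lambda>q. (snd q)(p := - (snd h + (\<Sum>i\<in>?I. fst h i * snd q i)) / fst h p + 1 / fst h p * fst q))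
      \<in> measurable (lborel \<Otimes>\<^sub>M leb ?I) (leb (insert p ?I))"
    proof -
      have "(\<lambda>q. (snd q, - (snd h + (\<Sum>i\<in>?I. fst h i * snd q i)) / fst h p + 1 / fst h p * fst q))
        \<in> measurable (lborel \<Otimes>\<^sub>M leb ?I) (leb ?I \<Otimes>\<^sub>M lborel)"
        using measurable_compose[OF measurable_snd sm] by (intro measurable_Pair) measurable
      from measurable_compose[OF this measurable_add_dim] show ?thesis by (simp only: split_def fst_conv snd_conv)
    qed
    from measurable_compose[OF this G]
    have "(\<lambda>(\<theta>, y). G (graph_at n h p \<theta> y)) \<in> borel_measurable (lborel \<Otimes>\<^sub>M leb ?I)"
      unfolding eq by (simp only: split_def)
    then show "(\<lambda>\<theta>. \<integral>\<^sup>+ y. G (graph_at n h p \<theta> y) \<partial>leb ?I) \<in> borel_measurable lborel"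
      by (rule sigma_finite_measure.borel_measurable_nn_integral[OF lborel_PiM.sigma_finite[OF finite_Diff[OF finite_lessThan]]])
  qed
  also have "\<dots> = (\<integral>\<^sup>+ \<theta>. r \<theta> * (\<integral>\<^sup>+ x. u x \<partial>surf n h p B \<theta>) \<partial>lborel)"
  proof (rule nn_integral_cong)
    fix \<theta> :: real
    have [measurable]: "graph_at n h p \<theta> \<in> measurable (leb ?I) (leb {..<n})" by (rule measurable_graph_at[OF assms(1)])
    have "ennreal \<bar>1 / fst h p\<bar> * (\<integral>\<^sup>+ y. G (graph_at n h p \<theta> y) \<partial>leb ?I)
      = (\<integral>\<^sup>+ y. ennreal \<bar>1 / fst h p\<bar> * G (graph_at n h p \<theta> y) \<partial>leb ?I)"
      by (intro nn_integral_cmult[symmetric] measurable_compose[OF measurable_graph_at[OF assms(1)] G[unfolded ins]])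
    also have "\<dots> = (\<integral>\<^sup>+ y. r \<theta> * (ennreal (gradnorm n h / \<bar>fst h p\<bar>) * indicator B (graph_at n h p \<theta> y) * u (graph_at n h p \<theta> y)) \<partial>leb ?I)"
    proof (rule nn_integral_cong)
      fix y
      have "ennreal (gradnorm n h / \<bar>fst h p\<bar>) = ennreal \<bar>1 / fst h p\<bar> * ennreal (gradnorm n h)"
        by (simp add: gradnorm_def sum_nonneg flip: ennreal_mult)
      then show "ennreal \<bar>1 / fst h p\<bar> * G (graph_at n h p \<theta> y) = r \<theta> * (ennreal (gradnorm n h / \<bar>fst h p\<bar>) * indicator B (graph_at n h p \<theta> y) * u (graph_at n h p \<theta> y))"
        unfolding G_def aff_graph_at[OF assms(1,2)] by (simp only: mult_ac)
    qed
    also have "\<dots> = r \<theta> * (\<integral>\<^sup>+ x. u x \<partial>surf n h p B \<theta>)"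
      unfolding nn_integral_surf[OF assms(1,3,4)] by (rule nn_integral_cmult) measurable
    finally show "ennreal \<bar>1 / fst h p\<bar> * (\<integral>\<^sup>+ y. G (graph_at n h p \<theta> y) \<partial>leb ?I) = r \<theta> * (\<integral>\<^sup>+ x. u x \<partial>surf n h p B \<theta>)" .
  qed
  finally show ?thesis unfolding G_def by simp
qed

text \<open>The level set is the \<open>graph_at\<close> image of a compact set in the other
  coordinates. This map fits \<open>linear_graph\<close> with
  \<open>w i = - fst h i / fst h p\<close>, and its area factor \<open>\<kappa>\<close> is the
  density in \<open>surf\<close>.\<close>

lemma hausdorff_measure_surf:
  assumes p: "p < n" "fst h p \<noteq> 0" and B: "closedin (Rn n) B" "B \<subseteq> box_Rn n a b" and X: "closedin (Rn n) X"
  shows "hausdorff_measure n (n - 1) ({x \<in> B. aff n h x = \<theta>} \<inter> X) \<le> emeasure (surf n h p B \<theta>) X"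
proof -
  let ?I = "{..<n} - {p}"
  define w where "w i = - fst h i / fst h p" for i
  define g where "g = graph_at n h p \<theta>"
  have ins: "insert p ?I = {..<n}" using p by auto
  interpret linear_graph n ?I w g
  proof
    fix x y
    have gp: "g x p - g y p = (\<Sum>i\<in>?I. w i * (\<lambda>i\<in>?I. x i - y i) i)"
    proof -
      have "g x p - g y p = ((\<Sum>i\<in>?I. fst h i * y i) - (\<Sum>i\<in>?I. fst h i * x i)) / fst h p"
        by (simp add: g_def graph_at_def diff_divide_distrib)
      also have "\<dots> = (\<Sum>i\<in>?I. (fst h i * y i - fst h i * x i) / fst h p)"
        by (simp add: sum_subtractf sum_divide_distrib diff_divide_distrib)
      also have "\<dots> = (\<Sum>i\<in>?I. w i * (\<lambda>i\<in>?I. x i - y i) i)"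
        using p by (intro sum.cong) (auto simp: w_def field_simps)
      finally show ?thesis .
    qed
    have "(\<Sum>i<n. (g x i - g y i)\<^sup>2) = (g x p - g y p)\<^sup>2 + (\<Sum>i\<in>?I. (g x i - g y i)\<^sup>2)"
      using p by (subst sum.remove[of _ p]) auto
    also have "(\<Sum>i\<in>?I. (g x i - g y i)\<^sup>2) = (\<Sum>i\<in>?I. ((\<lambda>i\<in>?I. x i - y i) i)\<^sup>2)"
      by (rule sum.cong) (auto simp: g_def graph_at_def)
    finally show "dist_Rn n (g x) (g y) = ellnorm w ?I (\<lambda>i\<in>?I. x i - y i)"
      unfolding dist_Rn_def L2_set_def ellnorm_def gp by (simp add: add.commute)
  qed simp
  have card: "card ?I = n - 1" using p by simp
  have cont: "continuous_map (prodtop ?I) (Rn n) g"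
    unfolding continuous_map_componentwise
  proof (intro conjI ballI)
    show "g ` topspace (prodtop ?I) \<subseteq> extensional {..<n}"
      using p by (auto simp: g_def graph_at_def extensional_def PiE_iff)
    fix i assume i: "i \<in> {..<n}"
    show "continuous_map (prodtop ?I) euclideanreal (\<lambda>y. g y i)"
    proof (cases "i = p")
      case True
      have eq: "(\<lambda>y. g y i) = (\<lambda>y. (\<theta> - snd h) / fst h p + (\<Sum>i\<in>?I. w i * y i))"
        using True by (simp add: g_def graph_at_def w_def diff_divide_distrib sum_divide_distrib sum_negf fun_eq_iff)
      show ?thesis unfolding eq
        by (intro continuous_map_add continuous_map_sum continuous_map_real_mult
            continuous_map_product_projection continuous_map_canonical_const) auto
    next
      case False
      then have eq: "(\<lambda>y. g y i) = (\<lambda>y. y i)" by (simp add: g_def graph_at_def)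
      show ?thesis unfolding eq by (rule continuous_map_product_projection) (use False i in simp)
    qed
  qed
  define K where "K = {y \<in> topspace (prodtop ?I). g y \<in> B \<inter> X}"
  have "closedin (prodtop ?I) K" unfolding K_def
    by (rule closedin_continuous_map_preimage[OF cont closedin_Int[OF B(1) X]])
  moreover have "a \<le> y i \<and> y i \<le> b" if "y \<in> K" "i \<in> ?I" for y i
  proof -
    have "g y \<in> box_Rn n a b" using that B(2) by (auto simp: K_def)
    then have "g y i \<in> {a..b}" using that by (auto simp: PiE_iff)
    moreover have "g y i = y i" using that by (auto simp: g_def graph_at_def)
    ultimately show ?thesis by simp
  qed
  ultimately have K: "compactin (prodtop ?I) K" by (rule compactin_prodtop)
  have "{x \<in> B. aff n h x = \<theta>} \<inter> X \<subseteq> g ` K"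
  proof
    fix x assume x: "x \<in> {x \<in> B. aff n h x = \<theta>} \<inter> X"
    then have xE: "x \<in> {..<n} \<rightarrow>\<^sub>E UNIV" using closedin_subset[OF B(1)] by auto
    define y where "y = (\<lambda>i\<in>?I. x i)"
    have "g y = x"
    proof (rule PiE_ext[of _ "{..<n}" "\<lambda>_. UNIV"])
      show "g y \<in> {..<n} \<rightarrow>\<^sub>E UNIV" using p by (auto simp: g_def graph_at_def y_def PiE_iff extensional_def)
      fix i assume i: "i \<in> {..<n}"
      have "fst h p * x p + (\<Sum>i\<in>?I. fst h i * x i) = \<theta> - snd h"
        using x p sum.remove[of "{..<n}" p "\<lambda>i. fst h i * x i"] by auto
      then have "(\<theta> - snd h - (\<Sum>i\<in>?I. fst h i * y i)) / fst h p = x p"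
        using p by (simp add: y_def field_simps)
      then show "g y i = x i" using i by (auto simp: g_def graph_at_def y_def)
    qed (rule xE)
    moreover have "y \<in> ?I \<rightarrow>\<^sub>E UNIV" by (simp add: y_def)
    ultimately show "x \<in> g ` K" using x by (intro image_eqI[of _ _ y]) (auto simp: K_def)
  qed
  then have "hausdorff_measure n (n - 1) ({x \<in> B. aff n h x = \<theta>} \<inter> X) \<le> hausdorff_measure n (card ?I) (g ` K)"
    unfolding card by (rule hausdorff_measure_mono)
  also have "\<dots> \<le> ennreal (sqrt (1 + (\<Sum>i\<in>?I. (w i)\<^sup>2))) * emeasure (leb ?I) K"
    by (rule hausdorff_measure_graph_le[OF K])
  also have "sqrt (1 + (\<Sum>i\<in>?I. (w i)\<^sup>2)) = gradnorm n h / \<bar>fst h p\<bar>"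
  proof -
    have "(\<Sum>i<n. (fst h i)\<^sup>2) = (fst h p)\<^sup>2 + (\<Sum>i\<in>?I. (fst h i)\<^sup>2)"
      using p by (subst sum.remove[of _ p]) auto
    then have "1 + (\<Sum>i\<in>?I. (w i)\<^sup>2) = (\<Sum>i<n. (fst h i)\<^sup>2) / (fst h p)\<^sup>2"
      using p by (simp add: w_def power_divide add_divide_distrib flip: sum_divide_distrib)
    then show ?thesis by (simp add: gradnorm_def real_sqrt_divide)
  qed
  also have "ennreal (gradnorm n h / \<bar>fst h p\<bar>) * emeasure (leb ?I) K = emeasure (surf n h p B \<theta>) X"
  proof -
    have Bm: "B \<in> sets (leb {..<n})" and Xm: "X \<in> sets (leb {..<n})"
      using B(1) X by (auto intro: closedin_prodtop_imp_measurable)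
    have Km: "K \<in> sets (leb ?I)"
      using compactin_prodtop_imp_closedin[OF K] by (intro closedin_prodtop_imp_measurable) auto
    have "emeasure (surf n h p B \<theta>) X = (\<integral>\<^sup>+ x. indicator X x \<partial>surf n h p B \<theta>)" using Xm by simp
    also have "\<dots> = (\<integral>\<^sup>+ y. ennreal (gradnorm n h / \<bar>fst h p\<bar>) * indicator B (g y) * indicator X (g y) \<partial>leb ?I)"
      unfolding g_def using Bm Xm p by (intro nn_integral_surf) auto
    also have "\<dots> = (\<integral>\<^sup>+ y. ennreal (gradnorm n h / \<bar>fst h p\<bar>) * indicator K y \<partial>leb ?I)"
      by (intro nn_integral_cong) (auto simp: K_def space_leb indicator_def)
    also have "\<dots> = ennreal (gradnorm n h / \<bar>fst h p\<bar>) * emeasure (leb ?I) K"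
      using Km by (simp add: nn_integral_cmult)
    finally show ?thesis by simp
  qed
  finally show ?thesis .
qed

text \<open>Finiteness makes Fubini's theorem available for these measures in
  \<open>average_weight\<close>.\<close>

lemma finite_measure_surf:
  assumes p: "p < n" "fst h p \<noteq> 0" and B: "B \<in> sets (leb {..<n})" "B \<subseteq> box_Rn n a b"
  shows "finite_measure (surf n h p B \<theta>)"
proof (rule finite_measureI)
  let ?I = "{..<n} - {p}"
  have "emeasure (surf n h p B \<theta>) (space (surf n h p B \<theta>)) = (\<integral>\<^sup>+ x. 1 \<partial>surf n h p B \<theta>)" by simp
  also have "\<dots> = (\<integral>\<^sup>+ y. ennreal (gradnorm n h / \<bar>fst h p\<bar>) * indicator B (graph_at n h p \<theta> y) * 1 \<partial>leb ?I)"
    using p B by (intro nn_integral_surf) auto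
  also have "\<dots> \<le> (\<integral>\<^sup>+ y. ennreal (gradnorm n h / \<bar>fst h p\<bar>) * indicator (?I \<rightarrow>\<^sub>E {a..b}) y \<partial>leb ?I)"
  proof (rule nn_integral_mono)
    fix y assume y: "y \<in> space (leb ?I)"
    show "ennreal (gradnorm n h / \<bar>fst h p\<bar>) * indicator B (graph_at n h p \<theta> y) * 1 \<le> ennreal (gradnorm n h / \<bar>fst h p\<bar>) * indicator (?I \<rightarrow>\<^sub>E {a..b}) y"
    proof (cases "graph_at n h p \<theta> y \<in> B")
      case True
      then have in_box: "graph_at n h p \<theta> y \<in> box_Rn n a b" using B by blast
      have "y \<in> ?I \<rightarrow>\<^sub>E {a..b}"
      proof
        fix i assume i: "i \<in> ?I"
        then have "graph_at n h p \<theta> y i \<in> {a..b}" using in_box by (auto simp: PiE_iff)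
        then show "y i \<in> {a..b}" using i by (simp add: graph_at_def)
      qed (use y in \<open>auto simp: space_leb PiE_iff extensional_def\<close>)
      then show ?thesis by (simp add: indicator_def)
    qed simp
  qed
  also have "\<dots> = ennreal (gradnorm n h / \<bar>fst h p\<bar>) * emeasure (leb ?I) (?I \<rightarrow>\<^sub>E {a..b})"
    by (simp add: nn_integral_cmult sets_PiM_I_finite)
  also have "\<dots> < top"
    by (simp add: lborel_PiM.emeasure_PiM less_top[symmetric] emeasure_lborel_Icc_eq ennreal_mult_eq_top_iff power_eq_top_ennreal)
  finally show "emeasure (surf n h p B \<theta>) (space (surf n h p B \<theta>)) \<noteq> \<infinity>" by simp
qed

section \<open>Periodic piecewise linear potentials\<close>

text \<open>Linear interpolation of the table \<open>c\<close> on the grid of mesh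
  \<open>1 / N\<close>.\<close>

definition pl :: "nat \<Rightarrow> (int \<Rightarrow> real) \<Rightarrow> real \<Rightarrow> real" where
  "pl N c y = c \<lfloor>real N * y\<rfloor> + (real N * y - \<lfloor>real N * y\<rfloor>) * (c (\<lfloor>real N * y\<rfloor> + 1) - c \<lfloor>real N * y\<rfloor>)"

text \<open>For \<open>N > 0\<close> the right-hand derivative of \<open>pl\<close>.\<close>

definition plslope :: "nat \<Rightarrow> (int \<Rightarrow> real) \<Rightarrow> real \<Rightarrow> real" where
  "plslope N c y = real N * (c (\<lfloor>real N * y\<rfloor> + 1) - c \<lfloor>real N * y\<rfloor>)"

text \<open>At a grid point the formulas of both adjacent intervals agree. This permits closed
  intervals here and closed cells later.\<close>

lemma pl_on:
  assumes "real_of_int i \<le> real N * y" "real N * y \<le> real_of_int i + 1"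
  shows "pl N c y = c i + (real N * y - i) * (c (i + 1) - c i)"
proof (cases "real N * y = real_of_int i + 1")
  case True
  then have "\<lfloor>real N * y\<rfloor> = i + 1" by (simp add: floor_eq_iff)
  then show ?thesis using True by (simp add: pl_def)
next
  case False
  then have "\<lfloor>real N * y\<rfloor> = i" using assms by (simp add: floor_eq_iff)
  then show ?thesis by (simp add: pl_def)
qed

lemma pl_at: "real N * y = real_of_int i \<Longrightarrow> pl N c y = c i"
  using pl_on[of i N y c] by simp

lemma isCont_pl: "isCont (pl N c) y"
proof -
  define i where "i = \<lfloor>real N * y\<rfloor>"
  \<comment> \<open>One visibly continuous formula for both grid intervals that meet at
    \<open>i\<close>.\<close>
  define g where "g x = c i + max 0 (real N * x - i) * (c (i + 1) - c i) + min 0 (real N * x - i) * (c i - c (i - 1))" for x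
  let ?U = "{x. real N * x \<in> {of_int i - 1<..<of_int i + 1}}"
  have eq: "pl N c x = g x" if "x \<in> ?U" for x
  proof (cases "real N * x \<ge> i")
    case True
    then show ?thesis using that pl_on[of i N x c] by (simp add: g_def)
  next
    case False
    then show ?thesis using that pl_on[of "i - 1" N x c] by (simp add: g_def algebra_simps)
  qed
  have "open ?U"
    unfolding Collect_conj_eq greaterThanLessThan_iff
    by (intro open_Int open_Collect_less continuous_intros)
  moreover have "y \<in> ?U" unfolding i_def by (simp add: floor_less_iff) linarith
  ultimately have "\<forall>\<^sub>F x in nhds y. x \<in> ?U" by (rule eventually_nhds_in_open)
  then have "\<forall>\<^sub>F x in nhds y. pl N c x = g x" by (rule eventually_mono) (rule eq)
  moreover have "isCont g y" unfolding g_def by (intro continuous_intros)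
  ultimately show ?thesis by (simp add: isCont_cong)
qed

lemma continuous_on_pl: "continuous_on UNIV (pl N c)"
  using isCont_pl by (simp add: continuous_at_imp_continuous_on)

lemma measurable_pl [measurable]: "pl N c \<in> borel_measurable borel"
  by (rule borel_measurable_continuous_onI[OF continuous_on_pl])

lemma measurable_plslope [measurable]: "plslope N c \<in> borel_measurable borel"
proof -
  have "(\<lambda>y. \<lfloor>real N * y\<rfloor>) \<in> measurable borel (count_space UNIV)" by measurable
  from measurable_compose[OF this, of "\<lambda>i. real N * (c (i + 1) - c i)" borel]
  show ?thesis by (simp add: plslope_def[abs_def])
qed

lemma pl_nonneg:
  assumes "\<And>i. c i \<ge> 0"
  shows "pl N c y \<ge> 0"
proof -
  define i where "i = \<lfloor>real N * y\<rfloor>"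
  define r where "r = real N * y - i"
  have r: "0 \<le> r" "r \<le> 1" unfolding r_def i_def by linarith+
  have "pl N c y = (1 - r) * c i + r * c (i + 1)" by (simp add: pl_def i_def r_def algebra_simps)
  then show ?thesis using r assms by simp
qed

definition pot :: "nat \<Rightarrow> nat \<Rightarrow> (int \<Rightarrow> real) \<Rightarrow> (nat \<Rightarrow> real) \<Rightarrow> real" where
  "pot n N c x = (\<Sum>i<n. pl N c (x i))"

definition potgrad :: "nat \<Rightarrow> nat \<Rightarrow> (int \<Rightarrow> real) \<Rightarrow> (nat \<Rightarrow> real) \<Rightarrow> real" where
  "potgrad n N c x = sqrt (\<Sum>i<n. (plslope N c (x i))\<^sup>2)"

lemma continuous_map_pot: "continuous_map (Rn n) euclideanreal (pot n N c)"
proof -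
  have "continuous_map euclideanreal euclideanreal (pl N c)"
    using continuous_on_pl by (simp add: continuous_map_iff_continuous2)
  then have "continuous_map (Rn n) euclideanreal (\<lambda>x. pl N c (x i))" if "i \<in> {..<n}" for i
    by (rule continuous_map_compose[OF continuous_map_product_projection[OF that], unfolded o_def])
  then show ?thesis unfolding pot_def[abs_def] by (intro continuous_map_sum) auto
qed

lemma measurable_pot [measurable]: "pot n N c \<in> borel_measurable (leb {..<n})"
  unfolding pot_def[abs_def]
  by (intro borel_measurable_sum measurable_compose[OF measurable_eval_leb measurable_pl])

lemma measurable_potgrad [measurable]: "potgrad n N c \<in> borel_measurable (leb {..<n})"
proof -
  have "(\<lambda>x. \<Sum>i<n. (plslope N c (x i))\<^sup>2) \<in> borel_measurable (leb {..<n})"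
    by (intro borel_measurable_sum borel_measurable_power measurable_compose[OF measurable_eval_leb measurable_plslope])
  then show ?thesis unfolding potgrad_def[abs_def] by measurable
qed

lemma openin_pot_less: "openin (Rn n) {x \<in> {..<n} \<rightarrow>\<^sub>E UNIV. pot n N c x < \<theta>}"
  using openin_continuous_map_preimage[OF continuous_map_pot, of "{..<\<theta>}"] by simp

lemma openin_pot_greater: "openin (Rn n) {x \<in> {..<n} \<rightarrow>\<^sub>E UNIV. pot n N c x > \<theta>}"
  using openin_continuous_map_preimage[OF continuous_map_pot, of "{\<theta><..}"] by simp

lemma closedin_pot_ge: "closedin (Rn n) {x \<in> {..<n} \<rightarrow>\<^sub>E UNIV. pot n N c x \<ge> \<theta>}"
  using closedin_continuous_map_preimage[OF continuous_map_pot, of "{\<theta>..}"] by simp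

lemma closedin_pot_le: "closedin (Rn n) {x \<in> {..<n} \<rightarrow>\<^sub>E UNIV. pot n N c x \<le> \<theta>}"
  using closedin_continuous_map_preimage[OF continuous_map_pot, of "{..\<theta>}"] by simp

lemma pot_permute: "\<pi> permutes {..<n} \<Longrightarrow> pot n N c (x \<circ> \<pi>) = pot n N c x"
  unfolding pot_def using sum.permute[of \<pi> "{..<n}" "\<lambda>i. pl N c (x i)"] by (simp add: o_def)

section \<open>Grid cells, on which the potential is affine\<close>

definition cell :: "nat \<Rightarrow> nat \<Rightarrow> (nat \<Rightarrow> int) \<Rightarrow> (nat \<Rightarrow> real) set" where
  "cell n N k = {x \<in> {..<n} \<rightarrow>\<^sub>E UNIV. \<forall>i<n. real_of_int (k i) \<le> real N * x i \<and> real N * x i \<le> real_of_int (k i) + 1}"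

definition cellaff :: "nat \<Rightarrow> nat \<Rightarrow> (int \<Rightarrow> real) \<Rightarrow> (nat \<Rightarrow> int) \<Rightarrow> (nat \<Rightarrow> real) \<times> real" where
  "cellaff n N c k = ((\<lambda>i. real N * (c (k i + 1) - c (k i))), (\<Sum>i<n. c (k i) - k i * (c (k i + 1) - c (k i))))"

lemma pot_on_cell:
  assumes "x \<in> cell n N k"
  shows "pot n N c x = aff n (cellaff n N c k) x"
proof -
  have "pot n N c x = (\<Sum>i<n. c (k i) + (real N * x i - k i) * (c (k i + 1) - c (k i)))"
    unfolding pot_def using assms by (intro sum.cong pl_on) (auto simp: cell_def)
  also have "\<dots> = (\<Sum>i<n. c (k i) - k i * (c (k i + 1) - c (k i)) + fst (cellaff n N c k) i * x i)"
    by (intro sum.cong) (auto simp: cellaff_def algebra_simps)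
  finally show ?thesis by (simp add: cellaff_def sum.distrib)
qed

lemma potgrad_in_cell:
  assumes "x \<in> {..<n} \<rightarrow>\<^sub>E UNIV" "\<And>i. i < n \<Longrightarrow> \<lfloor>real N * x i\<rfloor> = k i"
  shows "potgrad n N c x = gradnorm n (cellaff n N c k)"
  unfolding potgrad_def gradnorm_def plslope_def cellaff_def using assms by simp

lemma closedin_cell: "closedin (Rn n) (cell n N k)"
proof -
  have "cell n N k = (\<Pi>\<^sub>E i\<in>{..<n}. {y. real_of_int (k i) \<le> real N * y \<and> real N * y \<le> real_of_int (k i) + 1})"
    by (rule set_eqI) (simp only: cell_def PiE_iff mem_Collect_eq lessThan_iff Ball_def UNIV_I simp_thms conj_commute)
  also have "closedin (Rn n) \<dots>"
  proof -
    have "closed {y. real_of_int a \<le> real N * y \<and> real N * y \<le> real_of_int a + 1}" for a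
      unfolding Collect_conj_eq by (intro closed_Int closed_Collect_le continuous_intros)
    then show ?thesis by (simp add: closedin_product_topology)
  qed
  finally show ?thesis .
qed

definition cells :: "nat \<Rightarrow> nat \<Rightarrow> (nat \<Rightarrow> int) set" where
  "cells n N = {..<n} \<rightarrow>\<^sub>E {0..<2 * int N}"

lemma finite_cells: "finite (cells n N)"
  unfolding cells_def by (intro finite_PiE) auto

lemma box_cells:
  assumes "N > 0" "x \<in> box_Rn n 0 2"
  shows "\<exists>k\<in>cells n N. x \<in> cell n N k"
proof -
  \<comment> \<open>The minimum takes care of the coordinate \<open>2\<close>, whose floor would
    give the index \<open>2 * N\<close> outside \<open>cells\<close>.\<close>
  define k where "k = (\<lambda>i\<in>{..<n}. min \<lfloor>real N * x i\<rfloor> (2 * int N - 1))"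
  have x: "0 \<le> x i" "x i \<le> 2" if "i < n" for i using assms(2) that by (auto simp: PiE_iff)
  have Nx: "0 \<le> real N * x i" "real N * x i \<le> real N * 2" if "i < n" for i
    using x[OF that] by (auto intro: mult_left_mono)
  have "k \<in> cells n N" unfolding cells_def
  proof
    fix i assume i: "i \<in> {..<n}"
    have "0 \<le> \<lfloor>real N * x i\<rfloor>" using Nx(1)[of i] i by simp
    then show "k i \<in> {0..<2 * int N}" using assms(1) i by (auto simp: k_def)
  qed (simp add: k_def)
  moreover have "x \<in> cell n N k" unfolding cell_def
  proof (intro CollectI conjI allI impI)
    show "x \<in> {..<n} \<rightarrow>\<^sub>E UNIV" using assms(2) by (auto simp: PiE_iff)
    fix i assume i: "i < n"
    show "real_of_int (k i) \<le> real N * x i" using i by (simp add: k_def min_def) linarith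
    show "real N * x i \<le> real_of_int (k i) + 1"
    proof (cases "\<lfloor>real N * x i\<rfloor> \<le> 2 * int N - 1")
      case True
      then show ?thesis using i by (simp add: k_def min_def)
    next
      case False
      then have "k i = 2 * int N - 1" using i by (simp add: k_def)
      then show ?thesis using Nx(2)[OF i] by simp
    qed
  qed
  ultimately show ?thesis by blast
qed

text \<open>By \<open>c_flat\<close> a profile is constant only at height 0, so a positive level
  never fills a cell and lies in proper hyperplanes. By \<open>c_descend\<close> no grid point is a
  positive local minimum, so a positive level is a limit of lower points. \<open>T\<close> is the
  grid index of the peak.\<close>

locale profile =
  fixes N :: nat and c :: "int \<Rightarrow> real" and B :: real and T :: int
  assumes N_pos: "N > 0"
    and c_periodic: "\<And>i. c (i + int N) = c i"
    and c_nonneg: "\<And>i. c i \<ge> 0"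
    and c_flat: "\<And>i. c i = c (i + 1) \<Longrightarrow> c i = 0"
    and c_descend: "\<And>i. c i > 0 \<Longrightarrow> c (i + 1) < c i \<or> c (i - 1) < c i"
    and c_peak: "c T = B" and T: "0 \<le> T" "T \<le> int N"
begin

abbreviation "t \<equiv> real_of_int T / real N"

lemma t: "0 \<le> t" "t \<le> 1"
  using T N_pos by (auto simp: divide_le_eq)

lemma c_periodic_mult: "c (i + int N * z) = c i"
proof (induction z rule: int_induct[of _ 0])
  case (step1 z)
  then show ?case using c_periodic[of "i + int N * z"] by (simp add: algebra_simps)
next
  case (step2 z)
  then show ?case using c_periodic[of "i + int N * (z - 1)"] by (simp add: algebra_simps)
qed simp

lemma floor_shift: "\<lfloor>real N * (y + of_int z)\<rfloor> = \<lfloor>real N * y\<rfloor> + int N * z"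
proof -
  have "real N * (y + of_int z) = real N * y + of_int (int N * z)" by (simp add: algebra_simps)
  then show ?thesis by (simp only: floor_add_int)
qed

lemma pl_periodic: "pl N c (y + of_int z) = pl N c y"
proof -
  have "c (\<lfloor>real N * y\<rfloor> + int N * z + 1) = c (\<lfloor>real N * y\<rfloor> + 1)"
    using c_periodic_mult[of "\<lfloor>real N * y\<rfloor> + 1" z] by (simp add: algebra_simps)
  then show ?thesis unfolding pl_def floor_shift c_periodic_mult by (simp add: algebra_simps)
qed

lemma plslope_periodic: "plslope N c (y + of_int z) = plslope N c y"
proof -
  have "c (\<lfloor>real N * y\<rfloor> + int N * z + 1) = c (\<lfloor>real N * y\<rfloor> + 1)"
    using c_periodic_mult[of "\<lfloor>real N * y\<rfloor> + 1" z] by (simp add: algebra_simps)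
  then show ?thesis unfolding plslope_def floor_shift c_periodic_mult by simp
qed

lemma pl_peak: "pl N c (t + of_int z) = B"
proof -
  have "pl N c t = c T" using N_pos by (intro pl_at) simp
  then show ?thesis using c_peak by (simp add: pl_periodic)
qed

text \<open>Inside a grid interval a positive value forces a nonzero slope by \<open>c_flat\<close>;
  at a grid point \<open>c_descend\<close> names the interval in which to go down.\<close>

lemma pl_decrease:
  assumes "pl N c y > 0" "e > 0"
  shows "\<exists>y'. \<bar>y' - y\<bar> < e \<and> pl N c y' < pl N c y"
proof -
  have lin: "\<exists>y'. \<bar>y' - y\<bar> < e \<and> pl N c y' < pl N c y"
    if "of_int i < real N * y \<and> c i < c (i + 1) \<or> real N * y < of_int i + 1 \<and> c (i + 1) < c i"
      "of_int i \<le> real N * y" "real N * y \<le> of_int i + 1" for i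
  proof -
    \<comment> \<open>At most half of \<open>e\<close>, cut off so as to stay in the grid interval,
      with the sign that leads downhill.\<close>
    define s where "s = (if c i < c (i + 1) then - min (e / 2) ((real N * y - i) / real N) else min (e / 2) ((i + 1 - real N * y) / real N))"
    have s: "\<bar>s\<bar> < e" "s * (c (i + 1) - c i) < 0" "of_int i \<le> real N * (y + s)" "real N * (y + s) \<le> of_int i + 1"
    proof -
      have "\<bar>s\<bar> < e \<and> s * (c (i + 1) - c i) < 0 \<and> of_int i \<le> real N * (y + s) \<and> real N * (y + s) \<le> of_int i + 1"
      proof (cases "c i < c (i + 1)")
        case True
        then have gt: "of_int i < real N * y" using that(1) by auto
        define m where "m = min (e / 2) ((real N * y - i) / real N)"
        have m: "0 < m" "m < e" "m \<le> (real N * y - i) / real N" using gt assms(2) N_pos by (auto simp: m_def)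
        then have "real N * m \<le> real N * y - i" using N_pos by (simp add: pos_le_divide_eq mult.commute)
        moreover have "0 < real N * m" using m N_pos by simp
        moreover have "s = - m" using True by (simp add: s_def m_def)
        ultimately show ?thesis using m True that(3)
          by (auto simp: algebra_simps mult_less_cancel_right)
      next
        case False
        then have gt: "real N * y < of_int i + 1" "c (i + 1) < c i" using that(1) by auto
        define m where "m = min (e / 2) ((i + 1 - real N * y) / real N)"
        have m: "0 < m" "m < e" "m \<le> (i + 1 - real N * y) / real N" using gt assms(2) N_pos by (auto simp: m_def)
        then have "real N * m \<le> i + 1 - real N * y" using N_pos by (simp add: pos_le_divide_eq mult.commute)
        moreover have "0 < real N * m" using m N_pos by simp
        moreover have "s = m" using False by (simp add: s_def m_def)
        ultimately show ?thesis using m gt that(2)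
          by (auto simp: algebra_simps mult_less_cancel_right)
      qed
      then show "\<bar>s\<bar> < e" "s * (c (i + 1) - c i) < 0" "of_int i \<le> real N * (y + s)" "real N * (y + s) \<le> of_int i + 1" by auto
    qed
    have "pl N c (y + s) = pl N c y + real N * (s * (c (i + 1) - c i))"
      unfolding pl_on[OF s(3,4)] pl_on[OF that(2,3)] by (simp add: algebra_simps)
    also have "\<dots> < pl N c y" using s(2) N_pos by (simp add: mult_pos_neg)
    finally show ?thesis using s(1) by (intro exI[of _ "y + s"]) simp
  qed
  define i where "i = \<lfloor>real N * y\<rfloor>"
  have i: "of_int i \<le> real N * y" "real N * y < of_int i + 1" unfolding i_def by linarith+
  show ?thesis
  proof (cases "real N * y = of_int i")
    case True
    then have "c i > 0" using assms(1) pl_at[OF True] by simp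
    from c_descend[OF this] show ?thesis
    proof
      assume "c (i + 1) < c i"
      then show ?thesis using lin[of i] i by auto
    next
      assume "c (i - 1) < c i"
      then show ?thesis using lin[of "i - 1"] True by auto
    qed
  next
    case False
    have "c i \<noteq> c (i + 1)"
    proof
      assume eq: "c i = c (i + 1)"
      then have "c i = 0" by (rule c_flat)
      then show False using assms(1) eq pl_on[of i N y c] i by simp
    qed
    then have "of_int i < real N * y \<and> c i < c (i + 1) \<or> real N * y < of_int i + 1 \<and> c (i + 1) < c i"
      using i False by linarith
    then show ?thesis using i by (intro lin[of i]) auto
  qed
qed

lemma pot_nonneg: "pot n N c x \<ge> 0"
  unfolding pot_def by (intro sum_nonneg pl_nonneg c_nonneg)

lemma pot_periodic: "periodic_Rn n (pot n N c)"
  unfolding periodic_Rn_def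
proof (intro ballI)
  fix z x assume z: "z \<in> {..<n} \<rightarrow>\<^sub>E (\<int> :: real set)"
  have "pl N c (tr n z x i) = pl N c (x i)" if i: "i < n" for i
  proof -
    obtain m where "z i = of_int m" using PiE_mem[OF z] i by (auto elim: Ints_cases)
    then show ?thesis using i pl_periodic[of "x i" m] by (simp add: tr_def)
  qed
  then show "pot n N c (tr n z x) = pot n N c x" unfolding pot_def by (intro sum.cong) auto
qed

lemma potgrad_periodic: "periodic_Rn n (potgrad n N c)"
  unfolding periodic_Rn_def
proof (intro ballI)
  fix z x assume z: "z \<in> {..<n} \<rightarrow>\<^sub>E (\<int> :: real set)"
  have "plslope N c (tr n z x i) = plslope N c (x i)" if i: "i < n" for i
  proof -
    obtain m where "z i = of_int m" using PiE_mem[OF z] i by (auto elim: Ints_cases)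
    then show ?thesis using i plslope_periodic[of "x i" m] by (simp add: tr_def)
  qed
  then show "potgrad n N c (tr n z x) = potgrad n N c x" unfolding potgrad_def by simp
qed

lemma pot_peak:
  assumes "i < n" "x i = t + of_int z"
  shows "pot n N c x \<ge> B"
proof -
  have "B = pl N c (x i)" using pl_peak assms(2) by simp
  also have "\<dots> \<le> pot n N c x" unfolding pot_def
    using assms(1) by (intro member_le_sum) (auto intro: pl_nonneg c_nonneg)
  finally show ?thesis .
qed

lemma pot_decrease:
  assumes "x \<in> {..<n} \<rightarrow>\<^sub>E UNIV" "pot n N c x > 0" "e > 0"
  shows "\<exists>y\<in>{..<n} \<rightarrow>\<^sub>E UNIV. (\<forall>i\<in>{..<n}. \<bar>y i - x i\<bar> < e) \<and> pot n N c y < pot n N c x"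
proof -
  have "\<exists>i<n. pl N c (x i) > 0"
  proof (rule ccontr)
    assume "\<not> ?thesis"
    then have "pl N c (x i) \<le> 0" if "i < n" for i using that not_less by blast
    then have "pot n N c x \<le> 0" unfolding pot_def by (intro sum_nonpos) simp
    then show False using assms(2) by simp
  qed
  then obtain i where i: "i < n" "pl N c (x i) > 0" by blast
  obtain y' where y': "\<bar>y' - x i\<bar> < e" "pl N c y' < pl N c (x i)" using pl_decrease[OF i(2) assms(3)] by blast
  have "(\<Sum>j<n. pl N c ((x(i := y')) j)) = pl N c y' + (\<Sum>j\<in>{..<n} - {i}. pl N c ((x(i := y')) j))"
    using i by (subst sum.remove[of _ i]) auto
  also have "(\<Sum>j\<in>{..<n} - {i}. pl N c ((x(i := y')) j)) = (\<Sum>j\<in>{..<n} - {i}. pl N c (x j))"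
    by (rule sum.cong) auto
  also have "pl N c y' + \<dots> < pl N c (x i) + \<dots>" using y'(2) by simp
  also have "\<dots> = pot n N c x" unfolding pot_def using i by (subst (2) sum.remove[of _ i]) auto
  finally have "pot n N c (x(i := y')) < pot n N c x" unfolding pot_def .
  moreover have "x(i := y') \<in> {..<n} \<rightarrow>\<^sub>E UNIV" using assms(1) i by (auto simp: PiE_iff extensional_def)
  moreover have "\<forall>j\<in>{..<n}. \<bar>(x(i := y')) j - x j\<bar> < e" using y'(1) assms(3) by simp
  ultimately show ?thesis by blast
qed

text \<open>Zero slopes force zero values by \<open>c_flat\<close>. Hence every cell that meets a
  positive level has a nonconstant potential.\<close>

lemma cell_flat:
  assumes "x \<in> cell n N k" "\<And>i. i < n \<Longrightarrow> fst (cellaff n N c k) i = 0"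
  shows "pot n N c x = 0"
proof -
  have "c (k i + 1) = c (k i)" if "i < n" for i using assms(2)[OF that] N_pos by (simp add: cellaff_def)
  then have c0: "c (k i) = 0 \<and> c (k i + 1) = 0" if "i < n" for i using c_flat[of "k i"] that by simp
  have "pl N c (x i) = 0" if i: "i < n" for i
    using pl_on[of "k i" N "x i" c] c0[OF i] assms(1) i by (simp add: cell_def)
  then show ?thesis by (simp add: pot_def)
qed

end

section \<open>Inserting a level set into a tiling body\<close>

lemma continuous_map_tr: "continuous_map (Rn n) (Rn n) (tr n z)"
  unfolding continuous_map_componentwise
proof (intro conjI ballI)
  show "tr n z ` topspace (Rn n) \<subseteq> extensional {..<n}" by (auto simp: tr_def)
  fix i assume i: "i \<in> {..<n}"
  have "continuous_map (Rn n) euclideanreal (\<lambda>x. x i + z i)"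
    using i by (intro continuous_map_add continuous_map_product_projection continuous_map_canonical_const) auto
  then show "continuous_map (Rn n) euclideanreal (\<lambda>x. tr n z x i)" using i by (simp add: tr_def)
qed

lemma homeomorphic_map_tr: "homeomorphic_map (Rn n) (Rn n) (tr n z)"
proof -
  have "homeomorphic_maps (Rn n) (Rn n) (tr n z) (tr n (\<lambda>i\<in>{..<n}. - z i))"
    unfolding homeomorphic_maps_def using continuous_map_tr tr_neg_tr tr_tr_neg by simp
  then show ?thesis by (rule homeomorphic_maps_imp_map)
qed

text \<open>A nonempty open set inside both closures meets \<open>U\<close>, and its open
  intersection with \<open>U\<close> then meets \<open>V\<close>.\<close>

lemma disjoint_open_interior_closure:
  assumes "openin X U" "openin X V" "U \<inter> V = {}"
  shows "X interior_of (X closure_of U) \<inter> X interior_of (X closure_of V) = {}" (is "?W = {}")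
proof (rule ccontr)
  assume ne: "?W \<noteq> {}"
  have W: "openin X ?W" by (intro openin_Int openin_interior_of)
  have "?W \<subseteq> X closure_of U" "?W \<subseteq> X closure_of V"
    using interior_of_subset[of X "X closure_of U"] interior_of_subset[of X "X closure_of V"] by auto
  then have "U \<inter> ?W \<noteq> {}"
    using ne openin_Int_closure_of_eq_empty[OF W, of U] by auto
  moreover have "openin X (U \<inter> ?W)" using assms(1) W by (rule openin_Int)
  ultimately have "V \<inter> (U \<inter> ?W) \<noteq> {}"
    using openin_Int_closure_of_eq_empty[of X "U \<inter> ?W" V] \<open>?W \<subseteq> X closure_of V\<close> by auto
  then show False using assms(3) by auto
qed

text \<open>One implication is enough because permutations are invertible, and it passes easily to
  interiors and closures.\<close>

definition perm_closed :: "nat \<Rightarrow> (nat \<Rightarrow> real) set \<Rightarrow> bool" where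
  "perm_closed n S \<longleftrightarrow> (\<forall>\<pi>. \<pi> permutes {..<n} \<longrightarrow> (\<forall>x\<in>S. x \<circ> \<pi> \<in> S))"

lemma perm_symmetric_iff:
  assumes "S \<subseteq> {..<n} \<rightarrow>\<^sub>E UNIV"
  shows "perm_symmetric n S \<longleftrightarrow> perm_closed n S"
proof
  assume "perm_symmetric n S"
  then show "perm_closed n S" using assms unfolding perm_symmetric_def perm_closed_def by auto
next
  assume c: "perm_closed n S"
  have "x \<in> S" if \<pi>: "\<pi> permutes {..<n}" and x: "x \<circ> \<pi> \<in> S" for \<pi> x
  proof -
    have "(x \<circ> \<pi>) \<circ> inv \<pi> \<in> S" using c permutes_inv[OF \<pi>] x unfolding perm_closed_def by blast
    moreover have "(x \<circ> \<pi>) \<circ> inv \<pi> = x" using permutes_inv_o(1)[OF \<pi>] by (simp add: comp_assoc)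
    ultimately show ?thesis by simp
  qed
  then show "perm_symmetric n S" using c unfolding perm_symmetric_def perm_closed_def by blast
qed

lemma permute_in: "\<pi> permutes {..<n} \<Longrightarrow> x \<in> {..<n} \<rightarrow>\<^sub>E A \<Longrightarrow> x \<circ> \<pi> \<in> {..<n} \<rightarrow>\<^sub>E A"
  using permutes_in_image[of \<pi> "{..<n}"] permutes_not_in[of \<pi> "{..<n}"]
  by (auto simp: PiE_iff extensional_def)

lemma permute_near:
  assumes "\<pi> permutes {..<n}" "\<forall>i\<in>{..<n}. \<bar>y i - x i\<bar> < e"
  shows "\<forall>i\<in>{..<n}. \<bar>(y \<circ> \<pi>) i - (x \<circ> \<pi>) i\<bar> < e"
  using assms permutes_in_image[OF assms(1)] by auto

lemma perm_closed_interior: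
  assumes "perm_closed n S"
  shows "perm_closed n (Rn n interior_of S)"
  unfolding perm_closed_def
proof (intro allI impI ballI)
  fix \<pi> x assume \<pi>: "\<pi> permutes {..<n}" and x: "x \<in> Rn n interior_of S"
  obtain e where e: "e > 0" "\<forall>y\<in>{..<n} \<rightarrow>\<^sub>E UNIV. (\<forall>i\<in>{..<n}. \<bar>y i - x i\<bar> < e) \<longrightarrow> y \<in> S" and xE: "x \<in> {..<n} \<rightarrow>\<^sub>E UNIV"
    using x unfolding in_interior_of_prodtop[OF finite_lessThan] by blast
  have inv: "inv \<pi> permutes {..<n}" using \<pi> by (rule permutes_inv)
  have id: "u \<circ> \<pi> \<circ> inv \<pi> = u" "u \<circ> inv \<pi> \<circ> \<pi> = u" for u :: "nat \<Rightarrow> real"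
    using permutes_inv_o[OF \<pi>] by (simp_all add: comp_assoc)
  have "y \<in> S" if y: "y \<in> {..<n} \<rightarrow>\<^sub>E UNIV" "\<forall>i\<in>{..<n}. \<bar>y i - (x \<circ> \<pi>) i\<bar> < e" for y
  proof -
    have "\<forall>i\<in>{..<n}. \<bar>(y \<circ> inv \<pi>) i - x i\<bar> < e" using permute_near[OF inv y(2)] by (simp only: id)
    moreover have "y \<circ> inv \<pi> \<in> {..<n} \<rightarrow>\<^sub>E UNIV" by (rule permute_in[OF inv y(1)])
    ultimately have "y \<circ> inv \<pi> \<in> S" using e(2) by blast
    then have "y \<circ> inv \<pi> \<circ> \<pi> \<in> S" using assms \<pi> unfolding perm_closed_def by blast
    then show ?thesis by (simp only: id)
  qed
  then show "x \<circ> \<pi> \<in> Rn n interior_of S"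
    unfolding in_interior_of_prodtop[OF finite_lessThan] using e(1) permute_in[OF \<pi> xE] by blast
qed

lemma perm_closed_closure:
  assumes "perm_closed n S"
  shows "perm_closed n (Rn n closure_of S)"
  unfolding perm_closed_def
proof (intro allI impI ballI)
  fix \<pi> x assume \<pi>: "\<pi> permutes {..<n}" and x: "x \<in> Rn n closure_of S"
  then have xE: "x \<in> {..<n} \<rightarrow>\<^sub>E UNIV"
    and x': "\<And>e. e > 0 \<Longrightarrow> \<exists>y\<in>S \<inter> ({..<n} \<rightarrow>\<^sub>E UNIV). \<forall>i\<in>{..<n}. \<bar>y i - x i\<bar> < e"
    unfolding in_closure_of_prodtop[OF finite_lessThan] by blast+
  show "x \<circ> \<pi> \<in> Rn n closure_of S" unfolding in_closure_of_prodtop[OF finite_lessThan]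
  proof (intro conjI allI impI)
    show "x \<circ> \<pi> \<in> {..<n} \<rightarrow>\<^sub>E UNIV" by (rule permute_in[OF \<pi> xE])
    fix e :: real assume "e > 0"
    then obtain y where y: "y \<in> S \<inter> ({..<n} \<rightarrow>\<^sub>E UNIV)" "\<forall>i\<in>{..<n}. \<bar>y i - x i\<bar> < e" using x' by blast
    have "y \<circ> \<pi> \<in> S \<inter> ({..<n} \<rightarrow>\<^sub>E UNIV)"
      using y(1) assms \<pi> permute_in[OF \<pi>, of y UNIV] unfolding perm_closed_def by blast
    then show "\<exists>y\<in>S \<inter> ({..<n} \<rightarrow>\<^sub>E UNIV). \<forall>i\<in>{..<n}. \<bar>y i - (x \<circ> \<pi>) i\<bar> < e"
      using permute_near[OF \<pi> y(2)] by blast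
  qed
qed

definition polyhedral_frontier :: "nat \<Rightarrow> (nat \<Rightarrow> real) set \<Rightarrow> bool" where
  "polyhedral_frontier n D \<longleftrightarrow> (\<exists>H. finite H \<and> (\<forall>h\<in>H. \<exists>i<n. fst h i \<noteq> 0) \<and>
     Rn n frontier_of D \<subseteq> (\<Union>h\<in>H. {x \<in> {..<n} \<rightarrow>\<^sub>E UNIV. aff n h x = 0}))"

text \<open>The invariant of the iteration. The box \<open>[0, 2]^n\<close> contains every cube
  \<open>[t, t + 1]^n\<close> with \<open>0 \<le> t \<le> 1\<close>, so the bound does not grow with
  the number of steps.\<close>

definition good_body :: "nat \<Rightarrow> (nat \<Rightarrow> real) set \<Rightarrow> bool" where
  "good_body n D \<longleftrightarrow> tiling_body n D \<and> perm_symmetric n D \<and> D \<subseteq> box_Rn n 0 2 \<and> polyhedral_frontier n D"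

lemma good_body_closed: "good_body n D \<Longrightarrow> closedin (Rn n) D"
  unfolding good_body_def tiling_body_def body_def by (auto intro: compactin_prodtop_imp_closedin)

lemma good_body_null:
  assumes "good_body n D"
  shows "Rn n frontier_of D \<in> null_sets (leb {..<n})"
proof -
  obtain H where H: "finite H" "\<forall>h\<in>H. \<exists>i<n. fst h i \<noteq> 0"
     "Rn n frontier_of D \<subseteq> (\<Union>h\<in>H. {x \<in> {..<n} \<rightarrow>\<^sub>E UNIV. aff n h x = 0})"
    using assms unfolding good_body_def polyhedral_frontier_def by blast
  show ?thesis
    by (rule null_sets_hyperplanes[OF H(1) _ closedin_frontier_of H(3)]) (use H(2) in blast)
qed

lemma good_body_piecewise_smooth:
  assumes "good_body n D"
  shows "piecewise_smooth_surface n (Rn n frontier_of D)"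
proof -
  obtain H where H: "finite H" "\<forall>h\<in>H. \<exists>i<n. fst h i \<noteq> 0"
     "Rn n frontier_of D \<subseteq> (\<Union>h\<in>H. {x \<in> {..<n} \<rightarrow>\<^sub>E UNIV. aff n h x = 0})"
    using assms unfolding good_body_def polyhedral_frontier_def by blast
  show ?thesis
  proof (rule piecewise_smooth_frontier[OF _ _ H(1) _ H(3)])
    show "compactin (Rn n) D" "Rn n closure_of (Rn n interior_of D) = D"
      using assms unfolding good_body_def tiling_body_def body_def by auto
  qed (use H(2) in blast)
qed

lemma frontier_of_closed: "closedin X D \<Longrightarrow> X frontier_of D = D - X interior_of D"
  by (simp add: frontier_of_def closure_of_closedin)

lemma obox_open: "openin (Rn n) ({..<n} \<rightarrow>\<^sub>E {a<..<b::real})"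
  by (simp add: openin_PiE_gen)

lemma floor_shift_into:
  assumes "x \<in> {..<n} \<rightarrow>\<^sub>E UNIV" "\<And>i. i < n \<Longrightarrow> x i - t \<notin> \<int>"
  obtains z where "z \<in> {..<n} \<rightarrow>\<^sub>E \<int>" "tr n (\<lambda>i\<in>{..<n}. - z i) x \<in> {..<n} \<rightarrow>\<^sub>E {t<..<t+1}"
proof
  let ?z = "\<lambda>i\<in>{..<n}. real_of_int \<lfloor>x i - t\<rfloor>"
  show "?z \<in> {..<n} \<rightarrow>\<^sub>E \<int>" by auto
  show "tr n (\<lambda>i\<in>{..<n}. - ?z i) x \<in> {..<n} \<rightarrow>\<^sub>E {t<..<t+1}"
  proof
    fix i assume i: "i \<in> {..<n}"
    have "x i - t \<noteq> of_int \<lfloor>x i - t\<rfloor>" using assms(2)[of i] i by (metis Ints_of_int lessThan_iff)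
    then have "of_int \<lfloor>x i - t\<rfloor> < x i - t" "x i - t < of_int \<lfloor>x i - t\<rfloor> + 1" by linarith+
    moreover have "tr n (\<lambda>i\<in>{..<n}. - ?z i) x i = x i - of_int \<lfloor>x i - t\<rfloor>" using i by (simp add: tr_def)
    ultimately show "tr n (\<lambda>i\<in>{..<n}. - ?z i) x i \<in> {t<..<t+1}"
      unfolding greaterThanLessThan_iff by linarith
  qed (simp add: tr_def)
qed

lemma obox_shift_unique:
  assumes "z \<in> {..<n} \<rightarrow>\<^sub>E \<int>" "w \<in> {..<n} \<rightarrow>\<^sub>E \<int>"
    and "tr n (\<lambda>i\<in>{..<n}. - z i) x \<in> {..<n} \<rightarrow>\<^sub>E {t<..<t+1}" "tr n (\<lambda>i\<in>{..<n}. - w i) x \<in> {..<n} \<rightarrow>\<^sub>E {t<..<t+1}"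
  shows "z = w"
proof (rule PiE_ext[OF assms(1,2)])
  fix i assume i: "i \<in> {..<n}"
  obtain a b where ab: "z i = of_int a" "w i = of_int b"
    using PiE_mem[OF assms(1) i] PiE_mem[OF assms(2) i] by (auto elim!: Ints_cases)
  have "tr n (\<lambda>i\<in>{..<n}. - z i) x i \<in> {t<..<t+1}" "tr n (\<lambda>i\<in>{..<n}. - w i) x i \<in> {t<..<t+1}"
    using PiE_mem[OF assms(3) i] PiE_mem[OF assms(4) i] by auto
  then have "of_int a - of_int b < (1::real)" "of_int b - of_int a < (1::real)" using i ab by (auto simp: tr_def)
  then have "a - b < 1" "b - a < 1" by linarith+
  then show "z i = w i" using ab by simp
qed

context profile
begin

definition newE :: "nat \<Rightarrow> (nat \<Rightarrow> real) set \<Rightarrow> real \<Rightarrow> (nat \<Rightarrow> real) set" where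
  "newE n D \<theta> = (Rn n interior_of D \<inter> {x \<in> {..<n} \<rightarrow>\<^sub>E UNIV. pot n N c x > \<theta>}) \<union>
     (({..<n} \<rightarrow>\<^sub>E {t<..<t+1}) \<inter> {x \<in> {..<n} \<rightarrow>\<^sub>E UNIV. pot n N c x < \<theta>})"

text \<open>The closure of an open set is regular closed, as \<open>body\<close> demands.
  Disjointness of the translates is checked on the open set \<open>newE\<close>.\<close>

definition newD :: "nat \<Rightarrow> (nat \<Rightarrow> real) set \<Rightarrow> real \<Rightarrow> (nat \<Rightarrow> real) set" where
  "newD n D \<theta> = Rn n closure_of (newE n D \<theta>)"

lemma open_newE: "openin (Rn n) (newE n D \<theta>)"
  unfolding newE_def by (intro openin_Un openin_Int openin_interior_of obox_open openin_pot_less openin_pot_greater)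

lemma newE_sub_interior: "newE n D \<theta> \<subseteq> Rn n interior_of (newD n D \<theta>)"
  unfolding newD_def
  by (rule interior_of_maximal[OF closure_of_subset open_newE]) (rule openin_subset[OF open_newE])

lemma newE_sub: "newE n D \<theta> \<subseteq> newD n D \<theta>"
  by (rule order_trans[OF newE_sub_interior interior_of_subset])

lemma newD_sub:
  assumes "closedin (Rn n) D"
  shows "newD n D \<theta> \<subseteq> (D \<inter> {x \<in> {..<n} \<rightarrow>\<^sub>E UNIV. pot n N c x \<ge> \<theta>}) \<union> (box_Rn n t (t+1) \<inter> {x \<in> {..<n} \<rightarrow>\<^sub>E UNIV. pot n N c x \<le> \<theta>})"
    (is "_ \<subseteq> ?S")
  unfolding newD_def
proof (rule closure_of_minimal)
  have "Rn n interior_of D \<subseteq> D" by (rule interior_of_subset)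
  moreover have "{..<n} \<rightarrow>\<^sub>E {t<..<t+1} \<subseteq> box_Rn n t (t+1)" by (rule PiE_mono) auto
  ultimately show "newE n D \<theta> \<subseteq> ?S" unfolding newE_def by (intro Un_mono Int_mono) auto
  show "closedin (Rn n) ?S"
    using assms by (intro closedin_Un closedin_Int closedin_pot_ge closedin_pot_le) (auto simp: closedin_product_topology)
qed

text \<open>A coordinate in \<open>t + \<int>\<close> alone lifts the potential to \<open>B\<close>.
  So the walls of the cubes \<open>[t, t + 1]^n\<close> never appear in the region below a level
  \<open>\<theta> < B\<close>.\<close>

lemma low_not_wall:
  assumes "pot n N c x < B" "i < n"
  shows "x i - t \<notin> \<int>"
proof
  assume "x i - t \<in> \<int>"
  then obtain z where "x i - t = of_int z" by (auto elim: Ints_cases)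
  then have "x i = t + of_int z" by simp
  then show False using pot_peak[OF assms(2)] assms(1) by (simp add: not_le[symmetric])
qed

lemma pot_tr_neg:
  assumes "z \<in> {..<n} \<rightarrow>\<^sub>E \<int>" "x \<in> {..<n} \<rightarrow>\<^sub>E UNIV"
  shows "pot n N c (tr n (\<lambda>i\<in>{..<n}. - z i) x) = pot n N c x"
proof -
  have "(\<lambda>i\<in>{..<n}. - z i) \<in> {..<n} \<rightarrow>\<^sub>E \<int>" using assms(1) by (auto simp: PiE_iff)
  then show ?thesis using pot_periodic assms(2) unfolding periodic_Rn_def by blast
qed

text \<open>A point and its integer translates have the same potential. Hence the old tiling decides
  where it exceeds \<open>\<theta>\<close>, the tiling by cubes where it is below, and covering and
  disjointness can be verified in each region separately. The level itself is reached as a limit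
  from below.\<close>

lemma good_body_newD:
  assumes good: "good_body n D" and \<theta>: "0 < \<theta>" "\<theta> < B"
  shows "good_body n (newD n D \<theta>)"
    and "Rn n frontier_of (newD n D \<theta>) \<subseteq> (Rn n frontier_of D \<inter> {x \<in> {..<n} \<rightarrow>\<^sub>E UNIV. pot n N c x \<ge> \<theta>}) \<union>
      ({x \<in> D. pot n N c x = \<theta>} \<union> {x \<in> box_Rn n t (t+1). pot n N c x = \<theta>})"
proof -
  have cl: "closedin (Rn n) D" by (rule good_body_closed[OF good])
  have DE: "D \<subseteq> {..<n} \<rightarrow>\<^sub>E UNIV" using closedin_subset[OF cl] by simp
  have EE: "newE n D \<theta> \<subseteq> {..<n} \<rightarrow>\<^sub>E UNIV" using openin_subset[OF open_newE] by simp
  have tile: "tiling_body n D" and sym: "perm_symmetric n D" and D2: "D \<subseteq> box_Rn n 0 2"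
    using good by (auto simp: good_body_def)
  have reg: "Rn n closure_of (Rn n interior_of D) = D" using tile by (simp add: tiling_body_def body_def)
  have newcl: "closedin (Rn n) (newD n D \<theta>)" by (simp add: newD_def)
  have new2: "newD n D \<theta> \<subseteq> box_Rn n 0 2"
  proof -
    have "box_Rn n t (t+1) \<subseteq> box_Rn n 0 2" using t by (intro PiE_mono) auto
    then show ?thesis using newD_sub[OF cl, of \<theta>] D2 by blast
  qed
  have newDE: "newD n D \<theta> \<subseteq> {..<n} \<rightarrow>\<^sub>E UNIV" using closedin_subset[OF newcl] by simp
  show frontier: "Rn n frontier_of (newD n D \<theta>) \<subseteq> (Rn n frontier_of D \<inter> {x \<in> {..<n} \<rightarrow>\<^sub>E UNIV. pot n N c x \<ge> \<theta>}) \<union>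
      ({x \<in> D. pot n N c x = \<theta>} \<union> {x \<in> box_Rn n t (t+1). pot n N c x = \<theta>})"
  proof
    fix x assume "x \<in> Rn n frontier_of (newD n D \<theta>)"
    then have x: "x \<in> newD n D \<theta>" "x \<notin> newE n D \<theta>"
      using newE_sub_interior unfolding frontier_of_closed[OF newcl] by blast+
    have xE: "x \<in> {..<n} \<rightarrow>\<^sub>E UNIV" using x(1) newDE by blast
    have xs: "x \<in> D \<and> pot n N c x \<ge> \<theta> \<or> x \<in> box_Rn n t (t+1) \<and> pot n N c x \<le> \<theta>"
      using x(1) newD_sub[OF cl] by blast
    consider "pot n N c x > \<theta>" | "pot n N c x < \<theta>" | "pot n N c x = \<theta>" by linarith
    then show "x \<in> (Rn n frontier_of D \<inter> {x \<in> {..<n} \<rightarrow>\<^sub>E UNIV. pot n N c x \<ge> \<theta>}) \<union>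
      ({x \<in> D. pot n N c x = \<theta>} \<union> {x \<in> box_Rn n t (t+1). pot n N c x = \<theta>})"
    proof cases
      case 1
      then have "x \<in> D" using xs by linarith
      moreover have "x \<notin> Rn n interior_of D" using x(2) 1 xE by (auto simp: newE_def)
      ultimately show ?thesis unfolding frontier_of_closed[OF cl] using 1 xE by simp
    next
      case 2
      then have xb: "x \<in> box_Rn n t (t+1)" using xs by linarith
      have "x \<in> {..<n} \<rightarrow>\<^sub>E {t<..<t+1}"
      proof
        fix i assume i: "i \<in> {..<n}"
        have "x i - t \<notin> \<int>" using low_not_wall[of n x i] 2 \<theta> i by simp
        then have "x i - t \<noteq> 0" "x i - t \<noteq> 1" by auto
        moreover have "x i \<in> {t..t+1}" by (rule PiE_mem[OF xb i])
        ultimately show "x i \<in> {t<..<t+1}" by (simp add: less_le)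
      qed (use xE in \<open>auto simp: PiE_iff extensional_def\<close>)
      then have "x \<in> newE n D \<theta>" using 2 xE by (simp add: newE_def)
      then show ?thesis using x(2) by blast
    next
      case 3
      then show ?thesis using xs by blast
    qed
  qed
  have cover: "(\<Union>z\<in>{..<n} \<rightarrow>\<^sub>E \<int>. translate_Rn n z (newD n D \<theta>)) = topspace (Rn n)"
  proof
    show "(\<Union>z\<in>{..<n} \<rightarrow>\<^sub>E \<int>. translate_Rn n z (newD n D \<theta>)) \<subseteq> topspace (Rn n)"
      unfolding translate_Rn_tr by (intro UN_least image_subsetI) simp
    show "topspace (Rn n) \<subseteq> (\<Union>z\<in>{..<n} \<rightarrow>\<^sub>E \<int>. translate_Rn n z (newD n D \<theta>))"
    proof
      fix x assume "x \<in> topspace (Rn n)"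
      then have xE: "x \<in> {..<n} \<rightarrow>\<^sub>E UNIV" by simp
      have "\<exists>z\<in>{..<n} \<rightarrow>\<^sub>E \<int>. tr n (\<lambda>i\<in>{..<n}. - z i) x \<in> newD n D \<theta>"
      proof (cases "pot n N c x > \<theta>")
        case True
        have "x \<in> (\<Union>z\<in>{..<n} \<rightarrow>\<^sub>E \<int>. translate_Rn n z D)" using tile xE by (simp add: tiling_body_def)
        then obtain w where w: "w \<in> {..<n} \<rightarrow>\<^sub>E \<int>" "x \<in> tr n w ` D" by (auto simp: translate_Rn_tr)
        let ?y = "tr n (\<lambda>i\<in>{..<n}. - w i) x"
        have y: "?y \<in> D" using w(2) mem_tr_image[OF DE xE] by blast
        have py: "pot n N c ?y > \<theta>" using pot_tr_neg[OF w(1) xE] True by simp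
        let ?P = "{x \<in> {..<n} \<rightarrow>\<^sub>E UNIV. pot n N c x > \<theta>}"
        have "?y \<in> ?P \<inter> Rn n closure_of (Rn n interior_of D)" using y py by (simp add: reg)
        also have "\<dots> \<subseteq> Rn n closure_of (?P \<inter> Rn n interior_of D)"
          by (rule openin_Int_closure_of_subset[OF openin_pot_greater])
        also have "\<dots> \<subseteq> newD n D \<theta>" unfolding newD_def by (rule closure_of_mono) (auto simp: newE_def)
        finally show ?thesis using w(1) by blast
      next
        case False
        then have lt: "pot n N c x < B" using \<theta> by linarith
        obtain z where z: "z \<in> {..<n} \<rightarrow>\<^sub>E \<int>" "tr n (\<lambda>i\<in>{..<n}. - z i) x \<in> {..<n} \<rightarrow>\<^sub>E {t<..<t+1}"
          using floor_shift_into[OF xE low_not_wall[OF lt]] by blast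
        let ?y = "tr n (\<lambda>i\<in>{..<n}. - z i) x"
        have py: "pot n N c ?y \<le> \<theta>" using pot_tr_neg[OF z(1) xE] False by simp
        have "?y \<in> newD n D \<theta>"
        proof (cases "pot n N c ?y < \<theta>")
          case True
          then have "?y \<in> newE n D \<theta>" using z(2) by (simp add: newE_def)
          then show ?thesis using newE_sub by blast
        next
          case False
          \<comment> \<open>\<open>newE\<close> has no points on the level. There are no positive
            local minima, so arbitrarily close to \<open>?y\<close> the same open cube contains a
            point of lower potential.\<close>
          then have eq: "pot n N c ?y = \<theta>" using py by simp
          obtain e0 where e0: "e0 > 0" "\<forall>u\<in>{..<n} \<rightarrow>\<^sub>E UNIV. (\<forall>i\<in>{..<n}. \<bar>u i - ?y i\<bar> < e0) \<longrightarrow> u \<in> {..<n} \<rightarrow>\<^sub>E {t<..<t+1}"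
            using obox_open[of n t "t+1"] z(2) unfolding openin_prodtop[OF finite_lessThan] by blast
          show ?thesis unfolding newD_def in_closure_of_prodtop[OF finite_lessThan]
          proof (intro conjI allI impI)
            fix e :: real assume e: "e > 0"
            have "pot n N c ?y > 0" using eq \<theta> by simp
            then obtain u where u: "u \<in> {..<n} \<rightarrow>\<^sub>E UNIV" "\<forall>i\<in>{..<n}. \<bar>u i - ?y i\<bar> < min e e0" "pot n N c u < pot n N c ?y"
              using pot_decrease[of ?y n "min e e0"] e e0(1) by auto
            have near: "\<forall>i\<in>{..<n}. \<bar>u i - ?y i\<bar> < e" "\<forall>i\<in>{..<n}. \<bar>u i - ?y i\<bar> < e0" using u(2) by simp_all
            have "u \<in> {..<n} \<rightarrow>\<^sub>E {t<..<t+1}" using e0(2) u(1) near(2) by blast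
            then have "u \<in> newE n D \<theta>" using u(1,3) eq by (simp add: newE_def)
            then show "\<exists>v\<in>newE n D \<theta> \<inter> ({..<n} \<rightarrow>\<^sub>E UNIV). \<forall>i\<in>{..<n}. \<bar>v i - ?y i\<bar> < e"
              using u(1) near(1) by blast
          qed simp
        qed
        then show ?thesis using z(1) by blast
      qed
      then obtain z where z: "z \<in> {..<n} \<rightarrow>\<^sub>E \<int>" "x \<in> tr n z ` newD n D \<theta>" using mem_tr_image[OF newDE xE] by blast
      then show "x \<in> (\<Union>z\<in>{..<n} \<rightarrow>\<^sub>E \<int>. translate_Rn n z (newD n D \<theta>))" unfolding translate_Rn_tr by blast
    qed
  qed
  have disj: "Rn n interior_of translate_Rn n z (newD n D \<theta>) \<inter> Rn n interior_of translate_Rn n w (newD n D \<theta>) = {}"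
    if zw: "z \<in> {..<n} \<rightarrow>\<^sub>E \<int>" "w \<in> {..<n} \<rightarrow>\<^sub>E \<int>" "z \<noteq> w" for z w
  proof -
    have open': "openin (Rn n) (tr n z ` newE n D \<theta>)" for z
      using homeomorphic_map_openness[OF homeomorphic_map_tr, of "newE n D \<theta>" n z] EE open_newE by simp
    have clo: "translate_Rn n z (newD n D \<theta>) = Rn n closure_of (tr n z ` newE n D \<theta>)" for z
      unfolding translate_Rn_tr newD_def
      using homeomorphic_map_closure_of[OF homeomorphic_map_tr, of "newE n D \<theta>" n z] EE by simp
    have "tr n z ` newE n D \<theta> \<inter> tr n w ` newE n D \<theta> = {}"
    proof (rule ccontr)
      assume "\<not> ?thesis"
      then obtain x where x: "x \<in> tr n z ` newE n D \<theta>" "x \<in> tr n w ` newE n D \<theta>" by blast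
      then have xE: "x \<in> {..<n} \<rightarrow>\<^sub>E UNIV" using openin_subset[OF open'[of z]] by auto
      let ?a = "tr n (\<lambda>i\<in>{..<n}. - z i) x" and ?b = "tr n (\<lambda>i\<in>{..<n}. - w i) x"
      have ab: "?a \<in> newE n D \<theta>" "?b \<in> newE n D \<theta>" using x mem_tr_image[OF EE xE] by auto
      have pab: "pot n N c ?a = pot n N c x" "pot n N c ?b = pot n N c x" using pot_tr_neg zw xE by auto
      show False
      proof (cases "pot n N c x < \<theta>")
        case True
        then have "?a \<in> {..<n} \<rightarrow>\<^sub>E {t<..<t+1}" "?b \<in> {..<n} \<rightarrow>\<^sub>E {t<..<t+1}" using ab pab by (auto simp: newE_def)
        then show False using obox_shift_unique zw by blast
      next
        case False
        then have *: "?a \<in> Rn n interior_of D" "?b \<in> Rn n interior_of D" using ab pab by (auto simp: newE_def)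
        have int: "Rn n interior_of D \<subseteq> {..<n} \<rightarrow>\<^sub>E UNIV" using interior_of_subset_topspace[of "Rn n" D] by simp
        have "x \<in> Rn n interior_of translate_Rn n z D \<inter> Rn n interior_of translate_Rn n w D"
          unfolding translate_Rn_tr interior_of_tr[OF DE] using * mem_tr_image[OF int xE] by blast
        then show False using tile zw unfolding tiling_body_def by blast
      qed
    qed
    then show ?thesis unfolding clo by (rule disjoint_open_interior_closure[OF open' open'])
  qed
  have body: "body n (newD n D \<theta>)" unfolding body_def
  proof (intro conjI)
    show "newD n D \<theta> \<noteq> {}"
    proof
      assume "newD n D \<theta> = {}"
      then have "topspace (Rn n) = {}" using cover by (simp add: translate_Rn_def)
      then show False by (simp add: PiE_eq_empty_iff)
    qed
    show "compactin (Rn n) (newD n D \<theta>)"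
    proof (rule compactin_prodtop[OF newcl])
      fix x i assume "x \<in> newD n D \<theta>" "i \<in> {..<n}"
      then have "x i \<in> {0..2}" using new2 by (auto simp: PiE_iff)
      then show "0 \<le> x i \<and> x i \<le> 2" by simp
    qed
    show "Rn n closure_of (Rn n interior_of (newD n D \<theta>)) = newD n D \<theta>"
    proof
      show "Rn n closure_of (Rn n interior_of (newD n D \<theta>)) \<subseteq> newD n D \<theta>"
        by (rule closure_of_minimal[OF interior_of_subset newcl])
      have "Rn n closure_of (newE n D \<theta>) \<subseteq> Rn n closure_of (Rn n interior_of (newD n D \<theta>))"
        by (rule closure_of_mono[OF newE_sub_interior])
      then show "newD n D \<theta> \<subseteq> Rn n closure_of (Rn n interior_of (newD n D \<theta>))" by (simp add: newD_def)
    qed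
  qed
  have symm: "perm_symmetric n (newD n D \<theta>)"
  proof -
    have "perm_closed n (Rn n interior_of D)"
      using sym perm_closed_interior unfolding perm_symmetric_iff[OF DE] by blast
    then have int: "x \<circ> \<pi> \<in> Rn n interior_of D" if "\<pi> permutes {..<n}" "x \<in> Rn n interior_of D" for \<pi> x
      using that unfolding perm_closed_def by blast
    have "perm_closed n (newE n D \<theta>)" unfolding perm_closed_def
    proof (intro allI impI ballI)
      fix \<pi> x assume \<pi>: "\<pi> permutes {..<n}" and x: "x \<in> newE n D \<theta>"
      have "x \<circ> \<pi> \<in> {..<n} \<rightarrow>\<^sub>E UNIV" using x EE by (intro permute_in[OF \<pi>]) blast
      moreover have "x \<circ> \<pi> \<in> {..<n} \<rightarrow>\<^sub>E {t<..<t+1}" if "x \<in> {..<n} \<rightarrow>\<^sub>E {t<..<t+1}"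
        using that by (rule permute_in[OF \<pi>])
      ultimately show "x \<circ> \<pi> \<in> newE n D \<theta>"
        using x int[OF \<pi>, of x] unfolding newE_def Un_iff Int_iff mem_Collect_eq pot_permute[OF \<pi>] by blast
    qed
    then have "perm_closed n (newD n D \<theta>)" unfolding newD_def by (rule perm_closed_closure)
    then show ?thesis using perm_symmetric_iff[OF newDE] by blast
  qed
  have poly: "polyhedral_frontier n (newD n D \<theta>)"
  proof -
    obtain H where H: "finite H" "\<forall>h\<in>H. \<exists>i<n. fst h i \<noteq> 0"
      "Rn n frontier_of D \<subseteq> (\<Union>h\<in>H. {x \<in> {..<n} \<rightarrow>\<^sub>E UNIV. aff n h x = 0})"
      using good unfolding good_body_def polyhedral_frontier_def by blast
    \<comment> \<open>One hyperplane for each nonconstant cell. Constant cells have potential 0 and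
      do not meet the level, since \<open>\<theta> > 0\<close>.\<close>
    define G where "G = (\<lambda>k. (fst (cellaff n N c k), snd (cellaff n N c k) - \<theta>)) ` {k \<in> cells n N. \<exists>i<n. fst (cellaff n N c k) i \<noteq> 0}"
    have level: "\<exists>h\<in>G. aff n h x = 0" if x: "x \<in> box_Rn n 0 2" "pot n N c x = \<theta>" for x
    proof -
      obtain k where k: "k \<in> cells n N" "x \<in> cell n N k" using box_cells[OF N_pos x(1)] by blast
      have "\<exists>i<n. fst (cellaff n N c k) i \<noteq> 0" using cell_flat[OF k(2)] x(2) \<theta>(1) by force
      then have "(fst (cellaff n N c k), snd (cellaff n N c k) - \<theta>) \<in> G" using k(1) by (auto simp: G_def)
      moreover have "aff n (fst (cellaff n N c k), snd (cellaff n N c k) - \<theta>) x = 0"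
        using pot_on_cell[OF k(2), of c] x(2) by simp
      ultimately show ?thesis by blast
    qed
    show ?thesis unfolding polyhedral_frontier_def
    proof (intro exI[of _ "H \<union> G"] conjI)
      show "finite (H \<union> G)" using H(1) finite_cells by (simp add: G_def)
      show "\<forall>h\<in>H \<union> G. \<exists>i<n. fst h i \<noteq> 0" using H(2) by (auto simp: G_def)
      show "Rn n frontier_of newD n D \<theta> \<subseteq> (\<Union>h\<in>H \<union> G. {x \<in> {..<n} \<rightarrow>\<^sub>E UNIV. aff n h x = 0})"
      proof
        fix x assume x: "x \<in> Rn n frontier_of newD n D \<theta>"
        have xn: "x \<in> newD n D \<theta>" using x unfolding frontier_of_closed[OF newcl] by blast
        have xE: "x \<in> {..<n} \<rightarrow>\<^sub>E UNIV" using xn newDE by blast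
        have "x \<in> Rn n frontier_of D \<or> pot n N c x = \<theta>" using x frontier by blast
        then have "\<exists>h\<in>H \<union> G. aff n h x = 0"
        proof
          assume "x \<in> Rn n frontier_of D"
          then show ?thesis using H(3) by blast
        next
          assume "pot n N c x = \<theta>"
          then show ?thesis using level[of x] xn new2 by blast
        qed
        then show "x \<in> (\<Union>h\<in>H \<union> G. {x \<in> {..<n} \<rightarrow>\<^sub>E UNIV. aff n h x = 0})" using xE by blast
      qed
    qed
  qed
  show "good_body n (newD n D \<theta>)"
    unfolding good_body_def tiling_body_def using body cover disj symm poly new2 by blast
qed

end

section \<open>Random level sets\<close>

lemma measurable_nn_integral_surf:
  assumes "p < n" "B \<in> sets (leb {..<n})" "u \<in> borel_measurable (leb {..<n})"
  shows "(\<lambda>\<theta>. \<integral>\<^sup>+ x. u x \<partial>surf n h p B \<theta>) \<in> borel_measurable borel"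
proof -
  let ?I = "{..<n} - {p}"
  have ins: "insert p ?I = {..<n}" using assms by auto
  have "(\<lambda>q. (snd q, (fst q - snd h - (\<Sum>i\<in>?I. fst h i * snd q i)) / fst h p))
      \<in> measurable (borel \<Otimes>\<^sub>M leb ?I) (leb ?I \<Otimes>\<^sub>M lborel)"
    using measurable_compose[OF measurable_snd measurable_linear_leb[of "fst h" ?I]]
    by (intro measurable_Pair) measurable
  from measurable_compose[OF this measurable_add_dim[of p ?I "\<lambda>_. lborel"]]
  have g: "(\<lambda>q. graph_at n h p (fst q) (snd q)) \<in> measurable (borel \<Otimes>\<^sub>M leb ?I) (leb {..<n})"
    unfolding graph_at_def by (simp only: ins split_def fst_conv snd_conv)
  have "(\<lambda>x. ennreal (gradnorm n h / \<bar>fst h p\<bar>) * indicator B x * u x) \<in> borel_measurable (leb {..<n})"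
    using assms(2,3) by measurable
  from measurable_compose[OF g this]
  have "(\<lambda>(\<theta>, y). ennreal (gradnorm n h / \<bar>fst h p\<bar>) * indicator B (graph_at n h p \<theta> y) * u (graph_at n h p \<theta> y))
      \<in> borel_measurable (borel \<Otimes>\<^sub>M leb ?I)" by (simp only: split_def)
  then show ?thesis unfolding nn_integral_surf[OF assms]
    by (rule sigma_finite_measure.borel_measurable_nn_integral[OF lborel_PiM.sigma_finite[OF finite_Diff[OF finite_lessThan]]])
qed

text \<open>An exponential density equals its own tail, which relates the creation of walls to their
  survival. The truncation keeps every level below the peak, as \<open>good_body_newD\<close>
  requires.\<close>

definition rho :: "real \<Rightarrow> real \<Rightarrow> real" where
  "rho B \<theta> = (if 0 < \<theta> \<and> \<theta> < B then exp (- \<theta>) / (1 - exp (- B)) else 0)"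

lemma rho_nonneg: "rho B \<theta> \<ge> 0"
  by (auto simp: rho_def)

lemma measurable_rho [measurable]: "rho B \<in> borel_measurable borel"
  unfolding rho_def[abs_def] by measurable

lemma nn_integral_rho_upto:
  assumes "B > 0" "0 \<le> f"
  shows "(\<integral>\<^sup>+ \<theta>. ennreal (rho B \<theta>) * indicator {..f} \<theta> \<partial>lborel) = ennreal ((1 - exp (- min f B)) / (1 - exp (- B)))"
proof -
  let ?m = "min f B"
  have "(\<integral>\<^sup>+ \<theta>. ennreal (rho B \<theta>) * indicator {..f} \<theta> \<partial>lborel)
      = (\<integral>\<^sup>+ \<theta>. ennreal (exp (- \<theta>) / (1 - exp (- B))) * indicator {0..?m} \<theta> \<partial>lborel)"
  proof (rule nn_integral_cong_AE)
    have "AE \<theta> in lborel. \<theta> \<notin> {0, B}" by (rule AE_not_in) (rule finite_imp_null_set_lborel, simp)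
    then show "AE \<theta> in lborel. ennreal (rho B \<theta>) * indicator {..f} \<theta> = ennreal (exp (- \<theta>) / (1 - exp (- B))) * indicator {0..?m} \<theta>"
      by (rule eventually_mono) (auto simp: rho_def indicator_def)
  qed
  also have "\<dots> = ennreal (- exp (- ?m) / (1 - exp (- B)) - (- exp (- 0) / (1 - exp (- B))))"
  proof (rule nn_integral_FTC_Icc)
    show "(\<lambda>\<theta>. exp (- \<theta>) / (1 - exp (- B))) \<in> borel_measurable borel" by measurable
    show "((\<lambda>\<theta>. - exp (- \<theta>) / (1 - exp (- B))) has_real_derivative exp (- x) / (1 - exp (- B))) (at x)" for x
      using assms(1) by (auto intro!: derivative_eq_intros)
    show "0 \<le> exp (- x) / (1 - exp (- B))" for x using assms(1) by simp
    show "0 \<le> ?m" using assms by simp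
  qed
  finally show ?thesis using assms(1) by (simp add: diff_divide_distrib)
qed

lemma nn_integral_rho:
  assumes "B > 0"
  shows "(\<integral>\<^sup>+ \<theta>. ennreal (rho B \<theta>) \<partial>lborel) = 1"
proof -
  have "(\<integral>\<^sup>+ \<theta>. ennreal (rho B \<theta>) \<partial>lborel) = (\<integral>\<^sup>+ \<theta>. ennreal (rho B \<theta>) * indicator {..B} \<theta> \<partial>lborel)"
    by (intro nn_integral_cong) (auto simp: rho_def indicator_def)
  then show ?thesis using nn_integral_rho_upto[OF assms, of B] assms by simp
qed

lemma exists_le_average:
  assumes "B > 0" and W: "W \<in> borel_measurable borel" and le: "(\<integral>\<^sup>+ \<theta>. ennreal (rho B \<theta>) * W \<theta> \<partial>lborel) \<le> A"
  shows "\<exists>\<theta>. 0 < \<theta> \<and> \<theta> < B \<and> W \<theta> \<le> A"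
proof (rule ccontr)
  assume no: "\<not> ?thesis"
  then have gt: "A < W \<theta>" if "0 < \<theta>" "\<theta> < B" for \<theta> using that by (auto simp: not_le)
  \<comment> \<open>Being strictly below one value makes \<open>A\<close> finite, which
    \<open>nn_integral_less\<close> needs.\<close>
  have "A < W (B / 2)" using gt[of "B / 2"] assms(1) by simp
  then have A: "A \<noteq> top" by (auto simp: less_top[symmetric])
  have int: "(\<integral>\<^sup>+ \<theta>. ennreal (rho B \<theta>) * A \<partial>lborel) = A"
    using nn_integral_rho[OF assms(1)] by (simp add: nn_integral_multc)
  have "(\<integral>\<^sup>+ \<theta>. ennreal (rho B \<theta>) * A \<partial>lborel) < (\<integral>\<^sup>+ \<theta>. ennreal (rho B \<theta>) * W \<theta> \<partial>lborel)"
  proof (rule nn_integral_less)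
    show "(\<integral>\<^sup>+ \<theta>. ennreal (rho B \<theta>) * A \<partial>lborel) \<noteq> \<infinity>" unfolding int using A by simp
    have "ennreal (rho B \<theta>) * A \<le> ennreal (rho B \<theta>) * W \<theta>" for \<theta>
    proof (cases "0 < \<theta> \<and> \<theta> < B")
      case True
      then show ?thesis using gt[of \<theta>] by (intro mult_left_mono) auto
    qed (auto simp: rho_def)
    then show "AE \<theta> in lborel. ennreal (rho B \<theta>) * A \<le> ennreal (rho B \<theta>) * W \<theta>" by simp
    show "\<not> (AE \<theta> in lborel. ennreal (rho B \<theta>) * W \<theta> \<le> ennreal (rho B \<theta>) * A)"
    proof
      assume "AE \<theta> in lborel. ennreal (rho B \<theta>) * W \<theta> \<le> ennreal (rho B \<theta>) * A"
      then have "AE \<theta> in lborel. \<theta> \<notin> {0<..<B}"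
      proof (rule eventually_mono)
        fix \<theta> assume le: "ennreal (rho B \<theta>) * W \<theta> \<le> ennreal (rho B \<theta>) * A"
        show "\<theta> \<notin> {0<..<B}"
        proof
          assume in_range: "\<theta> \<in> {0<..<B}"
          then have "0 < rho B \<theta>" by (simp add: rho_def)
          then have "ennreal (rho B \<theta>) * A < ennreal (rho B \<theta>) * W \<theta>"
            using gt[of \<theta>] in_range by (intro ennreal_mult_strict_left_mono) auto
          then show False using le by simp
        qed
      qed
      then have "{0<..<B} \<in> null_sets lborel" by (subst AE_iff_null_sets) auto
      then show False using assms(1) by (simp add: null_sets_def)
    qed
  qed (use W in measurable)
  then show False using le int by simp
qed

lemma exists_le_average_finite:
  fixes a :: "nat \<Rightarrow> ennreal"
  assumes "m > 0" "(\<Sum>l<m. a l) \<le> of_nat m * A"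
  shows "\<exists>l<m. a l \<le> A"
proof (rule ccontr)
  assume no: "\<not> ?thesis"
  then have gt: "A < a l" if "l < m" for l using that by (auto simp: not_le)
  define b where "b = Min (a ` {..<m})"
  have "b \<in> a ` {..<m}" unfolding b_def using assms(1) by (intro Min_in) auto
  then have bA: "A < b" using gt by auto
  have "of_nat m * b = (\<Sum>l<m. b)" by simp
  also have "\<dots> \<le> (\<Sum>l<m. a l)" by (intro sum_mono) (auto simp: b_def)
  also have "\<dots> \<le> of_nat m * A" by (rule assms(2))
  finally have "of_nat m * b \<le> of_nat m * A" .
  moreover have "of_nat m * A < of_nat m * b"
    using bA assms(1) ennreal_mult_strict_left_mono[of A b "of_nat m"] by (simp add: of_nat_less_top)
  ultimately show False by simp
qed

text \<open>Only an upper bound of the area is tracked, as a list of measures: this needs neither the additivity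
  of the Hausdorff measure nor its exact value on a facet.\<close>

definition area_bound :: "nat \<Rightarrow> (nat \<Rightarrow> real) set \<Rightarrow> (nat \<Rightarrow> real) measure list \<Rightarrow> bool" where
  "area_bound n D Ms \<longleftrightarrow> (\<forall>M\<in>set Ms. sets M = sets (leb {..<n}) \<and> finite_measure M) \<and>
     (\<forall>X. closedin (Rn n) X \<longrightarrow>
        hausdorff_measure n (n - 1) (Rn n frontier_of D \<inter> X) \<le> (\<Sum>M\<leftarrow>Ms. emeasure M X))"

text \<open>\<open>h\<close> stands for the chance that a wall survives the steps still to come; for
  \<open>h = 1\<close> this is the total area bound. Lists let equal measures count
  separately.\<close>

definition weight :: "(nat \<Rightarrow> real) measure list \<Rightarrow> ((nat \<Rightarrow> real) \<Rightarrow> ennreal) \<Rightarrow> ennreal" where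
  "weight Ms h = (\<Sum>M\<leftarrow>Ms. \<integral>\<^sup>+ x. h x \<partial>M)"

lemma measurable_sum_list [measurable (raw)]:
  fixes f :: "'b \<Rightarrow> 'a \<Rightarrow> ennreal"
  assumes "\<And>x. x \<in> set xs \<Longrightarrow> f x \<in> borel_measurable M"
  shows "(\<lambda>y. \<Sum>x\<leftarrow>xs. f x y) \<in> borel_measurable M"
  using assms by (induction xs) auto

lemma nn_integral_sum_list:
  fixes f :: "'b \<Rightarrow> 'a \<Rightarrow> ennreal"
  assumes "\<And>x. x \<in> set xs \<Longrightarrow> f x \<in> borel_measurable M"
  shows "(\<integral>\<^sup>+ y. (\<Sum>x\<leftarrow>xs. f x y) \<partial>M) = (\<Sum>x\<leftarrow>xs. \<integral>\<^sup>+ y. f x y \<partial>M)"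
  using assms by (induction xs) (auto simp: nn_integral_add)

lemma sum_list_mult_left: "(c::ennreal) * (\<Sum>x\<leftarrow>xs. f x) = (\<Sum>x\<leftarrow>xs. c * f x)"
  by (induction xs) (auto simp: distrib_left)

context profile
begin

definition piv :: "nat \<Rightarrow> (nat \<Rightarrow> int) \<Rightarrow> nat" where
  "piv n k = (SOME p. p < n \<and> fst (cellaff n N c k) p \<noteq> 0)"

definition tcells :: "nat \<Rightarrow> (nat \<Rightarrow> int) set" where
  "tcells n = {k \<in> cells n N. \<exists>p<n. fst (cellaff n N c k) p \<noteq> 0}"

definition lsurf :: "nat \<Rightarrow> (nat \<Rightarrow> real) set \<Rightarrow> real \<Rightarrow> (nat \<Rightarrow> int) \<Rightarrow> (nat \<Rightarrow> real) measure" where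
  "lsurf n D \<theta> k = surf n (cellaff n N c k) (piv n k) (cell n N k \<inter> D) \<theta>"

lemma finite_tcells: "finite (tcells n)"
  unfolding tcells_def using finite_cells by simp

lemma piv:
  assumes "k \<in> tcells n"
  shows "piv n k < n" "fst (cellaff n N c k) (piv n k) \<noteq> 0"
proof -
  have "\<exists>p. p < n \<and> fst (cellaff n N c k) p \<noteq> 0" using assms by (auto simp: tcells_def)
  from someI_ex[OF this] show "piv n k < n" "fst (cellaff n N c k) (piv n k) \<noteq> 0"
    unfolding piv_def by auto
qed

lemma hausdorff_level:
  assumes \<theta>: "0 < \<theta>" and D: "closedin (Rn n) D" "D \<subseteq> box_Rn n 0 2" and X: "closedin (Rn n) X"
  shows "hausdorff_measure n (n - 1) ({x \<in> D. pot n N c x = \<theta>} \<inter> X) \<le> (\<Sum>k\<in>tcells n. emeasure (lsurf n D \<theta> k) X)"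
proof -
  let ?L = "\<lambda>k. {x \<in> cell n N k \<inter> D. aff n (cellaff n N c k) x = \<theta>} \<inter> X"
  have "{x \<in> D. pot n N c x = \<theta>} \<inter> X \<subseteq> (\<Union>k\<in>tcells n. ?L k)"
  proof
    fix x assume x: "x \<in> {x \<in> D. pot n N c x = \<theta>} \<inter> X"
    then obtain k where k: "k \<in> cells n N" "x \<in> cell n N k" using box_cells[OF N_pos, of x n] D(2) by blast
    have "\<exists>i<n. fst (cellaff n N c k) i \<noteq> 0" using cell_flat[OF k(2)] x \<theta>(1) by force
    then have "k \<in> tcells n" using k(1) by (simp add: tcells_def)
    moreover have "x \<in> ?L k" using x k(2) pot_on_cell[OF k(2), of c] by simp
    ultimately show "x \<in> (\<Union>k\<in>tcells n. ?L k)" by blast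
  qed
  then have "hausdorff_measure n (n - 1) ({x \<in> D. pot n N c x = \<theta>} \<inter> X) \<le> hausdorff_measure n (n - 1) (\<Union>k\<in>tcells n. ?L k)"
    by (rule hausdorff_measure_mono)
  also have "\<dots> \<le> (\<Sum>k\<in>tcells n. hausdorff_measure n (n - 1) (?L k))"
    by (rule hausdorff_measure_UN[OF finite_tcells])
  also have "\<dots> \<le> (\<Sum>k\<in>tcells n. emeasure (lsurf n D \<theta> k) X)"
  proof (rule sum_mono)
    fix k assume k: "k \<in> tcells n"
    have "cell n N k \<inter> D \<subseteq> box_Rn n 0 2" using D(2) by blast
    then show "hausdorff_measure n (n - 1) (?L k) \<le> emeasure (lsurf n D \<theta> k) X"
      unfolding lsurf_def by (intro hausdorff_measure_surf[OF piv[OF k] closedin_Int[OF closedin_cell D(1)] _ X])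
  qed
  finally show ?thesis .
qed

text \<open>Closed cells overlap only where some coordinate lies on the grid. Off this null set at
  most one cell contributes, with the gradient of the potential itself.\<close>

lemma sum_cells_gradnorm:
  "AE x in leb {..<n}. (\<Sum>k\<in>tcells n. ennreal (gradnorm n (cellaff n N c k)) * indicator (cell n N k) x) \<le> ennreal (potgrad n N c x)"
proof -
  have "countable (range (\<lambda>m::int. real_of_int m / real N))" by simp
  from AE_coord_neq[OF finite_lessThan this, of n] AE_space[of "leb {..<n}"]
  show ?thesis
  proof eventually_elim
    fix x assume x: "\<forall>i\<in>{..<n}. x i \<notin> range (\<lambda>m::int. real_of_int m / real N)" "x \<in> space (leb {..<n})"
    define k0 where "k0 = (\<lambda>i\<in>{..<n}. \<lfloor>real N * x i\<rfloor>)"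
    have xE: "x \<in> {..<n} \<rightarrow>\<^sub>E UNIV" using x(2) by (simp add: space_leb)
    have uniq: "k = k0" if k: "k \<in> tcells n" "x \<in> cell n N k" for k
    proof (rule extensionalityI[of _ "{..<n}"])
      show "k \<in> extensional {..<n}" using k(1) by (auto simp: tcells_def cells_def PiE_iff)
      show "k0 \<in> extensional {..<n}" by (simp add: k0_def)
      fix i assume i: "i \<in> {..<n}"
      have "real N * x i \<noteq> real_of_int (k i) + 1"
      proof
        assume "real N * x i = real_of_int (k i) + 1"
        then have "x i = real_of_int (k i + 1) / real N" using N_pos by (simp add: field_simps)
        then show False using x(1) i by blast
      qed
      moreover have "real_of_int (k i) \<le> real N * x i" "real N * x i \<le> real_of_int (k i) + 1"
        using k(2) i by (auto simp: cell_def)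
      ultimately have "\<lfloor>real N * x i\<rfloor> = k i" by (simp add: floor_eq_iff)
      then show "k i = k0 i" using i by (simp add: k0_def)
    qed
    have "(\<Sum>k\<in>tcells n. ennreal (gradnorm n (cellaff n N c k)) * indicator (cell n N k) x)
        \<le> (\<Sum>k\<in>tcells n. if k = k0 then ennreal (potgrad n N c x) else 0)"
    proof (rule sum_mono)
      fix k assume k: "k \<in> tcells n"
      show "ennreal (gradnorm n (cellaff n N c k)) * indicator (cell n N k) x \<le> (if k = k0 then ennreal (potgrad n N c x) else 0)"
      proof (cases "x \<in> cell n N k")
        case True
        then have k0: "k = k0" using uniq k by blast
        have "potgrad n N c x = gradnorm n (cellaff n N c k)"
          using xE by (intro potgrad_in_cell) (auto simp: k0 k0_def)
        then show ?thesis using k0 by (simp add: indicator_def)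
      qed simp
    qed
    also have "\<dots> \<le> ennreal (potgrad n N c x)" using finite_tcells by (simp add: sum.delta')
    finally show "(\<Sum>k\<in>tcells n. ennreal (gradnorm n (cellaff n N c k)) * indicator (cell n N k) x) \<le> ennreal (potgrad n N c x)" .
  qed
qed

lemma level_coarea:
  assumes D: "D \<in> sets (leb {..<n})" and u: "u \<in> borel_measurable (leb {..<n})" and r: "r \<in> borel_measurable borel"
  shows "(\<Sum>k\<in>tcells n. \<integral>\<^sup>+ \<theta>. r \<theta> * (\<integral>\<^sup>+ x. u x \<partial>lsurf n D \<theta> k) \<partial>lborel)
    \<le> (\<integral>\<^sup>+ x. (ennreal (potgrad n N c x) * u x * r (pot n N c x)) * indicator D x \<partial>leb {..<n})"
proof -
  note D[measurable] u[measurable] r[measurable]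
  have cm[measurable]: "cell n N k \<in> sets (leb {..<n})" for k
    by (rule closedin_prodtop_imp_measurable[OF finite_lessThan closedin_cell])
  have "(\<Sum>k\<in>tcells n. \<integral>\<^sup>+ \<theta>. r \<theta> * (\<integral>\<^sup>+ x. u x \<partial>lsurf n D \<theta> k) \<partial>lborel)
    = (\<Sum>k\<in>tcells n. \<integral>\<^sup>+ x. (ennreal (gradnorm n (cellaff n N c k)) * indicator (cell n N k) x) * (u x * r (pot n N c x) * indicator D x) \<partial>leb {..<n})"
  proof (rule sum.cong[OF refl])
    fix k assume k: "k \<in> tcells n"
    have "(\<integral>\<^sup>+ \<theta>. r \<theta> * (\<integral>\<^sup>+ x. u x \<partial>lsurf n D \<theta> k) \<partial>lborel)
      = (\<integral>\<^sup>+ x. ennreal (gradnorm n (cellaff n N c k)) * indicator (cell n N k \<inter> D) x * u x * r (aff n (cellaff n N c k) x) \<partial>leb {..<n})"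
      unfolding lsurf_def by (intro nn_integral_surf_coarea[OF piv[OF k] _ u r]) measurable
    also have "\<dots> = (\<integral>\<^sup>+ x. (ennreal (gradnorm n (cellaff n N c k)) * indicator (cell n N k) x) * (u x * r (pot n N c x) * indicator D x) \<partial>leb {..<n})"
    proof (rule nn_integral_cong)
      fix x
      show "ennreal (gradnorm n (cellaff n N c k)) * indicator (cell n N k \<inter> D) x * u x * r (aff n (cellaff n N c k) x)
        = (ennreal (gradnorm n (cellaff n N c k)) * indicator (cell n N k) x) * (u x * r (pot n N c x) * indicator D x)"
      proof (cases "x \<in> cell n N k")
        case True
        then show ?thesis using pot_on_cell[OF True, of c] by (cases "x \<in> D") (simp_all add: mult_ac)
      qed simp
    qed
    finally show "(\<integral>\<^sup>+ \<theta>. r \<theta> * (\<integral>\<^sup>+ x. u x \<partial>lsurf n D \<theta> k) \<partial>lborel) = \<dots>" .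
  qed
  also have "\<dots> = (\<integral>\<^sup>+ x. (\<Sum>k\<in>tcells n. (ennreal (gradnorm n (cellaff n N c k)) * indicator (cell n N k) x) * (u x * r (pot n N c x) * indicator D x)) \<partial>leb {..<n})"
    by (rule nn_integral_sum[symmetric]) measurable
  also have "\<dots> \<le> (\<integral>\<^sup>+ x. (ennreal (potgrad n N c x) * u x * r (pot n N c x)) * indicator D x \<partial>leb {..<n})"
  proof (rule nn_integral_mono_AE, rule eventually_mono[OF sum_cells_gradnorm])
    fix x assume le: "(\<Sum>k\<in>tcells n. ennreal (gradnorm n (cellaff n N c k)) * indicator (cell n N k) x) \<le> ennreal (potgrad n N c x)"
    have "(\<Sum>k\<in>tcells n. (ennreal (gradnorm n (cellaff n N c k)) * indicator (cell n N k) x) * (u x * r (pot n N c x) * indicator D x))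
      = (\<Sum>k\<in>tcells n. ennreal (gradnorm n (cellaff n N c k)) * indicator (cell n N k) x) * (u x * r (pot n N c x) * indicator D x)"
      by (rule sum_distrib_right[symmetric])
    also have "\<dots> \<le> ennreal (potgrad n N c x) * (u x * r (pot n N c x) * indicator D x)"
      using le by (rule mult_right_mono) simp
    finally show "(\<Sum>k\<in>tcells n. (ennreal (gradnorm n (cellaff n N c k)) * indicator (cell n N k) x) * (u x * r (pot n N c x) * indicator D x))
      \<le> (ennreal (potgrad n N c x) * u x * r (pot n N c x)) * indicator D x" by (simp only: mult.assoc)
  qed
  finally show ?thesis .
qed

end

text \<open>Used with \<open>t = 0\<close> for the starting body, and with the position of the peak
  for the inserted cube, so that \<open>tiling_nn_integral\<close> applies to the latter
  too.\<close>

lemma good_body_cube: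
  assumes t: "0 \<le> t" "t \<le> 1"
  shows "good_body n (box_Rn n t (t+1))"
proof -
  let ?C = "box_Rn n t (t+1)" and ?O = "{..<n} \<rightarrow>\<^sub>E {t<..<t+1}"
  have cl: "closedin (Rn n) ?C" by (simp add: closedin_product_topology)
  have CE: "?C \<subseteq> {..<n} \<rightarrow>\<^sub>E UNIV" by (rule PiE_mono) simp
  have OC: "?O \<subseteq> ?C" by (rule PiE_mono) auto
  have int: "Rn n interior_of ?C = ?O"
  proof
    show "?O \<subseteq> Rn n interior_of ?C" by (rule interior_of_maximal[OF OC obox_open])
    show "Rn n interior_of ?C \<subseteq> ?O"
    proof
      fix x assume x: "x \<in> Rn n interior_of ?C"
      obtain e where e: "e > 0" "\<forall>y\<in>{..<n} \<rightarrow>\<^sub>E UNIV. (\<forall>i\<in>{..<n}. \<bar>y i - x i\<bar> < e) \<longrightarrow> y \<in> ?C" and xE: "x \<in> {..<n} \<rightarrow>\<^sub>E UNIV"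
        using x unfolding in_interior_of_prodtop[OF finite_lessThan] by blast
      have in_C: "tr n (\<lambda>_. s) x \<in> ?C" if "\<bar>s\<bar> < e" for s
      proof -
        have "\<forall>i\<in>{..<n}. \<bar>tr n (\<lambda>_. s) x i - x i\<bar> < e" using that by (simp add: tr_def)
        then show ?thesis using e(2) tr_in[of n "\<lambda>_. s" x] by blast
      qed
      show "x \<in> ?O"
      proof
        fix i assume i: "i \<in> {..<n}"
        have "tr n (\<lambda>_. e / 2) x i \<in> {t..t+1}" "tr n (\<lambda>_. - e / 2) x i \<in> {t..t+1}"
          using PiE_mem[OF in_C i, of "e / 2"] PiE_mem[OF in_C i, of "- e / 2"] e(1) by auto
        then show "x i \<in> {t<..<t+1}" using i e(1) by (auto simp: tr_def)
      qed (use xE in \<open>auto simp: PiE_iff extensional_def\<close>)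
    qed
  qed
  have clo: "?C \<subseteq> Rn n closure_of ?O"
  proof
    fix x assume x: "x \<in> ?C"
    then have xE: "x \<in> {..<n} \<rightarrow>\<^sub>E UNIV" using CE by blast
    show "x \<in> Rn n closure_of ?O" unfolding in_closure_of_prodtop[OF finite_lessThan]
    proof (intro conjI allI impI)
      fix e :: real assume e: "e > 0"
      obtain d where d: "d > 0" "\<forall>s. \<bar>s\<bar> < d \<longrightarrow> (\<forall>i\<in>{..<n}. \<bar>seg n x (\<lambda>_. t + 1 / 2) s i - x i\<bar> < e)"
        using seg_near[OF e xE, of "\<lambda>_. t + 1 / 2"] by blast
      define s where "s = min (d / 2) 1"
      have s: "0 < s" "s \<le> 1" "\<bar>s\<bar> < d" using d(1) by (auto simp: s_def)
      have "seg n x (\<lambda>_. t + 1 / 2) s \<in> ?O"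
      proof
        fix i assume i: "i \<in> {..<n}"
        have xi: "t \<le> x i" "x i \<le> t + 1" using PiE_mem[OF x i] by auto
        have eq: "seg n x (\<lambda>_. t + 1 / 2) s i = t + ((1 - s) * (x i - t) + s * (1 / 2))"
          using i by (simp add: seg_def algebra_simps)
        have "0 < (1 - s) * (x i - t) + s * (1 / 2)" using s xi by (intro convex_comb_pos) auto
        moreover have "0 < (1 - s) * (t + 1 - x i) + s * (1 / 2)" using s xi by (intro convex_comb_pos) auto
        ultimately show "seg n x (\<lambda>_. t + 1 / 2) s i \<in> {t<..<t+1}" unfolding eq by (simp add: algebra_simps)
      qed (simp add: seg_def)
      then have "seg n x (\<lambda>_. t + 1 / 2) s \<in> ?O \<inter> ({..<n} \<rightarrow>\<^sub>E UNIV)" by simp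
      moreover have "\<forall>i\<in>{..<n}. \<bar>seg n x (\<lambda>_. t + 1 / 2) s i - x i\<bar> < e" using d(2) s(3) by blast
      ultimately show "\<exists>y\<in>?O \<inter> ({..<n} \<rightarrow>\<^sub>E UNIV). \<forall>i\<in>{..<n}. \<bar>y i - x i\<bar> < e" by blast
    qed (rule xE)
  qed
  have comp: "compactin (Rn n) ?C" by (simp add: compactin_PiE)
  have body: "body n ?C" unfolding body_def
  proof (intro conjI)
    show "?C \<noteq> {}" by (simp add: PiE_eq_empty_iff)
    show "Rn n closure_of (Rn n interior_of ?C) = ?C"
      unfolding int using clo closure_of_minimal[OF OC cl] by blast
  qed (rule comp)
  have cover: "(\<Union>z\<in>{..<n} \<rightarrow>\<^sub>E \<int>. translate_Rn n z ?C) = topspace (Rn n)"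
  proof
    show "(\<Union>z\<in>{..<n} \<rightarrow>\<^sub>E \<int>. translate_Rn n z ?C) \<subseteq> topspace (Rn n)"
      unfolding translate_Rn_tr by (intro UN_least image_subsetI) simp
    show "topspace (Rn n) \<subseteq> (\<Union>z\<in>{..<n} \<rightarrow>\<^sub>E \<int>. translate_Rn n z ?C)"
    proof
      fix x assume "x \<in> topspace (Rn n)"
      then have xE: "x \<in> {..<n} \<rightarrow>\<^sub>E UNIV" by simp
      define z where "z = (\<lambda>i\<in>{..<n}. real_of_int \<lfloor>x i - t\<rfloor>)"
      have "tr n (\<lambda>i\<in>{..<n}. - z i) x \<in> ?C"
      proof
        fix i assume i: "i \<in> {..<n}"
        have "tr n (\<lambda>i\<in>{..<n}. - z i) x i = x i - of_int \<lfloor>x i - t\<rfloor>" using i by (simp add: tr_def z_def)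
        moreover have "of_int \<lfloor>x i - t\<rfloor> \<le> x i - t" "x i - t \<le> of_int \<lfloor>x i - t\<rfloor> + 1" by linarith+
        ultimately show "tr n (\<lambda>i\<in>{..<n}. - z i) x i \<in> {t..t+1}" unfolding atLeastAtMost_iff by linarith
      qed (simp add: tr_def)
      then have "x \<in> tr n z ` ?C" using mem_tr_image[OF CE xE] by blast
      moreover have "z \<in> {..<n} \<rightarrow>\<^sub>E \<int>" by (simp add: z_def)
      ultimately show "x \<in> (\<Union>z\<in>{..<n} \<rightarrow>\<^sub>E \<int>. translate_Rn n z ?C)" unfolding translate_Rn_tr by blast
    qed
  qed
  have OE: "?O \<subseteq> {..<n} \<rightarrow>\<^sub>E UNIV" by (rule PiE_mono) simp
  have disj: "Rn n interior_of translate_Rn n z ?C \<inter> Rn n interior_of translate_Rn n w ?C = {}"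
    if zw: "z \<in> {..<n} \<rightarrow>\<^sub>E \<int>" "w \<in> {..<n} \<rightarrow>\<^sub>E \<int>" "z \<noteq> w" for z w
  proof (rule ccontr)
    assume "\<not> ?thesis"
    then obtain x where x: "x \<in> tr n z ` ?O" "x \<in> tr n w ` ?O"
      unfolding translate_Rn_tr interior_of_tr[OF CE] int by blast
    obtain u where "x = tr n z u" using x(1) by blast
    then have xE: "x \<in> {..<n} \<rightarrow>\<^sub>E UNIV" by (simp only: tr_in)
    show False using x obox_shift_unique[OF zw(1,2)] zw(3) unfolding mem_tr_image[OF OE xE] by blast
  qed
  have sym: "perm_symmetric n ?C"
    unfolding perm_symmetric_iff[OF CE] perm_closed_def by (intro allI impI ballI permute_in)
  have poly: "polyhedral_frontier n ?C" unfolding polyhedral_frontier_def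
  proof (intro exI[of _ "(\<lambda>(i, e). ((\<lambda>j. if j = i then 1 else 0), - e)) ` ({..<n} \<times> {t, t + 1})"] conjI)
    let ?H = "(\<lambda>(i, e). ((\<lambda>j. if j = i then 1 else 0), - e)) ` ({..<n} \<times> {t, t + 1}) :: ((nat \<Rightarrow> real) \<times> real) set"
    show "finite ?H" by simp
    show "\<forall>h\<in>?H. \<exists>i<n. fst h i \<noteq> 0" by auto
    show "Rn n frontier_of ?C \<subseteq> (\<Union>h\<in>?H. {x \<in> {..<n} \<rightarrow>\<^sub>E UNIV. aff n h x = 0})"
    proof
      fix x assume "x \<in> Rn n frontier_of ?C"
      then have x: "x \<in> ?C" "x \<notin> ?O" unfolding frontier_of_closed[OF cl] int by auto
      have "\<exists>i<n. x i \<notin> {t<..<t+1}" using x by (auto simp: PiE_iff)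
      then obtain i where i: "i < n" "x i \<notin> {t<..<t+1}" by blast
      then have e: "x i \<in> {t, t + 1}" using PiE_mem[OF x(1), of i] by auto
      let ?h = "((\<lambda>j. if j = i then 1 else 0), - x i) :: (nat \<Rightarrow> real) \<times> real"
      have "?h \<in> ?H" using i(1) e by (intro image_eqI[of _ _ "(i, x i)"]) auto
      moreover have "aff n ?h x = 0"
      proof -
        have "(\<Sum>j<n. (if j = i then 1 else 0) * x j) = (\<Sum>j<n. if j = i then x j else 0)" by (rule sum.cong) auto
        then show ?thesis using i(1) by simp
      qed
      moreover have "x \<in> {..<n} \<rightarrow>\<^sub>E UNIV" using x(1) CE by blast
      ultimately show "x \<in> (\<Union>h\<in>?H. {x \<in> {..<n} \<rightarrow>\<^sub>E UNIV. aff n h x = 0})" by blast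
    qed
  qed
  have "?C \<subseteq> box_Rn n 0 2" using t by (intro PiE_mono) auto
  moreover have "tiling_body n ?C"
    unfolding tiling_body_def by (intro conjI ballI impI body cover disj)
  ultimately show ?thesis unfolding good_body_def by (intro conjI sym poly)
qed

text \<open>The probability of \<open>\<theta> \<le> f\<close> for a random level \<open>\<theta>\<close> with density \<open>rho B\<close>.\<close>

definition surv :: "real \<Rightarrow> real \<Rightarrow> real" where
  "surv B f = (1 - exp (- min f B)) / (1 - exp (- B))"

lemma measurable_surv [measurable]: "surv B \<in> borel_measurable borel"
  unfolding surv_def[abs_def] by measurable

context profile
begin

definition klist :: "nat \<Rightarrow> (nat \<Rightarrow> int) list" where
  "klist n = (SOME xs. set xs = tcells n \<and> distinct xs)"

lemma klist: "set (klist n) = tcells n" "distinct (klist n)"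
proof -
  have "\<exists>xs. set xs = tcells n \<and> distinct xs" using finite_distinct_list[OF finite_tcells] by blast
  from someI_ex[OF this] show "set (klist n) = tcells n" "distinct (klist n)" unfolding klist_def by auto
qed

lemma sum_klist: "(\<Sum>k\<leftarrow>klist n. f k) = (\<Sum>k\<in>tcells n. f k)"
  using sum.distinct_set_conv_list[OF klist(2), of f n] klist(1) by simp

text \<open>The level set is entered once inside \<open>D\<close> and once inside the cube
  \<open>[t, t + 1]^n\<close>, because the closures of both parts of \<open>newE\<close> can reach
  it. This is the source of the factor \<open>2\<close> in \<open>average_weight\<close>.\<close>

definition newMs :: "nat \<Rightarrow> (nat \<Rightarrow> real) set \<Rightarrow> (nat \<Rightarrow> real) measure list \<Rightarrow> real \<Rightarrow> (nat \<Rightarrow> real) measure list" where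
  "newMs n D Ms \<theta> = map (\<lambda>M. density M (indicator {x \<in> {..<n} \<rightarrow>\<^sub>E UNIV. pot n N c x \<ge> \<theta>})) Ms
     @ map (lsurf n D \<theta>) (klist n) @ map (lsurf n (box_Rn n t (t+1)) \<theta>) (klist n)"

lemma area_bound_newD:
  assumes good: "good_body n D" and ab: "area_bound n D Ms" and \<theta>: "0 < \<theta>" "\<theta> < B"
  shows "area_bound n (newD n D \<theta>) (newMs n D Ms \<theta>)"
proof -
  let ?P = "{x \<in> {..<n} \<rightarrow>\<^sub>E UNIV. pot n N c x \<ge> \<theta>}" and ?C = "box_Rn n t (t+1)"
  have cl: "closedin (Rn n) D" by (rule good_body_closed[OF good])
  have D2: "D \<subseteq> box_Rn n 0 2" using good by (simp add: good_body_def)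
  have clC: "closedin (Rn n) ?C" by (simp add: closedin_product_topology)
  have C2: "?C \<subseteq> box_Rn n 0 2" using t by (intro PiE_mono) auto
  have clP: "closedin (Rn n) ?P" by (rule closedin_pot_ge)
  have Pm: "?P \<in> sets (leb {..<n})" by (rule closedin_prodtop_imp_measurable[OF finite_lessThan clP])
  have Dm: "D \<in> sets (leb {..<n})" by (rule closedin_prodtop_imp_measurable[OF finite_lessThan cl])
  have Cm: "?C \<in> sets (leb {..<n})" by (rule closedin_prodtop_imp_measurable[OF finite_lessThan clC])
  have cm: "cell n N k \<in> sets (leb {..<n})" for k
    by (rule closedin_prodtop_imp_measurable[OF finite_lessThan closedin_cell])
  have Ms: "sets M = sets (leb {..<n})" "finite_measure M" if "M \<in> set Ms" for M
    using ab that unfolding area_bound_def by auto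
  have fin_density: "finite_measure (density M (indicator ?P))" if M: "M \<in> set Ms" for M
  proof (rule finite_measureI)
    have P': "?P \<in> sets M" using Ms(1)[OF M] Pm by simp
    have "emeasure (density M (indicator ?P)) (space M) = (\<integral>\<^sup>+ x. indicator ?P x * indicator (space M) x \<partial>M)"
      using P' by (intro emeasure_density) auto
    also have "\<dots> \<le> (\<integral>\<^sup>+ x. 1 \<partial>M)" by (intro nn_integral_mono) (auto simp: indicator_def)
    also have "\<dots> < top" using finite_measure.emeasure_finite[OF Ms(2)[OF M]] by (simp add: less_top[symmetric])
    finally show "emeasure (density M (indicator ?P)) (space (density M (indicator ?P))) \<noteq> \<infinity>" by simp
  qed
  have fin_surf: "finite_measure (lsurf n S \<theta> k)" if "k \<in> tcells n" "S \<in> sets (leb {..<n})" "S \<subseteq> box_Rn n 0 2" for k S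
    unfolding lsurf_def using that cm
    by (intro finite_measure_surf[OF piv[OF that(1)], where a = 0 and b = 2]) auto
  show ?thesis unfolding area_bound_def
  proof (intro conjI ballI allI impI)
    fix M assume "M \<in> set (newMs n D Ms \<theta>)"
    then consider M' where "M' \<in> set Ms" "M = density M' (indicator ?P)"
      | k where "k \<in> tcells n" "M = lsurf n D \<theta> k" | k where "k \<in> tcells n" "M = lsurf n ?C \<theta> k"
      unfolding newMs_def using klist(1) by auto
    then show "sets M = sets (leb {..<n})" "finite_measure M"
      by (cases; use Ms fin_density fin_surf Dm Cm D2 C2 in \<open>simp add: lsurf_def[symmetric]\<close>; simp add: lsurf_def)+
  next
    fix X assume X: "closedin (Rn n) X"
    have Xm: "X \<in> sets (leb {..<n})" by (rule closedin_prodtop_imp_measurable[OF finite_lessThan X])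
    let ?H = "hausdorff_measure n (n - 1)"
    have "?H (Rn n frontier_of newD n D \<theta> \<inter> X) \<le>
      ?H (Rn n frontier_of D \<inter> (?P \<inter> X) \<union> ({x \<in> D. pot n N c x = \<theta>} \<inter> X \<union> {x \<in> ?C. pot n N c x = \<theta>} \<inter> X))"
      using good_body_newD(2)[OF good \<theta>] by (intro hausdorff_measure_mono) blast
    also have "\<dots> \<le> ?H (Rn n frontier_of D \<inter> (?P \<inter> X)) + (?H ({x \<in> D. pot n N c x = \<theta>} \<inter> X) + ?H ({x \<in> ?C. pot n N c x = \<theta>} \<inter> X))"
      by (rule order_trans[OF hausdorff_measure_Un add_left_mono[OF hausdorff_measure_Un]])
    also have "\<dots> \<le> (\<Sum>M\<leftarrow>Ms. emeasure M (?P \<inter> X)) + ((\<Sum>k\<in>tcells n. emeasure (lsurf n D \<theta> k) X) + (\<Sum>k\<in>tcells n. emeasure (lsurf n ?C \<theta> k) X))"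
    proof (intro add_mono)
      show "?H (Rn n frontier_of D \<inter> (?P \<inter> X)) \<le> (\<Sum>M\<leftarrow>Ms. emeasure M (?P \<inter> X))"
        using ab closedin_Int[OF clP X] unfolding area_bound_def by blast
    qed (rule hausdorff_level[OF \<theta>(1) cl D2 X], rule hausdorff_level[OF \<theta>(1) clC C2 X])
    also have "(\<Sum>M\<leftarrow>Ms. emeasure M (?P \<inter> X)) = (\<Sum>M\<leftarrow>Ms. emeasure (density M (indicator ?P)) X)"
    proof (rule arg_cong[where f = sum_list], rule map_cong[OF refl])
      fix M assume M: "M \<in> set Ms"
      have m: "?P \<in> sets M" "X \<in> sets M" using Ms(1)[OF M] Pm Xm by simp_all
      then have "emeasure (density M (indicator ?P)) X = (\<integral>\<^sup>+ x. indicator ?P x * indicator X x \<partial>M)"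
        by (intro emeasure_density) auto
      also have "\<dots> = (\<integral>\<^sup>+ x. indicator (?P \<inter> X) x \<partial>M)" by (simp only: indicator_inter_arith)
      also have "\<dots> = emeasure M (?P \<inter> X)" using m by (intro nn_integral_indicator) auto
      finally show "emeasure M (?P \<inter> X) = emeasure (density M (indicator ?P)) X" by simp
    qed
    also have "(\<Sum>M\<leftarrow>Ms. emeasure (density M (indicator ?P)) X) + ((\<Sum>k\<in>tcells n. emeasure (lsurf n D \<theta> k) X) + (\<Sum>k\<in>tcells n. emeasure (lsurf n ?C \<theta> k) X))
      = (\<Sum>M\<leftarrow>newMs n D Ms \<theta>. emeasure M X)"
      by (simp add: newMs_def o_def sum_klist)
    finally show "?H (Rn n frontier_of newD n D \<theta> \<inter> X) \<le> (\<Sum>M\<leftarrow>newMs n D Ms \<theta>. emeasure M X)" .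
  qed
qed

lemma weight_newMs:
  assumes Ms: "\<And>M. M \<in> set Ms \<Longrightarrow> sets M = sets (leb {..<n})" and h: "h \<in> borel_measurable (leb {..<n})"
  shows "weight (newMs n D Ms \<theta>) h = (\<Sum>M\<leftarrow>Ms. \<integral>\<^sup>+ x. h x * indicator {\<theta>..} (pot n N c x) \<partial>M)
    + ((\<Sum>k\<in>tcells n. \<integral>\<^sup>+ x. h x \<partial>lsurf n D \<theta> k) + (\<Sum>k\<in>tcells n. \<integral>\<^sup>+ x. h x \<partial>lsurf n (box_Rn n t (t+1)) \<theta> k))"
proof -
  let ?P = "{x \<in> {..<n} \<rightarrow>\<^sub>E UNIV. pot n N c x \<ge> \<theta>}"
  have Pm: "?P \<in> sets (leb {..<n})" by (rule closedin_prodtop_imp_measurable[OF finite_lessThan closedin_pot_ge])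
  have "(\<integral>\<^sup>+ x. h x \<partial>density M (indicator ?P)) = (\<integral>\<^sup>+ x. h x * indicator {\<theta>..} (pot n N c x) \<partial>M)" if M: "M \<in> set Ms" for M
  proof -
    have sp: "space M = {..<n} \<rightarrow>\<^sub>E UNIV" using sets_eq_imp_space_eq[OF Ms[OF M]] by (simp add: space_leb)
    have "?P \<in> sets M" using Pm Ms[OF M] by simp
    moreover have "h \<in> borel_measurable M" using h by (simp only: measurable_cong_sets[OF Ms[OF M] refl])
    ultimately have "(\<integral>\<^sup>+ x. h x \<partial>density M (indicator ?P)) = (\<integral>\<^sup>+ x. indicator ?P x * h x \<partial>M)"
      by (intro nn_integral_density) auto
    also have "\<dots> = (\<integral>\<^sup>+ x. h x * indicator {\<theta>..} (pot n N c x) \<partial>M)"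
      by (rule nn_integral_cong) (simp add: sp indicator_def)
    finally show ?thesis .
  qed
  then have "(\<Sum>M\<leftarrow>Ms. \<integral>\<^sup>+ x. h x \<partial>density M (indicator ?P)) = (\<Sum>M\<leftarrow>Ms. \<integral>\<^sup>+ x. h x * indicator {\<theta>..} (pot n N c x) \<partial>M)"
    by (intro arg_cong[where f = sum_list] map_cong) auto
  then show ?thesis by (simp add: weight_def newMs_def o_def sum_klist)
qed

text \<open>By Fubini an old wall at \<open>x\<close> receives the probability \<open>surv\<close>
  that \<open>\<theta>\<close> is at most the potential at \<open>x\<close>, and
  \<open>level_coarea\<close> bounds the new walls. The integrand there is periodic, so
  \<open>D\<close> and the cube \<open>[t, t + 1]^n\<close> both yield the integral over the unit
  cube.\<close>

lemma average_weight:
  assumes B: "B > 0" and good: "good_body n D" and ab: "area_bound n D Ms"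
    and h: "h \<in> borel_measurable (leb {..<n})" and per: "periodic_Rn n h"
  shows "(\<lambda>\<theta>. weight (newMs n D Ms \<theta>) h) \<in> borel_measurable borel"
    and "(\<integral>\<^sup>+ \<theta>. ennreal (rho B \<theta>) * weight (newMs n D Ms \<theta>) h \<partial>lborel) \<le>
      weight Ms (\<lambda>x. h x * ennreal (surv B (pot n N c x)))
      + 2 * (\<integral>\<^sup>+ x. h x * ennreal (potgrad n N c x * rho B (pot n N c x)) * indicator (box_Rn n 0 1) x \<partial>leb {..<n})"
proof -
  let ?C = "box_Rn n t (t+1)"
  have cl: "closedin (Rn n) D" by (rule good_body_closed[OF good])
  have clC: "closedin (Rn n) ?C" by (simp add: closedin_product_topology)
  have Dm: "D \<in> sets (leb {..<n})" by (rule closedin_prodtop_imp_measurable[OF finite_lessThan cl])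
  have Cm: "?C \<in> sets (leb {..<n})" by (rule closedin_prodtop_imp_measurable[OF finite_lessThan clC])
  have cm: "cell n N k \<in> sets (leb {..<n})" for k
    by (rule closedin_prodtop_imp_measurable[OF finite_lessThan closedin_cell])
  have Ms: "sets M = sets (leb {..<n})" "finite_measure M" if "M \<in> set Ms" for M
    using ab that unfolding area_bound_def by auto
  have surfm: "(\<lambda>\<theta>. \<integral>\<^sup>+ x. h x \<partial>lsurf n S \<theta> k) \<in> borel_measurable borel" if "k \<in> tcells n" "S \<in> sets (leb {..<n})" for k S
    unfolding lsurf_def using that cm h piv[OF that(1)] by (intro measurable_nn_integral_surf) auto
  have joint: "(\<lambda>(\<theta>, x). h x * indicator {\<theta>..} (pot n N c x)) \<in> borel_measurable (borel \<Otimes>\<^sub>M M)" if M: "M \<in> set Ms" for M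
  proof -
    have h': "h \<in> borel_measurable M" "pot n N c \<in> borel_measurable M"
      using h measurable_pot[of n N c] by (simp_all only: measurable_cong_sets[OF Ms(1)[OF M] refl])
    have "(\<lambda>p. h (snd p) * (if fst p \<le> pot n N c (snd p) then 1 else 0)) \<in> borel_measurable (borel \<Otimes>\<^sub>M M)"
      using measurable_compose[OF measurable_snd h'(1)] measurable_compose[OF measurable_snd h'(2)] by measurable
    moreover have "(\<lambda>(\<theta>, x). h x * indicator {\<theta>..} (pot n N c x)) = (\<lambda>p. h (snd p) * (if fst p \<le> pot n N c (snd p) then 1 else 0))"
      by (auto simp: fun_eq_iff indicator_def)
    ultimately show ?thesis by simp
  qed
  have Mm: "(\<lambda>\<theta>. \<integral>\<^sup>+ x. h x * indicator {\<theta>..} (pot n N c x) \<partial>M) \<in> borel_measurable borel" if M: "M \<in> set Ms" for M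
    using sigma_finite_measure.borel_measurable_nn_integral[OF finite_measure.axioms(1)[OF Ms(2)[OF M]] joint[OF M]] .
  have wn: "weight (newMs n D Ms \<theta>) h = (\<Sum>M\<leftarrow>Ms. \<integral>\<^sup>+ x. h x * indicator {\<theta>..} (pot n N c x) \<partial>M)
    + ((\<Sum>k\<in>tcells n. \<integral>\<^sup>+ x. h x \<partial>lsurf n D \<theta> k) + (\<Sum>k\<in>tcells n. \<integral>\<^sup>+ x. h x \<partial>lsurf n ?C \<theta> k))" for \<theta>
    by (rule weight_newMs[OF Ms(1) h])
  show meas: "(\<lambda>\<theta>. weight (newMs n D Ms \<theta>) h) \<in> borel_measurable borel"
    unfolding wn using surfm[OF _ Dm] surfm[OF _ Cm] Mm
    by (intro borel_measurable_add measurable_sum_list borel_measurable_sum) auto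
  let ?r = "\<lambda>\<theta>. ennreal (rho B \<theta>)"
  have "(\<integral>\<^sup>+ \<theta>. ?r \<theta> * weight (newMs n D Ms \<theta>) h \<partial>lborel) =
    (\<integral>\<^sup>+ \<theta>. (\<Sum>M\<leftarrow>Ms. ?r \<theta> * (\<integral>\<^sup>+ x. h x * indicator {\<theta>..} (pot n N c x) \<partial>M))
      + ((\<Sum>k\<in>tcells n. ?r \<theta> * (\<integral>\<^sup>+ x. h x \<partial>lsurf n D \<theta> k)) + (\<Sum>k\<in>tcells n. ?r \<theta> * (\<integral>\<^sup>+ x. h x \<partial>lsurf n ?C \<theta> k))) \<partial>lborel)"
    unfolding wn by (simp only: distrib_left sum_distrib_left sum_list_mult_left)
  also have "\<dots> = (\<Sum>M\<leftarrow>Ms. \<integral>\<^sup>+ \<theta>. ?r \<theta> * (\<integral>\<^sup>+ x. h x * indicator {\<theta>..} (pot n N c x) \<partial>M) \<partial>lborel)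
      + ((\<Sum>k\<in>tcells n. \<integral>\<^sup>+ \<theta>. ?r \<theta> * (\<integral>\<^sup>+ x. h x \<partial>lsurf n D \<theta> k) \<partial>lborel)
      + (\<Sum>k\<in>tcells n. \<integral>\<^sup>+ \<theta>. ?r \<theta> * (\<integral>\<^sup>+ x. h x \<partial>lsurf n ?C \<theta> k) \<partial>lborel))"
  proof -
    have m1: "(\<lambda>\<theta>. ?r \<theta> * (\<integral>\<^sup>+ x. h x * indicator {\<theta>..} (pot n N c x) \<partial>M)) \<in> borel_measurable lborel" if "M \<in> set Ms" for M
      using Mm[OF that] by measurable
    have m2: "(\<lambda>\<theta>. ?r \<theta> * (\<integral>\<^sup>+ x. h x \<partial>lsurf n D \<theta> k)) \<in> borel_measurable lborel" if "k \<in> tcells n" for k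
      using surfm[OF that Dm] by measurable
    have m3: "(\<lambda>\<theta>. ?r \<theta> * (\<integral>\<^sup>+ x. h x \<partial>lsurf n ?C \<theta> k)) \<in> borel_measurable lborel" if "k \<in> tcells n" for k
      using surfm[OF that Cm] by measurable
    have s1: "(\<lambda>\<theta>. \<Sum>M\<leftarrow>Ms. ?r \<theta> * (\<integral>\<^sup>+ x. h x * indicator {\<theta>..} (pot n N c x) \<partial>M)) \<in> borel_measurable lborel"
      by (rule measurable_sum_list) (rule m1)
    have s2: "(\<lambda>\<theta>. \<Sum>k\<in>tcells n. ?r \<theta> * (\<integral>\<^sup>+ x. h x \<partial>lsurf n D \<theta> k)) \<in> borel_measurable lborel"
      by (rule borel_measurable_sum) (rule m2)
    have s3: "(\<lambda>\<theta>. \<Sum>k\<in>tcells n. ?r \<theta> * (\<integral>\<^sup>+ x. h x \<partial>lsurf n ?C \<theta> k)) \<in> borel_measurable lborel"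
      by (rule borel_measurable_sum) (rule m3)
    have e1: "(\<integral>\<^sup>+ \<theta>. (\<Sum>M\<leftarrow>Ms. ?r \<theta> * (\<integral>\<^sup>+ x. h x * indicator {\<theta>..} (pot n N c x) \<partial>M)) \<partial>lborel)
        = (\<Sum>M\<leftarrow>Ms. \<integral>\<^sup>+ \<theta>. ?r \<theta> * (\<integral>\<^sup>+ x. h x * indicator {\<theta>..} (pot n N c x) \<partial>M) \<partial>lborel)"
      by (rule nn_integral_sum_list) (rule m1)
    have e2: "(\<integral>\<^sup>+ \<theta>. (\<Sum>k\<in>tcells n. ?r \<theta> * (\<integral>\<^sup>+ x. h x \<partial>lsurf n D \<theta> k)) \<partial>lborel)
        = (\<Sum>k\<in>tcells n. \<integral>\<^sup>+ \<theta>. ?r \<theta> * (\<integral>\<^sup>+ x. h x \<partial>lsurf n D \<theta> k) \<partial>lborel)"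
      by (rule nn_integral_sum) (rule m2)
    have e3: "(\<integral>\<^sup>+ \<theta>. (\<Sum>k\<in>tcells n. ?r \<theta> * (\<integral>\<^sup>+ x. h x \<partial>lsurf n ?C \<theta> k)) \<partial>lborel)
        = (\<Sum>k\<in>tcells n. \<integral>\<^sup>+ \<theta>. ?r \<theta> * (\<integral>\<^sup>+ x. h x \<partial>lsurf n ?C \<theta> k) \<partial>lborel)"
      by (rule nn_integral_sum) (rule m3)
    show ?thesis
      unfolding nn_integral_add[OF s1 borel_measurable_add[OF s2 s3]] nn_integral_add[OF s2 s3] e1 e2 e3 ..
  qed
  also have "(\<Sum>M\<leftarrow>Ms. \<integral>\<^sup>+ \<theta>. ?r \<theta> * (\<integral>\<^sup>+ x. h x * indicator {\<theta>..} (pot n N c x) \<partial>M) \<partial>lborel)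
      = weight Ms (\<lambda>x. h x * ennreal (surv B (pot n N c x)))"
    unfolding weight_def
  proof (rule arg_cong[where f = sum_list], rule map_cong[OF refl])
    fix M assume M: "M \<in> set Ms"
    interpret pair_sigma_finite "lborel :: real measure" M
      by (rule pair_sigma_finite.intro[OF sigma_finite_lborel finite_measure.axioms(1)[OF Ms(2)[OF M]]])
    have h': "h \<in> borel_measurable M" "pot n N c \<in> borel_measurable M"
      using h measurable_pot[of n N c] by (simp_all only: measurable_cong_sets[OF Ms(1)[OF M] refl])
    have j: "(\<lambda>(\<theta>, x). ?r \<theta> * (h x * indicator {\<theta>..} (pot n N c x))) \<in> borel_measurable (lborel \<Otimes>\<^sub>M M)"
    proof -
      have "(\<lambda>(\<theta>, x). h x * indicator {\<theta>..} (pot n N c x)) \<in> borel_measurable (lborel \<Otimes>\<^sub>M M)"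
        using joint[OF M] measurable_cong_sets[OF sets_pair_measure_cong[OF sets_lborel refl], of borel borel M] by simp
      then have "(\<lambda>p. ?r (fst p) * (case p of (\<theta>, x) \<Rightarrow> h x * indicator {\<theta>..} (pot n N c x))) \<in> borel_measurable (lborel \<Otimes>\<^sub>M M)"
        by measurable
      then show ?thesis by (simp only: split_def)
    qed
    have "(\<integral>\<^sup>+ \<theta>. ?r \<theta> * (\<integral>\<^sup>+ x. h x * indicator {\<theta>..} (pot n N c x) \<partial>M) \<partial>lborel)
      = (\<integral>\<^sup>+ \<theta>. \<integral>\<^sup>+ x. ?r \<theta> * (h x * indicator {\<theta>..} (pot n N c x)) \<partial>M \<partial>lborel)"
    proof (rule nn_integral_cong)
      fix \<theta>
      have "(\<lambda>x. h x * indicator {\<theta>..} (pot n N c x)) \<in> borel_measurable M" using h' by measurable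
      then show "?r \<theta> * (\<integral>\<^sup>+ x. h x * indicator {\<theta>..} (pot n N c x) \<partial>M) = (\<integral>\<^sup>+ x. ?r \<theta> * (h x * indicator {\<theta>..} (pot n N c x)) \<partial>M)"
        by (rule nn_integral_cmult[symmetric])
    qed
    also have "\<dots> = (\<integral>\<^sup>+ x. \<integral>\<^sup>+ \<theta>. ?r \<theta> * (h x * indicator {\<theta>..} (pot n N c x)) \<partial>lborel \<partial>M)"
      using Fubini'[OF j] by simp
    also have "\<dots> = (\<integral>\<^sup>+ x. h x * ennreal (surv B (pot n N c x)) \<partial>M)"
    proof (rule nn_integral_cong)
      fix x
      have "(\<integral>\<^sup>+ \<theta>. ?r \<theta> * (h x * indicator {\<theta>..} (pot n N c x)) \<partial>lborel)
        = (\<integral>\<^sup>+ \<theta>. h x * (?r \<theta> * indicator {..pot n N c x} \<theta>) \<partial>lborel)"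
        by (rule nn_integral_cong) (simp add: indicator_def mult_ac)
      also have "\<dots> = h x * (\<integral>\<^sup>+ \<theta>. ?r \<theta> * indicator {..pot n N c x} \<theta> \<partial>lborel)"
        by (rule nn_integral_cmult) measurable
      also have "\<dots> = h x * ennreal (surv B (pot n N c x))"
        unfolding nn_integral_rho_upto[OF B pot_nonneg] surv_def ..
      finally show "(\<integral>\<^sup>+ \<theta>. ?r \<theta> * (h x * indicator {\<theta>..} (pot n N c x)) \<partial>lborel) = h x * ennreal (surv B (pot n N c x))" .
    qed
    finally show "(\<integral>\<^sup>+ \<theta>. ?r \<theta> * (\<integral>\<^sup>+ x. h x * indicator {\<theta>..} (pot n N c x) \<partial>M) \<partial>lborel) = (\<integral>\<^sup>+ x. h x * ennreal (surv B (pot n N c x)) \<partial>M)" .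
  qed
  also have "weight Ms (\<lambda>x. h x * ennreal (surv B (pot n N c x))) + ((\<Sum>k\<in>tcells n. \<integral>\<^sup>+ \<theta>. ?r \<theta> * (\<integral>\<^sup>+ x. h x \<partial>lsurf n D \<theta> k) \<partial>lborel)
      + (\<Sum>k\<in>tcells n. \<integral>\<^sup>+ \<theta>. ?r \<theta> * (\<integral>\<^sup>+ x. h x \<partial>lsurf n ?C \<theta> k) \<partial>lborel))
      \<le> weight Ms (\<lambda>x. h x * ennreal (surv B (pot n N c x))) + 2 * (\<integral>\<^sup>+ x. h x * ennreal (potgrad n N c x * rho B (pot n N c x)) * indicator (box_Rn n 0 1) x \<partial>leb {..<n})"
  proof (rule add_left_mono)
    define v where "v x = ennreal (potgrad n N c x) * h x * ?r (pot n N c x)" for x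
    have rm: "(\<lambda>\<theta>. ?r \<theta>) \<in> borel_measurable borel" by measurable
    have vm: "v \<in> borel_measurable (leb {..<n})" unfolding v_def[abs_def] using h by measurable
    have vp: "periodic_Rn n v"
      using per pot_periodic[of n] potgrad_periodic[of n] unfolding periodic_Rn_def v_def by simp
    have bound: "(\<Sum>k\<in>tcells n. \<integral>\<^sup>+ \<theta>. ?r \<theta> * (\<integral>\<^sup>+ x. h x \<partial>lsurf n S \<theta> k) \<partial>lborel) \<le> (\<integral>\<^sup>+ x. v x * indicator (box_Rn n 0 1) x \<partial>leb {..<n})"
      if S: "good_body n S" for S
    proof -
      have Sm: "S \<in> sets (leb {..<n})" by (rule closedin_prodtop_imp_measurable[OF finite_lessThan good_body_closed[OF S]])
      have "(\<Sum>k\<in>tcells n. \<integral>\<^sup>+ \<theta>. ?r \<theta> * (\<integral>\<^sup>+ x. h x \<partial>lsurf n S \<theta> k) \<partial>lborel) \<le> (\<integral>\<^sup>+ x. v x * indicator S x \<partial>leb {..<n})"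
        unfolding v_def by (rule level_coarea[OF Sm h rm])
      also have "\<dots> = (\<integral>\<^sup>+ x. v x * indicator (box_Rn n 0 1) x \<partial>leb {..<n})"
        using S by (intro tiling_nn_integral good_body_null vm vp) (auto simp: good_body_def)
      finally show ?thesis .
    qed
    have "v x = h x * ennreal (potgrad n N c x * rho B (pot n N c x))" for x
      by (simp add: v_def ennreal_mult rho_nonneg potgrad_def sum_nonneg mult_ac)
    then have veq: "v = (\<lambda>x. h x * ennreal (potgrad n N c x * rho B (pot n N c x)))" by blast
    have "(\<Sum>k\<in>tcells n. \<integral>\<^sup>+ \<theta>. ?r \<theta> * (\<integral>\<^sup>+ x. h x \<partial>lsurf n D \<theta> k) \<partial>lborel)
      + (\<Sum>k\<in>tcells n. \<integral>\<^sup>+ \<theta>. ?r \<theta> * (\<integral>\<^sup>+ x. h x \<partial>lsurf n ?C \<theta> k) \<partial>lborel)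
      \<le> (\<integral>\<^sup>+ x. v x * indicator (box_Rn n 0 1) x \<partial>leb {..<n}) + (\<integral>\<^sup>+ x. v x * indicator (box_Rn n 0 1) x \<partial>leb {..<n})"
      by (intro add_mono bound good good_body_cube t)
    then show "(\<Sum>k\<in>tcells n. \<integral>\<^sup>+ \<theta>. ?r \<theta> * (\<integral>\<^sup>+ x. h x \<partial>lsurf n D \<theta> k) \<partial>lborel)
      + (\<Sum>k\<in>tcells n. \<integral>\<^sup>+ \<theta>. ?r \<theta> * (\<integral>\<^sup>+ x. h x \<partial>lsurf n ?C \<theta> k) \<partial>lborel)
      \<le> 2 * (\<integral>\<^sup>+ x. h x * ennreal (potgrad n N c x * rho B (pot n N c x)) * indicator (box_Rn n 0 1) x \<partial>leb {..<n})" unfolding mult_2 veq .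
  qed
  finally show "(\<integral>\<^sup>+ \<theta>. ?r \<theta> * weight (newMs n D Ms \<theta>) h \<partial>lborel) \<le>
      weight Ms (\<lambda>x. h x * ennreal (surv B (pot n N c x)))
      + 2 * (\<integral>\<^sup>+ x. h x * ennreal (potgrad n N c x * rho B (pot n N c x)) * indicator (box_Rn n 0 1) x \<partial>leb {..<n})" .
qed

end

lemma weight_cmult:
  assumes "f \<in> borel_measurable (leb {..<n})" "\<And>M. M \<in> set Ms \<Longrightarrow> sets M = sets (leb {..<n})"
  shows "weight Ms (\<lambda>x. r * f x) = r * weight Ms f"
  unfolding weight_def sum_list_mult_left
proof (intro arg_cong[where f = sum_list] map_cong refl)
  fix M assume "M \<in> set Ms"
  then have "f \<in> borel_measurable M" using assms measurable_cong_sets[OF assms(2) refl, of M borel] by auto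
  then show "(\<integral>\<^sup>+ x. r * f x \<partial>M) = r * (\<integral>\<^sup>+ x. f x \<partial>M)" by (rule nn_integral_cmult)
qed

lemma weight_sum:
  assumes "\<And>l. l < m \<Longrightarrow> f l \<in> borel_measurable (leb {..<n})" "\<And>M. M \<in> set Ms \<Longrightarrow> sets M = sets (leb {..<n})"
  shows "weight Ms (\<lambda>x. \<Sum>l<m. f l x) = (\<Sum>l<m. weight Ms (f l))"
  using assms(2)
proof (induction Ms)
  case Nil
  then show ?case by (simp add: weight_def)
next
  case (Cons M Ms)
  have "sets M = sets (leb {..<n})" using Cons.prems by simp
  then have "f l \<in> borel_measurable M" if "l < m" for l
    using assms(1)[OF that] measurable_cong_sets[of M "leb {..<n}" borel borel] by auto
  then have "(\<integral>\<^sup>+ x. (\<Sum>l<m. f l x) \<partial>M) = (\<Sum>l<m. \<integral>\<^sup>+ x. f l x \<partial>M)" by (intro nn_integral_sum) auto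
  moreover have "weight Ms (\<lambda>x. \<Sum>l<m. f l x) = (\<Sum>l<m. weight Ms (f l))" using Cons by auto
  ultimately show ?case by (simp add: weight_def sum.distrib)
qed

section \<open>The faces of the unit cube as the initial walls\<close>

definition face :: "nat \<Rightarrow> nat \<Rightarrow> real \<Rightarrow> (nat \<Rightarrow> real) measure" where
  "face n i e = surf n ((\<lambda>j. if j = i then 1 else 0), - e) i (box_Rn n 0 1) 0"

definition faces0 :: "nat \<Rightarrow> (nat \<Rightarrow> real) measure list" where
  "faces0 n = concat (map (\<lambda>i. [face n i 0, face n i 1]) [0..<n])"

lemma aff_face:
  assumes "i < n"
  shows "aff n ((\<lambda>j. if j = i then 1 else 0), - e) x = x i - e"
proof -
  have "(\<Sum>j<n. (if j = i then 1 else 0) * x j) = (\<Sum>j<n. if j = i then x j else 0)" by (rule sum.cong) auto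
  then show ?thesis using assms by simp
qed

lemma nn_integral_face:
  assumes i: "i < n" and u: "u \<in> borel_measurable (leb {..<n})" and e: "e \<in> {0, 1}"
  shows "(\<integral>\<^sup>+ x. u x \<partial>face n i e) = (\<integral>\<^sup>+ y. indicator ({..<n} - {i} \<rightarrow>\<^sub>E {0..1}) y * u (y(i := e)) \<partial>leb ({..<n} - {i}))"
proof -
  have bm: "box_Rn n 0 1 \<in> sets (leb {..<n})" by (intro sets_PiM_I_finite) auto
  have "(\<Sum>j<n. (if j = i then 1 else 0 :: real)\<^sup>2) = (\<Sum>j<n. if j = i then 1 else 0)" by (rule sum.cong) auto
  then have gn: "gradnorm n ((\<lambda>j. if j = i then 1 else 0), - e) = 1" using i by (simp add: gradnorm_def)
  have "(\<Sum>j\<in>{..<n} - {i}. (if j = i then 1 else 0) * y j) = 0" for y :: "nat \<Rightarrow> real" by (rule sum.neutral) auto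
  then have ga: "graph_at n ((\<lambda>j. if j = i then 1 else 0), - e) i 0 y = y(i := e)" for y
    by (simp add: graph_at_def)
  show ?thesis unfolding face_def nn_integral_surf[OF i bm u] ga gn
  proof (rule nn_integral_cong)
    fix y assume y: "y \<in> space (leb ({..<n} - {i}))"
    have "y(i := e) \<in> box_Rn n 0 1 \<longleftrightarrow> y \<in> {..<n} - {i} \<rightarrow>\<^sub>E {0..1}"
    proof
      assume b: "y(i := e) \<in> box_Rn n 0 1"
      show "y \<in> {..<n} - {i} \<rightarrow>\<^sub>E {0..1}"
      proof
        fix j assume j: "j \<in> {..<n} - {i}"
        then show "y j \<in> {0..1}" using PiE_mem[OF b, of j] by auto
      qed (use y in \<open>auto simp: space_leb PiE_iff extensional_def\<close>)
    next
      assume b: "y \<in> {..<n} - {i} \<rightarrow>\<^sub>E {0..1}"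
      show "y(i := e) \<in> box_Rn n 0 1"
      proof
        fix j assume "j \<in> {..<n}"
        then show "(y(i := e)) j \<in> {0..1}" using PiE_mem[OF b, of j] e by (cases "j = i") auto
      next
        fix j assume "j \<notin> {..<n}"
        then show "(y(i := e)) j = undefined" using b i by (auto simp: PiE_iff extensional_def)
      qed
    qed
    then show "ennreal (1 / \<bar>fst ((\<lambda>j. if j = i then 1 else 0), - e) i\<bar>) * indicator (box_Rn n 0 1) (y(i := e)) * u (y(i := e))
      = indicator ({..<n} - {i} \<rightarrow>\<^sub>E {0..1}) y * u (y(i := e))"
      by (simp add: indicator_def)
  qed
qed

lemma set_faces0: "set (faces0 n) = (\<lambda>(i, e). face n i e) ` ({..<n} \<times> {0, 1})"
  unfolding faces0_def by (auto simp: image_iff)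

lemma sum_list_faces0: "(\<Sum>M\<leftarrow>faces0 n. f M) = (\<Sum>i<n. f (face n i 0) + f (face n i 1))" for f :: "_ \<Rightarrow> ennreal"
proof -
  have "(\<Sum>M\<leftarrow>concat (map (\<lambda>i. [face n i 0, face n i 1]) [0..<k]). f M) = (\<Sum>i<k. f (face n i 0) + f (face n i 1))" for k
    by (induction k) (auto simp: add.assoc)
  then show ?thesis by (simp add: faces0_def)
qed

lemma area_bound_cube: "area_bound n (box_Rn n 0 1) (faces0 n)"
  unfolding area_bound_def
proof (intro conjI ballI allI impI)
  have cl: "closedin (Rn n) (box_Rn n 0 1)" by (simp add: closedin_product_topology)
  have bm: "box_Rn n 0 1 \<in> sets (leb {..<n})" by (intro sets_PiM_I_finite) auto
  fix M assume "M \<in> set (faces0 n)"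
  then obtain i e where ie: "i < n" "M = face n i e" unfolding set_faces0 by auto
  show "sets M = sets (leb {..<n})" unfolding ie face_def by simp
  show "finite_measure M" unfolding ie face_def
    by (rule finite_measure_surf[OF ie(1) _ bm order_refl]) simp
next
  fix X assume X: "closedin (Rn n) X"
  have cl: "closedin (Rn n) (box_Rn n 0 1)" by (simp add: closedin_product_topology)
  let ?F = "\<lambda>(i, e). {x \<in> box_Rn n 0 1. aff n ((\<lambda>j. if j = i then 1 else 0), - e) x = 0} \<inter> X"
  have "Rn n frontier_of (box_Rn n 0 1) \<inter> X \<subseteq> (\<Union>ie\<in>{..<n} \<times> {0, 1}. ?F ie)"
  proof
    fix x assume "x \<in> Rn n frontier_of (box_Rn n 0 1) \<inter> X"
    moreover have "{..<n} \<rightarrow>\<^sub>E {0<..<1} \<subseteq> Rn n interior_of (box_Rn n 0 1)"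
      by (rule interior_of_maximal[OF PiE_mono obox_open]) auto
    ultimately have x: "x \<in> box_Rn n 0 1" "x \<notin> {..<n} \<rightarrow>\<^sub>E {0<..<1}" "x \<in> X"
      unfolding frontier_of_closed[OF cl] by auto
    have "\<exists>i<n. x i \<notin> {0<..<1}" using x(1,2) by (auto simp: PiE_iff)
    then obtain i where i: "i < n" "x i \<notin> {0<..<1}" by blast
    then have e: "x i \<in> {0, 1}" using PiE_mem[OF x(1), of i] by auto
    have "x \<in> ?F (i, x i)" using x(1,3) aff_face[OF i(1), of "x i" x] by simp
    then show "x \<in> (\<Union>ie\<in>{..<n} \<times> {0, 1}. ?F ie)" using i(1) e by blast
  qed
  then have "hausdorff_measure n (n - 1) (Rn n frontier_of (box_Rn n 0 1) \<inter> X) \<le> hausdorff_measure n (n - 1) (\<Union>ie\<in>{..<n} \<times> {0, 1}. ?F ie)"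
    by (rule hausdorff_measure_mono)
  also have "\<dots> \<le> (\<Sum>ie\<in>{..<n} \<times> {0, 1}. hausdorff_measure n (n - 1) (?F ie))"
    by (rule hausdorff_measure_UN) simp
  also have "\<dots> \<le> (\<Sum>ie\<in>{..<n} \<times> {0, 1}. emeasure (face n (fst ie) (snd ie)) X)"
  proof (rule sum_mono)
    fix ie :: "nat \<times> real" assume "ie \<in> {..<n} \<times> {0, 1}"
    then obtain i e where ie: "ie = (i, e)" "i < n" by auto
    show "hausdorff_measure n (n - 1) (?F ie) \<le> emeasure (face n (fst ie) (snd ie)) X"
      using hausdorff_measure_surf[OF ie(2) _ cl order_refl X, of "(\<lambda>j. if j = i then 1 else 0, - e)" 0]
      unfolding ie face_def split_conv fst_conv snd_conv by simp
  qed
  also have "\<dots> = (\<Sum>i<n. emeasure (face n i 0) X + emeasure (face n i 1) X)"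
    by (simp add: sum.cartesian_product')
  also have "\<dots> = (\<Sum>M\<leftarrow>faces0 n. emeasure M X)" by (rule sum_list_faces0[symmetric])
  finally show "hausdorff_measure n (n - 1) (Rn n frontier_of (box_Rn n 0 1) \<inter> X) \<le> (\<Sum>M\<leftarrow>faces0 n. emeasure M X)" .
qed

section \<open>Averaging over a family of profiles and iterating\<close>

locale profile_family =
  fixes m N :: nat and B :: real and c :: "nat \<Rightarrow> int \<Rightarrow> real" and T :: "nat \<Rightarrow> int"
  assumes m_pos: "m > 0" and B_pos: "B > 0" and profiles: "\<And>l. l < m \<Longrightarrow> profile N (c l) B (T l)"
begin

text \<open>The chance that a wall through \<open>x\<close> survives one step with a random profile
  and a random level.\<close>

definition Sv :: "nat \<Rightarrow> (nat \<Rightarrow> real) \<Rightarrow> real" where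
  "Sv n x = (\<Sum>l<m. surv B (pot n N (c l) x)) / m"

text \<open>The expected amount of new wall per unit volume at \<open>x\<close> in one such step, up
  to the factor \<open>2\<close> of \<open>average_weight\<close>.\<close>

definition Gb :: "nat \<Rightarrow> (nat \<Rightarrow> real) \<Rightarrow> real" where
  "Gb n x = (\<Sum>l<m. potgrad n N (c l) x * rho B (pot n N (c l) x)) / m"

lemma surv_nonneg: "l < m \<Longrightarrow> 0 \<le> surv B (pot n N (c l) x)"
  unfolding surv_def using B_pos profile.pot_nonneg[OF profiles, of l n x] by (intro divide_nonneg_pos) auto

lemma surv_le_1: "surv B f \<le> 1"
  unfolding surv_def using B_pos by (simp add: divide_le_eq_1)

lemma Sv_nonneg: "0 \<le> Sv n x"
  unfolding Sv_def by (intro divide_nonneg_nonneg sum_nonneg surv_nonneg) auto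

lemma Sv_le_1: "Sv n x \<le> 1"
proof -
  have "(\<Sum>l<m. surv B (pot n N (c l) x)) \<le> (\<Sum>l<m. 1)" by (intro sum_mono surv_le_1)
  then show ?thesis using m_pos by (simp add: Sv_def divide_le_eq_1)
qed

lemma potgrad_nonneg: "0 \<le> potgrad n N c' x"
  by (simp add: potgrad_def sum_nonneg)

lemma Gb_nonneg: "0 \<le> Gb n x"
  unfolding Gb_def by (intro divide_nonneg_nonneg sum_nonneg mult_nonneg_nonneg rho_nonneg potgrad_nonneg) simp

lemma measurable_Sv [measurable]: "Sv n \<in> borel_measurable (leb {..<n})"
  unfolding Sv_def[abs_def] by measurable

lemma measurable_Gb [measurable]: "Gb n \<in> borel_measurable (leb {..<n})"
  unfolding Gb_def[abs_def] by measurable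

lemma Sv_periodic: "periodic_Rn n (Sv n)"
  using profile.pot_periodic[OF profiles] unfolding periodic_Rn_def Sv_def by simp

text \<open>Some profile and then some level do not exceed the average over all choices.\<close>

lemma improve:
  assumes good: "good_body n D" and ab: "area_bound n D Ms"
    and h: "h \<in> borel_measurable (leb {..<n})" and per: "periodic_Rn n h"
  shows "\<exists>D' Ms'. good_body n D' \<and> area_bound n D' Ms' \<and> weight Ms' h \<le>
    weight Ms (\<lambda>x. h x * ennreal (Sv n x)) + 2 * (\<integral>\<^sup>+ x. h x * ennreal (Gb n x) * indicator (box_Rn n 0 1) x \<partial>leb {..<n})"
proof -
  have Ms: "sets M = sets (leb {..<n})" if "M \<in> set Ms" for M using ab that unfolding area_bound_def by auto
  have bm[measurable]: "box_Rn n 0 1 \<in> sets (leb {..<n})" by (intro sets_PiM_I_finite) auto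
  note h[measurable]
  define s where "s l x = h x * ennreal (surv B (pot n N (c l) x))" for l x
  define q where "q l x = h x * ennreal (potgrad n N (c l) x * rho B (pot n N (c l) x)) * indicator (box_Rn n 0 1) x" for l x
  have sm[measurable]: "s l \<in> borel_measurable (leb {..<n})" for l unfolding s_def[abs_def] by measurable
  have qm[measurable]: "q l \<in> borel_measurable (leb {..<n})" for l unfolding q_def[abs_def] by measurable
  define A where "A = weight Ms (\<lambda>x. h x * ennreal (Sv n x)) + 2 * (\<integral>\<^sup>+ x. h x * ennreal (Gb n x) * indicator (box_Rn n 0 1) x \<partial>leb {..<n})"
  define a where "a l = weight Ms (s l) + 2 * (\<integral>\<^sup>+ x. q l x \<partial>leb {..<n})" for l
  have mm: "of_nat m * ennreal (y / m) = ennreal y" if "y \<ge> 0" for y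
    using that m_pos by (simp add: ennreal_of_nat_eq_real_of_nat flip: ennreal_mult)
  have ss: "(\<Sum>l<m. s l x) = of_nat m * (h x * ennreal (Sv n x))" for x
  proof -
    have "(\<Sum>l<m. s l x) = h x * (\<Sum>l<m. ennreal (surv B (pot n N (c l) x)))"
      by (simp only: s_def sum_distrib_left)
    also have "(\<Sum>l<m. ennreal (surv B (pot n N (c l) x))) = ennreal (\<Sum>l<m. surv B (pot n N (c l) x))"
      by (rule sum_ennreal) (use surv_nonneg in simp)
    also have "ennreal (\<Sum>l<m. surv B (pot n N (c l) x)) = of_nat m * ennreal (Sv n x)"
      unfolding Sv_def by (rule mm[symmetric]) (intro sum_nonneg surv_nonneg, simp)
    finally show ?thesis by (simp only: mult_ac)
  qed
  have qq: "(\<Sum>l<m. q l x) = of_nat m * (h x * ennreal (Gb n x) * indicator (box_Rn n 0 1) x)" for x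
  proof -
    have "(\<Sum>l<m. q l x) = h x * ennreal (\<Sum>l<m. potgrad n N (c l) x * rho B (pot n N (c l) x)) * indicator (box_Rn n 0 1) x"
      by (simp add: q_def sum_ennreal mult_nonneg_nonneg rho_nonneg potgrad_nonneg flip: sum_distrib_left sum_distrib_right)
    also have "ennreal (\<Sum>l<m. potgrad n N (c l) x * rho B (pot n N (c l) x)) = of_nat m * ennreal (Gb n x)"
      unfolding Gb_def by (rule mm[symmetric]) (intro sum_nonneg mult_nonneg_nonneg rho_nonneg potgrad_nonneg)
    finally show ?thesis by (simp only: mult_ac)
  qed
  have "(\<Sum>l<m. a l) = (\<Sum>l<m. weight Ms (s l)) + 2 * (\<Sum>l<m. \<integral>\<^sup>+ x. q l x \<partial>leb {..<n})"
    by (simp add: a_def sum.distrib sum_distrib_left)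
  also have "(\<Sum>l<m. weight Ms (s l)) = weight Ms (\<lambda>x. \<Sum>l<m. s l x)"
    by (rule weight_sum[symmetric]) (use Ms sm in auto)
  also have "\<dots> = of_nat m * weight Ms (\<lambda>x. h x * ennreal (Sv n x))"
    unfolding ss
  proof (rule weight_cmult)
    show "(\<lambda>x. h x * ennreal (Sv n x)) \<in> borel_measurable (leb {..<n})" by measurable
  qed (rule Ms)
  also have "(\<Sum>l<m. \<integral>\<^sup>+ x. q l x \<partial>leb {..<n}) = (\<integral>\<^sup>+ x. (\<Sum>l<m. q l x) \<partial>leb {..<n})"
    by (rule nn_integral_sum[symmetric]) measurable
  also have "\<dots> = of_nat m * (\<integral>\<^sup>+ x. h x * ennreal (Gb n x) * indicator (box_Rn n 0 1) x \<partial>leb {..<n})"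
    unfolding qq by (rule nn_integral_cmult) measurable
  finally have "(\<Sum>l<m. a l) = of_nat m * A" by (simp add: A_def distrib_left mult_ac)
  then obtain l where l: "l < m" "a l \<le> A" using exists_le_average_finite[OF m_pos, of a A] by auto
  interpret profile N "c l" B "T l" by (rule profiles[OF l(1)])
  have "(\<integral>\<^sup>+ \<theta>. ennreal (rho B \<theta>) * weight (newMs n D Ms \<theta>) h \<partial>lborel) \<le> a l"
    using average_weight(2)[OF B_pos good ab h per] unfolding a_def s_def q_def .
  then have "(\<integral>\<^sup>+ \<theta>. ennreal (rho B \<theta>) * weight (newMs n D Ms \<theta>) h \<partial>lborel) \<le> A" using l(2) by (rule order_trans)
  then obtain \<theta> where \<theta>: "0 < \<theta>" "\<theta> < B" "weight (newMs n D Ms \<theta>) h \<le> A"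
    using exists_le_average[OF B_pos average_weight(1)[OF B_pos good ab h per]] by blast
  then show ?thesis
    using good_body_newD(1)[OF good \<theta>(1,2)] area_bound_newD[OF good ab \<theta>(1,2)] unfolding A_def by blast
qed

text \<open>The method of conditional expectations: a wall is weighted by its chance to survive the
  remaining steps. Peeling off the last step turns \<open>h\<close> into \<open>h * Sv n\<close>, so
  \<open>h\<close> has to vary in the induction, and walls created with \<open>r\<close> steps to go
  carry \<open>Sv n x ^ r\<close>.\<close>

lemma iterate:
  assumes "h \<in> borel_measurable (leb {..<n})" "periodic_Rn n h"
  shows "\<exists>D Ms. good_body n D \<and> area_bound n D Ms \<and> weight Ms h \<le>
    weight (faces0 n) (\<lambda>x. h x * ennreal (Sv n x ^ K)) +
    (\<Sum>r<K. 2 * (\<integral>\<^sup>+ x. h x * ennreal (Sv n x ^ r * Gb n x) * indicator (box_Rn n 0 1) x \<partial>leb {..<n}))"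
  using assms
proof (induction K arbitrary: h)
  case 0
  then show ?case using good_body_cube[of 0 n] area_bound_cube[of n] by (intro exI[of _ "box_Rn n 0 1"] exI[of _ "faces0 n"]) simp
next
  case (Suc K)
  note Suc.prems(1)[measurable]
  let ?h = "\<lambda>x. h x * ennreal (Sv n x)"
  have "?h \<in> borel_measurable (leb {..<n})" by measurable
  moreover have "periodic_Rn n ?h" using Suc.prems(2) Sv_periodic[of n] unfolding periodic_Rn_def by simp
  ultimately obtain D Ms where D: "good_body n D" "area_bound n D Ms" "weight Ms ?h \<le>
    weight (faces0 n) (\<lambda>x. ?h x * ennreal (Sv n x ^ K)) +
    (\<Sum>r<K. 2 * (\<integral>\<^sup>+ x. ?h x * ennreal (Sv n x ^ r * Gb n x) * indicator (box_Rn n 0 1) x \<partial>leb {..<n}))"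
    using Suc.IH by blast
  obtain D' Ms' where D': "good_body n D'" "area_bound n D' Ms'" "weight Ms' h \<le>
    weight Ms ?h + 2 * (\<integral>\<^sup>+ x. h x * ennreal (Gb n x) * indicator (box_Rn n 0 1) x \<partial>leb {..<n})"
    using improve[OF D(1,2) Suc.prems] by blast
  have e1: "?h x * ennreal (Sv n x ^ K) = h x * ennreal (Sv n x ^ Suc K)" for x
    using Sv_nonneg[of n x] by (simp add: ennreal_mult mult.assoc)
  have e2: "?h x * ennreal (Sv n x ^ r * Gb n x) = h x * ennreal (Sv n x ^ Suc r * Gb n x)" for x r
    using Sv_nonneg[of n x] Gb_nonneg[of n x] by (simp add: ennreal_mult mult.assoc)
  have "weight Ms' h \<le> weight (faces0 n) (\<lambda>x. h x * ennreal (Sv n x ^ Suc K)) +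
    (\<Sum>r<K. 2 * (\<integral>\<^sup>+ x. h x * ennreal (Sv n x ^ Suc r * Gb n x) * indicator (box_Rn n 0 1) x \<partial>leb {..<n}))
     + 2 * (\<integral>\<^sup>+ x. h x * ennreal (Gb n x) * indicator (box_Rn n 0 1) x \<partial>leb {..<n})"
    using D'(3) add_right_mono[OF D(3)[unfolded e1 e2]] by (rule order_trans)
  also have "\<dots> = weight (faces0 n) (\<lambda>x. h x * ennreal (Sv n x ^ Suc K)) +
    (\<Sum>r<Suc K. 2 * (\<integral>\<^sup>+ x. h x * ennreal (Sv n x ^ r * Gb n x) * indicator (box_Rn n 0 1) x \<partial>leb {..<n}))"
    unfolding sum.lessThan_Suc_shift by (simp add: ac_simps)
  finally show ?case using D'(1,2) by blast
qed

lemma exists_small_body: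
  "\<exists>D. good_body n D \<and> surface_area n D \<le>
    (\<Sum>i<n. \<Sum>e\<in>{0, 1}. \<integral>\<^sup>+ y. indicator ({..<n} - {i} \<rightarrow>\<^sub>E {0..1}) y * ennreal (Sv n (y(i := e)) ^ K) \<partial>leb ({..<n} - {i})) +
    2 * (\<integral>\<^sup>+ x. ennreal ((\<Sum>r<K. Sv n x ^ r) * Gb n x) * indicator (box_Rn n 0 1) x \<partial>leb {..<n})"
proof -
  have bm[measurable]: "box_Rn n 0 1 \<in> sets (leb {..<n})" by (intro sets_PiM_I_finite) auto
  have "periodic_Rn n (\<lambda>_. 1 :: ennreal)" by (simp add: periodic_Rn_def)
  from iterate[OF _ this, of K]
  obtain D Ms where D: "good_body n D" "area_bound n D Ms" "weight Ms (\<lambda>_. 1) \<le>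
    weight (faces0 n) (\<lambda>x. ennreal (Sv n x ^ K)) +
    (\<Sum>r<K. 2 * (\<integral>\<^sup>+ x. ennreal (Sv n x ^ r * Gb n x) * indicator (box_Rn n 0 1) x \<partial>leb {..<n}))" by auto
  have "surface_area n D = hausdorff_measure n (n - 1) (Rn n frontier_of D \<inter> topspace (Rn n))"
    unfolding surface_area_def using frontier_of_subset_topspace[of "Rn n" D] by (simp add: Int_absorb2 del: topspace_product_topology)
  also have "\<dots> \<le> (\<Sum>M\<leftarrow>Ms. emeasure M (topspace (Rn n)))"
    using D(2) closedin_topspace unfolding area_bound_def by blast
  also have "\<dots> \<le> weight Ms (\<lambda>_. 1)"
    unfolding weight_def by (intro sum_list_mono) (simp add: emeasure_space)
  also have "\<dots> \<le> weight (faces0 n) (\<lambda>x. ennreal (Sv n x ^ K)) +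
    (\<Sum>r<K. 2 * (\<integral>\<^sup>+ x. ennreal (Sv n x ^ r * Gb n x) * indicator (box_Rn n 0 1) x \<partial>leb {..<n}))" by (rule D(3))
  also have "weight (faces0 n) (\<lambda>x. ennreal (Sv n x ^ K)) =
    (\<Sum>i<n. \<Sum>e\<in>{0, 1}. \<integral>\<^sup>+ y. indicator ({..<n} - {i} \<rightarrow>\<^sub>E {0..1}) y * ennreal (Sv n (y(i := e)) ^ K) \<partial>leb ({..<n} - {i}))"
    unfolding weight_def sum_list_faces0
  proof (rule sum.cong[OF refl])
    fix i assume i: "i \<in> {..<n}"
    have "(\<lambda>x. ennreal (Sv n x ^ K)) \<in> borel_measurable (leb {..<n})" by measurable
    from nn_integral_face[OF _ this, of i] i
    show "(\<integral>\<^sup>+ x. ennreal (Sv n x ^ K) \<partial>face n i 0) + (\<integral>\<^sup>+ x. ennreal (Sv n x ^ K) \<partial>face n i 1) =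
      (\<Sum>e\<in>{0, 1}. \<integral>\<^sup>+ y. indicator ({..<n} - {i} \<rightarrow>\<^sub>E {0..1}) y * ennreal (Sv n (y(i := e)) ^ K) \<partial>leb ({..<n} - {i}))" by simp
  qed
  also have "(\<Sum>r<K. 2 * (\<integral>\<^sup>+ x. ennreal (Sv n x ^ r * Gb n x) * indicator (box_Rn n 0 1) x \<partial>leb {..<n}))
    = 2 * (\<integral>\<^sup>+ x. ennreal ((\<Sum>r<K. Sv n x ^ r) * Gb n x) * indicator (box_Rn n 0 1) x \<partial>leb {..<n})"
  proof -
    have eq: "ennreal ((\<Sum>r<K. Sv n x ^ r) * Gb n x) * indicator (box_Rn n 0 1) x
      = (\<Sum>r<K. ennreal (Sv n x ^ r * Gb n x) * indicator (box_Rn n 0 1) x)" for x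
      using Sv_nonneg[of n x] Gb_nonneg[of n x] by (simp add: sum_distrib_right sum_ennreal flip: sum_distrib_right)
    have "(\<integral>\<^sup>+ x. ennreal ((\<Sum>r<K. Sv n x ^ r) * Gb n x) * indicator (box_Rn n 0 1) x \<partial>leb {..<n})
      = (\<Sum>r<K. \<integral>\<^sup>+ x. ennreal (Sv n x ^ r * Gb n x) * indicator (box_Rn n 0 1) x \<partial>leb {..<n})"
      unfolding eq by (rule nn_integral_sum) measurable
    then show ?thesis by (simp add: sum_distrib_left)
  qed
  finally show ?thesis using D(1) by blast
qed

end

section \<open>A concrete family of potentials\<close>

text \<open>The values of the profile at distance \<open>k / N\<close> from its peak. Since \<open>exp (- beta M k) = (k / M)\<^sup>2\<close>, the
  squared slope times \<open>exp (- f)\<close> stays bounded up to the peak.\<close>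

definition beta :: "nat \<Rightarrow> int \<Rightarrow> real" where
  "beta M k = (if k = 0 then 2 * ln (real M) + 2 else if k < int M then 2 * ln (real M / real_of_int k) else 0)"

lemma beta_ln: "1 \<le> k \<Longrightarrow> k \<le> int M \<Longrightarrow> beta M k = 2 * ln (real M / real_of_int k)"
  by (cases "k = int M") (auto simp: beta_def)

lemma beta_zero: "int M \<le> k \<Longrightarrow> M \<ge> 1 \<Longrightarrow> beta M k = 0"
  by (auto simp: beta_def)

lemma beta_nonneg: "0 \<le> k \<Longrightarrow> M \<ge> 1 \<Longrightarrow> beta M k \<ge> 0"
  by (auto simp: beta_def ln_ge_zero_iff le_divide_eq)

lemma beta_decr:
  assumes "0 \<le> k" "k < int M"
  shows "beta M (k + 1) < beta M k"
proof (cases "k = 0")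
  case True
  have "beta M 1 = 2 * ln (real M)" using beta_ln[of 1 M] assms by simp
  then show ?thesis using True by (simp add: beta_def)
next
  case False
  then have k: "1 \<le> k" using assms by simp
  have "real M / real_of_int (k + 1) < real M / real_of_int k"
    using k assms by (intro divide_strict_left_mono) auto
  moreover have "0 < real M / real_of_int (k + 1)" using k assms by (intro divide_pos_pos) auto
  ultimately show ?thesis
    using beta_ln[of k M] beta_ln[of "k + 1" M] k assms by simp
qed

lemma beta_pos_less: "M \<ge> 1 \<Longrightarrow> beta M k > 0 \<Longrightarrow> k < int M"
  using beta_zero[of M k] by force

text \<open>For \<open>k \<ge> 1\<close> the drop is \<open>2 * ln (1 + 1 / k)\<close>, at most
  \<open>4 / (k + 1)\<close>, and squared it cancels against
  \<open>exp (- beta M (k + 1)) = ((k + 1) / M)\<^sup>2\<close>. At \<open>k = 0\<close>, where the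
  logarithm would be infinite, the summand \<open>2\<close> in the peak height makes the drop equal
  to \<open>2\<close>.\<close>

lemma beta_step:
  assumes "0 \<le> k" "M \<ge> 1"
  shows "(beta M k - beta M (k + 1))\<^sup>2 * exp (- beta M (k + 1)) \<le> 16 / (real M)\<^sup>2"
proof -
  have exp_beta: "exp (- beta M j) = (real_of_int j / real M)\<^sup>2" if "1 \<le> j" "j \<le> int M" for j
  proof -
    have pos: "0 < real M / real_of_int j" using that by (intro divide_pos_pos) auto
    have "exp (- beta M j) = exp (- ln (real M / real_of_int j)) ^ 2"
      unfolding beta_ln[OF that] by (simp flip: exp_of_nat_mult)
    also have "exp (- ln (real M / real_of_int j)) = real_of_int j / real M"
      using pos by (simp add: exp_minus)
    finally show ?thesis .
  qed
  consider "int M \<le> k" | "k = 0" | "1 \<le> k" "k < int M" using assms by linarith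
  then show ?thesis
  proof cases
    case 1
    then show ?thesis using beta_zero[of M k] beta_zero[of M "k + 1"] assms by simp
  next
    case 2
    have "beta M 0 - beta M 1 = 2" using beta_ln[of 1 M] assms by (simp add: beta_def)
    moreover have "exp (- beta M 1) = 1 / (real M)\<^sup>2" using exp_beta[of 1] assms by (simp add: power_divide)
    ultimately show ?thesis using 2 by (simp add: divide_right_mono)
  next
    case 3
    have pos: "0 < real M / real_of_int k" "0 < real M / real_of_int (k + 1)" using 3 by (auto intro!: divide_pos_pos)
    have "beta M k - beta M (k + 1) = 2 * (ln (real M / real_of_int k) - ln (real M / real_of_int (k + 1)))"
      using beta_ln[of k M] beta_ln[of "k + 1" M] 3 by simp
    also have "\<dots> = 2 * ln (1 + 1 / real_of_int k)"
    proof -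
      have "ln (real M / real_of_int k) - ln (real M / real_of_int (k + 1)) = ln ((real M / real_of_int k) / (real M / real_of_int (k + 1)))"
        using pos by (subst ln_div) auto
      also have "(real M / real_of_int k) / (real M / real_of_int (k + 1)) = 1 + 1 / real_of_int k"
        using 3 assms by (simp add: field_simps)
      finally show ?thesis by simp
    qed
    finally have d: "beta M k - beta M (k + 1) = 2 * ln (1 + 1 / real_of_int k)" .
    have "0 \<le> ln (1 + 1 / real_of_int k)" using 3 by (intro ln_ge_zero) simp
    moreover have "ln (1 + 1 / real_of_int k) \<le> 1 / real_of_int k" using 3 by (intro ln_add_one_self_le_self) simp
    moreover have "1 / real_of_int k \<le> 2 / real_of_int (k + 1)" using 3 by (simp add: field_simps)
    ultimately have "(beta M k - beta M (k + 1))\<^sup>2 \<le> (4 / real_of_int (k + 1))\<^sup>2"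
      unfolding d by (intro power_mono) auto
    then have "(beta M k - beta M (k + 1))\<^sup>2 * exp (- beta M (k + 1)) \<le> (4 / real_of_int (k + 1))\<^sup>2 * exp (- beta M (k + 1))"
      by (rule mult_right_mono) simp
    also have "\<dots> = 16 / (real M)\<^sup>2"
      using 3 exp_beta[of "k + 1"] by (simp add: power_divide)
    finally show ?thesis .
  qed
qed

text \<open>The period has \<open>2 * m * M\<close> grid steps. Window \<open>l\<close> runs from
  index \<open>2 * l * M\<close> to \<open>2 * (l + 1) * M\<close>, with the peak in its
  middle.\<close>

definition ctab :: "nat \<Rightarrow> nat \<Rightarrow> nat \<Rightarrow> int \<Rightarrow> real" where
  "ctab m M l i = beta M \<bar>i mod int (2 * m * M) - int ((2 * l + 1) * M)\<bar>"

locale table =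
  fixes m M l :: nat
  assumes m: "m > 0" and M: "M \<ge> 1" and l: "l < m"
begin

abbreviation "NN \<equiv> 2 * m * M"
abbreviation "TT \<equiv> (2 * l + 1) * M"

lemma TT_bounds: "M \<le> TT" "TT + M \<le> NN"
proof -
  have "(2 * l + 2) * M \<le> (2 * m) * M" using l by (intro mult_right_mono) auto
  then show "TT + M \<le> NN" by (simp add: algebra_simps)
qed simp

lemma NN_pos: "NN > 0"
  using m M by simp

lemma ctab_nonneg: "ctab m M l i \<ge> 0"
  unfolding ctab_def by (rule beta_nonneg) (use M in auto)

lemma ctab_in: "0 \<le> i \<Longrightarrow> i < int NN \<Longrightarrow> ctab m M l i = beta M \<bar>i - int TT\<bar>"
  by (simp add: ctab_def)

lemma ctab_out:
  assumes "0 \<le> i" "i \<le> int NN" "int M \<le> \<bar>i - int TT\<bar>"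
  shows "ctab m M l i = 0"
proof (cases "i = int NN")
  case True
  have "int M \<le> \<bar>0 - int TT\<bar>" using TT_bounds by linarith
  then show ?thesis using True M by (simp add: ctab_def beta_zero del: of_nat_mult)
next
  case False
  then have "i < int NN" using assms(2) by linarith
  then show ?thesis using beta_zero[OF assms(3) M] ctab_in[OF assms(1)] by metis
qed

lemma ctab_shift: "ctab m M l (i + int NN) = ctab m M l i"
  by (simp add: ctab_def del: of_nat_mult)

lemma ctab_mod: "ctab m M l i = ctab m M l (i mod int NN)" "ctab m M l (i + 1) = ctab m M l (i mod int NN + 1)"
  by (simp_all add: ctab_def mod_add_left_eq del: of_nat_mult)

lemma ctab_at_end: "ctab m M l (int NN) = 0"
proof (rule ctab_out[OF of_nat_0_le_iff order_refl])
  show "int M \<le> \<bar>int NN - int TT\<bar>" using TT_bounds by linarith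
qed

text \<open>A grid interval never contains the peak in its inside, so it either leads away from the
  peak (first case) or towards it (second case). Claims about neighbouring entries thus become
  claims about consecutive values of \<open>beta\<close>.\<close>

lemma ctab_step:
  obtains k where "0 \<le> k" "ctab m M l i = beta M k \<and> ctab m M l (i + 1) = beta M (k + 1)"
  | k where "0 \<le> k" "ctab m M l i = beta M (k + 1) \<and> ctab m M l (i + 1) = beta M k"
proof -
  define j where "j = i mod int NN"
  have j: "0 \<le> j" "j < int NN" using NN_pos by (auto simp: j_def simp del: of_nat_mult)
  have ij: "ctab m M l i = ctab m M l j" "ctab m M l (i + 1) = ctab m M l (j + 1)"
    unfolding j_def by (rule ctab_mod)+
  show ?thesis
  proof (cases "j < int TT")
    case True
    have j1: "0 \<le> j + 1" "j + 1 < int NN" using True j TT_bounds M by linarith+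
    have e: "\<bar>j - int TT\<bar> = int TT - (j + 1) + 1" "\<bar>j + 1 - int TT\<bar> = int TT - (j + 1)" using True by linarith+
    show ?thesis
    proof (rule that(2))
      show "0 \<le> int TT - (j + 1)" using True by linarith
      show "ctab m M l i = beta M (int TT - (j + 1) + 1) \<and> ctab m M l (i + 1) = beta M (int TT - (j + 1))"
        unfolding ij ctab_in[OF j] ctab_in[OF j1] e by (rule conjI) (rule refl)+
    qed
  next
    case False
    have e: "\<bar>j - int TT\<bar> = j - int TT" "\<bar>j + 1 - int TT\<bar> = j - int TT + 1" using False by linarith+
    have c1: "ctab m M l (j + 1) = beta M (j - int TT + 1)"
    proof (cases "j + 1 = int NN")
      case True
      have "beta M (j - int TT + 1) = 0" using True TT_bounds M by (intro beta_zero) linarith+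
      then show ?thesis unfolding True ctab_at_end by (rule sym)
    next
      case neq: False
      have j1: "0 \<le> j + 1" "j + 1 < int NN" using neq j by linarith+
      show ?thesis unfolding ctab_in[OF j1] e by (rule refl)
    qed
    show ?thesis
    proof (rule that(1))
      show "0 \<le> j - int TT" using False by linarith
      show "ctab m M l i = beta M (j - int TT) \<and> ctab m M l (i + 1) = beta M (j - int TT + 1)"
        unfolding ij ctab_in[OF j] c1 e by (rule conjI) (rule refl)+
    qed
  qed
qed

lemma profile_ctab: "profile NN (ctab m M l) (2 * ln (real M) + 2) (int TT)"
proof
  show "NN > 0" by (rule NN_pos)
  show "ctab m M l (i + int NN) = ctab m M l i" for i by (rule ctab_shift)
  show "ctab m M l i \<ge> 0" for i by (rule ctab_nonneg)
  show "0 \<le> int TT" "int TT \<le> int NN" using TT_bounds by linarith+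
  have "int TT < int NN" using TT_bounds M by linarith
  then have "ctab m M l (int TT) = beta M 0" using ctab_in[OF of_nat_0_le_iff, of TT] by simp
  then show "ctab m M l (int TT) = 2 * ln (real M) + 2" by (simp add: beta_def)
  show "ctab m M l i = 0" if eq: "ctab m M l i = ctab m M l (i + 1)" for i
  proof (cases rule: ctab_step[of i])
    case (1 k)
    then have "\<not> k < int M" using eq beta_decr[of k M] by auto
    then show ?thesis using 1 beta_zero[of M k] M by simp
  next
    case (2 k)
    then have "\<not> k < int M" using eq beta_decr[of k M] by auto
    then show ?thesis using 2 beta_zero[of M "k + 1"] M by simp
  qed
  show "ctab m M l (i + 1) < ctab m M l i \<or> ctab m M l (i - 1) < ctab m M l i" if pos: "ctab m M l i > 0" for i
  proof (cases rule: ctab_step[of i])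
    case (1 k)
    then have "k < int M" using beta_pos_less[OF M, of k] pos by simp
    then show ?thesis using 1 beta_decr[of k M] by simp
  next
    case (2 k)
    \<comment> \<open>The lower neighbour is the one farther from the peak: \<open>i + 1\<close> if
      \<open>j \<ge> TT\<close>, and \<open>i - 1\<close> otherwise.\<close>
    define j where "j = i mod int NN"
    have j: "0 \<le> j" "j < int NN" using NN_pos by (auto simp: j_def simp del: of_nat_mult)
    have cj: "ctab m M l i = beta M \<bar>j - int TT\<bar>" by (simp add: ctab_def j_def)
    then have less: "\<bar>j - int TT\<bar> < int M" using beta_pos_less[OF M] pos by simp
    show ?thesis
    proof (cases "j \<ge> int TT")
      case True
      have "ctab m M l (i + 1) = ctab m M l (j + 1)" unfolding j_def by (rule ctab_mod)
      also have "\<dots> = beta M (\<bar>j - int TT\<bar> + 1)"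
      proof (cases "j + 1 = int NN")
        case e: True
        have "beta M (\<bar>j - int TT\<bar> + 1) = 0" using e True TT_bounds M by (intro beta_zero) linarith+
        then show ?thesis using e ctab_at_end by simp
      next
        case False
        then have j1: "0 \<le> j + 1" "j + 1 < int NN" using j by linarith+
        have "\<bar>j + 1 - int TT\<bar> = \<bar>j - int TT\<bar> + 1" using True by linarith
        then show ?thesis unfolding ctab_in[OF j1] by simp
      qed
      also have "\<dots> < beta M \<bar>j - int TT\<bar>" using less by (intro beta_decr) auto
      finally show ?thesis using cj by simp
    next
      case False
      then have j1: "0 \<le> j - 1" using less TT_bounds by linarith
      have "(i - 1) mod int NN = j - 1"
      proof -
        have "(i - 1) mod int NN = (j - 1) mod int NN" unfolding j_def by (simp add: mod_diff_left_eq del: of_nat_mult)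
        then show ?thesis using j1 j by (simp del: of_nat_mult)
      qed
      then have "ctab m M l (i - 1) = beta M \<bar>j - 1 - int TT\<bar>" unfolding ctab_def by (rule arg_cong)
      moreover have "\<bar>j - 1 - int TT\<bar> = \<bar>j - int TT\<bar> + 1" using False by linarith
      ultimately have "ctab m M l (i - 1) = beta M (\<bar>j - int TT\<bar> + 1)" by (simp only:)
      also have "\<dots> < beta M \<bar>j - int TT\<bar>" using less by (intro beta_decr) auto
      finally show ?thesis using cj by simp
    qed
  qed
qed

lemma pl_window:
  assumes "0 \<le> y" "y \<le> 1" "y \<le> l / m \<or> (l + 1) / m \<le> y"
  shows "pl NN (ctab m M l) y = 0"
proof (cases "y = 1")
  case True
  then show ?thesis using pl_at[of NN y "int NN" "ctab m M l"] ctab_at_end by simp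
next
  case False
  define i where "i = \<lfloor>real NN * y\<rfloor>"
  have i: "real_of_int i \<le> real NN * y" "real NN * y < real_of_int i + 1" unfolding i_def by linarith+
  have "real NN * y < real NN * 1" using False assms NN_pos by (intro mult_strict_left_mono) auto
  then have iN: "0 \<le> i" "i < int NN" using assms(1) by (auto simp: i_def floor_less_iff)
  have edge: "real NN * (real a / real m) = real (2 * a * M)" for a using m by simp
  show ?thesis using assms(3)
  proof
    assume "y \<le> l / m"
    then have "real NN * y \<le> real NN * (l / m)" by (intro mult_left_mono) auto
    then have le: "real NN * y \<le> real (2 * l * M)" unfolding edge .
    show ?thesis
    proof (cases "real NN * y = real_of_int i")
      case True
      then have "i \<le> int (2 * l * M)" using le by linarith
      then have "ctab m M l i = 0" using iN by (intro ctab_out) (auto simp: algebra_simps)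
      then show ?thesis using pl_at[OF True] by simp
    next
      case False
      then have "real_of_int i < real (2 * l * M)" using i le by linarith
      then have "i + 1 \<le> int (2 * l * M)" by linarith
      then have "ctab m M l i = 0" "ctab m M l (i + 1) = 0" using iN by (auto intro!: ctab_out simp: algebra_simps)
      then show ?thesis using pl_on[of i NN y "ctab m M l"] i by simp
    qed
  next
    assume "(l + 1) / m \<le> y"
    then have "real NN * (real (l + 1) / m) \<le> real NN * y" by (intro mult_left_mono) auto
    then have "real (2 * (l + 1) * M) \<le> real NN * y" unfolding edge .
    then have "int (2 * (l + 1) * M) \<le> i" using i by linarith
    then have "ctab m M l i = 0" "ctab m M l (i + 1) = 0" using iN by (auto intro!: ctab_out simp: algebra_simps)
    then show ?thesis using pl_on[of i NN y "ctab m M l"] i by simp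
  qed
qed

text \<open>The inequality at the left end is strict because \<open>plslope\<close> looks to the
  right, and at \<open>l / m\<close> it already sees the window.\<close>

lemma plslope_window:
  assumes "0 \<le> y" "y < 1" "y < l / m \<or> (l + 1) / m \<le> y"
  shows "plslope NN (ctab m M l) y = 0"
proof -
  define i where "i = \<lfloor>real NN * y\<rfloor>"
  have i: "real_of_int i \<le> real NN * y" "real NN * y < real_of_int i + 1" unfolding i_def by linarith+
  have "real NN * y < real NN * 1" using assms NN_pos by (intro mult_strict_left_mono) auto
  then have iN: "0 \<le> i" "i < int NN" using assms(1) by (auto simp: i_def floor_less_iff)
  have edge: "real NN * (real a / real m) = real (2 * a * M)" for a using m by simp
  have "ctab m M l i = 0 \<and> ctab m M l (i + 1) = 0" using assms(3)
  proof
    assume "y < l / m"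
    then have "real NN * y < real NN * (l / m)" using NN_pos by (intro mult_strict_left_mono) auto
    then have "real NN * y < real (2 * l * M)" unfolding edge .
    then have "real_of_int i < real (2 * l * M)" using i by linarith
    then have "i + 1 \<le> int (2 * l * M)" by linarith
    then show ?thesis using iN by (auto intro!: ctab_out simp: algebra_simps)
  next
    assume "(l + 1) / m \<le> y"
    then have "real NN * (real (l + 1) / m) \<le> real NN * y" by (intro mult_left_mono) auto
    then have "real (2 * (l + 1) * M) \<le> real NN * y" unfolding edge .
    then have "int (2 * (l + 1) * M) \<le> i" using i by linarith
    then show ?thesis using iN by (auto intro!: ctab_out simp: algebra_simps)
  qed
  then show ?thesis by (simp add: plslope_def i_def)
qed

text \<open>On a grid interval the profile stays above the smaller end value, so
  \<open>beta_step\<close> bounds the squared increment by \<open>16 / M\<^sup>2\<close>. The factor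
  \<open>NN\<^sup>2 = 4 * m\<^sup>2 * M\<^sup>2\<close> then gives
  \<open>64 * m\<^sup>2\<close>.\<close>

lemma plslope_bound: "(plslope NN (ctab m M l) y)\<^sup>2 * exp (- pl NN (ctab m M l) y) \<le> 64 * (real m)\<^sup>2"
proof -
  define i where "i = \<lfloor>real NN * y\<rfloor>"
  define r where "r = real NN * y - i"
  define a where "a = ctab m M l i"
  define b where "b = ctab m M l (i + 1)"
  have r: "0 \<le> r" "r \<le> 1" unfolding r_def i_def by linarith+
  have pl: "pl NN (ctab m M l) y = (1 - r) * a + r * b" by (simp add: pl_def i_def r_def a_def b_def algebra_simps)
  have ge: "min a b \<le> (1 - r) * a + r * b"
  proof -
    have "(1 - r) * min a b + r * min a b \<le> (1 - r) * a + r * b" using r by (intro add_mono mult_left_mono) auto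
    then show ?thesis by (simp add: algebra_simps)
  qed
  have "(b - a)\<^sup>2 * exp (- min a b) \<le> 16 / (real M)\<^sup>2"
  proof (cases rule: ctab_step[of i])
    case (1 k)
    have "b \<le> a" using 1 beta_decr[of k M] beta_zero[of M k] beta_zero[of M "k + 1"] M unfolding a_def b_def by (cases "k < int M") auto
    then show ?thesis using 1 beta_step[of k M] M unfolding a_def b_def by (simp add: power2_commute min_absorb2)
  next
    case (2 k)
    have "a \<le> b" using 2 beta_decr[of k M] beta_zero[of M k] beta_zero[of M "k + 1"] M unfolding a_def b_def by (cases "k < int M") auto
    then show ?thesis using 2 beta_step[of k M] M unfolding a_def b_def by (simp add: min_absorb1)
  qed
  moreover have "(b - a)\<^sup>2 * exp (- pl NN (ctab m M l) y) \<le> (b - a)\<^sup>2 * exp (- min a b)"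
    unfolding pl using ge by (intro mult_left_mono) auto
  ultimately have le: "(b - a)\<^sup>2 * exp (- pl NN (ctab m M l) y) \<le> 16 / (real M)\<^sup>2" by linarith
  have "(plslope NN (ctab m M l) y)\<^sup>2 * exp (- pl NN (ctab m M l) y) = (real NN)\<^sup>2 * ((b - a)\<^sup>2 * exp (- pl NN (ctab m M l) y))"
    by (simp add: plslope_def i_def a_def b_def power_mult_distrib)
  also have "\<dots> \<le> (real NN)\<^sup>2 * (16 / (real M)\<^sup>2)" using le by (intro mult_left_mono) auto
  also have "\<dots> = 64 * (real m)\<^sup>2" using M by (simp add: power_mult_distrib)
  finally show ?thesis .
qed

end

section \<open>Product integrals over the unit cube\<close>

lemma indicator_unit_box:
  assumes "finite I" "x \<in> space (leb I)"
  shows "(indicator (I \<rightarrow>\<^sub>E {0..1}) x :: real) = (\<Prod>i\<in>I. indicator {0..1} (x i))"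
proof (cases "x \<in> I \<rightarrow>\<^sub>E {0..1}")
  case True
  then have "(\<Prod>i\<in>I. indicator {0..1} (x i) :: real) = (\<Prod>i\<in>I. 1)" by (intro prod.cong) (auto simp: PiE_iff)
  then show ?thesis using True by simp
next
  case False
  then obtain i where i: "i \<in> I" "x i \<notin> {0..1}" using assms(2) by (auto simp: space_leb PiE_iff)
  have "(indicator {0..1} (x i) :: real) = 0" using i(2) by (rule indicator_simps(2))
  then have "(\<Prod>i\<in>I. indicator {0..1} (x i) :: real) = 0" using assms(1) i(1) by (intro prod_zero) auto
  then show ?thesis using False by simp
qed

lemma integrable_unit:
  fixes f :: "real \<Rightarrow> real"
  assumes "f \<in> borel_measurable borel" "\<And>y. 0 \<le> f y" "\<And>y. f y \<le> 1"
  shows "integrable lborel (\<lambda>y. f y * indicator {0..1} y)"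
proof (rule Bochner_Integration.integrable_bound)
  show "integrable lborel (indicator {0..1} :: real \<Rightarrow> real)" by simp
  show "(\<lambda>y. f y * indicator {0..1} y) \<in> borel_measurable lborel" using assms(1) by simp
  show "AE y in lborel. norm (f y * indicator {0..1} y) \<le> norm (indicator {0..1} y :: real)"
    using assms(2,3) by (auto simp: indicator_def)
qed

text \<open>By \<open>sep\<close>, \<open>a l y * a k y = a l y + a k y - 1\<close>, so that the products for different \<open>l\<close> are negatively correlated;
  the claim is then Chebyshev's inequality.\<close>

lemma second_moment_bound:
  fixes a :: "nat \<Rightarrow> real \<Rightarrow> real" and I :: "'i set"
  assumes I: "finite I" and am: "\<And>l. a l \<in> borel_measurable borel"
    and a01: "\<And>l y. 0 \<le> a l y" "\<And>l y. a l y \<le> 1"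
    and sep: "\<And>l k y. l < m \<Longrightarrow> k < m \<Longrightarrow> l \<noteq> k \<Longrightarrow> 0 \<le> y \<Longrightarrow> y \<le> 1 \<Longrightarrow> a l y = 1 \<or> a k y = 1"
    and E: "E = (\<Sum>l<m. (\<integral>y. a l y * indicator {0..1} y \<partial>lborel) ^ card I)" "E > 0"
  shows "emeasure (leb I) {x \<in> I \<rightarrow>\<^sub>E {0..1}. (\<Sum>l<m. \<Prod>i\<in>I. a l (x i)) < E / 2} \<le> ennreal (4 / E)"
proof -
  define w where "w = (indicator {0..1} :: real \<Rightarrow> real)"
  define \<mu> where "\<mu> l = (\<integral>y. a l y * w y \<partial>lborel)" for l
  define M2 where "M2 l k = (\<integral>y. (a l y * a k y) * w y \<partial>lborel)" for l k
  define Z where "Z x = (\<Sum>l<m. \<Prod>i\<in>I. a l (x i))" for x :: "'i \<Rightarrow> real"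
  \<comment> \<open>This is \<open>(Z - E)\<^sup>2\<close> on the unit box, expanded into products
    over the coordinates so that the integral factorises.\<close>
  define V where "V x = (\<Sum>l<m. \<Sum>k<m. \<Prod>i\<in>I. (a l (x i) * a k (x i)) * w (x i)) - 2 * E * (\<Sum>l<m. \<Prod>i\<in>I. a l (x i) * w (x i)) + E\<^sup>2 * (\<Prod>i\<in>I. 1 * w (x i))" for x :: "'i \<Rightarrow> real"
  have int1: "integrable lborel (\<lambda>y. 1 * w y)" unfolding w_def by (rule integrable_unit) auto
  have inta: "integrable lborel (\<lambda>y. a l y * w y)" for l unfolding w_def by (rule integrable_unit) (use am a01 in auto)
  have intaa: "integrable lborel (\<lambda>y. (a l y * a k y) * w y)" for l k unfolding w_def
    by (rule integrable_unit) (use am a01 in \<open>auto intro: mult_le_one\<close>)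
  have w1: "(\<integral>y. 1 * w y \<partial>lborel) = 1" unfolding w_def by simp
  note pint = lborel_PiM.product_integral_prod[OF I] and pintb = lborel_PiM.product_integrable_prod[OF I]
  have intV: "integrable (leb I) V" unfolding V_def
    by (intro Bochner_Integration.integrable_add Bochner_Integration.integrable_diff integrable_mult_right
        Bochner_Integration.integrable_sum pintb int1 inta intaa)
  have "(\<integral>x. V x \<partial>leb I) = (\<Sum>l<m. \<Sum>k<m. M2 l k ^ card I) - 2 * E * (\<Sum>l<m. \<mu> l ^ card I) + E\<^sup>2 * 1 ^ card I"
  proof -
    have "(\<integral>x. V x \<partial>leb I) = (\<integral>x. (\<Sum>l<m. \<Sum>k<m. \<Prod>i\<in>I. (a l (x i) * a k (x i)) * w (x i)) \<partial>leb I)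
        - (\<integral>x. 2 * E * (\<Sum>l<m. \<Prod>i\<in>I. a l (x i) * w (x i)) \<partial>leb I) + (\<integral>x. E\<^sup>2 * (\<Prod>i\<in>I. 1 * w (x i)) \<partial>leb I)"
    proof -
      have i1: "integrable (leb I) (\<lambda>x. \<Sum>l<m. \<Sum>k<m. \<Prod>i\<in>I. (a l (x i) * a k (x i)) * w (x i))"
        by (intro Bochner_Integration.integrable_sum pintb intaa)
      have i2: "integrable (leb I) (\<lambda>x. 2 * E * (\<Sum>l<m. \<Prod>i\<in>I. a l (x i) * w (x i)))"
        by (intro integrable_mult_right Bochner_Integration.integrable_sum pintb inta)
      have i3: "integrable (leb I) (\<lambda>x. E\<^sup>2 * (\<Prod>i\<in>I. 1 * w (x i)))"
        by (intro integrable_mult_right pintb int1)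
      show ?thesis unfolding V_def
        by (simp only: Bochner_Integration.integral_add[OF Bochner_Integration.integrable_diff[OF i1 i2] i3]
            Bochner_Integration.integral_diff[OF i1 i2])
    qed
    also have "(\<integral>x. (\<Sum>l<m. \<Sum>k<m. \<Prod>i\<in>I. (a l (x i) * a k (x i)) * w (x i)) \<partial>leb I) = (\<Sum>l<m. \<Sum>k<m. M2 l k ^ card I)"
    proof -
      have "(\<integral>x. (\<Sum>l<m. \<Sum>k<m. \<Prod>i\<in>I. (a l (x i) * a k (x i)) * w (x i)) \<partial>leb I)
        = (\<Sum>l<m. \<integral>x. (\<Sum>k<m. \<Prod>i\<in>I. (a l (x i) * a k (x i)) * w (x i)) \<partial>leb I)"
        by (intro Bochner_Integration.integral_sum Bochner_Integration.integrable_sum pintb intaa)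
      also have "\<dots> = (\<Sum>l<m. \<Sum>k<m. \<integral>x. (\<Prod>i\<in>I. (a l (x i) * a k (x i)) * w (x i)) \<partial>leb I)"
        by (intro sum.cong refl Bochner_Integration.integral_sum pintb intaa)
      also have "\<dots> = (\<Sum>l<m. \<Sum>k<m. M2 l k ^ card I)"
        by (intro sum.cong refl) (subst pint, rule intaa, simp add: M2_def)
      finally show ?thesis .
    qed
    also have "(\<integral>x. 2 * E * (\<Sum>l<m. \<Prod>i\<in>I. a l (x i) * w (x i)) \<partial>leb I) = 2 * E * (\<Sum>l<m. \<mu> l ^ card I)"
    proof -
      have "(\<integral>x. (\<Sum>l<m. \<Prod>i\<in>I. a l (x i) * w (x i)) \<partial>leb I) = (\<Sum>l<m. \<integral>x. (\<Prod>i\<in>I. a l (x i) * w (x i)) \<partial>leb I)"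
        by (intro Bochner_Integration.integral_sum pintb inta)
      also have "\<dots> = (\<Sum>l<m. \<mu> l ^ card I)"
        by (intro sum.cong refl) (subst pint, rule inta, simp add: \<mu>_def)
      finally show ?thesis by simp
    qed
    also have "(\<integral>x. E\<^sup>2 * (\<Prod>i\<in>I. 1 * w (x i)) \<partial>leb I) = E\<^sup>2 * 1 ^ card I"
      using pint[of "\<lambda>_ y. 1 * w y"] int1 w1 by simp
    finally show ?thesis .
  qed
  also have "\<dots> = (\<Sum>l<m. \<Sum>k<m. M2 l k ^ card I) - E\<^sup>2"
    using E(1) unfolding \<mu>_def w_def by (simp add: power2_eq_square)
  also have "\<dots> \<le> E"
  proof -
    have \<mu>0: "0 \<le> \<mu> l" for l unfolding \<mu>_def w_def using a01 by (intro integral_nonneg_AE) auto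
    have M20: "0 \<le> M2 l k" for l k unfolding M2_def w_def using a01 by (intro integral_nonneg_AE) auto
    have \<mu>1: "\<mu> l \<le> 1" for l
    proof -
      have "\<mu> l \<le> (\<integral>y. 1 * w y \<partial>lborel)" unfolding \<mu>_def
        using a01 by (intro integral_mono inta int1 mult_right_mono) (auto simp: w_def)
      then show ?thesis using w1 by simp
    qed
    have diag: "M2 l l \<le> \<mu> l" for l unfolding M2_def \<mu>_def
      using a01 by (intro integral_mono inta intaa mult_right_mono) (auto simp: w_def mult_left_le)
    have off: "M2 l k \<le> \<mu> l * \<mu> k" if lk: "l < m" "k < m" "l \<noteq> k" for l k
    proof -
      have "(a l y * a k y) * w y = (a l y * w y + a k y * w y) - 1 * w y" for y
      proof (cases "0 \<le> y \<and> y \<le> 1")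
        case True
        then show ?thesis using sep[OF lk, of y] by (auto simp: w_def)
      next
        case False
        then show ?thesis by (auto simp: w_def indicator_def)
      qed
      then have "M2 l k = (\<integral>y. (a l y * w y + a k y * w y) - 1 * w y \<partial>lborel)" unfolding M2_def by simp
      also have "\<dots> = (\<integral>y. (a l y * w y + a k y * w y) \<partial>lborel) - (\<integral>y. 1 * w y \<partial>lborel)"
        by (rule Bochner_Integration.integral_diff[OF Bochner_Integration.integrable_add[OF inta inta] int1])
      also have "\<dots> = \<mu> l + \<mu> k - 1"
        unfolding w1 \<mu>_def by (subst Bochner_Integration.integral_add[OF inta inta]) simp
      also have "\<dots> \<le> \<mu> l * \<mu> k"
      proof -
        have "0 \<le> (1 - \<mu> l) * (1 - \<mu> k)" using \<mu>1 by (intro mult_nonneg_nonneg) auto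
        then show ?thesis by (simp add: algebra_simps)
      qed
      finally show ?thesis .
    qed
    have "M2 l k ^ card I \<le> (if l = k then \<mu> l ^ card I else 0) + \<mu> l ^ card I * \<mu> k ^ card I" if "l < m" "k < m" for l k
    proof (cases "l = k")
      case True
      have "M2 l l ^ card I \<le> \<mu> l ^ card I" using diag M20 by (intro power_mono) auto
      moreover have "0 \<le> \<mu> l ^ card I * \<mu> k ^ card I" using \<mu>0 by simp
      ultimately have "M2 l l ^ card I \<le> \<mu> l ^ card I + \<mu> l ^ card I * \<mu> k ^ card I" by linarith
      then show ?thesis using True by simp
    next
      case False
      have "M2 l k ^ card I \<le> (\<mu> l * \<mu> k) ^ card I" using off[OF that False] M20 by (intro power_mono) auto
      then show ?thesis using False by (simp add: power_mult_distrib)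
    qed
    then have "(\<Sum>l<m. \<Sum>k<m. M2 l k ^ card I) \<le> (\<Sum>l<m. \<Sum>k<m. (if l = k then \<mu> l ^ card I else 0) + \<mu> l ^ card I * \<mu> k ^ card I)"
      by (intro sum_mono) auto
    also have "\<dots> = (\<Sum>l<m. \<mu> l ^ card I) + (\<Sum>l<m. \<mu> l ^ card I) * (\<Sum>k<m. \<mu> k ^ card I)"
      by (simp add: sum.distrib sum_product)
    also have "\<dots> = E + E\<^sup>2" using E(1) unfolding \<mu>_def w_def by (simp add: power2_eq_square)
    finally show ?thesis by simp
  qed
  finally have VE: "(\<integral>x. V x \<partial>leb I) \<le> E" .
  have V_eq: "V x = (Z x - E)\<^sup>2 * indicator (I \<rightarrow>\<^sub>E {0..1}) x" if x: "x \<in> space (leb I)" for x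
  proof -
    define W where "W = (\<Prod>i\<in>I. w (x i))"
    have W: "W = indicator (I \<rightarrow>\<^sub>E {0..1}) x" using indicator_unit_box[OF I x] by (simp add: W_def w_def)
    have "V x = (\<Sum>l<m. \<Sum>k<m. (\<Prod>i\<in>I. a l (x i)) * (\<Prod>i\<in>I. a k (x i))) * W - 2 * E * (\<Sum>l<m. \<Prod>i\<in>I. a l (x i)) * W + E\<^sup>2 * W"
      by (simp add: V_def prod.distrib W_def sum_distrib_right)
    also have "(\<Sum>l<m. \<Sum>k<m. (\<Prod>i\<in>I. a l (x i)) * (\<Prod>i\<in>I. a k (x i))) = (Z x)\<^sup>2"
      by (simp add: Z_def sum_product power2_eq_square)
    finally show ?thesis unfolding W Z_def[symmetric] by (simp add: power2_diff algebra_simps)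
  qed
  have Zm[measurable]: "Z \<in> borel_measurable (leb I)" unfolding Z_def[abs_def]
    by (intro borel_measurable_sum borel_measurable_prod measurable_compose[OF measurable_eval_leb am])
  have bm[measurable]: "I \<rightarrow>\<^sub>E {0..1} \<in> sets (leb I)" using I by (intro sets_PiM_I_finite) auto
  let ?bad = "{x \<in> I \<rightarrow>\<^sub>E {0..1}. Z x < E / 2}"
  have "?bad = {x \<in> space (leb I). x \<in> I \<rightarrow>\<^sub>E {0..1} \<and> Z x < E / 2}" by (auto simp: space_leb PiE_iff)
  also have "\<dots> \<in> sets (leb I)" by measurable
  finally have badm: "?bad \<in> sets (leb I)" .
  have "emeasure (leb I) ?bad = (\<integral>\<^sup>+ x. indicator ?bad x \<partial>leb I)" using badm by simp
  also have "\<dots> \<le> (\<integral>\<^sup>+ x. ennreal (4 / E\<^sup>2 * V x) \<partial>leb I)"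
  proof (rule nn_integral_mono)
    fix x assume x: "x \<in> space (leb I)"
    show "(indicator ?bad x :: ennreal) \<le> ennreal (4 / E\<^sup>2 * V x)"
    proof (cases "x \<in> ?bad")
      case True
      then have "E / 2 \<le> E - Z x" by simp
      then have "(E / 2)\<^sup>2 \<le> (E - Z x)\<^sup>2" using E(2) by (intro power_mono) auto
      then have "E\<^sup>2 / 4 \<le> V x" using True unfolding V_eq[OF x] by (simp add: power2_commute power_divide)
      then have "1 \<le> 4 / E\<^sup>2 * V x" using E(2) by (simp add: field_simps)
      then show ?thesis using True by (simp add: ennreal_leI flip: ennreal_1)
    qed simp
  qed
  also have "\<dots> = ennreal (\<integral>x. 4 / E\<^sup>2 * V x \<partial>leb I)"
    using V_eq by (intro nn_integral_eq_integral integrable_mult_right intV AE_I2) auto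
  also have "\<dots> = ennreal (4 / E\<^sup>2 * (\<integral>x. V x \<partial>leb I))" by simp
  also have "\<dots> \<le> ennreal (4 / E\<^sup>2 * E)" using VE E(2) by (intro ennreal_leI mult_left_mono) auto
  also have "4 / E\<^sup>2 * E = 4 / E" using E(2) by (simp add: power2_eq_square)
  finally show ?thesis unfolding Z_def .
qed

text \<open>The shape of \<open>\<bar>\<nabla>F\<bar>\<^sup>2 * exp (- F)\<close>: each squared
  slope depends on one coordinate, and all other coordinates contribute equal factors.\<close>

lemma nn_integral_sum_prod:
  fixes f g :: "real \<Rightarrow> ennreal"
  assumes I: "finite I" and f: "f \<in> borel_measurable borel" and g: "g \<in> borel_measurable borel"
  shows "(\<integral>\<^sup>+ x. (\<Sum>i\<in>I. f (x i) * (\<Prod>j\<in>I - {i}. g (x j))) \<partial>leb I)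
    = of_nat (card I) * ((\<integral>\<^sup>+ y. f y \<partial>lborel) * (\<integral>\<^sup>+ y. g y \<partial>lborel) ^ (card I - 1))"
proof -
  have eq: "f (x i) * (\<Prod>j\<in>I - {i}. g (x j)) = (\<Prod>j\<in>I. (if j = i then f else g) (x j))" if "i \<in> I" for i and x :: "'a \<Rightarrow> real"
  proof -
    have "(\<Prod>j\<in>I. (if j = i then f else g) (x j)) = f (x i) * (\<Prod>j\<in>I - {i}. (if j = i then f else g) (x j))"
      using I that by (subst prod.remove[of _ i]) auto
    also have "(\<Prod>j\<in>I - {i}. (if j = i then f else g) (x j)) = (\<Prod>j\<in>I - {i}. g (x j))" by (rule prod.cong) auto
    finally show ?thesis by simp
  qed
  have fg: "(if j = i then f else g) \<in> borel_measurable lborel" for i j :: 'a using f g by simp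
  have "(\<integral>\<^sup>+ x. (\<Sum>i\<in>I. f (x i) * (\<Prod>j\<in>I - {i}. g (x j))) \<partial>leb I) = (\<integral>\<^sup>+ x. (\<Sum>i\<in>I. \<Prod>j\<in>I. (if j = i then f else g) (x j)) \<partial>leb I)"
    using eq by (intro nn_integral_cong sum.cong) auto
  also have "\<dots> = (\<Sum>i\<in>I. \<integral>\<^sup>+ x. (\<Prod>j\<in>I. (if j = i then f else g) (x j)) \<partial>leb I)"
    using fg by (intro nn_integral_sum borel_measurable_prod measurable_compose[OF measurable_eval_leb]) auto
  also have "\<dots> = (\<Sum>i\<in>I. (\<integral>\<^sup>+ y. f y \<partial>lborel) * (\<integral>\<^sup>+ y. g y \<partial>lborel) ^ (card I - 1))"
  proof (rule sum.cong[OF refl])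
    fix i assume i: "i \<in> I"
    have "(\<integral>\<^sup>+ x. (\<Prod>j\<in>I. (if j = i then f else g) (x j)) \<partial>leb I) = (\<Prod>j\<in>I. \<integral>\<^sup>+ y. (if j = i then f else g) y \<partial>lborel)"
      using fg by (intro lborel_PiM.product_nn_integral_prod[OF I])
    also have "\<dots> = (\<integral>\<^sup>+ y. f y \<partial>lborel) * (\<Prod>j\<in>I - {i}. \<integral>\<^sup>+ y. (if j = i then f else g) y \<partial>lborel)"
      using I i by (subst prod.remove[of _ i]) auto
    also have "(\<Prod>j\<in>I - {i}. \<integral>\<^sup>+ y. (if j = i then f else g) y \<partial>lborel) = (\<Prod>j\<in>I - {i}. \<integral>\<^sup>+ y. g y \<partial>lborel)" by (rule prod.cong) auto
    also have "\<dots> = (\<integral>\<^sup>+ y. g y \<partial>lborel) ^ (card I - 1)" using I i by simp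
    finally show "(\<integral>\<^sup>+ x. (\<Prod>j\<in>I. (if j = i then f else g) (x j)) \<partial>leb I) = (\<integral>\<^sup>+ y. f y \<partial>lborel) * (\<integral>\<^sup>+ y. g y \<partial>lborel) ^ (card I - 1)" .
  qed
  finally show ?thesis by simp
qed

section \<open>Estimates for the concrete family\<close>

text \<open>For \<open>f \<le> B\<close>, with \<open>u = exp (- f)\<close> and
  \<open>v = exp (- B)\<close>, the claim reduces to \<open>v * (u - v) \<ge> 0\<close>. So
  truncating the levels at \<open>B\<close> costs no more than \<open>exp (- B)\<close>.\<close>

lemma surv_le:
  assumes "B > 0" "0 \<le> f"
  shows "surv B f \<le> 1 - (exp (- f) - exp (- B))"
proof (cases "f \<le> B")
  case True
  define u where "u = exp (- f)"
  define v where "v = exp (- B)"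
  have uv: "v \<le> u" "0 < v" "v < 1" using True assms by (auto simp: u_def v_def)
  have "0 \<le> v * (u - v)" using uv by (intro mult_nonneg_nonneg) auto
  then have "1 - u \<le> (1 - (u - v)) * (1 - v)" by (simp add: algebra_simps)
  then show ?thesis using True uv by (simp add: surv_def min_absorb1 u_def[symmetric] v_def[symmetric] divide_le_eq)
next
  case False
  then have "exp (- f) \<le> exp (- B)" by simp
  moreover have "surv B f = 1" using False assms by (simp add: surv_def min_absorb2)
  ultimately show ?thesis by simp
qed

lemma rho_le:
  assumes "B \<ge> 1"
  shows "rho B f \<le> 2 * exp (- f)"
proof -
  have "exp (- B) \<le> exp (- 1)" using assms by simp
  also have "\<dots> \<le> (1 / 2 :: real)" using exp_ge_add_one_self[of 1] by (simp add: exp_minus field_simps)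
  finally have "1 / 2 \<le> 1 - exp (- B)" by simp
  then have "exp (- f) / (1 - exp (- B)) \<le> exp (- f) / (1 / 2)" by (intro frac_le) auto
  then show ?thesis by (simp add: rho_def)
qed

lemma geometric_le:
  fixes q :: real
  assumes "0 \<le> q" "q < 1"
  shows "(\<Sum>r<K. q ^ r) \<le> 1 / (1 - q)"
proof -
  have "(1 - q) * (\<Sum>r<K. q ^ r) = 1 - q ^ K" by (rule one_diff_power_eq[symmetric])
  also have "\<dots> \<le> 1" using assms by simp
  finally show ?thesis using assms by (simp add: pos_le_divide_eq mult.commute)
qed

text \<open>\<open>\<nu>\<close> is a lower bound for the mean of \<open>exp (- F)\<close> under
  each profile. \<open>peak\<close> makes the truncation error \<open>exp (- B)\<close> at most a
  quarter of it, and the condition on \<open>K\<close> lets \<open>K\<close> steps reduce a wall at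
  a typical point to the fraction \<open>1 / n\<close>. The tables have \<open>n\<close> grid steps
  per half window, whence the peak height.\<close>

locale estimate =
  fixes n m K :: nat and \<nu> :: real
  assumes n: "n \<ge> 2" and m: "m \<ge> 2" and \<nu>_def: "\<nu> = (1 - 1 / real m) ^ n"
    and peak: "4 * exp (- (2 * ln (real n) + 2)) \<le> \<nu>" and K: "4 * ln (real n) \<le> real K * \<nu>"
begin

abbreviation "N \<equiv> 2 * m * n"
abbreviation "B \<equiv> 2 * ln (real n) + 2"
abbreviation "f l \<equiv> pl N (ctab m n l)"

lemma table: "l < m \<Longrightarrow> table m n l"
  using n m by unfold_locales auto

sublocale profile_family m N B "ctab m n" "\<lambda>l. int ((2 * l + 1) * n)"
proof (rule profile_family.intro)
  show "m > 0" using m by simp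
  show "B > 0" using n by (simp add: add_nonneg_pos)
  show "profile N (ctab m n l) B (int ((2 * l + 1) * n))" if "l < m" for l
    using table.profile_ctab[OF table[OF that]] .
qed

lemma ln_n: "ln (real n) > 0"
  using n by simp

definition a :: "nat \<Rightarrow> real \<Rightarrow> real" where
  "a l y = exp (- f l y)"

definition w :: "real \<Rightarrow> real" where
  "w = indicator {0..1}"

definition \<mu> :: "nat \<Rightarrow> real" where
  "\<mu> l = (\<integral>y. a l y * indicator {0..1} y \<partial>lborel)"

text \<open>\<open>E n\<close> is the mean of \<open>Z\<close> over the unit cube and
  \<open>E (n - 1)\<close> its mean over a face, where one coordinate contributes the factor
  1.\<close>

definition E :: "nat \<Rightarrow> real" where
  "E d = (\<Sum>l<m. \<mu> l ^ d)"

lemma ctab_nonneg: "ctab m n l i \<ge> 0"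
  unfolding ctab_def using n by (intro beta_nonneg) auto

lemma f_nonneg: "f l y \<ge> 0"
  by (rule pl_nonneg[OF ctab_nonneg])

lemma a_bounds: "0 \<le> a l y" "a l y \<le> 1" "0 < a l y"
  using f_nonneg by (auto simp: a_def)

lemma a_measurable [measurable]: "a l \<in> borel_measurable borel"
  unfolding a_def[abs_def] by measurable

text \<open>Both \<open>0\<close> and \<open>1\<close> are ends of windows. On a face of the cube
  the fixed coordinate therefore drops out of all potentials.\<close>

lemma f_end: "l < m \<Longrightarrow> e \<in> {0, 1} \<Longrightarrow> f l e = 0"
  using table.pl_window[OF table, of l e] m by (auto simp: divide_le_eq)

lemma separated:
  assumes "l < m" "k < m" "l \<noteq> k" "0 \<le> y" "y \<le> 1"
  shows "a l y = 1 \<or> a k y = 1"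
proof -
  have one: "a j y = 1" if "j < m" "y \<le> real j / m \<or> real (j + 1) / m \<le> y" for j
    using table.pl_window[OF table[OF that(1)] assms(4,5)] that(2) by (simp add: a_def)
  have less: "a i y = 1 \<or> a j y = 1" if "i < j" "i < m" "j < m" for i j
  proof (cases "y \<le> real j / m")
    case True
    then show ?thesis using one[OF that(3)] by simp
  next
    case False
    moreover have "real (i + 1) / m \<le> real j / m" using that(1) by (intro divide_right_mono) auto
    ultimately have "real (i + 1) / m \<le> y" by linarith
    then show ?thesis using one[OF that(2)] by simp
  qed
  show ?thesis
  proof (cases "l < k")
    case True
    then show ?thesis using less[of l k] assms(1,2) by simp
  next
    case False
    then have "k < l" using assms(3) by simp
    then show ?thesis using less[of k l] assms(1,2) by blast
  qed
qed

lemma integrable_a: "integrable lborel (\<lambda>y. a l y * indicator {0..1} y)"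
  by (rule integrable_unit) (use a_bounds in auto)

lemma \<mu>_le_1: "\<mu> l \<le> 1"
proof -
  have "\<mu> l \<le> (\<integral>y. indicator {0..1} (y :: real) \<partial>lborel)" unfolding \<mu>_def
  proof (rule integral_mono[OF integrable_a])
    show "a l y * indicator {0..1} y \<le> indicator {0..1} y" for y
      using a_bounds(2)[of l y] by (simp add: indicator_def)
  qed simp
  then show ?thesis by simp
qed

text \<open>Outside a window of length \<open>1 / m\<close> the function \<open>a l\<close> equals
  1.\<close>

lemma \<mu>_ge:
  assumes "l < m"
  shows "1 - 1 / real m \<le> \<mu> l"
proof -
  let ?W = "{real l / m..real (l + 1) / m}"
  have W: "real l / m \<le> real (l + 1) / m" by (intro divide_right_mono) auto
  have i01: "integrable lborel (indicator {0..1} :: real \<Rightarrow> real)" by simp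
  have iW: "integrable lborel (indicator ?W :: real \<Rightarrow> real)"
    by (rule integrable_real_indicator) (simp, unfold emeasure_lborel_Icc[OF W], simp)
  have "(\<integral>y. indicator {0..1} y - indicator ?W y \<partial>lborel) \<le> \<mu> l" unfolding \<mu>_def
  proof (rule integral_mono[OF Bochner_Integration.integrable_diff[OF i01 iW] integrable_a])
    fix y
    show "indicator {0..1} y - indicator ?W y \<le> a l y * indicator {0..1} y"
    proof (cases "y \<in> {0..1} \<and> y \<notin> ?W")
      case True
      then have "f l y = 0" using table.pl_window[OF table[OF assms], of y] by auto
      then show ?thesis using True by (simp add: a_def)
    next
      case False
      then show ?thesis using a_bounds(1)[of l y] by (auto simp: indicator_def)
    qed
  qed
  moreover have "((\<integral>y. indicator {0..1} y - indicator ?W y \<partial>lborel) :: real) = (\<integral>y. indicator {0..1} (y :: real) \<partial>lborel) - (\<integral>y. indicator ?W y \<partial>lborel)"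
    by (rule Bochner_Integration.integral_diff[OF i01 iW])
  moreover have "(\<integral>y. indicator {0..1} (y :: real) \<partial>lborel) = (1 :: real)" by simp
  moreover have "(\<integral>y. indicator ?W y \<partial>lborel) = measure lborel ?W" by simp
  moreover have "measure lborel ?W = 1 / m" unfolding measure_lborel_Icc[OF W] by (simp add: add_divide_distrib)
  ultimately show ?thesis by linarith
qed

lemma \<mu>_half: "l < m \<Longrightarrow> 1 / 2 \<le> \<mu> l"
proof -
  assume "l < m"
  have "1 / real m \<le> 1 / 2" using m by (intro divide_left_mono) auto
  then show ?thesis using \<mu>_ge[OF \<open>l < m\<close>] by linarith
qed

lemma \<nu>_pos: "\<nu> > 0"
  unfolding \<nu>_def using m by (intro zero_less_power) (simp add: divide_less_eq)

lemma E_ge: "real m * \<nu> \<le> E n"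
proof -
  have "(\<Sum>l<m. \<nu>) \<le> E n" unfolding E_def \<nu>_def
    using m \<mu>_ge by (intro sum_mono power_mono) (auto simp: divide_le_eq)
  then show ?thesis by simp
qed

lemma E_pos: "E n > 0"
  using E_ge \<nu>_pos m by (smt (verit) mult_pos_pos of_nat_0_less_iff less_le_trans zero_less_numeral pos2)

lemma E_pred: "E n \<le> E (n - 1)"
  unfolding E_def
proof (intro sum_mono)
  fix l assume "l \<in> {..<m}"
  then have "0 \<le> \<mu> l" using \<mu>_half[of l] by auto
  then show "\<mu> l ^ n \<le> \<mu> l ^ (n - 1)" using \<mu>_le_1 by (intro power_decreasing) auto
qed

lemma exp_pot: "exp (- pot n N (ctab m n l) x) = (\<Prod>i<n. a l (x i))"
  unfolding pot_def a_def by (simp add: exp_sum flip: sum_negf)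

text \<open>The sum of the \<open>exp (- F)\<close> is at least \<open>E n / 2\<close>, while the
  truncation error \<open>m * exp (- B)\<close> is at most \<open>E n / 4\<close>. The parameter
  \<open>e\<close> serves the cube, with \<open>E n\<close>, as well as its faces, with
  \<open>E (n - 1)\<close>.\<close>

lemma Sv_le:
  assumes "(\<Sum>l<m. exp (- pot n N (ctab m n l) x)) \<ge> e / 2" "e \<ge> E n"
  shows "Sv n x \<le> 1 - E n / (4 * m)"
proof -
  have "(\<Sum>l<m. surv B (pot n N (ctab m n l) x)) \<le> (\<Sum>l<m. (1 + exp (- B)) - exp (- pot n N (ctab m n l) x))"
  proof (intro sum_mono)
    fix l assume "l \<in> {..<m}"
    then show "surv B (pot n N (ctab m n l) x) \<le> (1 + exp (- B)) - exp (- pot n N (ctab m n l) x)"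
      using surv_le[OF B_pos profile.pot_nonneg[OF profiles], of l n x] by simp
  qed
  also have "\<dots> = m * (1 + exp (- B)) - (\<Sum>l<m. exp (- pot n N (ctab m n l) x))"
    by (simp add: sum_subtractf)
  also have "\<dots> \<le> m + m * exp (- B) - E n / 2" using assms by (simp add: distrib_left)
  also have "m * exp (- B) \<le> m * (\<nu> / 4)" using peak by (intro mult_left_mono) auto
  also have "m * (\<nu> / 4) \<le> E n / 4" using E_ge by simp
  finally have "(\<Sum>l<m. surv B (pot n N (ctab m n l) x)) \<le> m - E n / 4" by simp
  then have "Sv n x \<le> (m - E n / 4) / m" unfolding Sv_def by (intro divide_right_mono) auto
  also have "\<dots> = 1 - E n / (4 * m)" using m by (simp add: diff_divide_distrib)
  finally show ?thesis .
qed

text \<open>By \<open>1 - u \<le> exp (- u)\<close> the power is at most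
  \<open>exp (- K * E n / (4 * m))\<close>, and \<open>E n / m \<ge> \<nu>\<close> brings in the
  assumption on \<open>K\<close>.\<close>

lemma Sv_power_le:
  assumes "Sv n x \<le> 1 - E n / (4 * m)"
  shows "Sv n x ^ K \<le> 1 / n"
proof -
  have "Sv n x \<le> exp (- (E n / (4 * m)))" using assms exp_ge_add_one_self[of "- (E n / (4 * m))"] by linarith
  then have "Sv n x ^ K \<le> exp (- (E n / (4 * m))) ^ K" using Sv_nonneg by (rule power_mono)
  also have "\<dots> = exp (- (K * (E n / (4 * m))))" by (simp flip: exp_of_nat_mult)
  also have "\<dots> \<le> exp (- ln (real n))"
  proof -
    have "K * \<nu> / 4 = K * (real m * \<nu>) / (4 * m)" using m by simp
    also have "\<dots> \<le> K * E n / (4 * m)" using E_ge by (intro divide_right_mono mult_left_mono) auto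
    finally have "ln (real n) \<le> K * E n / (4 * m)" using K by linarith
    then show ?thesis by simp
  qed
  also have "\<dots> = 1 / n" using n by (simp add: exp_minus inverse_eq_divide)
  finally show ?thesis .
qed

lemma bad_measure:
  fixes I :: "nat set"
  assumes "finite I" "E (card I) > 0"
  shows "emeasure (leb I) {x \<in> I \<rightarrow>\<^sub>E {0..1}. (\<Sum>l<m. \<Prod>i\<in>I. a l (x i)) < E (card I) / 2} \<le> ennreal (4 / E (card I))"
  by (rule second_moment_bound[OF assms(1) a_measurable a_bounds(1,2) separated _ assms(2)])
     (auto simp: E_def \<mu>_def)

lemma bad_set:
  fixes I :: "nat set"
  assumes "finite I"
  shows "{x \<in> I \<rightarrow>\<^sub>E {0..1}. (\<Sum>l<m. \<Prod>i\<in>I. a l (x i)) < r} \<in> sets (leb I)"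
proof -
  have [measurable]: "(\<lambda>x. \<Sum>l<m. \<Prod>i\<in>I. a l (x i)) \<in> borel_measurable (leb I)"
    by (intro borel_measurable_sum borel_measurable_prod measurable_compose[OF measurable_eval_leb a_measurable])
  have [measurable]: "I \<rightarrow>\<^sub>E {0..1} \<in> sets (leb I)" using assms by (intro sets_PiM_I_finite) auto
  have "{x \<in> I \<rightarrow>\<^sub>E {0..1}. (\<Sum>l<m. \<Prod>i\<in>I. a l (x i)) < r} = {x \<in> space (leb I). x \<in> I \<rightarrow>\<^sub>E {0..1} \<and> (\<Sum>l<m. \<Prod>i\<in>I. a l (x i)) < r}"
    by (auto simp: space_leb PiE_iff)
  also have "\<dots> \<in> sets (leb I)" by measurable
  finally show ?thesis .
qed

lemma emeasure_unit_box: "finite I \<Longrightarrow> emeasure (leb I) (I \<rightarrow>\<^sub>E {0..1}) = 1"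
  by (simp add: lborel_PiM.emeasure_PiM)

text \<open>Where \<open>Z\<close> is at least half its mean on the face, the weight is at most
  \<open>1 / n\<close>; elsewhere it is at most \<open>1\<close>, on a set of measure at most
  \<open>4 / E (n - 1)\<close>, hence at most \<open>4 / E n\<close>.\<close>

lemma wall_integral:
  assumes i: "i < n" and e: "e \<in> {0, 1}"
  shows "(\<integral>\<^sup>+ y. indicator ({..<n} - {i} \<rightarrow>\<^sub>E {0..1}) y * ennreal (Sv n (y(i := e)) ^ K) \<partial>leb ({..<n} - {i}))
    \<le> ennreal (1 / n + 4 / E n)"
proof -
  let ?I = "{..<n} - {i}"
  let ?box = "?I \<rightarrow>\<^sub>E {0..1 :: real}"
  have card: "card ?I = n - 1" using i by simp
  have Ep: "E (card ?I) > 0" unfolding card using E_pos E_pred by linarith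
  let ?bad = "{x \<in> ?box. (\<Sum>l<m. \<Prod>j\<in>?I. a l (x j)) < E (card ?I) / 2}"
  have badm: "?bad \<in> sets (leb ?I)" by (rule bad_set) simp
  have boxm: "?box \<in> sets (leb ?I)" by (intro sets_PiM_I_finite) auto
  have "(\<integral>\<^sup>+ y. indicator ?box y * ennreal (Sv n (y(i := e)) ^ K) \<partial>leb ?I)
    \<le> (\<integral>\<^sup>+ y. ennreal (1 / n) * indicator ?box y + indicator ?bad y \<partial>leb ?I)"
  proof (rule nn_integral_mono)
    fix y
    show "indicator ?box y * ennreal (Sv n (y(i := e)) ^ K) \<le> ennreal (1 / n) * indicator ?box y + indicator ?bad y"
    proof (cases "y \<in> ?box")
      case box: True
      show ?thesis
      proof (cases "y \<in> ?bad")
        case True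
        have "Sv n (y(i := e)) ^ K \<le> 1" using Sv_nonneg Sv_le_1 by (rule power_le_one)
        then have "ennreal (Sv n (y(i := e)) ^ K) \<le> 1" by (simp add: ennreal_le_1)
        also have "1 \<le> ennreal (1 / n) + 1" by simp
        finally show ?thesis using True box by simp
      next
        case False
        have "(\<Prod>j<n. a l ((y(i := e)) j)) = (\<Prod>j\<in>?I. a l (y j))" if "l < m" for l
        proof -
          have "(\<Prod>j<n. a l ((y(i := e)) j)) = a l e * (\<Prod>j\<in>?I. a l ((y(i := e)) j))"
            using i by (subst prod.remove[of _ i]) auto
          also have "a l e = 1" using f_end[OF that e] by (simp add: a_def)
          also have "(\<Prod>j\<in>?I. a l ((y(i := e)) j)) = (\<Prod>j\<in>?I. a l (y j))" by (rule prod.cong) auto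
          finally show ?thesis by simp
        qed
        then have "(\<Sum>l<m. exp (- pot n N (ctab m n l) (y(i := e)))) \<ge> E (card ?I) / 2"
          using False box by (simp add: exp_pot)
        then have "Sv n (y(i := e)) ^ K \<le> 1 / n"
          by (intro Sv_power_le Sv_le) (use E_pred card in simp_all)
        then show ?thesis using False box by (simp add: ennreal_leI)
      qed
    qed simp
  qed
  also have "\<dots> = ennreal (1 / n) * emeasure (leb ?I) ?box + emeasure (leb ?I) ?bad"
    using badm boxm by (simp add: nn_integral_add nn_integral_cmult)
  also have "\<dots> \<le> ennreal (1 / n) * 1 + ennreal (4 / E (card ?I))"
    using bad_measure[OF _ Ep] by (intro add_mono) (simp_all add: emeasure_unit_box)
  also have "\<dots> = ennreal (1 / n + 4 / E (card ?I))" using Ep by (subst ennreal_plus) auto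
  also have "\<dots> \<le> ennreal (1 / n + 4 / E n)"
    unfolding card using E_pos E_pred by (intro ennreal_leI add_left_mono divide_left_mono) auto
  finally show ?thesis .
qed

definition sq :: "nat \<Rightarrow> real \<Rightarrow> real" where
  "sq l y = (plslope N (ctab m n l) y)\<^sup>2 * a l y"

lemma sq_nonneg: "0 \<le> sq l y"
  unfolding sq_def using a_bounds by simp

lemma sq_le: "l < m \<Longrightarrow> sq l y \<le> 64 * (real m)\<^sup>2"
  using table.plslope_bound[OF table] by (simp add: sq_def a_def)

lemma sq_measurable [measurable]: "sq l \<in> borel_measurable borel"
  unfolding sq_def[abs_def] by measurable

text \<open>The integrand is at most \<open>64 * m\<^sup>2\<close> and lives on a window of length
  \<open>1 / m\<close>, which saves one factor \<open>m\<close>.\<close>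

lemma sq_integral:
  assumes "l < m"
  shows "(\<integral>\<^sup>+ y. ennreal (sq l y * w y) \<partial>lborel) \<le> ennreal (64 * real m)"
proof -
  let ?W = "{real l / m..real (l + 1) / m}"
  have W: "real l / m \<le> real (l + 1) / m" by (intro divide_right_mono) auto
  have "(\<integral>\<^sup>+ y. ennreal (sq l y * w y) \<partial>lborel) \<le> (\<integral>\<^sup>+ y. ennreal (64 * (real m)\<^sup>2) * indicator ?W y \<partial>lborel)"
  proof (rule nn_integral_mono_AE)
    \<comment> \<open>At \<open>y = 1\<close> the right-hand slope belongs to the next period, where
      \<open>plslope_window\<close> says nothing.\<close>
    have "AE y in lborel. y \<noteq> (1 :: real)" by (rule AE_lborel_singleton)
    then show "AE y in lborel. ennreal (sq l y * w y) \<le> ennreal (64 * (real m)\<^sup>2) * indicator ?W y"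
    proof (rule eventually_mono)
      fix y :: real assume y1: "y \<noteq> 1"
      show "ennreal (sq l y * w y) \<le> ennreal (64 * (real m)\<^sup>2) * indicator ?W y"
      proof (cases "y \<in> {0..1} \<and> y \<notin> ?W")
        case True
        then have "plslope N (ctab m n l) y = 0"
          using y1 by (intro table.plslope_window[OF table[OF assms]]) auto
        then show ?thesis by (simp add: sq_def)
      next
        case False
        then show ?thesis using sq_le[OF assms, of y] by (auto simp: w_def indicator_def intro!: ennreal_leI)
      qed
    qed
  qed
  also have "\<dots> = ennreal (64 * (real m)\<^sup>2) * emeasure lborel ?W" by (rule nn_integral_cmult_indicator) simp
  also have "emeasure lborel ?W = ennreal (1 / m)" using W by (simp add: add_divide_distrib)
  also have "ennreal (64 * (real m)\<^sup>2) * ennreal (1 / m) = ennreal (64 * real m)"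
    using m by (simp add: power2_eq_square flip: ennreal_mult)
  finally show ?thesis .
qed

lemma a_integral: "(\<integral>\<^sup>+ y. ennreal (a l y * w y) \<partial>lborel) = ennreal (\<mu> l)"
  unfolding \<mu>_def w_def using a_bounds by (intro nn_integral_eq_integral integrable_a) auto

text \<open>On the unit cube \<open>G l\<close> is \<open>exp (- F)\<close> and \<open>Q l\<close>
  is \<open>\<bar>\<nabla>F\<bar>\<^sup>2 * exp (- F)\<close> for the potential of profile
  \<open>l\<close>; both vanish at the other points of the space. The product form makes their
  integrals explicit.\<close>

definition G :: "nat \<Rightarrow> (nat \<Rightarrow> real) \<Rightarrow> ennreal" where
  "G l x = (\<Prod>i<n. ennreal (a l (x i) * w (x i)))"

definition Q :: "nat \<Rightarrow> (nat \<Rightarrow> real) \<Rightarrow> ennreal" where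
  "Q l x = (\<Sum>i<n. ennreal (sq l (x i) * w (x i)) * (\<Prod>j\<in>{..<n} - {i}. ennreal (a l (x j) * w (x j))))"

lemma w_measurable [measurable]: "w \<in> borel_measurable borel"
  by (simp add: w_def)

lemma G_measurable [measurable]: "G l \<in> borel_measurable (leb {..<n})"
proof -
  have 1: "(\<lambda>y. ennreal (a l y * w y)) \<in> borel_measurable borel" by measurable
  show ?thesis unfolding G_def[abs_def]
    by (rule borel_measurable_prod_ennreal) (rule measurable_compose[OF measurable_eval_leb 1])
qed

lemma Q_measurable [measurable]: "Q l \<in> borel_measurable (leb {..<n})"
proof -
  have 1: "(\<lambda>y. ennreal (a l y * w y)) \<in> borel_measurable borel" by measurable
  have 2: "(\<lambda>y. ennreal (sq l y * w y)) \<in> borel_measurable borel" by measurable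
  have "(\<lambda>x. \<Prod>j\<in>{..<n} - {i}. ennreal (a l (x j) * w (x j))) \<in> borel_measurable (leb {..<n})" for i
    by (rule borel_measurable_prod_ennreal) (rule measurable_compose[OF measurable_eval_leb 1], simp)
  moreover have "(\<lambda>x. ennreal (sq l (x i) * w (x i))) \<in> borel_measurable (leb {..<n})" if "i \<in> {..<n}" for i
    by (rule measurable_compose[OF measurable_eval_leb[OF that] 2])
  ultimately show ?thesis unfolding Q_def[abs_def]
    by (intro borel_measurable_sum borel_measurable_times_ennreal) simp_all
qed

lemma G_integral: "(\<integral>\<^sup>+ x. G l x \<partial>leb {..<n}) = ennreal (\<mu> l ^ n)"
proof -
  have "(\<integral>\<^sup>+ x. G l x \<partial>leb {..<n}) = (\<Prod>i<n. \<integral>\<^sup>+ y. ennreal (a l y * w y) \<partial>lborel)"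
    unfolding G_def by (rule lborel_PiM.product_nn_integral_prod) auto
  moreover have "0 \<le> \<mu> l" unfolding \<mu>_def using a_bounds by (intro integral_nonneg_AE) auto
  ultimately show ?thesis by (simp add: a_integral ennreal_power)
qed

text \<open>Since \<open>\<mu> l \<ge> 1 / 2\<close>, the missing power of \<open>\<mu> l\<close> is
  restored at the cost of a factor \<open>2\<close>. This makes the bound a multiple of the integral
  of \<open>G l\<close>, so that summing over \<open>l\<close> again produces
  \<open>E n\<close>.\<close>

lemma Q_integral:
  assumes "l < m"
  shows "(\<integral>\<^sup>+ x. Q l x \<partial>leb {..<n}) \<le> ennreal (128 * n * m * \<mu> l ^ n)"
proof -
  have \<mu>0: "0 \<le> \<mu> l" "1 / 2 \<le> \<mu> l" using \<mu>_half[OF assms] by auto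
  have "(\<integral>\<^sup>+ x. Q l x \<partial>leb {..<n}) = of_nat n * ((\<integral>\<^sup>+ y. ennreal (sq l y * w y) \<partial>lborel) * ennreal (\<mu> l) ^ (n - 1))"
    unfolding Q_def using nn_integral_sum_prod[of "{..<n}" "\<lambda>y. ennreal (sq l y * w y)" "\<lambda>y. ennreal (a l y * w y)"]
    by (simp add: a_integral)
  also have "\<dots> \<le> of_nat n * (ennreal (64 * real m) * ennreal (\<mu> l) ^ (n - 1))"
    using sq_integral[OF assms] by (intro mult_left_mono mult_right_mono) auto
  also have "\<dots> = ennreal (n * (64 * real m * \<mu> l ^ (n - 1)))"
    using \<mu>0 by (simp add: ennreal_power ennreal_mult ennreal_of_nat_eq_real_of_nat)
  also have "\<dots> \<le> ennreal (128 * n * m * \<mu> l ^ n)"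
  proof (rule ennreal_leI)
    have "\<mu> l ^ n = \<mu> l * \<mu> l ^ (n - 1)" using n by (simp add: power_eq_if)
    moreover have "1 / 2 * \<mu> l ^ (n - 1) \<le> \<mu> l * \<mu> l ^ (n - 1)" using \<mu>0 by (intro mult_right_mono) auto
    ultimately have "\<mu> l ^ (n - 1) \<le> 2 * \<mu> l ^ n" by simp
    then have "64 * real n * real m * \<mu> l ^ (n - 1) \<le> 64 * real n * real m * (2 * \<mu> l ^ n)" by (intro mult_left_mono) auto
    then show "n * (64 * real m * \<mu> l ^ (n - 1)) \<le> 128 * n * m * \<mu> l ^ n" by (simp add: mult_ac)
  qed
  finally show ?thesis .
qed

text \<open>The third bound is crude: it uses \<open>g \<le> 1\<close> and bounds every
  \<open>sq\<close> by its maximum. It serves on the bad set, whose small measure compensates for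
  it.\<close>

lemma grad_bounds:
  assumes l: "l < m" and x: "x \<in> box_Rn n 0 1"
  defines "g \<equiv> exp (- pot n N (ctab m n l) x)" and "\<Gamma> \<equiv> potgrad n N (ctab m n l) x"
  shows "G l x = ennreal g" "ennreal (\<Gamma>\<^sup>2 * g) = Q l x" "\<Gamma> * g \<le> 8 * m * sqrt n"
proof -
  have w1: "w (x i) = 1" if "i < n" for i using PiE_mem[OF x, of i] that by (simp add: w_def)
  have g: "g = (\<Prod>i<n. a l (x i))" unfolding g_def by (rule exp_pot)
  have "G l x = (\<Prod>i<n. ennreal (a l (x i)))" unfolding G_def using w1 by (intro prod.cong) auto
  then show "G l x = ennreal g" unfolding g using a_bounds by (simp add: prod_ennreal)
  have \<Gamma>2: "\<Gamma>\<^sup>2 = (\<Sum>i<n. (plslope N (ctab m n l) (x i))\<^sup>2)"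
    unfolding \<Gamma>_def potgrad_def by (rule real_sqrt_pow2) (simp add: sum_nonneg)
  have split: "g = a l (x i) * (\<Prod>j\<in>{..<n} - {i}. a l (x j))" if "i < n" for i
    unfolding g using that by (subst prod.remove[of _ i]) auto
  have eq: "\<Gamma>\<^sup>2 * g = (\<Sum>i<n. sq l (x i) * (\<Prod>j\<in>{..<n} - {i}. a l (x j)))"
    unfolding \<Gamma>2 sum_distrib_right
  proof (rule sum.cong[OF refl])
    fix i assume "i \<in> {..<n}"
    then show "(plslope N (ctab m n l) (x i))\<^sup>2 * g = sq l (x i) * (\<Prod>j\<in>{..<n} - {i}. a l (x j))"
      using split[of i] by (simp add: sq_def)
  qed
  have P0: "0 \<le> (\<Prod>j\<in>J. a l (x j))" for J using a_bounds by (intro prod_nonneg) auto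
  have P1: "(\<Prod>j\<in>J. a l (x j)) \<le> 1" for J using a_bounds by (intro prod_le_1) auto
  have "Q l x = (\<Sum>i<n. ennreal (sq l (x i) * (\<Prod>j\<in>{..<n} - {i}. a l (x j))))"
    unfolding Q_def
  proof (rule sum.cong[OF refl])
    fix i assume i: "i \<in> {..<n}"
    have "(\<Prod>j\<in>{..<n} - {i}. ennreal (a l (x j) * w (x j))) = (\<Prod>j\<in>{..<n} - {i}. ennreal (a l (x j)))"
      using w1 by (intro prod.cong) auto
    also have "\<dots> = ennreal (\<Prod>j\<in>{..<n} - {i}. a l (x j))" using a_bounds by (simp add: prod_ennreal)
    finally show "ennreal (sq l (x i) * w (x i)) * (\<Prod>j\<in>{..<n} - {i}. ennreal (a l (x j) * w (x j)))
      = ennreal (sq l (x i) * (\<Prod>j\<in>{..<n} - {i}. a l (x j)))"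
      using w1 i sq_nonneg P0 by (simp add: ennreal_mult)
  qed
  then show "ennreal (\<Gamma>\<^sup>2 * g) = Q l x"
    unfolding eq using sq_nonneg P0 by (simp add: sum_ennreal)
  have g01: "0 \<le> g" "g \<le> 1" unfolding g by (rule P0, rule P1)
  have "(\<Gamma> * g)\<^sup>2 = (\<Gamma>\<^sup>2 * g) * g" by (simp add: power2_eq_square mult_ac)
  also have "\<dots> \<le> (\<Gamma>\<^sup>2 * g) * 1" using g01 by (intro mult_left_mono) auto
  also have "\<dots> \<le> (\<Sum>i<n. 64 * (real m)\<^sup>2 * 1)" unfolding eq mult_1_right
    using sum_mono[of "{..<n}" "\<lambda>i. sq l (x i) * (\<Prod>j\<in>{..<n} - {i}. a l (x j))" "\<lambda>i. 64 * (real m)\<^sup>2 * 1"]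
      mult_mono[OF sq_le[OF l] P1 _ P0] by simp
  also have "\<dots> = (8 * m * sqrt n)\<^sup>2" by (simp add: power_mult_distrib)
  finally show "\<Gamma> * g \<le> 8 * m * sqrt n" by (rule power2_le_imp_le) simp
qed

lemma Gb_le: "Gb n x \<le> (\<Sum>l<m. potgrad n N (ctab m n l) x * (2 * exp (- pot n N (ctab m n l) x))) / m"
  unfolding Gb_def using ln_n
  by (intro divide_right_mono sum_mono mult_left_mono rho_le potgrad_nonneg) auto

text \<open>Off the bad set the geometric sum is at most \<open>4 * m / E n\<close>: the
  \<open>m\<close> cancels the average in \<open>Gb\<close>, and \<open>E n\<close> cancels the sum
  of the \<open>\<mu> l ^ n\<close> left after integrating \<open>G\<close> and \<open>Q\<close>. On
  the bad set the sum is at most \<open>K\<close> and \<open>Gb\<close> at most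
  \<open>16 * m * sqrt n\<close>, against measure \<open>4 / E n\<close>.\<close>

lemma interior_integral:
  assumes A: "A > 0"
  shows "(\<integral>\<^sup>+ x. ennreal ((\<Sum>r<K. Sv n x ^ r) * Gb n x) * indicator (box_Rn n 0 1) x \<partial>leb {..<n})
    \<le> ennreal (4 * A + 512 * n * m / A + 64 * K * m * sqrt n / E n)"
proof -
  let ?bad = "{x \<in> box_Rn n 0 1. (\<Sum>l<m. \<Prod>i<n. a l (x i)) < E n / 2}"
  let ?g = "\<lambda>l x. exp (- pot n N (ctab m n l) x)"
  let ?\<Gamma> = "\<lambda>l x. potgrad n N (ctab m n l) x"
  have badm: "?bad \<in> sets (leb {..<n})" by (rule bad_set) simp
  have \<mu>0: "0 \<le> \<mu> l" for l unfolding \<mu>_def using a_bounds by (intro integral_nonneg_AE) auto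
  have lin: "ennreal (\<alpha> * u + \<beta> * v) = ennreal \<alpha> * ennreal u + ennreal \<beta> * ennreal v"
    if "0 \<le> \<alpha>" "0 \<le> u" "0 \<le> \<beta>" "0 \<le> v" for \<alpha> u \<beta> v
    using that by (simp add: ennreal_mult)
  have point: "ennreal ((\<Sum>r<K. Sv n x ^ r) * Gb n x) * indicator (box_Rn n 0 1) x \<le>
    (\<Sum>l<m. ennreal (4 * A / E n) * G l x + ennreal (4 / (A * E n)) * Q l x) + ennreal (16 * K * m * sqrt n) * indicator ?bad x" for x
  proof (cases "x \<in> box_Rn n 0 1")
    case box: True
    define S where "S = (\<Sum>r<K. Sv n x ^ r)"
    have S0: "0 \<le> S" unfolding S_def by (intro sum_nonneg zero_le_power Sv_nonneg)
    show ?thesis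
    proof (cases "x \<in> ?bad")
      case True
      have "S \<le> (\<Sum>r<K. 1)" unfolding S_def by (intro sum_mono power_le_one Sv_nonneg Sv_le_1)
      then have SK: "S \<le> K" by simp
      have "Gb n x \<le> (\<Sum>l<m. 16 * m * sqrt n) / m"
      proof (rule order_trans[OF Gb_le divide_right_mono[OF sum_mono]])
        fix l assume "l \<in> {..<m}"
        then show "?\<Gamma> l x * (2 * ?g l x) \<le> 16 * m * sqrt n" using grad_bounds(3)[OF _ box, of l] by simp
      qed simp
      then have "Gb n x \<le> 16 * m * sqrt n" using m by simp
      then have "S * Gb n x \<le> K * (16 * m * sqrt n)" using SK S0 Gb_nonneg by (intro mult_mono) auto
      then have "ennreal (S * Gb n x) \<le> ennreal (16 * K * m * sqrt n)" by (intro ennreal_leI) (simp add: mult_ac)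
      then show ?thesis using True box unfolding S_def[symmetric] by (simp add: add_increasing)
    next
      case False
      then have "(\<Sum>l<m. ?g l x) \<ge> E n / 2" using box by (simp add: exp_pot)
      then have Sv: "Sv n x \<le> 1 - E n / (4 * m)" by (rule Sv_le) simp
      have pos: "E n / (4 * m) > 0" using E_pos m by simp
      have "S \<le> 1 / (1 - Sv n x)" unfolding S_def using Sv pos Sv_nonneg by (intro geometric_le) auto
      also have "\<dots> \<le> 1 / (E n / (4 * m))" using Sv pos by (intro frac_le) auto
      finally have S: "S \<le> 4 * m / E n" by simp
      have amgm: "?\<Gamma> l x * (2 * ?g l x) \<le> A * ?g l x + (?\<Gamma> l x)\<^sup>2 * ?g l x / A" for l
      proof -
        have "0 \<le> (A - ?\<Gamma> l x)\<^sup>2 * ?g l x / A" using A by simp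
        also have "\<dots> = A * ?g l x + (?\<Gamma> l x)\<^sup>2 * ?g l x / A - ?\<Gamma> l x * (2 * ?g l x)"
          using A by (simp add: power2_eq_square field_simps)
        finally show ?thesis by simp
      qed
      have "S * Gb n x \<le> (4 * m / E n) * ((\<Sum>l<m. ?\<Gamma> l x * (2 * ?g l x)) / m)"
        using S S0 Gb_nonneg Gb_le by (intro mult_mono) (auto intro: order_trans)
      also have "\<dots> = (4 / E n) * (\<Sum>l<m. ?\<Gamma> l x * (2 * ?g l x))" using m by simp
      also have "\<dots> \<le> (4 / E n) * (\<Sum>l<m. A * ?g l x + (?\<Gamma> l x)\<^sup>2 * ?g l x / A)"
        using amgm E_pos by (intro mult_left_mono sum_mono) auto
      also have "\<dots> = (\<Sum>l<m. 4 * A / E n * ?g l x + 4 / (A * E n) * ((?\<Gamma> l x)\<^sup>2 * ?g l x))"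
        unfolding sum_distrib_left using A E_pos by (intro sum.cong) (auto simp: field_simps)
      finally have "ennreal (S * Gb n x) \<le> ennreal (\<Sum>l<m. 4 * A / E n * ?g l x + 4 / (A * E n) * ((?\<Gamma> l x)\<^sup>2 * ?g l x))"
        by (rule ennreal_leI)
      also have "\<dots> = (\<Sum>l<m. ennreal (4 * A / E n * ?g l x + 4 / (A * E n) * ((?\<Gamma> l x)\<^sup>2 * ?g l x)))"
        using A E_pos by (intro sum_ennreal[symmetric]) auto
      also have "\<dots> = (\<Sum>l<m. ennreal (4 * A / E n) * G l x + ennreal (4 / (A * E n)) * Q l x)"
      proof (rule sum.cong[OF refl])
        fix l assume "l \<in> {..<m}"
        then have l: "l < m" by simp
        show "ennreal (4 * A / E n * ?g l x + 4 / (A * E n) * ((?\<Gamma> l x)\<^sup>2 * ?g l x))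
          = ennreal (4 * A / E n) * G l x + ennreal (4 / (A * E n)) * Q l x"
          unfolding grad_bounds(1)[OF l box] grad_bounds(2)[OF l box, symmetric]
          by (rule lin) (use A E_pos in auto)
      qed
      finally show ?thesis using False box unfolding S_def[symmetric] by simp
    qed
  qed simp
  have "(\<integral>\<^sup>+ x. ennreal ((\<Sum>r<K. Sv n x ^ r) * Gb n x) * indicator (box_Rn n 0 1) x \<partial>leb {..<n}) \<le>
    (\<integral>\<^sup>+ x. (\<Sum>l<m. ennreal (4 * A / E n) * G l x + ennreal (4 / (A * E n)) * Q l x) + ennreal (16 * K * m * sqrt n) * indicator ?bad x \<partial>leb {..<n})"
    by (rule nn_integral_mono) (rule point)
  also have "\<dots> = (\<Sum>l<m. ennreal (4 * A / E n) * (\<integral>\<^sup>+ x. G l x \<partial>leb {..<n}) + ennreal (4 / (A * E n)) * (\<integral>\<^sup>+ x. Q l x \<partial>leb {..<n}))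
    + ennreal (16 * K * m * sqrt n) * emeasure (leb {..<n}) ?bad"
    using badm by (subst nn_integral_add) (auto simp: nn_integral_sum nn_integral_add nn_integral_cmult)
  also have "\<dots> \<le> (\<Sum>l<m. ennreal (4 * A / E n) * ennreal (\<mu> l ^ n) + ennreal (4 / (A * E n)) * ennreal (128 * n * m * \<mu> l ^ n))
    + ennreal (16 * K * m * sqrt n) * ennreal (4 / E n)"
  proof (intro add_mono sum_mono mult_left_mono)
    show "emeasure (leb {..<n}) ?bad \<le> ennreal (4 / E n)" using bad_measure[of "{..<n}"] E_pos by simp
    show "(\<integral>\<^sup>+ x. G l x \<partial>leb {..<n}) \<le> ennreal (\<mu> l ^ n)" for l by (simp add: G_integral)
    show "(\<integral>\<^sup>+ x. Q l x \<partial>leb {..<n}) \<le> ennreal (128 * n * m * \<mu> l ^ n)" if "l \<in> {..<m}" for l using that by (intro Q_integral) simp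
  qed simp_all
  also have "\<dots> = (\<Sum>l<m. ennreal ((4 * A / E n + 512 * n * m / (A * E n)) * \<mu> l ^ n)) + ennreal (64 * K * m * sqrt n / E n)"
  proof -
    have 1: "ennreal (4 * A / E n) * ennreal (\<mu> l ^ n) + ennreal (4 / (A * E n)) * ennreal (128 * n * m * \<mu> l ^ n)
      = ennreal ((4 * A / E n + 512 * n * m / (A * E n)) * \<mu> l ^ n)" for l
    proof -
      have "ennreal (4 * A / E n) * ennreal (\<mu> l ^ n) + ennreal (4 / (A * E n)) * ennreal (128 * n * m * \<mu> l ^ n)
        = ennreal (4 * A / E n * \<mu> l ^ n + 4 / (A * E n) * (128 * n * m * \<mu> l ^ n))"
        using A E_pos \<mu>0[of l] by (intro lin[symmetric]) auto
      also have "4 * A / E n * \<mu> l ^ n + 4 / (A * E n) * (128 * n * m * \<mu> l ^ n) = (4 * A / E n + 512 * n * m / (A * E n)) * \<mu> l ^ n"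
        by (simp add: distrib_right)
      finally show ?thesis .
    qed
    have 2: "ennreal (16 * K * m * sqrt n) * ennreal (4 / E n) = ennreal (64 * K * m * sqrt n / E n)"
      using E_pos by (simp flip: ennreal_mult)
    show ?thesis unfolding 1 2 ..
  qed
  also have "(\<Sum>l<m. ennreal ((4 * A / E n + 512 * n * m / (A * E n)) * \<mu> l ^ n)) = ennreal (4 * A + 512 * n * m / A)"
  proof -
    have "(\<Sum>l<m. ennreal ((4 * A / E n + 512 * n * m / (A * E n)) * \<mu> l ^ n)) = ennreal (\<Sum>l<m. (4 * A / E n + 512 * n * m / (A * E n)) * \<mu> l ^ n)"
      using A E_pos \<mu>0 by (intro sum_ennreal) auto
    also have "(\<Sum>l<m. (4 * A / E n + 512 * n * m / (A * E n)) * \<mu> l ^ n) = (4 * A / E n + 512 * n * m / (A * E n)) * E n"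
      by (simp add: E_def sum_distrib_left)
    also have "\<dots> = 4 * A + 512 * n * m / A" using A E_pos by (simp add: field_simps)
    finally show ?thesis .
  qed
  also have "ennreal (4 * A + 512 * n * m / A) + ennreal (64 * K * m * sqrt n / E n) = ennreal (4 * A + 512 * n * m / A + 64 * K * m * sqrt n / E n)"
    using A E_pos by (intro ennreal_plus[symmetric]) auto
  finally show ?thesis .
qed

lemma exists_body:
  assumes A: "A > 0"
  shows "\<exists>D. good_body n D \<and> surface_area n D \<le>
    ennreal (2 + 8 * n / E n + 8 * A + 1024 * n * m / A + 128 * K * m * sqrt n / E n)"
proof -
  obtain D where D: "good_body n D" "surface_area n D \<le>
    (\<Sum>i<n. \<Sum>e\<in>{0, 1}. \<integral>\<^sup>+ y. indicator ({..<n} - {i} \<rightarrow>\<^sub>E {0..1}) y * ennreal (Sv n (y(i := e)) ^ K) \<partial>leb ({..<n} - {i})) +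
    2 * (\<integral>\<^sup>+ x. ennreal ((\<Sum>r<K. Sv n x ^ r) * Gb n x) * indicator (box_Rn n 0 1) x \<partial>leb {..<n})"
    using exists_small_body[of n K] by blast
  have "(\<Sum>i<n. \<Sum>e\<in>{0, 1}. \<integral>\<^sup>+ y. indicator ({..<n} - {i} \<rightarrow>\<^sub>E {0..1}) y * ennreal (Sv n (y(i := e)) ^ K) \<partial>leb ({..<n} - {i}))
    \<le> (\<Sum>i<n. \<Sum>e\<in>{0, 1 :: real}. ennreal (1 / n + 4 / E n))"
    by (intro sum_mono wall_integral) auto
  also have "\<dots> = (\<Sum>i<n. ennreal (\<Sum>e\<in>{0, 1 :: real}. 1 / n + 4 / E n))"
    using E_pos by (intro sum.cong refl sum_ennreal) auto
  also have "\<dots> = ennreal (\<Sum>i<n. \<Sum>e\<in>{0, 1 :: real}. 1 / n + 4 / E n)"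
    using E_pos by (intro sum_ennreal) auto
  also have "(\<Sum>i<n. \<Sum>e\<in>{0, 1 :: real}. 1 / n + 4 / E n) = 2 + 8 * n / E n"
    using n by (simp add: field_simps)
  finally have walls: "(\<Sum>i<n. \<Sum>e\<in>{0, 1}. \<integral>\<^sup>+ y. indicator ({..<n} - {i} \<rightarrow>\<^sub>E {0..1}) y * ennreal (Sv n (y(i := e)) ^ K) \<partial>leb ({..<n} - {i}))
    \<le> ennreal (2 + 8 * n / E n)" .
  have "2 * (\<integral>\<^sup>+ x. ennreal ((\<Sum>r<K. Sv n x ^ r) * Gb n x) * indicator (box_Rn n 0 1) x \<partial>leb {..<n})
    \<le> 2 * ennreal (4 * A + 512 * n * m / A + 64 * K * m * sqrt n / E n)"
    by (intro mult_left_mono interior_integral A) simp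
  also have "\<dots> = ennreal (2 * (4 * A + 512 * n * m / A + 64 * K * m * sqrt n / E n))"
    using A E_pos by (subst ennreal_mult) auto
  finally have "surface_area n D \<le> ennreal (2 + 8 * n / E n) + ennreal (2 * (4 * A + 512 * n * m / A + 64 * K * m * sqrt n / E n))"
    using order_trans[OF D(2) add_mono[OF walls]] by blast
  also have "\<dots> = ennreal (2 + 8 * n / E n + 2 * (4 * A + 512 * n * m / A + 64 * K * m * sqrt n / E n))"
    using A E_pos by (intro ennreal_plus[symmetric]) auto
  also have "2 + 8 * n / E n + 2 * (4 * A + 512 * n * m / A + 64 * K * m * sqrt n / E n) = 2 + 8 * n / E n + 8 * A + 1024 * n * m / A + 128 * K * m * sqrt n / E n"
    by (simp add: algebra_simps)
  finally show ?thesis using D(1) by blast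
qed

end

section \<open>Volume, choice of the parameters and the final bound\<close>

lemma good_body_volume:
  assumes "good_body n D"
  shows "emeasure (leb {..<n}) D = 1"
proof -
  have D: "D \<in> sets (leb {..<n})" by (rule closedin_prodtop_imp_measurable[OF finite_lessThan good_body_closed[OF assms]])
  have bm: "box_Rn n 0 1 \<in> sets (leb {..<n})" by (intro sets_PiM_I_finite) auto
  have "emeasure (leb {..<n}) D = (\<integral>\<^sup>+ x. 1 * indicator D x \<partial>leb {..<n})" using D by simp
  also have "\<dots> = (\<integral>\<^sup>+ x. 1 * indicator (box_Rn n 0 1) x \<partial>leb {..<n})"
    using assms good_body_null[OF assms]
    by (intro tiling_nn_integral) (auto simp: good_body_def periodic_Rn_def)
  also have "\<dots> = emeasure (leb {..<n}) (box_Rn n 0 1)" using bm by simp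
  also have "\<dots> = 1" by (subst lborel_PiM.emeasure_PiM) auto
  finally show ?thesis .
qed

text \<open>\<open>t\<close> is a unit for small powers of \<open>n\<close>: the logarithm is at
  most \<open>16 * t\<^sup>2\<close> and \<open>1 / \<nu>\<close> at most \<open>t ^ 4\<close>, so
  that lower-order terms can later be compared as powers of \<open>t\<close>.\<close>

lemma exists_parameters:
  fixes n :: nat
  assumes n: "n \<ge> 2"
  defines "L \<equiv> ln (real n)"
  obtains m K :: nat and \<nu> t :: real where "estimate n m K \<nu>" "t \<ge> 1" "t ^ 32 = real n" "L \<le> 16 * t\<^sup>2"
    "16 * real n \<le> real m * L" "real m * L \<le> 17 * real n" "1 \<le> \<nu> * t ^ 4" "real K \<le> 4 * L * t ^ 4 + 1"
proof -
  have ceil: "real (nat \<lceil>x\<rceil>) \<le> x + 1" if "0 \<le> x" for x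
    using of_int_ceiling_le_add_one[of x] that by (simp add: of_nat_nat)
  define t where "t = real n powr (1 / 32)"
  have t1: "t \<ge> 1" unfolding t_def using n by (intro ge_one_powr_ge_zero) auto
  have tk: "t ^ k = real n powr (real k / 32)" for k
    unfolding t_def using n by (subst powr_realpow[symmetric]) (auto simp: powr_powr)
  have t32: "t ^ 32 = real n" using n unfolding tk by simp
  have L0: "L > 0" using n by (simp add: L_def)
  have Ln: "L \<le> real n" using ln_le_minus_one[of "real n"] n by (simp add: L_def)
  have Lt: "L \<le> 16 * t\<^sup>2" using ln_powr_bound[of "real n" "1 / 16"] n by (simp add: tk L_def)
  \<comment> \<open>The factor \<open>16\<close> makes \<open>2 * n / m\<close> at most
    \<open>L / 8\<close>. Hence \<open>\<nu> \<ge> exp (- (2 * n / m))\<close> is at least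
    \<open>n powr (- 1 / 8)\<close>, the inverse of \<open>t ^ 4\<close>.\<close>
  define m where "m = nat \<lceil>16 * real n / L\<rceil>"
  have "real m \<ge> 16 * real n / L" unfolding m_def by (rule real_nat_ceiling_ge)
  then have mlow: "16 * real n \<le> real m * L" using L0 by (simp add: field_simps)
  have "real m \<le> 16 * real n / L + 1"
    unfolding m_def by (rule ceil) (use L0 in simp)
  then have "real m * L \<le> 16 * real n + L" using L0 by (simp add: field_simps)
  then have mup: "real m * L \<le> 17 * real n" using Ln by linarith
  have "16 * L \<le> real m * L" using mlow Ln by linarith
  then have m16: "real m \<ge> 16" using L0 by simp
  define \<nu> where "\<nu> = (1 - 1 / real m) ^ n"
  have x: "1 / real m \<le> 1 / 2" "0 \<le> 1 / real m" using m16 by (auto simp: field_simps)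
  have "2 * (1 / real m)\<^sup>2 \<le> 1 / real m"
    using mult_right_mono[OF x] by (simp add: power2_eq_square)
  then have "- (2 / real m) \<le> ln (1 - 1 / real m)"
    using ln_one_minus_pos_lower_bound[OF x(2,1)] by linarith
  then have "exp (- (2 / real m)) \<le> exp (ln (1 - 1 / real m))" by (simp only: exp_le_cancel_iff)
  also have "\<dots> = 1 - 1 / real m" using x(1) by (intro exp_ln) linarith
  finally have "exp (- (2 / real m)) ^ n \<le> \<nu>" unfolding \<nu>_def by (intro power_mono) auto
  moreover have "exp (- (2 / real m)) ^ n = exp (- (2 * real n / real m))"
    by (simp add: exp_of_nat_mult[symmetric] mult_ac)
  moreover have "exp (- (L / 8)) \<le> exp (- (2 * real n / real m))"
    using mlow m16 by (simp add: field_simps)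
  ultimately have \<nu>L: "exp (- (L / 8)) \<le> \<nu>" by linarith
  have t4: "t ^ 4 = exp (L / 8)" using n by (simp add: tk powr_def L_def)
  have "1 = exp (- (L / 8)) * t ^ 4" by (simp add: t4 flip: exp_add)
  also have "\<dots> \<le> \<nu> * t ^ 4" using \<nu>L t1 by (intro mult_right_mono) auto
  finally have \<nu>t: "1 \<le> \<nu> * t ^ 4" .
  have \<nu>0: "\<nu> > 0" using \<nu>L exp_gt_zero[of "- (L / 8)"] by linarith
  define K where "K = nat \<lceil>4 * L / \<nu>\<rceil>"
  have "real K \<ge> 4 * L / \<nu>" unfolding K_def by (rule real_nat_ceiling_ge)
  then have Klow: "4 * L \<le> real K * \<nu>" using \<nu>0 by (simp add: field_simps)
  have "real K \<le> 4 * L / \<nu> + 1"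
    unfolding K_def by (rule ceil) (use L0 \<nu>0 in simp)
  also have "4 * L / \<nu> \<le> 4 * L * t ^ 4"
    using mult_left_mono[OF \<nu>t, of "4 * L"] L0 \<nu>0 by (simp add: field_simps)
  finally have Kup: "real K \<le> 4 * L * t ^ 4 + 1" by simp
  have "4 * exp (- (2 * L + 2)) \<le> exp (- (L / 8))"
  proof -
    have "(4::real) \<le> exp 1 ^ 2" using power_mono[of 2 "exp 1 :: real" 2] exp_ge_add_one_self[of 1] by simp
    then have "4 \<le> exp (2::real)" by (simp flip: exp_of_nat_mult)
    then have "4 * exp (- (2 * L + 2)) \<le> exp 2 * exp (- (2 * L + 2))" by (intro mult_right_mono) auto
    also have "\<dots> = exp (- (2 * L))" by (simp flip: exp_add)
    also have "\<dots> \<le> exp (- (L / 8))" using L0 by simp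
    finally show ?thesis .
  qed
  then have peak: "4 * exp (- (2 * L + 2)) \<le> \<nu>" using \<nu>L by linarith
  have "m \<ge> 2" using m16 by linarith
  then have "estimate n m K \<nu>" using n peak Klow by unfold_locales (auto simp: \<nu>_def L_def)
  then show ?thesis using t1 t32 Lt mlow mup \<nu>t Kup by (rule that)
qed

text \<open>As \<open>m\<close> is of order \<open>n / ln n\<close>, the choice
  \<open>A = n / sqrt (ln n)\<close> balances \<open>8 * A\<close> and
  \<open>1024 * n * m / A\<close>. The other terms are at most a constant times
  \<open>t ^ 26\<close>, whereas \<open>A \<ge> t ^ 31 / 4\<close>.\<close>

lemma exists_small_area_body:
  assumes n: "n \<ge> 2"
  shows "\<exists>D. good_body n D \<and> surface_area n D \<le> ennreal (60000 * (real n / sqrt (ln (real n))))"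
proof -
  define L where "L = ln (real n)"
  define s where "s = sqrt L"
  have L0: "L > 0" using n by (simp add: L_def)
  then have s0: "s > 0" and ss: "s * s = L" by (simp_all add: s_def)
  obtain m K :: nat and \<nu> t :: real where est: "estimate n m K \<nu>" and t: "t \<ge> 1" "t ^ 32 = real n" "L \<le> 16 * t\<^sup>2"
    and mL: "16 * real n \<le> real m * L" "real m * L \<le> 17 * real n"
    and \<nu>t: "1 \<le> \<nu> * t ^ 4" and K_le: "real K \<le> 4 * L * t ^ 4 + 1"
    using exists_parameters[OF n] unfolding L_def by blast
  interpret estimate n m K \<nu> by (rule est)
  define A where "A = real n / s"
  have A0: "A > 0" using n s0 by (simp add: A_def)
  have m0: "real m > 0" using m by simp
  have \<nu>0: "\<nu> > 0"
  proof (rule ccontr)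
    assume "\<not> \<nu> > 0"
    then have "\<nu> * t ^ 4 \<le> 0" using t(1) by (intro mult_nonpos_nonneg) auto
    then show False using \<nu>t by linarith
  qed
  have E0: "E n > 0" using E_ge mult_pos_pos[OF m0 \<nu>0] by linarith
  have inv\<nu>: "1 / \<nu> \<le> t ^ 4" using \<nu>t \<nu>0 by (simp add: field_simps)
  have "s \<le> sqrt (16 * t\<^sup>2)" unfolding s_def using t(3) by simp
  also have "\<dots> = 4 * t" using t(1) by (simp add: real_sqrt_mult)
  finally have s4t: "s \<le> 4 * t" .
  have tA: "t ^ 31 \<le> 4 * A"
  proof -
    have "t ^ 31 * s \<le> t ^ 31 * (4 * t)" using s4t t(1) by (intro mult_left_mono) auto
    also have "\<dots> = 4 * real n" using t(2) by (simp flip: power_Suc2)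
    finally show ?thesis using s0 by (simp add: A_def field_simps)
  qed
  have tk: "t ^ k \<le> 4 * A" if "k \<le> 31" for k using power_increasing[OF that t(1)] tA by linarith
  have sqrt_n: "sqrt (real n) = t ^ 16"
  proof -
    have "real n = (t ^ 16)\<^sup>2" using t(2) by (simp flip: power_mult)
    then show ?thesis using t(1) by (intro real_sqrt_unique) auto
  qed
  have b1: "2 \<le> 8 * A" using tk[of 0] by simp
  have b2: "8 * n / E n \<le> 32 * A"
  proof -
    have "8 * n / E n \<le> 8 * n / (real m * \<nu>)" using E_ge m0 \<nu>0 E0 by (intro divide_left_mono) auto
    also have "\<dots> = 8 * (real n / real m) * (1 / \<nu>)" by simp
    also have "\<dots> \<le> 8 * (L / 16) * t ^ 4"
      using mL(1) m0 inv\<nu> \<nu>0 L0 by (intro mult_mono) (auto simp: field_simps)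
    also have "\<dots> \<le> 8 * (t\<^sup>2) * t ^ 4" using t by (intro mult_right_mono) auto
    also have "\<dots> = 8 * t ^ 6" by (simp flip: power_add)
    also have "\<dots> \<le> 32 * A" using tk[of 6] by simp
    finally show ?thesis .
  qed
  have b3: "1024 * n * m / A \<le> 17408 * A"
  proof -
    have "1024 * n * m / A = 1024 * (real m * s)" using n by (simp add: A_def)
    also have "real m * s = real m * L / s" using s0 by (simp flip: ss)
    also have "\<dots> \<le> 17 * real n / s" using mL(2) s0 by (intro divide_right_mono) auto
    finally show ?thesis by (simp add: A_def)
  qed
  have b4: "128 * K * m * sqrt n / E n \<le> 33280 * A"
  proof -
    have "128 * K * m * sqrt n / E n \<le> 128 * K * m * sqrt n / (real m * \<nu>)"
      using E_ge m0 \<nu>0 E0 by (intro divide_left_mono) auto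
    also have "\<dots> = 128 * real K * t ^ 16 * (1 / \<nu>)" using m0 sqrt_n by simp
    also have "\<dots> \<le> 128 * real K * t ^ 16 * t ^ 4" using inv\<nu> t(1) by (intro mult_left_mono) auto
    also have "\<dots> = 128 * real K * t ^ 20" by (simp flip: power_add)
    finally have Kt: "128 * K * m * sqrt n / E n \<le> 128 * real K * t ^ 20" .
    have "real K \<le> 65 * t ^ 6"
    proof -
      have "4 * L * t ^ 4 \<le> 4 * (16 * t\<^sup>2) * t ^ 4" using t by (intro mult_right_mono mult_left_mono) auto
      also have "\<dots> = 64 * t ^ 6" by (simp flip: power_add)
      finally show ?thesis using K_le one_le_power[OF t(1), of 6] by linarith
    qed
    note Kt
    also have "128 * real K * t ^ 20 \<le> 128 * (65 * t ^ 6) * t ^ 20" using \<open>real K \<le> 65 * t ^ 6\<close> t(1) by (intro mult_right_mono mult_left_mono) auto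
    also have "\<dots> = 8320 * t ^ 26" by (simp flip: power_add)
    also have "\<dots> \<le> 33280 * A" using tk[of 26] by simp
    finally show ?thesis .
  qed
  obtain D where D: "good_body n D" "surface_area n D \<le> ennreal (2 + 8 * n / E n + 8 * A + 1024 * n * m / A + 128 * K * m * sqrt n / E n)"
    using exists_body[OF A0] by blast
  note D(2)
  \<comment> \<open>The five bounds add up to \<open>50736 * A\<close>.\<close>
  also have "ennreal (2 + 8 * n / E n + 8 * A + 1024 * n * m / A + 128 * K * m * sqrt n / E n) \<le> ennreal (60000 * A)"
    using b1 b2 b3 b4 A0 by (intro ennreal_leI) linarith
  finally show ?thesis using D(1) unfolding A_def s_def L_def by blast
qed

text \<open>For \<open>n \<le> 1\<close> the logarithm is \<open>0\<close>, and division by zero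
  would turn the right-hand side into \<open>0\<close>; hence the dimensions start at
  \<open>2\<close>.\<close>

theorem theorem1p4:
  "\<exists>C::real. C > 0 \<and>
     (\<forall>n::nat. n \<ge> 2 \<longrightarrow>
       (\<exists>D :: (nat \<Rightarrow> real) set.
          tiling_body n D \<and>
          perm_symmetric n D \<and>
          emeasure (lebesgue_Rn n) D = 1 \<and>
          piecewise_smooth_surface n (Rn n frontier_of D) \<and>
          surface_area n D \<le> ennreal (C * (real n / sqrt (ln (real n))))))"
proof (intro exI[of _ 60000] conjI allI impI)
  fix n :: nat assume "n \<ge> 2"
  then obtain D where D: "good_body n D" "surface_area n D \<le> ennreal (60000 * (real n / sqrt (ln (real n))))"
    using exists_small_area_body by blast
  show "\<exists>D. tiling_body n D \<and> perm_symmetric n D \<and> emeasure (lebesgue_Rn n) D = 1 \<and>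
      piecewise_smooth_surface n (Rn n frontier_of D) \<and>
      surface_area n D \<le> ennreal (60000 * (real n / sqrt (ln (real n))))"
    using D good_body_volume[OF D(1)] good_body_piecewise_smooth[OF D(1)] unfolding good_body_def by blast
qed simp

end
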